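(* Let $\Omega\subset\mathbb R^N$ be any bounded Lipschitz domain, let $s\in(0,1)$, $0<\lambda\le\Lambda$, and let $L$ be the operator $$-Lu(x)=\int_{\mathbb R^N}\Big(u(x)-\frac{u(x+y)+u(x-y)}{2}\Big)K(y)\,dy,$$ where $K$ satisfies $K(y)=K(-y)$ and $\frac{\lambda}{|y|^{N+2s}}\le K(y)\le\frac{\Lambda}{|y|^{N+2s}}$ for all $y\in\mathbb R^N\setminus\{0\}$. Then there exists $\beta_0>0$, depending only on $\Omega$, $s$, $\lambda$ and $\Lambda$, such that the following holds. Let $\alpha\in(0,1)$ with $\alpha\in(0,\beta_0]$, let $C_0>0$, and let $g:\mathbb R^N\setminus\Omega\to\mathbb R$ satisfy $$|g(x)-g(z)|\le C_0|x-z|^\alpha\quad\text{for all }x\in\mathbb R^N\setminus\Omega,\ z\in\partial\Omega,$$ $$|g(x)|\le C_0(1+|x|^\alpha)\quad\text{for all }x\in\mathbb R^N\setminus\Omega.$$ Then the solution $u$ to $$Lu=0\ \text{ in }\Omega,\qquad u=g\ \text{ in }\mathbb R^N\setminus\Omega$$ is of class $C^{0,\alpha}(\overline\Omega)$, with $$\|u\|_{C^{0,\alpha}(\overline\Omega)}\le C\,C_0,$$ where $C$ depends only on $N$, $s$, $\lambda$, $\Lambda$, $\alpha$ and $\Omega$.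
   Context: All functions are real-valued and measurable. The kernel $K$ is not assumed to be homogeneous. "Solution" means a weak or a viscosity solution; the result applies to either notion, whenever such a solution exists. - Viscosity solution: $u\in C(\overline\Omega)$, $u=g$ in $\mathbb R^N\setminus\Omega$, and whenever $x_0\in\Omega$, $B_r(x_0)\subset\Omega$, $\phi\in C^2(\overline{B_r(x_0)})$ with $\phi(x_0)=u(x_0)$ and $\phi\ge u$ (resp. $\phi\le u$) in $B_r(x_0)$, the function $w$ equal to $\phi$ in $B_r(x_0)$ and to $u$ elsewhere satisfies $Lw(x_0)\ge0$ (resp. $Lw(x_0)\le0$). - Weak solution: $u=g$ in $\mathbb R^N\setminus\Omega$, $\iint_{(\mathbb R^N\times\mathbb R^N)\setminus(\Omega^c\times\Omega^c)}|u(x)-u(y)|^2K(x-y)\,dx\,dy<\infty$, and $\iint_{\mathbb R^N\times\mathbb R^N}(u(x)-u(y))(\eta(x)-\eta(y))K(x-y)\,dx\,dy=0$ for all $\eta\in C_c^\infty(\Omega)$. $\|u\|_{C^{0,\alpha}(\overline\Omega)}=\sup_{\overline\Omega}|u|+\sup_{x\ne y\in\overline\Omega}\frac{|u(x)-u(y)|}{|x-y|^\alpha}$. *)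

theory Defs
  imports "HOL-Analysis.Analysis"
begin

(* The space R^N is an arbitrary 'a :: euclidean_space, N = DIM('a).
   "Measurable" means Lebesgue measurable throughout. *)

(* A domain is a nonempty connected open set. Near each boundary point it is the strict
   epigraph, in some direction \<nu>, of a Lipschitz function on the hyperplane orthogonal
   to \<nu>; x - (x \<bullet> \<nu>) \<nu> is the orthogonal projection of x onto that hyperplane. *)
definition bounded_lipschitz_domain :: "'a::euclidean_space set \<Rightarrow> bool" where
  "bounded_lipschitz_domain \<Omega> \<longleftrightarrow>
     open \<Omega> \<and> connected \<Omega> \<and> \<Omega> \<noteq> {} \<and> bounded \<Omega> \<and>
     (\<forall>x0\<in>frontier \<Omega>. \<exists>r>0. \<exists>\<nu> M \<gamma>. norm \<nu> = 1 \<and>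
        M-lipschitz_on {v. v \<bullet> \<nu> = 0} (\<gamma> :: 'a \<Rightarrow> real) \<and>
        (\<forall>x\<in>ball x0 r. x \<in> \<Omega> \<longleftrightarrow> \<gamma> (x - (x \<bullet> \<nu>) *\<^sub>R \<nu>) < x \<bullet> \<nu>))"

definition admissible_kernel ::
  "real \<Rightarrow> real \<Rightarrow> real \<Rightarrow> ('a::euclidean_space \<Rightarrow> real) \<Rightarrow> bool" where
  "admissible_kernel s lam Lam K \<longleftrightarrow>
     K \<in> borel_measurable lebesgue \<and>
     (\<forall>y. y \<noteq> 0 \<longrightarrow> K y = K (- y)
        \<and> lam / norm y powr (real DIM('a) + 2 * s) \<le> K y
        \<and> K y \<le> Lam / norm y powr (real DIM('a) + 2 * s))"

definition L_integrand ::
  "('a::euclidean_space \<Rightarrow> real) \<Rightarrow> ('a \<Rightarrow> real) \<Rightarrow> 'a \<Rightarrow> 'a \<Rightarrow> real" where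
  "L_integrand K u x y = (u x - (u (x + y) + u (x - y)) / 2) * K y"

definition L_op ::
  "('a::euclidean_space \<Rightarrow> real) \<Rightarrow> ('a \<Rightarrow> real) \<Rightarrow> 'a \<Rightarrow> real" where
  "L_op K u x = - (\<integral>y. L_integrand K u x y \<partial>lebesgue)"

(* The Bochner integral is 0 for non-integrable functions, so that "L u (x) is defined"
   has to be said separately. *)
definition L_defined ::
  "('a::euclidean_space \<Rightarrow> real) \<Rightarrow> ('a \<Rightarrow> real) \<Rightarrow> 'a \<Rightarrow> bool" where
  "L_defined K u x \<longleftrightarrow> integrable lebesgue (L_integrand K u x)"

(* f is k times continuously differentiable in the open set U, and f and all its partial
   derivatives of order at most k extend continuously to closure U. D is the gradient in U;
   its values on the boundary of U are the extension. For U = UNIV this is C^k(R^N). *)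
primrec Ck_closure :: "nat \<Rightarrow> 'a::euclidean_space set \<Rightarrow> ('a \<Rightarrow> real) \<Rightarrow> bool" where
  "Ck_closure 0 U f \<longleftrightarrow> continuous_on (closure U) f"
| "Ck_closure (Suc k) U f \<longleftrightarrow> continuous_on (closure U) f \<and>
     (\<exists>D :: 'a \<Rightarrow> 'a. (\<forall>x\<in>U. (f has_derivative (\<lambda>h. D x \<bullet> h)) (at x)) \<and>
        (\<forall>b\<in>Basis. Ck_closure k U (\<lambda>x. D x \<bullet> b)))"

(* C_c^\<infinity>(\<Omega>), its elements being extended by zero to the whole space. *)
definition test_functions :: "'a::euclidean_space set \<Rightarrow> ('a \<Rightarrow> real) set" where
  "test_functions \<Omega> = {\<eta>. (\<forall>k. Ck_closure k UNIV \<eta>) \<and>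
     compact (closure {x. \<eta> x \<noteq> 0}) \<and> closure {x. \<eta> x \<noteq> 0} \<subseteq> \<Omega>}"

(* Only the values of g outside \<Omega> matter, here and below. *)
definition viscosity_solution ::
  "('a::euclidean_space \<Rightarrow> real) \<Rightarrow> 'a set \<Rightarrow> ('a \<Rightarrow> real) \<Rightarrow> ('a \<Rightarrow> real) \<Rightarrow> bool" where
  "viscosity_solution K \<Omega> g u \<longleftrightarrow>
     u \<in> borel_measurable lebesgue \<and>
     continuous_on (closure \<Omega>) u \<and>
     (\<forall>x\<in>-\<Omega>. u x = g x) \<and>
     (\<forall>x0\<in>\<Omega>. \<forall>r>0. \<forall>\<phi>.
        ball x0 r \<subseteq> \<Omega> \<and> Ck_closure 2 (ball x0 r) \<phi> \<and> \<phi> x0 = u x0 \<longrightarrow>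
        (let w = (\<lambda>x. if x \<in> ball x0 r then \<phi> x else u x) in
           ((\<forall>x\<in>ball x0 r. u x \<le> \<phi> x) \<longrightarrow> L_defined K w x0 \<and> 0 \<le> L_op K w x0) \<and>
           ((\<forall>x\<in>ball x0 r. \<phi> x \<le> u x) \<longrightarrow> L_defined K w x0 \<and> L_op K w x0 \<le> 0)))"

(* Double integrals are taken over the Euclidean space 'a \<times> 'a, of dimension 2N.
   The last integrand is integrable once the energy is finite. *)
definition weak_solution ::
  "('a::euclidean_space \<Rightarrow> real) \<Rightarrow> 'a set \<Rightarrow> ('a \<Rightarrow> real) \<Rightarrow> ('a \<Rightarrow> real) \<Rightarrow> bool" where
  "weak_solution K \<Omega> g u \<longleftrightarrow>
     u \<in> borel_measurable lebesgue \<and>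
     (\<forall>x\<in>-\<Omega>. u x = g x) \<and>
     (\<integral>\<^sup>+p\<in>- ((-\<Omega>) \<times> (-\<Omega>)).
        ennreal (\<bar>u (fst p) - u (snd p)\<bar>\<^sup>2 * K (fst p - snd p)) \<partial>lebesgue) < \<infinity> \<and>
     (\<forall>\<eta>\<in>test_functions \<Omega>.
        (\<integral>p. (u (fst p) - u (snd p)) * (\<eta> (fst p) - \<eta> (snd p)) * K (fst p - snd p)
           \<partial>lebesgue) = 0)"

definition holder_norm :: "real \<Rightarrow> 'a::euclidean_space set \<Rightarrow> ('a \<Rightarrow> real) \<Rightarrow> ennreal" where
  "holder_norm \<alpha> S u =
     (SUP x\<in>S. ennreal \<bar>u x\<bar>) +
     (SUP p\<in>{p\<in>S \<times> S. fst p \<noteq> snd p}.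
        ennreal (\<bar>u (fst p) - u (snd p)\<bar> / norm (fst p - snd p) powr \<alpha>))"

definition holder_class :: "real \<Rightarrow> 'a::euclidean_space set \<Rightarrow> ('a \<Rightarrow> real) set" where
  "holder_class \<alpha> S = {u. holder_norm \<alpha> S u < \<infinity>}"

end

theory Submission
  imports Defs
begin

text \<open>Everything rests on one geometric and one analytic observation. A bounded Lipschitz domain has exterior
corkscrews: every ball \<open>ball z \<rho>\<close> around a boundary point contains a ball of comparable radius outside \<open>\<Omega>\<close>
(\<open>lipschitz_exterior_corkscrew\<close>). Hence a function that is \<open>2 * norm (x - z) powr \<alpha>\<close> inside \<open>\<Omega>\<close> and only
\<open>norm (x - z) powr \<alpha>\<close> outside drops by a fixed fraction of its value on a set of positive proportion at every
scale. As \<open>\<alpha>\<close> tends to 0 the function \<open>norm (x - z) powr \<alpha>\<close> becomes flat at scale \<open>norm (x - z)\<close>, so its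
own contribution to the operator is \<open>O(\<alpha>)\<close> while the drop contributes a fixed negative amount. For small
\<open>\<alpha>\<close> this \<open>barrier\<close> is therefore a strict supersolution, uniformly over all kernels with the given bounds
(\<open>barrier_supersolution\<close>), and \<open>g z + C\<^sub>0 * barrier\<close> dominates the exterior datum by hypothesis. Comparison
gives \<open>\<bar>u x - g z\<bar> \<le> 2 * C\<^sub>0 * norm (x - z) powr \<alpha>\<close>; the barrier is discontinuous across the boundary, but a
touching point lies inside \<open>\<Omega>\<close>, where it is smooth.

Inside \<open>\<Omega>\<close> the oscillation of a solution decays geometrically over dyadic balls: if \<open>u\<close> lies below its
middle value on half of a ball, a quadratic function touching \<open>u\<close> from above near its maximum is incompatible with
the equation unless the maximum is smaller by a fixed amount (\<open>half_ball_decay\<close>, \<open>interior_holder\<close>).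
Applied in balls of radius half the distance to the boundary, and combined with the boundary estimate, which also
controls the tails, this gives the Hoelder bound (\<open>holder_norm_le_of_boundary_interior\<close>).

For viscosity solutions both steps only use test functions that are quadratic near the touching point, and these are
captured by the notion \<open>nonlocal_subsolution\<close>. Weak solutions are reduced to the same notion by mollification:
since the kernel is translation invariant, the mollification of a weak solution solves the equation pointwise in the
points whose \<open>\<delta>\<close>-ball stays in \<open>\<Omega>\<close> (\<open>mollified_equation\<close>), hence the interior estimate applies to it with
constants that do not depend on \<open>\<delta>\<close>. What mollification does not preserve is the exterior condition, so the
comparison with the barrier is an energy argument. The finite energy together with the corkscrews yields the
Hardy inequality \<open>excess_hardy\<close>: the excess of the solution over the barrier, divided by
\<open>dist_bdry x powr s\<close>, is square integrable. The positive part \<open>p\<close> of the mollified excess is a subsolution away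
from the boundary; testing with \<open>p\<close> times a squared cutoff (\<open>caccioppoli_inequality\<close>) bounds its norm by cutoff errors, and
the Hardy inequality makes these errors tend to 0 with the width of the boundary layer
(\<open>mollified_excess_estimate\<close>, \<open>weak_comparison\<close>). The mollifications are then uniformly Hoelder continuous
and converge to the required representative (\<open>continuous_representative\<close>).\<close>

section \<open>Integrals against singular kernels\<close>

definition sing_kernel :: "real \<Rightarrow> 'a::euclidean_space \<Rightarrow> real" where
  "sing_kernel s y = 1 / norm y powr (real DIM('a) + 2 * s)"

text \<open>The weight \<open>min (t\<^sup>2) (t powr s)\<close> with \<open>t = norm y / r\<close>. It is quadratic below scale \<open>r\<close>, as needed for
integrability against a kernel of order \<open>2 * s\<close> at the origin, and of growth \<open>s < 2 * s\<close> at infinity. Its integral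
against \<open>sing_kernel\<close> scales like \<open>r powr (- 2 * s)\<close>, so every pointwise bound by a multiple of it turns into a
scale-invariant bound of the operator.\<close>
definition scale_weight :: "real \<Rightarrow> real \<Rightarrow> 'a::euclidean_space \<Rightarrow> real" where
  "scale_weight s r y = min ((norm y / r)\<^sup>2) ((norm y / r) powr s)"

lemma sing_kernel_nonneg: "0 \<le> sing_kernel s y"
  by (simp add: sing_kernel_def)

lemma sing_kernel_minus [simp]: "sing_kernel s (- y) = sing_kernel s y"
  by (simp add: sing_kernel_def)

lemma sing_kernel_eq_powr: "sing_kernel s (y::'a::euclidean_space) = norm y powr (- (real DIM('a) + 2 * s))"
  by (simp only: sing_kernel_def powr_minus_divide)

lemma sing_kernel_ge:
  fixes y :: "'a::euclidean_space"
  assumes "0 < s" "y \<noteq> 0" "norm y \<le> r"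
  shows "r powr (- (real DIM('a) + 2 * s)) \<le> sing_kernel s y"
proof -
  have "r powr (- (real DIM('a) + 2 * s)) \<le> norm y powr (- (real DIM('a) + 2 * s))"
    using assms by (intro powr_mono2') auto
  then show ?thesis by (simp only: sing_kernel_eq_powr)
qed

lemma sing_kernel_le:
  fixes y :: "'a::euclidean_space"
  assumes "0 < s" "0 < r" "r \<le> norm y"
  shows "sing_kernel s y \<le> r powr (- (real DIM('a) + 2 * s))"
proof -
  have "norm y powr (- (real DIM('a) + 2 * s)) \<le> r powr (- (real DIM('a) + 2 * s))"
    using assms by (intro powr_mono2') auto
  then show ?thesis by (simp only: sing_kernel_eq_powr)
qed

lemma scale_weight_nonneg: "0 \<le> scale_weight s r y"
  by (simp add: scale_weight_def)

lemma scale_weight_minus [simp]: "scale_weight s r (- y) = scale_weight s r y"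
  by (simp add: scale_weight_def)

lemma scale_weight_inner:
  assumes "0 < s" "s < 1" "0 < r" "norm y \<le> r"
  shows "scale_weight s r y = (norm y / r)\<^sup>2"
proof -
  let ?t = "norm y / r"
  have t: "0 \<le> ?t" "?t \<le> 1" using assms by auto
  have "?t\<^sup>2 \<le> ?t powr s"
  proof (cases "?t = 0")
    case False
    then have "?t\<^sup>2 = ?t powr 2" using t by (simp add: powr_numeral)
    also have "\<dots> \<le> ?t powr s" using t assms False by (intro powr_mono') auto
    finally show ?thesis .
  qed auto
  then show ?thesis by (simp add: scale_weight_def)
qed

lemma scale_weight_outer:
  assumes "0 < s" "s < 1" "0 < r" "r \<le> norm y"
  shows "scale_weight s r y = (norm y / r) powr s"
proof -
  let ?t = "norm y / r"
  have t: "1 \<le> ?t" using assms by auto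
  have "?t powr s \<le> ?t powr 2" using t assms by (intro powr_mono) auto
  also have "\<dots> = ?t\<^sup>2" using t by (simp add: powr_numeral)
  finally show ?thesis by (simp add: scale_weight_def)
qed

lemma scale_weight_ge_power2:
  assumes "0 < s" "s < 1" "0 < r" "0 < c" "c \<le> 1" "c * r \<le> norm y"
  shows "c\<^sup>2 \<le> scale_weight s r y"
proof (cases "norm y \<le> r")
  case True
  have "c \<le> norm y / r" using assms by (simp add: field_simps)
  then have "c\<^sup>2 \<le> (norm y / r)\<^sup>2" using assms by (intro power_mono) auto
  then show ?thesis using scale_weight_inner[OF assms(1-3) True] by simp
next
  case False
  then have *: "1 \<le> norm y / r" using assms by simp
  have "1 \<le> (norm y / r) powr s" using assms * by (intro ge_one_powr_ge_zero) auto
  moreover have "c\<^sup>2 \<le> 1" using assms by (simp add: power_le_one)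
  ultimately show ?thesis using scale_weight_outer[OF assms(1-3), of y] False by simp
qed

lemma borel_measurable_sing_kernel [measurable]: "sing_kernel s \<in> borel_measurable borel"
  unfolding sing_kernel_def by measurable

lemma borel_measurable_scale_weight [measurable]: "scale_weight s r \<in> borel_measurable borel"
  unfolding scale_weight_def by measurable

lemma ennreal_le_suminf: "(f :: nat \<Rightarrow> ennreal) j \<le> (\<Sum>k. f k)"
  using sum_le_suminf[of f "{j}"] by simp

text \<open>Decompose the ball into the annuli between the radii \<open>r / 2 ^ Suc k\<close> and \<open>r / 2 ^ k\<close>, on which the weight
and the kernel are comparable to constants; the contributions form a geometric series of ratio \<open>2 powr (2 * s - 2)\<close>.
Replacing each annulus by its enclosing ball avoids polar coordinates.\<close>
lemma nn_integral_sing_inner: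
  fixes s r :: real
  assumes "0 < s" "s < 1" "0 < r"
  shows "(\<integral>\<^sup>+y\<in>ball (0::'a::euclidean_space) r. ennreal (scale_weight s r y * sing_kernel s y) \<partial>lborel)
     \<le> ennreal ((unit_ball_vol (real DIM('a)) * 2 powr (real DIM('a) + 2 * s) / (1 - 2 powr (2 * s - 2))) * r powr (- 2 * s))"
proof -
  let ?N = "real DIM('a)" and ?V = "unit_ball_vol (real DIM('a))"
  define q :: real where "q = 2 powr (2 * s - 2)"
  have q: "0 < q" "q < 1" using assms by (auto simp: q_def powr_less_one)
  define c where "c k = (1/2)^(2*k) * (r * (1/2)^Suc k) powr (- (?N + 2 * s))" for k :: nat
  have c0: "0 \<le> c k" for k by (simp add: c_def)
  have pt: "ennreal (scale_weight s r y * sing_kernel s y) * indicator (ball 0 r) y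
     \<le> (\<Sum>k. ennreal (c k) * indicator (ball 0 (r * (1/2)^k)) y)" for y :: 'a
  proof (cases "y \<in> ball 0 r \<and> y \<noteq> 0")
    case True
    then have y: "0 < norm y" "norm y < r" by auto
    have "\<exists>k. r * (1/2)^k \<le> norm y"
    proof -
      have "0 < norm y / r" using y assms(3) by (intro divide_pos_pos) auto
      then obtain k where "(1/2::real)^k < norm y / r" using real_arch_pow_inv[of "norm y / r" "1/2"] by auto
      then show ?thesis using y assms by (intro exI[of _ k]) (simp add: field_simps)
    qed
    define k where "k = (LEAST k. r * (1/2)^k \<le> norm y)"
    have k1: "r * (1/2)^k \<le> norm y" unfolding k_def using \<open>\<exists>k. _\<close> by (rule LeastI_ex)
    have "k \<noteq> 0" using k1 y by (intro notI) simp
    then obtain j where j: "k = Suc j" using not0_implies_Suc by blast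
    have k2: "norm y < r * (1/2)^j"
      using not_less_Least[of j "\<lambda>k. r * (1/2)^k \<le> norm y"] j k_def by auto
    have "scale_weight s r y = (norm y / r)\<^sup>2" by (rule scale_weight_inner[OF assms less_imp_le[OF y(2)]])
    also have "\<dots> \<le> ((1/2)^j)\<^sup>2"
    proof (intro power_mono)
      show "norm y / r \<le> (1/2)^j"
        unfolding pos_divide_le_eq[OF assms(3)] using k2 by (simp only: mult.commute less_imp_le)
      show "0 \<le> norm y / r" using assms(3) by (intro divide_nonneg_pos) auto
    qed
    also have "\<dots> = (1/2)^(2*j)" by (simp only: power_mult[symmetric] mult.commute)
    finally have w: "scale_weight s r y \<le> (1/2)^(2*j)" .
    have "sing_kernel s y \<le> (r * (1/2)^Suc j) powr (- (?N + 2 * s))"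
      using assms k1 j by (intro sing_kernel_le) auto
    then have "scale_weight s r y * sing_kernel s y \<le> c j"
      unfolding c_def by (intro mult_mono w) (auto simp: sing_kernel_nonneg)
    then have "ennreal (scale_weight s r y * sing_kernel s y) * indicator (ball 0 r) y
       \<le> ennreal (c j) * indicator (ball 0 (r * (1/2)^j)) y"
      using True k2 by (auto intro: ennreal_leI)
    also have "\<dots> \<le> (\<Sum>k. ennreal (c k) * indicator (ball 0 (r * (1/2)^k)) y)"
      by (rule ennreal_le_suminf)
    finally show ?thesis .
  next
    case False
    then show ?thesis by (auto simp: scale_weight_def split: split_indicator)
  qed
  have "(\<integral>\<^sup>+y\<in>ball (0::'a) r. ennreal (scale_weight s r y * sing_kernel s y) \<partial>lborel)
     \<le> (\<integral>\<^sup>+y. (\<Sum>k. ennreal (c k) * indicator (ball (0::'a) (r * (1/2)^k)) y) \<partial>lborel)"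
    by (intro nn_integral_mono pt)
  also have "\<dots> = (\<Sum>k. \<integral>\<^sup>+y. ennreal (c k) * indicator (ball (0::'a) (r * (1/2)^k)) y \<partial>lborel)"
    by (intro nn_integral_suminf borel_measurable_times_ennreal borel_measurable_indicator) auto
  also have "\<dots> = (\<Sum>k. ennreal (c k) * ennreal (?V * (r * (1/2)^k) ^ DIM('a)))"
    using assms by (simp add: nn_integral_cmult_indicator emeasure_ball)
  also have "\<dots> = (\<Sum>k. ennreal (?V * 2 powr (?N + 2 * s) * r powr (- 2 * s) * q ^ k))"
  proof (intro suminf_cong)
    fix k
    have "(r * (1/2)^Suc k) powr (- (?N + 2 * s)) * (r * (1/2)^k) ^ DIM('a) * (1/2)^(2*k)
       = 2 powr (?N + 2 * s) * r powr (- 2 * s) * q ^ k"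
    proof -
      have h: "(1/2::real)^n = 2 powr (- real n)" for n
        by (simp add: powr_minus powr_realpow power_one_over inverse_eq_divide)
      have h2: "(r * (1/2)^k) ^ DIM('a) = r powr ?N * 2 powr (- real k * ?N)"
        using assms by (simp add: h powr_realpow[symmetric] powr_mult powr_powr)
      have h3: "q ^ k = 2 powr ((2 * s - 2) * real k)"
        using q by (simp add: q_def powr_realpow[symmetric] powr_powr)
      have h4: "(r * (1/2)^Suc k) powr (- (?N + 2 * s)) = r powr (- (?N + 2 * s)) * 2 powr ((real k + 1) * (?N + 2 * s))"
        unfolding h using assms by (simp add: powr_mult powr_powr algebra_simps)
      have h5: "(1/2::real)^(2*k) = 2 powr (- 2 * real k)" by (simp only: h) simp
      have "r powr (- (?N + 2 * s)) * 2 powr ((real k + 1) * (?N + 2 * s)) * (r powr ?N * 2 powr (- real k * ?N)) * 2 powr (- 2 * real k)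
        = (r powr (- (?N + 2 * s)) * r powr ?N) * (2 powr ((real k + 1) * (?N + 2 * s)) * 2 powr (- real k * ?N) * 2 powr (- 2 * real k))"
        by (simp only: mult_ac)
      also have "\<dots> = r powr (- 2 * s) * 2 powr ((?N + 2 * s) + (2 * s - 2) * real k)"
        unfolding powr_add[symmetric] by (simp add: algebra_simps)
      also have "\<dots> = 2 powr (?N + 2 * s) * r powr (- 2 * s) * 2 powr ((2 * s - 2) * real k)"
        unfolding powr_add by (simp only: mult_ac)
      finally show ?thesis unfolding h2 h3 h4 h5 .
    qed
    then have "c k * (?V * (r * (1/2)^k) ^ DIM('a)) = ?V * 2 powr (?N + 2 * s) * r powr (- 2 * s) * q ^ k"
      unfolding c_def by (simp add: mult_ac)
    then show "ennreal (c k) * ennreal (?V * (r * (1/2)^k) ^ DIM('a))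
        = ennreal (?V * 2 powr (?N + 2 * s) * r powr (- 2 * s) * q ^ k)"
      unfolding ennreal_mult'[OF c0, symmetric] by (simp only:)
  qed
  also have "\<dots> = ennreal (\<Sum>k. ?V * 2 powr (?N + 2 * s) * r powr (- 2 * s) * q ^ k)"
    using q by (intro suminf_ennreal2) (auto intro!: summable_mult summable_geometric)
  also have "(\<Sum>k. ?V * 2 powr (?N + 2 * s) * r powr (- 2 * s) * q ^ k) = ?V * 2 powr (?N + 2 * s) * r powr (- 2 * s) * (1 / (1 - q))"
    using q by (simp add: suminf_mult suminf_geometric summable_geometric)
  also have "\<dots> = (?V * 2 powr (?N + 2 * s) / (1 - 2 powr (2 * s - 2))) * r powr (- 2 * s)"
    by (simp add: q_def)
  finally show ?thesis .
qed

text \<open>The same decomposition into the annuli between \<open>r * 2 ^ k\<close> and \<open>r * 2 ^ Suc k\<close>; the ratio is now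
\<open>2 powr (- s)\<close>, since the weight grows like \<open>norm y powr s\<close>.\<close>
lemma nn_integral_sing_outer:
  fixes s r :: real
  assumes "0 < s" "s < 1" "0 < r"
  shows "(\<integral>\<^sup>+y\<in>- ball (0::'a::euclidean_space) r. ennreal (scale_weight s r y * sing_kernel s y) \<partial>lborel)
     \<le> ennreal ((unit_ball_vol (real DIM('a)) * 2 powr (real DIM('a) + s) / (1 - 2 powr (- s))) * r powr (- 2 * s))"
proof -
  let ?N = "real DIM('a)" and ?V = "unit_ball_vol (real DIM('a))"
  define q :: real where "q = 2 powr (- s)"
  have q: "0 < q" "q < 1" using assms by (auto simp: q_def powr_less_one)
  define c where "c k = (2^Suc k) powr s * (r * 2^k) powr (- (?N + 2 * s))" for k :: nat
  have c0: "0 \<le> c k" for k by (simp add: c_def)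
  have pt: "ennreal (scale_weight s r y * sing_kernel s y) * indicator (- ball 0 r) y
     \<le> (\<Sum>k. ennreal (c k) * indicator (ball 0 (r * 2^Suc k)) y)" for y :: 'a
  proof (cases "y \<in> ball 0 r")
    case False
    then have y: "r \<le> norm y" by auto
    have "\<exists>k. norm y < r * 2^k"
    proof -
      obtain k where "norm y / r < (2::real)^k" using real_arch_pow[of 2 "norm y / r"] by auto
      then show ?thesis using y assms by (intro exI[of _ k]) (simp add: field_simps)
    qed
    define k where "k = (LEAST k. norm y < r * 2^k)"
    have k1: "norm y < r * 2^k" unfolding k_def using \<open>\<exists>k. _\<close> by (rule LeastI_ex)
    have "k \<noteq> 0" using k1 y by (intro notI) simp
    then obtain j where j: "k = Suc j" using not0_implies_Suc by blast
    have k2: "r * 2^j \<le> norm y"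
      using not_less_Least[of j "\<lambda>k. norm y < r * 2^k"] j k_def by auto
    have "scale_weight s r y = (norm y / r) powr s" using assms y by (intro scale_weight_outer) auto
    also have "\<dots> \<le> (2^Suc j) powr s" using k1 j assms y by (intro powr_mono2) (auto simp: field_simps)
    finally have w: "scale_weight s r y \<le> (2^Suc j) powr s" .
    have "sing_kernel s y \<le> (r * 2^j) powr (- (?N + 2 * s))"
      using assms k2 by (intro sing_kernel_le) auto
    then have "scale_weight s r y * sing_kernel s y \<le> c j"
      unfolding c_def by (intro mult_mono w) (auto simp: sing_kernel_nonneg)
    then have "ennreal (scale_weight s r y * sing_kernel s y) * indicator (- ball 0 r) y
       \<le> ennreal (c j) * indicator (ball 0 (r * 2^Suc j)) y"
      using False k1 j by (auto intro: ennreal_leI)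
    also have "\<dots> \<le> (\<Sum>k. ennreal (c k) * indicator (ball 0 (r * 2^Suc k)) y)"
      by (rule ennreal_le_suminf)
    finally show ?thesis .
  qed auto
  have "(\<integral>\<^sup>+y\<in>- ball (0::'a) r. ennreal (scale_weight s r y * sing_kernel s y) \<partial>lborel)
     \<le> (\<integral>\<^sup>+y. (\<Sum>k. ennreal (c k) * indicator (ball (0::'a) (r * 2^Suc k)) y) \<partial>lborel)"
    by (intro nn_integral_mono pt)
  also have "\<dots> = (\<Sum>k. \<integral>\<^sup>+y. ennreal (c k) * indicator (ball (0::'a) (r * 2^Suc k)) y \<partial>lborel)"
    by (intro nn_integral_suminf borel_measurable_times_ennreal borel_measurable_indicator) auto
  also have "\<dots> = (\<Sum>k. ennreal (c k) * ennreal (?V * (r * 2^Suc k) ^ DIM('a)))"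
    using assms by (simp add: nn_integral_cmult_indicator emeasure_ball)
  also have "\<dots> = (\<Sum>k. ennreal (?V * 2 powr (?N + s) * r powr (- 2 * s) * q ^ k))"
  proof (intro suminf_cong)
    fix k
    have "(2^Suc k) powr s * (r * 2^k) powr (- (?N + 2 * s)) * (r * 2^Suc k) ^ DIM('a)
       = 2 powr (?N + s) * r powr (- 2 * s) * q ^ k"
    proof -
      have h: "(2::real)^n = 2 powr (real n)" for n
        by (simp add: powr_realpow)
      have h2: "(r * 2^Suc k) ^ DIM('a) = r powr ?N * 2 powr ((real k + 1) * ?N)"
        unfolding h using assms by (simp add: powr_realpow[symmetric] powr_mult powr_powr algebra_simps)
      have h3: "q ^ k = 2 powr (- s * real k)"
        using q by (simp add: q_def powr_realpow[symmetric] powr_powr)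
      have h4: "(r * 2^k) powr (- (?N + 2 * s)) = r powr (- (?N + 2 * s)) * 2 powr (- real k * (?N + 2 * s))"
        unfolding h using assms by (simp add: powr_mult powr_powr algebra_simps)
      have h5: "(2^Suc k::real) powr s = 2 powr ((real k + 1) * s)" unfolding h by (simp add: powr_powr algebra_simps)
      have "2 powr ((real k + 1) * s) * (r powr (- (?N + 2 * s)) * 2 powr (- real k * (?N + 2 * s))) * (r powr ?N * 2 powr ((real k + 1) * ?N))
        = (r powr (- (?N + 2 * s)) * r powr ?N) * (2 powr ((real k + 1) * s) * 2 powr (- real k * (?N + 2 * s)) * 2 powr ((real k + 1) * ?N))"
        by (simp only: mult_ac)
      also have "\<dots> = r powr (- 2 * s) * 2 powr ((?N + s) + (- s) * real k)"
        unfolding powr_add[symmetric] by (simp add: algebra_simps)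
      also have "\<dots> = 2 powr (?N + s) * r powr (- 2 * s) * 2 powr (- s * real k)"
        unfolding powr_add by (simp only: mult_ac)
      finally show ?thesis unfolding h2 h3 h4 h5 .
    qed
    then have "c k * (?V * (r * 2^Suc k) ^ DIM('a)) = ?V * 2 powr (?N + s) * r powr (- 2 * s) * q ^ k"
      unfolding c_def by (simp add: mult_ac)
    then show "ennreal (c k) * ennreal (?V * (r * 2^Suc k) ^ DIM('a))
        = ennreal (?V * 2 powr (?N + s) * r powr (- 2 * s) * q ^ k)"
      unfolding ennreal_mult'[OF c0, symmetric] by (simp only:)
  qed
  also have "\<dots> = ennreal (\<Sum>k. ?V * 2 powr (?N + s) * r powr (- 2 * s) * q ^ k)"
    using q by (intro suminf_ennreal2) (auto intro!: summable_mult summable_geometric)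
  also have "(\<Sum>k. ?V * 2 powr (?N + s) * r powr (- 2 * s) * q ^ k) = ?V * 2 powr (?N + s) * r powr (- 2 * s) * (1 / (1 - q))"
    using q by (simp add: suminf_mult suminf_geometric summable_geometric)
  also have "\<dots> = (?V * 2 powr (?N + s) / (1 - 2 powr (- s))) * r powr (- 2 * s)"
    by (simp add: q_def)
  finally show ?thesis .
qed

text \<open>The sum of the constants of the inner and the outer dyadic series.\<close>
definition weight_const :: "'a::euclidean_space itself \<Rightarrow> real \<Rightarrow> real" where
  "weight_const _ s = unit_ball_vol (real DIM('a)) *
     (2 powr (real DIM('a) + 2 * s) / (1 - 2 powr (2 * s - 2)) + 2 powr (real DIM('a) + s) / (1 - 2 powr (- s)))"

lemma weight_const_pos:
  assumes "0 < s" "s < 1"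
  shows "0 < weight_const TYPE('a::euclidean_space) s"
proof -
  have "2 powr (2 * s - 2) < 1" "2 powr (- s) < 1" using assms by (auto intro!: powr_less_one)
  then show ?thesis by (auto simp: weight_const_def intro!: mult_pos_pos add_pos_pos)
qed

lemma nn_integral_weight_le:
  fixes s r :: real
  assumes "0 < s" "s < 1" "0 < r"
  shows "(\<integral>\<^sup>+y. ennreal (scale_weight s r y * sing_kernel s (y::'a::euclidean_space)) \<partial>lborel)
    \<le> ennreal (weight_const TYPE('a) s * r powr (- 2 * s))"
proof -
  let ?V = "unit_ball_vol (real DIM('a))"
  define J1 where "J1 = ?V * 2 powr (real DIM('a) + 2 * s) / (1 - 2 powr (2 * s - 2))"
  define J2 where "J2 = ?V * 2 powr (real DIM('a) + s) / (1 - 2 powr (- s))"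
  have "2 powr (2 * s - 2) < 1" "2 powr (- s) < 1" using assms by (auto intro!: powr_less_one)
  then have J: "0 \<le> J1" "0 \<le> J2" by (auto simp: J1_def J2_def)
  have "(\<integral>\<^sup>+y. ennreal (scale_weight s r y * sing_kernel s (y::'a)) \<partial>lborel)
    = (\<integral>\<^sup>+y. ennreal (scale_weight s r y * sing_kernel s y) * indicator (ball 0 r) (y::'a)
         + ennreal (scale_weight s r y * sing_kernel s y) * indicator (- ball 0 r) y \<partial>lborel)"
    by (intro nn_integral_cong) (auto split: split_indicator)
  also have "\<dots> = (\<integral>\<^sup>+y. ennreal (scale_weight s r y * sing_kernel s y) * indicator (ball 0 r) (y::'a) \<partial>lborel)
         + (\<integral>\<^sup>+y. ennreal (scale_weight s r y * sing_kernel s (y::'a)) * indicator (- ball 0 r) y \<partial>lborel)"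
    by (intro nn_integral_add) (measurable; simp)+
  also have "\<dots> \<le> ennreal (J1 * r powr (- 2 * s)) + ennreal (J2 * r powr (- 2 * s))"
    unfolding J1_def J2_def by (intro add_mono nn_integral_sing_inner nn_integral_sing_outer assms)
  also have "\<dots> = ennreal ((J1 + J2) * r powr (- 2 * s))"
    using J by (simp add: ennreal_plus[symmetric] algebra_simps del: ennreal_plus)
  also have "J1 + J2 = weight_const TYPE('a) s"
    by (simp add: J1_def J2_def weight_const_def algebra_simps)
  finally show ?thesis .
qed

text \<open>The upper half of the bounds on \<open>K\<close>. It is kept separate from the lower one because truncated kernels
satisfy only this part.\<close>
definition upper_kernel :: "real \<Rightarrow> real \<Rightarrow> ('a::euclidean_space \<Rightarrow> real) \<Rightarrow> bool" where
  "upper_kernel s Lam K \<longleftrightarrow> K \<in> borel_measurable lebesgue \<and>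
     (\<forall>y. y \<noteq> 0 \<longrightarrow> K (- y) = K y \<and> 0 \<le> K y \<and> K y \<le> Lam * sing_kernel s y)"

lemma AE_lebesgue_nonzero: "AE y::'a::euclidean_space in lebesgue. y \<noteq> 0"
  using AE_completion[OF AE_lborel_singleton] .

lemma integrable_weight:
  fixes s r :: real
  assumes "0 < s" "s < 1" "0 < r"
  shows "integrable lebesgue (\<lambda>y::'a::euclidean_space. scale_weight s r y * sing_kernel s y)"
    and "(\<integral>y. scale_weight s r (y::'a) * sing_kernel s y \<partial>lebesgue) \<le> weight_const TYPE('a) s * r powr (- 2 * s)"
proof -
  let ?f = "\<lambda>y::'a. scale_weight s r y * sing_kernel s y"
  have m: "?f \<in> borel_measurable lborel" by simp
  have nn: "0 \<le> ?f y" for y by (simp add: scale_weight_nonneg sing_kernel_nonneg)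
  have i: "integrable lborel ?f"
    using nn nn_integral_weight_le[OF assms, where 'a='a]
    by (intro integrableI_bounded m) (auto simp: top.not_eq_extremum intro: le_less_trans)
  then show "integrable lebesgue ?f" using m by (simp add: integrable_completion)
  have "ennreal (\<integral>y. ?f y \<partial>lborel) \<le> ennreal (weight_const TYPE('a) s * r powr (- 2 * s))"
    using nn_integral_eq_integral[OF i] nn nn_integral_weight_le[OF assms, where 'a='a] by simp
  then have "(\<integral>y. ?f y \<partial>lborel) \<le> weight_const TYPE('a) s * r powr (- 2 * s)"
    using weight_const_pos[OF assms(1,2), where 'a='a] by (simp add: ennreal_le_iff)
  then show "(\<integral>y. ?f y \<partial>lebesgue) \<le> weight_const TYPE('a) s * r powr (- 2 * s)"
    using m by (simp add: integral_completion)
qed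

lemma integrable_mult_kernel:
  fixes f :: "'a::euclidean_space \<Rightarrow> real"
  assumes s: "0 < s" "s < 1" "0 < r" and K: "upper_kernel s Lam K"
    and f: "f \<in> borel_measurable lebesgue" "\<And>y. y \<noteq> 0 \<Longrightarrow> \<bar>f y\<bar> \<le> B * scale_weight s r y"
  shows "integrable lebesgue (\<lambda>y. f y * K y)"
proof (rule Bochner_Integration.integrable_bound)
  show "integrable lebesgue (\<lambda>y::'a. B * Lam * (scale_weight s r y * sing_kernel s y))"
    using integrable_weight(1)[OF s, where 'a='a] by simp
  show "(\<lambda>y. f y * K y) \<in> borel_measurable lebesgue"
    using f K by (auto simp: upper_kernel_def)
  have "norm (f y * K y) \<le> norm (B * Lam * (scale_weight s r y * sing_kernel s y))" if "y \<noteq> 0" for y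
  proof -
    have "\<bar>f y\<bar> * K y \<le> (B * scale_weight s r y) * (Lam * sing_kernel s y)"
      using K that f(2)[OF that] by (intro mult_mono) (auto simp: upper_kernel_def)
    also have "\<dots> = B * Lam * (scale_weight s r y * sing_kernel s y)" by (simp add: mult_ac)
    finally have "\<bar>f y\<bar> * K y \<le> \<bar>B * Lam * (scale_weight s r y * sing_kernel s y)\<bar>" by linarith
    then show ?thesis using K that by (auto simp: upper_kernel_def abs_mult)
  qed
  then show "AE y in lebesgue. norm (f y * K y) \<le> norm (B * Lam * (scale_weight s r y * sing_kernel s y))"
    using AE_lebesgue_nonzero by (auto elim!: eventually_mono)
qed

text \<open>This is how all contradictions arise: an increment of size at most \<open>e\<close> in the weighted sense that drops by
\<open>q\<close> on a set \<open>S\<close> of positive proportion at scale \<open>r\<close> has a negative integral as soon as \<open>e\<close> is small compared with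
\<open>q\<close>, because \<open>K\<close> is at least \<open>lam * (2 * r) powr (- (N + 2 * s))\<close> on \<open>S\<close>.\<close>
lemma kernel_integral_le:
  fixes f :: "'a::euclidean_space \<Rightarrow> real"
  assumes s: "0 < s" "s < 1" "0 < r" and K: "upper_kernel s Lam K"
    and "0 \<le> Lam" "0 \<le> lam" "0 \<le> e" "0 \<le> q"
    and int: "integrable lebesgue (\<lambda>y. f y * K y)"
    and S: "S \<in> lmeasurable" "S \<subseteq> cball 0 (2 * r)" "mu * r ^ DIM('a) \<le> measure lebesgue S"
    and Klow: "\<And>y. y \<in> S \<Longrightarrow> y \<noteq> 0 \<Longrightarrow> lam * sing_kernel s y \<le> K y"
    and f: "\<And>y. y \<noteq> 0 \<Longrightarrow> f y \<le> e * scale_weight s r y - q * indicator S y"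
  shows "(\<integral>y. f y * K y \<partial>lebesgue)
    \<le> (e * Lam * weight_const TYPE('a) s - q * lam * mu * 2 powr (- (real DIM('a) + 2 * s))) * r powr (- 2 * s)"
proof -
  let ?N = "real DIM('a)"
  define p where "p = (2 * r) powr (- (?N + 2 * s))"
  have p: "p = 2 powr (- (?N + 2 * s)) * (r powr (- ?N) * r powr (- 2 * s))"
    using s by (simp add: p_def powr_mult powr_add[symmetric] algebra_simps)
  let ?g = "\<lambda>y::'a. e * Lam * (scale_weight s r y * sing_kernel s y) - q * lam * p * indicator S y"
  have iS: "integrable lebesgue (indicator S :: 'a \<Rightarrow> real)"
    using S(1) by (auto simp: fmeasurable_def intro: integrable_real_indicator)
  have ig: "integrable lebesgue ?g"
    using integrable_weight(1)[OF s, where 'a='a] iS by (intro Bochner_Integration.integrable_diff) auto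
  have "f y * K y \<le> ?g y" if y: "y \<noteq> 0" for y
  proof -
    have K0: "0 \<le> K y" "K y \<le> Lam * sing_kernel s y" using K y by (auto simp: upper_kernel_def)
    have "f y * K y \<le> (e * scale_weight s r y - q * indicator S y) * K y"
      using f[OF y] K0 by (intro mult_right_mono) auto
    also have "\<dots> = e * scale_weight s r y * K y - q * (indicator S y * K y)" by (simp add: algebra_simps)
    also have "\<dots> \<le> e * scale_weight s r y * (Lam * sing_kernel s y) - q * (lam * p * indicator S y)"
    proof (intro diff_mono mult_left_mono)
      show "lam * p * indicator S y \<le> indicator S y * K y"
      proof (cases "y \<in> S")
        case True
        have "p \<le> sing_kernel s y" unfolding p_def using s y True S by (intro sing_kernel_ge) auto
        then have "lam * p \<le> lam * sing_kernel s y" using \<open>0 \<le> lam\<close> by (rule mult_left_mono)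
        also have "\<dots> \<le> K y" using Klow[OF True y] .
        finally show ?thesis using True by simp
      qed auto
    qed (use K0 assms in \<open>auto simp: scale_weight_nonneg\<close>)
    finally show ?thesis by (simp add: algebra_simps)
  qed
  then have "(\<integral>y. f y * K y \<partial>lebesgue) \<le> (\<integral>y. ?g y \<partial>lebesgue)"
    using AE_lebesgue_nonzero by (intro integral_mono_AE int ig) (auto elim!: eventually_mono)
  also have "\<dots> = e * Lam * (\<integral>y. scale_weight s r (y::'a) * sing_kernel s y \<partial>lebesgue) - q * lam * p * measure lebesgue S"
    using integrable_weight(1)[OF s, where 'a='a] iS S(1)
    by (subst Bochner_Integration.integral_diff) (auto simp: fmeasurable_def)
  also have "\<dots> \<le> e * Lam * (weight_const TYPE('a) s * r powr (- 2 * s)) - q * lam * p * (mu * r ^ DIM('a))"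
    using assms integrable_weight(2)[OF s, where 'a='a] by (intro diff_mono mult_left_mono) (auto simp: p_def)
  also have "q * lam * p * (mu * r ^ DIM('a)) = q * lam * mu * 2 powr (- (?N + 2 * s)) * r powr (- 2 * s) * (r powr (- ?N) * r ^ DIM('a))"
    unfolding p by (simp add: mult_ac)
  also have "r powr (- ?N) * r ^ DIM('a) = 1"
    using s by (simp add: powr_realpow[symmetric] powr_add[symmetric])
  finally show ?thesis by (simp add: algebra_simps)
qed

section \<open>Subsolutions tested by quadratic touching functions\<close>

text \<open>The function \<open>H\<close> bounds the increments of \<open>u\<close> at \<open>x\<close> from above everywhere and is quadratic near 0. Asking for
a global majorant, rather than for the operator on a spliced function, makes the condition meaningful for viscosity
solutions and for mollified weak solutions alike, and only involves integrals that are known to converge.\<close>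
definition nonlocal_subsolution :: "('a::euclidean_space \<Rightarrow> real) \<Rightarrow> 'a set \<Rightarrow> ('a \<Rightarrow> real) \<Rightarrow> bool" where
  "nonlocal_subsolution K U u \<longleftrightarrow>
     (\<forall>x\<in>U. \<forall>r>0. \<forall>p c H. (\<forall>y. norm y < r \<longrightarrow> H y = p \<bullet> y + c * (norm y)\<^sup>2) \<longrightarrow>
        (\<forall>y. u (x + y) - u x \<le> H y) \<longrightarrow> H \<in> borel_measurable lebesgue \<longrightarrow>
        integrable lebesgue (\<lambda>y. (H y + H (- y)) * K y) \<longrightarrow>
        0 \<le> (\<integral>y. (H y + H (- y)) * K y \<partial>lebesgue))"

lemma nonlocal_subsolutionD:
  assumes "nonlocal_subsolution K U u" "x \<in> U" "0 < r"
    and "\<And>y. norm y < r \<Longrightarrow> H y = p \<bullet> y + c * (norm y)\<^sup>2"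
    and "\<And>y. u (x + y) - u x \<le> H y" "H \<in> borel_measurable lebesgue"
    and "integrable lebesgue (\<lambda>y. (H y + H (- y)) * K y)"
  shows "0 \<le> (\<integral>y. (H y + H (- y)) * K y \<partial>lebesgue)"
  using assms unfolding nonlocal_subsolution_def by blast

lemma nonlocal_subsolution_mono:
  assumes "nonlocal_subsolution K U u" "V \<subseteq> U"
  shows "nonlocal_subsolution K V u"
  using assms unfolding nonlocal_subsolution_def by blast

lemma Ck_closure_quadratic:
  fixes x0 :: "'a::euclidean_space"
  shows "Ck_closure 2 U (\<lambda>x. a + p \<bullet> (x - x0) + c * (norm (x - x0))\<^sup>2)"
proof -
  have 1: "((\<lambda>x. a + p \<bullet> (x - x0) + c * (norm (x - x0))\<^sup>2) has_derivative (\<lambda>h. (p + (2 * c) *\<^sub>R (x - x0)) \<bullet> h)) (at x)" for x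
    unfolding power2_norm_eq_inner
    by (auto intro!: derivative_eq_intros simp: inner_simps inner_commute algebra_simps)
  have 2: "((\<lambda>x. (p + (2 * c) *\<^sub>R (x - x0)) \<bullet> b) has_derivative (\<lambda>h. ((2 * c) *\<^sub>R b) \<bullet> h)) (at x)" for x b
    by (auto intro!: derivative_eq_intros simp: inner_simps inner_commute algebra_simps)
  have c1: "continuous_on S (\<lambda>x. a + p \<bullet> (x - x0) + c * (norm (x - x0))\<^sup>2)" for S by (intro continuous_intros)
  have c2: "continuous_on S (\<lambda>x. (p + (2 * c) *\<^sub>R (x - x0)) \<bullet> b)" for S b by (intro continuous_intros)
  have "Ck_closure (Suc 0) U (\<lambda>x. (p + (2 * c) *\<^sub>R (x - x0)) \<bullet> b)" for b
    unfolding Ck_closure.simps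
    by (intro conjI exI[of _ "\<lambda>x. (2 * c) *\<^sub>R b"] ballI c2 2 continuous_intros)
  then have "Ck_closure (Suc (Suc 0)) U (\<lambda>x. a + p \<bullet> (x - x0) + c * (norm (x - x0))\<^sup>2)"
    unfolding Ck_closure.simps(2)[of "Suc 0"] using 1 c1 by (intro conjI exI[of _ "\<lambda>x. p + (2 * c) *\<^sub>R (x - x0)"]) auto
  then show ?thesis by (simp only: numeral_2_eq_2)
qed

text \<open>The converse sign convention of \<open>L_integrand\<close> and its factor one half are absorbed here.\<close>
lemma L_integrand_le:
  fixes K :: "'a::euclidean_space \<Rightarrow> real"
  assumes "\<And>y. w (x + y) - w x \<le> H y" and "\<And>y. y \<noteq> 0 \<Longrightarrow> 0 \<le> K y" and "H 0 = 0"
  shows "- L_integrand K w x y \<le> ((H y + H (- y)) * K y) / 2"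
proof (cases "y = 0")
  case True
  then show ?thesis using assms(3) by (simp add: L_integrand_def)
next
  case False
  have "((w (x + y) - w x) + (w (x - y) - w x)) * K y \<le> (H y + H (- y)) * K y"
    using assms(1)[of y] assms(1)[of "- y"] assms(2)[OF False] by (intro mult_right_mono add_mono) auto
  then show ?thesis by (simp add: L_integrand_def field_simps)
qed

text \<open>Near \<open>x\<close> the majorant \<open>u x + H (z - x)\<close> is an admissible test function, and the spliced function still has its
increments below \<open>H\<close>.\<close>
lemma viscosity_imp_subsolution:
  fixes u :: "'a::euclidean_space \<Rightarrow> real"
  assumes v: "viscosity_solution K \<Omega> g u" and K: "\<And>y. y \<noteq> 0 \<Longrightarrow> 0 \<le> K y" and \<Omega>: "open \<Omega>"
  shows "nonlocal_subsolution K \<Omega> u"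
  unfolding nonlocal_subsolution_def
proof (intro ballI allI impI)
  fix x r p c H
  assume x: "x \<in> \<Omega>" and r: "(0::real) < r" and H: "\<forall>y. norm y < r \<longrightarrow> H y = p \<bullet> y + c * (norm y)\<^sup>2"
    and uH: "\<forall>y. u (x + y) - u x \<le> H y" and m: "H \<in> borel_measurable lebesgue"
    and int: "integrable lebesgue (\<lambda>y. (H y + H (- y)) * K y)"
  obtain r' where r': "0 < r'" "ball x r' \<subseteq> \<Omega>" using \<Omega> x openE by blast
  define \<rho> where "\<rho> = min r r'"
  have \<rho>: "0 < \<rho>" "ball x \<rho> \<subseteq> \<Omega>" "\<rho> \<le> r" using r r' by (auto simp: \<rho>_def)
  define \<phi> where "\<phi> = (\<lambda>z. u x + p \<bullet> (z - x) + c * (norm (z - x))\<^sup>2)"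
  define w where "w = (\<lambda>z. if z \<in> ball x \<rho> then \<phi> z else u z)"
  have "Ck_closure 2 (ball x \<rho>) \<phi>" unfolding \<phi>_def by (rule Ck_closure_quadratic)
  moreover have "\<phi> x = u x" by (simp add: \<phi>_def)
  moreover have \<phi>H: "\<phi> z = u x + H (z - x)" if "z \<in> ball x \<rho>" for z
    using H[rule_format, of "z - x"] that \<rho> by (simp add: \<phi>_def dist_norm norm_minus_commute)
  then have "\<forall>z\<in>ball x \<rho>. u z \<le> \<phi> z"
    using uH[rule_format, of "_ - x"] by (auto simp: algebra_simps)
  ultimately have L: "L_defined K w x \<and> 0 \<le> L_op K w x"
    using v \<rho> x unfolding viscosity_solution_def w_def Let_def by blast
  have wH: "w (x + y) - w x \<le> H y" for y
    using \<phi>H[of "x + y"] uH \<open>\<phi> x = u x\<close> \<rho> by (auto simp: w_def)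
  have "H 0 = 0" using H[rule_format, of 0] r by simp
  have "0 \<le> (\<integral>y. - L_integrand K w x y \<partial>lebesgue)" using L by (simp add: L_op_def)
  also have "\<dots> \<le> (\<integral>y. ((H y + H (- y)) * K y) / 2 \<partial>lebesgue)"
    using L int by (intro integral_mono L_integrand_le[OF wH K \<open>H 0 = 0\<close>]) (auto simp: L_defined_def)
  finally show "0 \<le> (\<integral>y. (H y + H (- y)) * K y \<partial>lebesgue)" by simp
qed

lemma Ck_closure_uminus: "Ck_closure k U f \<Longrightarrow> Ck_closure k U (\<lambda>x. - f x)"
proof (induction k arbitrary: f)
  case (Suc k)
  then obtain D where D: "\<forall>x\<in>U. (f has_derivative (\<lambda>h. D x \<bullet> h)) (at x)" "\<forall>b\<in>Basis. Ck_closure k U (\<lambda>x. D x \<bullet> b)"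
    by auto
  have "\<forall>x\<in>U. ((\<lambda>x. - f x) has_derivative (\<lambda>h. (- D x) \<bullet> h)) (at x)"
    using D(1) by (auto dest!: bspec intro!: derivative_eq_intros)
  moreover have "\<forall>b\<in>Basis. Ck_closure k U (\<lambda>x. (- D x) \<bullet> b)"
    using D(2) Suc.IH by auto
  ultimately show ?case using Suc.prems by (auto intro!: continuous_intros exI[of _ "\<lambda>x. - D x"])
qed (auto intro: continuous_intros)

lemma L_integrand_uminus: "L_integrand K (\<lambda>x. - u x) x = (\<lambda>y. - L_integrand K u x y)"
  by (auto simp: L_integrand_def fun_eq_iff field_simps)

lemma L_defined_uminus: "L_defined K (\<lambda>x. - u x) x \<longleftrightarrow> L_defined K u x"
  by (simp add: L_defined_def L_integrand_uminus)

lemma L_op_uminus: "L_op K (\<lambda>x. - u x) x = - L_op K u x"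
  by (simp add: L_op_def L_integrand_uminus)

lemma viscosity_solution_uminus:
  assumes "viscosity_solution K \<Omega> g u"
  shows "viscosity_solution K \<Omega> (\<lambda>x. - g x) (\<lambda>x. - u x)"
proof -
  have "(let w = (\<lambda>x. if x \<in> ball x0 r then \<phi> x else - u x) in
           ((\<forall>x\<in>ball x0 r. - u x \<le> \<phi> x) \<longrightarrow> L_defined K w x0 \<and> 0 \<le> L_op K w x0) \<and>
           ((\<forall>x\<in>ball x0 r. \<phi> x \<le> - u x) \<longrightarrow> L_defined K w x0 \<and> L_op K w x0 \<le> 0))"
    if h: "x0 \<in> \<Omega>" "0 < r" "ball x0 r \<subseteq> \<Omega>" "Ck_closure 2 (ball x0 r) \<phi>" "\<phi> x0 = - u x0" for x0 r \<phi>
  proof -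
    define w where "w = (\<lambda>x. if x \<in> ball x0 r then \<phi> x else - u x)"
    define w' where "w' = (\<lambda>x. if x \<in> ball x0 r then - \<phi> x else u x)"
    have w: "w = (\<lambda>x. - w' x)" by (auto simp: w_def w'_def)
    have "((\<forall>x\<in>ball x0 r. u x \<le> - \<phi> x) \<longrightarrow> L_defined K w' x0 \<and> 0 \<le> L_op K w' x0) \<and>
           ((\<forall>x\<in>ball x0 r. - \<phi> x \<le> u x) \<longrightarrow> L_defined K w' x0 \<and> L_op K w' x0 \<le> 0)"
      using assms h Ck_closure_uminus[OF h(4)]
      unfolding viscosity_solution_def Let_def w'_def by simp
    then have "((\<forall>x\<in>ball x0 r. - u x \<le> \<phi> x) \<longrightarrow> L_defined K w x0 \<and> 0 \<le> L_op K w x0) \<and>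
           ((\<forall>x\<in>ball x0 r. \<phi> x \<le> - u x) \<longrightarrow> L_defined K w x0 \<and> L_op K w x0 \<le> 0)"
      unfolding w L_defined_uminus L_op_uminus by (simp add: le_minus_iff minus_le_iff)
    then show ?thesis unfolding Let_def w_def .
  qed
  then show ?thesis using assms unfolding viscosity_solution_def by (auto intro!: continuous_intros)
qed

text \<open>Quantifies how flat \<open>x powr a\<close> becomes as \<open>a\<close> tends to 0: the increment has a factor \<open>a\<close>, at the price of the
larger exponent \<open>s\<close>, which the kernel still integrates.\<close>
lemma powr_minus_one_le:
  fixes a s x :: real
  assumes "0 < a" "a \<le> s / 2" "1 \<le> x"
  shows "x powr a - 1 \<le> (2 * a / s) * x powr s"
proof -
  define L where "L = a * ln x"
  have s: "0 < s" using assms by linarith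
  have L0: "0 \<le> L" using assms by (simp add: L_def)
  have xa: "x powr a = exp L" using assms by (simp add: powr_def L_def)
  have "1 + (- L) \<le> exp (- L)" by (rule exp_ge_add_one_self)
  then have "(1 - L) * exp L \<le> exp (- L) * exp L" by (intro mult_right_mono) auto
  then have 1: "exp L - 1 \<le> L * exp L" by (simp add: exp_minus algebra_simps)
  have "1 + (s / 2) * ln x \<le> exp ((s / 2) * ln x)" by (rule exp_ge_add_one_self)
  moreover have "x powr (s / 2) = exp ((s / 2) * ln x)" using assms by (simp add: powr_def)
  ultimately have "(s / 2) * ln x \<le> x powr (s / 2)" by linarith
  then have "L \<le> (2 * a / s) * x powr (s / 2)" using s assms(1) mult_left_mono[of "(s / 2) * ln x" "x powr (s/2)" "2 * a / s"]
    by (simp add: L_def)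
  moreover have "exp L \<le> x powr (s / 2)" unfolding xa[symmetric] using assms by (intro powr_mono) auto
  ultimately have "L * exp L \<le> ((2 * a / s) * x powr (s / 2)) * x powr (s / 2)"
    using s assms by (intro mult_mono) auto
  also have "\<dots> = (2 * a / s) * x powr s" using s by (simp add: powr_add[symmetric])
  finally show ?thesis using 1 xa by linarith
qed

section \<open>Interior oscillation decay\<close>

text \<open>The factor 16 comes from the ring \<open>r / 4 \<le> norm y \<le> r\<close>, where the weight is quadratic and at least \<open>1 / 16\<close>.\<close>
lemma scale_weight_ge_powr:
  assumes "0 < s" "s < 1" "0 < r" "r / 4 \<le> norm y"
  shows "(norm y / r) powr s \<le> 16 * scale_weight s r y"
proof (cases "r \<le> norm y")
  case True
  then show ?thesis using scale_weight_outer[OF assms(1-3) True] by simp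
next
  case False
  then have "(norm y / r) powr s \<le> 1" using assms by (intro powr_le1) auto
  moreover have "(1/4)\<^sup>2 \<le> scale_weight s r y" using assms by (intro scale_weight_ge_power2) auto
  ultimately show ?thesis by (simp add: power2_eq_square)
qed

text \<open>Suppose \<open>u\<close> came within \<open>5 * \<tau> / 16 * w\<close> of its upper bound \<open>m + w\<close> in the half ball. Adding \<open>\<tau> * w * b\<close> with
the paraboloid \<open>b x = 1 - (norm (x - x0) / r)\<^sup>2\<close> forces the maximum of the sum to an interior point \<open>x2\<close>, where \<open>u\<close>
is touched from above by a paraboloid of opening \<open>O(\<tau>)\<close>. At \<open>x2\<close> the values of \<open>u\<close> are at least \<open>m + w - \<tau> * w\<close>,
whereas \<open>u\<close> is at most \<open>m\<close> on half of the ball. The resulting drop outweighs the opening of the paraboloid and the growth of the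
tail, which is \<open>O(\<alpha>)\<close>. The growth condition outside the ball is the one that the iteration over dyadic balls produces.\<close>
lemma half_ball_decay:
  fixes s lam Lam :: real
  assumes s: "0 < s" "s < 1" and lam: "0 < lam" "0 < Lam"
  obtains \<theta> a0 where "0 < \<theta>" "\<theta> < 1" "0 < a0"
    "\<And>(K :: 'a::euclidean_space \<Rightarrow> real) \<alpha> u x0 r m w y.
      \<lbrakk>upper_kernel s Lam K; \<And>y. y \<noteq> 0 \<Longrightarrow> lam * sing_kernel s y \<le> K y;
       0 < \<alpha>; \<alpha> \<le> a0; 0 < r; 0 < w; nonlocal_subsolution K (ball x0 r) u;
       continuous_on (ball x0 r) u; u \<in> borel_measurable lebesgue;
       \<And>y. y \<in> ball x0 r \<Longrightarrow> u y \<le> m + w;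
       \<And>y. y \<notin> ball x0 r \<Longrightarrow> u y \<le> m + w * (2 * (2 * norm (y - x0) / r) powr \<alpha> - 1);
       measure lebesgue (ball x0 r) / 2 \<le> measure lebesgue {y\<in>ball x0 r. u y \<le> m};
       y \<in> ball x0 (r / 2)\<rbrakk> \<Longrightarrow> u y \<le> m + (1 - \<theta>) * w"
proof -
  let ?N = "real DIM('a)" and ?V = "unit_ball_vol (real DIM('a))" and ?J = "weight_const TYPE('a) s"
  have J: "0 < ?J" using weight_const_pos s by blast
  define q0 where "q0 = lam * (?V / 4) * 2 powr (- (?N + 2 * s))"
  have q0: "0 < q0" using lam by (simp add: q0_def)
  \<comment> \<open>The opening \<open>\<tau>\<close> and the exponent bound \<open>a0\<close> each use up at most a quarter of the drop \<open>q0\<close>.\<close>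
  define \<tau> where "\<tau> = min (1/2) (q0 / (128 * Lam * ?J))"
  define a0 where "a0 = min (s / 2) (q0 * s / (5120 * Lam * ?J))"
  have \<tau>: "0 < \<tau>" "\<tau> \<le> 1/2" "\<tau> \<le> q0 / (128 * Lam * ?J)" using q0 lam J by (auto simp: \<tau>_def)
  have a0: "0 < a0" "a0 \<le> s / 2" "a0 \<le> q0 * s / (5120 * Lam * ?J)" using q0 lam J s by (auto simp: a0_def)
  have \<tau>q: "32 * \<tau> * Lam * ?J \<le> q0 / 4" using \<tau>(3) lam J by (simp add: field_simps)
  have aq: "1280 * \<alpha> / s * Lam * ?J \<le> q0 / 4" if "\<alpha> \<le> a0" for \<alpha>
  proof -
    have "\<alpha> \<le> q0 * s / (5120 * Lam * ?J)" using that a0 by simp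
    then show ?thesis using lam J s by (simp add: field_simps)
  qed
  show thesis
  proof
    show "0 < 5 * \<tau> / 16" "5 * \<tau> / 16 < 1" "0 < a0" using \<tau> a0 by auto
    fix K :: "'a \<Rightarrow> real" and \<alpha> u x0 r m w x1
    assume K: "upper_kernel s Lam K" and Kl: "\<And>y. y \<noteq> 0 \<Longrightarrow> lam * sing_kernel s y \<le> K y"
      and \<alpha>: "0 < \<alpha>" "\<alpha> \<le> a0" and r: "0 < r" and w: "0 < w"
      and sub: "nonlocal_subsolution K (ball x0 r) u" and cont: "continuous_on (ball x0 r) u"
      and meas: "u \<in> borel_measurable lebesgue"
      and ub: "\<And>y. y \<in> ball x0 r \<Longrightarrow> u y \<le> m + w"
      and growth: "\<And>y. y \<notin> ball x0 r \<Longrightarrow> u y \<le> m + w * (2 * (2 * norm (y - x0) / r) powr \<alpha> - 1)"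
      and half: "measure lebesgue (ball x0 r) / 2 \<le> measure lebesgue {y\<in>ball x0 r. u y \<le> m}"
      and x1: "x1 \<in> ball x0 (r / 2)"
    show "u x1 \<le> m + (1 - 5 * \<tau> / 16) * w"
    proof (rule ccontr)
      assume "\<not> u x1 \<le> m + (1 - 5 * \<tau> / 16) * w"
      then have big: "m + (1 - 5 * \<tau> / 16) * w < u x1" by simp
      define b where "b = (\<lambda>x. 1 - (norm (x - x0) / r)\<^sup>2)"
      define f where "f = (\<lambda>x. u x + \<tau> * w * b x)"
      have b1: "b x \<le> 1" for x by (simp add: b_def)
      have \<tau>w: "0 < \<tau> * w" using \<tau> w by simp
      have bsq: "b x \<ge> 1 - c\<^sup>2" if "norm (x - x0) \<le> c * r" for x c
      proof -
        have "norm (x - x0) / r \<le> c" using that r by (simp add: field_simps)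
        then have "(norm (x - x0) / r)\<^sup>2 \<le> c\<^sup>2" using r by (intro power_mono) auto
        then show ?thesis by (simp add: b_def)
      qed
      have bsq2: "b x \<le> 1 - c\<^sup>2" if "c * r \<le> norm (x - x0)" "0 \<le> c" for x c
      proof -
        have "c \<le> norm (x - x0) / r" using that r by (simp add: field_simps)
        then have "c\<^sup>2 \<le> (norm (x - x0) / r)\<^sup>2" using that by (intro power_mono) auto
        then show ?thesis by (simp add: b_def)
      qed
      have "3/4 \<le> b x1" using bsq[of x1 "1/2"] x1 by (simp add: dist_norm norm_minus_commute power2_eq_square)
      then have "\<tau> * w * (3/4) \<le> \<tau> * w * b x1" using \<tau>w by (intro mult_left_mono) auto
      \<comment> \<open>On the half ball \<open>b\<close> is at least \<open>3 / 4\<close>, beyond radius \<open>3 / 4 * r\<close> at most \<open>7 / 16\<close>; the gap is \<open>5 / 16\<close>.\<close>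
      then have f1: "m + w + \<tau> * w * (7/16) < f x1" using big unfolding f_def by (simp add: algebra_simps)
      have cf: "continuous_on (cball x0 (3/4 * r)) f"
        unfolding f_def b_def using r by (intro continuous_intros continuous_on_subset[OF cont]) auto
      have x1b: "x1 \<in> cball x0 (3/4 * r)" using x1 r by auto
      obtain x2 where x2: "x2 \<in> cball x0 (3/4 * r)" "\<And>x. x \<in> cball x0 (3/4 * r) \<Longrightarrow> f x \<le> f x2"
        using continuous_attains_sup[OF compact_cball _ cf] x1b by blast
      have M: "m + w + \<tau> * w * (7/16) < f x2" using x2(2)[OF x1b] f1 by simp
      have fring: "f x \<le> m + w + \<tau> * w * (7/16)" if "x \<in> ball x0 r" "3/4 * r \<le> norm (x - x0)" for x
      proof -
        have "b x \<le> 7/16" using bsq2[OF that(2)] by (simp add: power2_eq_square)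
        then have "\<tau> * w * b x \<le> \<tau> * w * (7/16)" using \<tau>w by (intro mult_left_mono) auto
        then show ?thesis using ub[OF that(1)] by (simp add: f_def)
      qed
      have fmax: "f x \<le> f x2" if "x \<in> ball x0 r" for x
        using fring[OF that] x2(2)[of x] M by (cases "x \<in> cball x0 (3/4 * r)") (auto simp: dist_norm norm_minus_commute)
      have x2r: "norm (x2 - x0) < 3/4 * r"
      proof (rule ccontr)
        assume "\<not> ?thesis"
        then show False using fring[of x2] x2(1) M r by (auto simp: dist_norm norm_minus_commute)
      qed
      have x2in: "x2 \<in> ball x0 r" using x2r r by (auto simp: dist_norm norm_minus_commute)
      have ux2: "m + w - \<tau> * w \<le> u x2"
      proof -
        have "\<tau> * w * b x2 \<le> \<tau> * w * 1" using \<tau>w b1 by (intro mult_left_mono) auto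
        then show ?thesis using M \<tau>w unfolding f_def by simp
      qed
      \<comment> \<open>Removing the ball around \<open>x2\<close>, at most a quarter of the volume, keeps the set away from the region where \<open>H\<close> is quadratic.\<close>
      define G where "G = {y\<in>ball x0 r. u y \<le> m} - ball x2 (r/4)"
      define S where "S = {y. x2 + y \<in> G}"
      have Gm: "{y\<in>ball x0 r. u y \<le> m} \<in> lmeasurable"
      proof (rule fmeasurableI2[of "ball x0 r"])
        have "{y \<in> space lebesgue. u y \<le> m} \<in> sets lebesgue" using meas by measurable
        then have "ball x0 r \<inter> {y. u y \<le> m} \<in> sets lebesgue" by (intro sets.Int) auto
        then show "{y\<in>ball x0 r. u y \<le> m} \<in> sets lebesgue" by (simp add: Int_def)
      qed auto
      then have G: "G \<in> lmeasurable" unfolding G_def by (intro fmeasurable_Diff) auto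
      have mG: "?V / 4 * r ^ DIM('a) \<le> measure lebesgue G"
      proof -
        have "measure lebesgue {y\<in>ball x0 r. u y \<le> m} \<le> measure lebesgue (G \<union> ball x2 (r/4))"
          using Gm fmeasurable.Un[OF G lmeasurable_ball]
          by (intro measure_mono_fmeasurable) (auto simp: G_def dest: fmeasurableD)
        also have "\<dots> \<le> measure lebesgue G + measure lebesgue (ball x2 (r/4))"
          using G by (intro measure_Un_le) auto
        also have "measure lebesgue (ball x2 (r/4)) = ?V * (r/4) ^ DIM('a)" using r by (simp add: content_ball)
        also have "\<dots> = ?V * r ^ DIM('a) * (1/4) ^ DIM('a)" by (simp add: power_divide)
        also have "\<dots> \<le> ?V * r ^ DIM('a) * (1/4) ^ 1" using r
          by (intro mult_left_mono power_decreasing) (auto intro: Suc_leI)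
        finally show ?thesis using half r by (simp add: content_ball)
      qed
      have Sim: "S = (\<lambda>y. y - x2) ` G" by (force simp: S_def image_iff algebra_simps)
      have S: "S \<in> lmeasurable" unfolding Sim by (rule measurable_translation_subtract[OF G])
      have mS: "?V / 4 * r ^ DIM('a) \<le> measure lebesgue S" unfolding Sim measure_translation_subtract by (rule mG)
      have Sb: "S \<subseteq> cball 0 (2 * r)"
      proof
        fix y assume "y \<in> S"
        then have "norm (x2 + y - x0) < r" by (simp add: S_def G_def dist_norm norm_minus_commute)
        then have "norm (x2 + y - x0) + norm (x2 - x0) < 2 * r" using x2r r by simp
        then show "y \<in> cball 0 (2 * r)" using norm_triangle_ineq4[of "x2 + y - x0" "x2 - x0"] by simp
      qed
      have S4: "r / 4 \<le> norm y" if "y \<in> S" for y using that by (auto simp: S_def G_def dist_norm)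
      define p where "p = (2 * \<tau> * w / r\<^sup>2) *\<^sub>R (x2 - x0)"
      define c where "c = \<tau> * w / r\<^sup>2"
      \<comment> \<open>Beyond \<open>r / 4\<close> the distance to \<open>x0\<close> is at most \<open>5 * norm y\<close>, whence the factor 10.\<close>
      define H where "H = (\<lambda>y. if norm y < r/4 then p \<bullet> y + c * (norm y)\<^sup>2
         else \<tau> * w + 2 * w * ((10 * norm y / r) powr \<alpha> - 1) - w * indicator S y)"
      have uH: "u (x2 + y) - u x2 \<le> H y" for y
      proof (cases "norm y < r/4")
        case True
        have inb: "x2 + y \<in> ball x0 r"
        proof -
          have "norm (x2 + y - x0) \<le> norm (x2 - x0) + norm y" using norm_triangle_ineq[of "x2 - x0" y] by (simp add: algebra_simps)
          then show ?thesis using True x2r r by (simp add: dist_norm norm_minus_commute)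
        qed
        have "(norm (x2 + y - x0))\<^sup>2 = (norm (x2 - x0))\<^sup>2 + 2 * ((x2 - x0) \<bullet> y) + (norm y)\<^sup>2"
          using dot_norm[of "x2 - x0" y] by (simp add: algebra_simps)
        then have "\<tau> * w * (b x2 - b (x2 + y)) = 2 * c * ((x2 - x0) \<bullet> y) + c * (norm y)\<^sup>2"
          using r by (simp add: b_def c_def power_divide field_simps)
        also have "2 * c * ((x2 - x0) \<bullet> y) = p \<bullet> y" unfolding p_def c_def inner_scaleR_left by simp
        finally have "\<tau> * w * (b x2 - b (x2 + y)) = p \<bullet> y + c * (norm y)\<^sup>2" .
        then show ?thesis using fmax[OF inb] True by (simp add: f_def H_def algebra_simps)
      next
        case False
        then have t: "1 \<le> 10 * norm y / r" using r by (simp add: field_simps)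
        then have ge: "0 \<le> (10 * norm y / r) powr \<alpha> - 1" using \<alpha> ge_one_powr_ge_zero by fastforce
        have ge': "0 \<le> 2 * w * ((10 * norm y / r) powr \<alpha> - 1)" using ge w by simp
        show ?thesis
        proof (cases "x2 + y \<in> ball x0 r")
          case True
          show ?thesis
          proof (cases "y \<in> S")
            case yS: True
            then have "u (x2 + y) \<le> m" by (simp add: S_def G_def)
            then show ?thesis using ux2 False yS ge' by (simp add: H_def)
          next
            case yS: False
            then show ?thesis using ux2 ub[OF True] False ge' by (simp add: H_def)
          qed
        next
          case out: False
          then have yS: "y \<notin> S" by (auto simp: S_def G_def)
          have "norm (x2 + y - x0) \<le> norm (x2 - x0) + norm y" using norm_triangle_ineq[of "x2 - x0" y] by (simp add: algebra_simps)
          then have "2 * norm (x2 + y - x0) / r \<le> 10 * norm y / r" using False x2r r by (intro divide_right_mono) auto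
          then have "(2 * norm (x2 + y - x0) / r) powr \<alpha> \<le> (10 * norm y / r) powr \<alpha>" using r \<alpha> by (intro powr_mono2) auto
          then have "w * (2 * (2 * norm (x2 + y - x0) / r) powr \<alpha> - 1) \<le> w * (2 * (10 * norm y / r) powr \<alpha> - 1)"
            using w by (intro mult_left_mono) auto
          then show ?thesis using growth[OF out] ux2 False yS by (simp add: H_def algebra_simps)
        qed
      qed
      have Hm: "H \<in> borel_measurable lebesgue"
      proof -
        have "(\<lambda>y. indicator S y :: real) \<in> borel_measurable lebesgue" using S by (auto simp: fmeasurable_def)
        moreover have "(\<lambda>y. p \<bullet> y + c * (norm y)\<^sup>2) \<in> borel_measurable lebesgue"
          "(\<lambda>y::'a. \<tau> * w + 2 * w * ((10 * norm y / r) powr \<alpha> - 1)) \<in> borel_measurable lebesgue"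
          by (auto intro!: measurable_completion)
        moreover have "Measurable.pred lebesgue (\<lambda>y::'a. norm y < r / 4)"
          by (rule measurable_completion) measurable
        ultimately show ?thesis unfolding H_def by measurable
      qed
      define e where "e = w * (32 * \<tau> + 1280 * \<alpha> / s)"
      have e0: "0 \<le> e" using w \<tau> \<alpha> s by (simp add: e_def)
      let ?W = "\<lambda>y::'a. scale_weight s r y"
      have bounds: "H y + H (- y) \<le> e * ?W y - w * indicator S y \<and> - (32 * w * ?W y) \<le> H y + H (- y)" for y
      proof (cases "norm y < r/4")
        case True
        then have W: "?W y = (norm y / r)\<^sup>2" using r s by (intro scale_weight_inner) auto
        have "H y + H (- y) = 2 * c * (norm y)\<^sup>2" using True by (simp add: H_def)
        also have "\<dots> = 2 * \<tau> * w * ?W y" by (simp add: W c_def power_divide)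
        finally have eq: "H y + H (- y) = 2 * \<tau> * w * ?W y" .
        have "2 * \<tau> * w \<le> e" using w \<tau> \<alpha> s by (simp add: e_def field_simps)
        then have "2 * \<tau> * w * ?W y \<le> e * ?W y" by (intro mult_right_mono scale_weight_nonneg)
        moreover have "y \<notin> S" using S4 True by force
        moreover have "0 \<le> 2 * \<tau> * w * ?W y" "0 \<le> 32 * w * ?W y" using \<tau> w by (auto simp: scale_weight_nonneg)
        ultimately show ?thesis using eq by simp
      next
        case False
        then have y4: "r / 4 \<le> norm y" by simp
        have t: "1 \<le> 10 * norm y / r" using y4 r by (simp add: field_simps)
        have W1: "1 \<le> 16 * ?W y" using scale_weight_ge_power2[of s r "1/4" y] s r y4 by (simp add: power2_eq_square)
        have "(10 * norm y / r) powr \<alpha> - 1 \<le> (2 * \<alpha> / s) * (10 * norm y / r) powr s"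
          using \<alpha> a0 t by (intro powr_minus_one_le) auto
        also have "(10 * norm y / r) powr s = 10 powr s * (norm y / r) powr s" using r by (simp add: powr_mult[symmetric])
        also have "(2 * \<alpha> / s) * (10 powr s * (norm y / r) powr s) \<le> (2 * \<alpha> / s) * (10 powr 1 * (16 * ?W y))"
          using s \<alpha> r y4 by (intro mult_left_mono mult_mono powr_mono scale_weight_ge_powr) auto
        finally have g: "(10 * norm y / r) powr \<alpha> - 1 \<le> 320 * \<alpha> / s * ?W y" by simp
        have ge: "0 \<le> (10 * norm y / r) powr \<alpha> - 1" using \<alpha> t ge_one_powr_ge_zero by fastforce
        have ge': "0 \<le> 4 * w * ((10 * norm y / r) powr \<alpha> - 1)" using ge w by simp
        have eq: "H y + H (- y) = 2 * (\<tau> * w) + 4 * w * ((10 * norm y / r) powr \<alpha> - 1) - w * indicator S y - w * indicator S (- y)"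
          using False by (simp add: H_def)
        have "4 * w * ((10 * norm y / r) powr \<alpha> - 1) \<le> 4 * w * (320 * \<alpha> / s * ?W y)"
          using g w by (intro mult_left_mono) auto
        moreover have "2 * (\<tau> * w) * 1 \<le> 2 * (\<tau> * w) * (16 * ?W y)" using W1 \<tau>w by (intro mult_left_mono) auto
        moreover have "0 \<le> w * indicator S (- y)" "w * indicator S (- y) \<le> w" "w * indicator S y \<le> w" using w by (auto split: split_indicator)
        moreover have "2 * w * 1 \<le> 2 * w * (16 * ?W y)" using W1 w by (intro mult_left_mono) auto
        moreover have "e * ?W y = 2 * (\<tau> * w) * (16 * ?W y) + 4 * w * (320 * \<alpha> / s * ?W y)" by (simp add: e_def algebra_simps)
        ultimately show ?thesis unfolding eq using \<tau>w ge' by (intro conjI; linarith)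
      qed
      have mm: "(\<lambda>y. H y + H (- y)) \<in> borel_measurable lebesgue"
        using Hm measurable_compose[OF lebesgue_measurable_scaling[of "- 1"] Hm] by simp
      have int: "integrable lebesgue (\<lambda>y. (H y + H (- y)) * K y)"
      proof (rule integrable_mult_kernel[OF s r K mm])
        fix y
        have "0 \<le> w * indicator S y" "0 \<le> e * ?W y" "0 \<le> 32 * w * ?W y" using w e0 by (auto simp: scale_weight_nonneg)
        then show "\<bar>H y + H (- y)\<bar> \<le> (e + 32 * w) * ?W y"
          using bounds[of y] by (simp add: distrib_right abs_le_iff)
      qed
      have "0 \<le> (\<integral>y. (H y + H (- y)) * K y \<partial>lebesgue)"
        using r by (intro nonlocal_subsolutionD[OF sub x2in, of "r/4" H p c] uH Hm int) (auto simp: H_def)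
      also have "\<dots> \<le> (e * Lam * ?J - w * lam * (?V / 4) * 2 powr (- (?N + 2 * s))) * r powr (- 2 * s)"
        using lam w e0 bounds
        by (intro kernel_integral_le[OF s r K _ _ _ _ int S Sb mS]) (auto intro: Kl)
      finally have "0 \<le> e * Lam * ?J - w * lam * (?V / 4) * 2 powr (- (?N + 2 * s))"
        using r by (simp add: zero_le_mult_iff)
      also have "\<dots> = w * (32 * \<tau> * Lam * ?J + 1280 * \<alpha> / s * Lam * ?J - q0)"
        by (simp add: e_def q0_def algebra_simps)
      finally have "0 \<le> 32 * \<tau> * Lam * ?J + 1280 * \<alpha> / s * Lam * ?J - q0"
        using w by (simp add: zero_le_mult_iff)
      then show False using \<tau>q aq[OF \<alpha>(2)] q0 by linarith
    qed
  qed
qed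

text \<open>One of the two sets where \<open>u\<close> lies below or above its middle value fills half of the ball; apply
\<open>half_ball_decay\<close> to \<open>u\<close> or to \<open>- u\<close>. The exponent is so small that \<open>1 - \<theta> / 2 \<le> 2 powr (- \<alpha>)\<close>, hence the gain
\<open>\<theta>\<close> suffices for the smaller ball, and the growth bounds outside are reproduced with the same constant \<open>B\<close>.\<close>
lemma oscillation_halving:
  fixes s lam Lam :: real
  assumes s: "0 < s" "s < 1" and lam: "0 < lam" "0 < Lam"
  obtains a0 where "0 < a0"
    "\<And>(K :: 'a::euclidean_space \<Rightarrow> real) \<alpha> u x0 r B a.
      \<lbrakk>upper_kernel s Lam K; \<And>y. y \<noteq> 0 \<Longrightarrow> lam * sing_kernel s y \<le> K y;
       0 < \<alpha>; \<alpha> \<le> a0; 0 < r; 0 < B; nonlocal_subsolution K (ball x0 r) u; nonlocal_subsolution K (ball x0 r) (\<lambda>x. - u x);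
       continuous_on (ball x0 r) u; u \<in> borel_measurable lebesgue;
       \<And>y. y \<in> ball x0 r \<Longrightarrow> a \<le> u y \<and> u y \<le> a + 2 * B * r powr \<alpha>;
       \<And>y. y \<notin> ball x0 r \<Longrightarrow> u y \<le> a + 2 * B * (2 * norm (y - x0)) powr \<alpha> \<and>
          a + 2 * B * r powr \<alpha> - 2 * B * (2 * norm (y - x0)) powr \<alpha> \<le> u y\<rbrakk>
      \<Longrightarrow> \<exists>a'. (\<forall>y\<in>ball x0 (r / 2). a' \<le> u y \<and> u y \<le> a' + 2 * B * (r / 2) powr \<alpha>) \<and>
          (\<forall>y. y \<notin> ball x0 (r / 2) \<longrightarrow> u y \<le> a' + 2 * B * (2 * norm (y - x0)) powr \<alpha> \<and>
          a' + 2 * B * (r / 2) powr \<alpha> - 2 * B * (2 * norm (y - x0)) powr \<alpha> \<le> u y)"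
proof -
  obtain \<theta> a1 where \<theta>: "0 < \<theta>" "\<theta> < 1" "0 < a1" and decay:
    "\<And>(K :: 'a \<Rightarrow> real) \<alpha> u x0 r m w y.
      \<lbrakk>upper_kernel s Lam K; \<And>y. y \<noteq> 0 \<Longrightarrow> lam * sing_kernel s y \<le> K y;
       0 < \<alpha>; \<alpha> \<le> a1; 0 < r; 0 < w; nonlocal_subsolution K (ball x0 r) u;
       continuous_on (ball x0 r) u; u \<in> borel_measurable lebesgue;
       \<And>y. y \<in> ball x0 r \<Longrightarrow> u y \<le> m + w;
       \<And>y. y \<notin> ball x0 r \<Longrightarrow> u y \<le> m + w * (2 * (2 * norm (y - x0) / r) powr \<alpha> - 1);
       measure lebesgue (ball x0 r) / 2 \<le> measure lebesgue {y\<in>ball x0 r. u y \<le> m};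
       y \<in> ball x0 (r / 2)\<rbrakk> \<Longrightarrow> u y \<le> m + (1 - \<theta>) * w"
    using half_ball_decay[OF s lam, where 'a='a] by blast
  define a0 where "a0 = min a1 (- log 2 (1 - \<theta> / 2))"
  have a0: "0 < a0" using \<theta> by (simp add: a0_def)
  show thesis
  proof (rule that[OF a0])
    fix K :: "'a \<Rightarrow> real" and \<alpha> u x0 r B a
    assume K: "upper_kernel s Lam K" and Kl: "\<And>y. y \<noteq> 0 \<Longrightarrow> lam * sing_kernel s y \<le> K y"
      and \<alpha>: "0 < \<alpha>" "\<alpha> \<le> a0" and r: "0 < r" and B: "0 < B"
      and sub: "nonlocal_subsolution K (ball x0 r) u" "nonlocal_subsolution K (ball x0 r) (\<lambda>x. - u x)"
      and cont: "continuous_on (ball x0 r) u" and meas: "u \<in> borel_measurable lebesgue"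
      and bd: "\<And>y. y \<in> ball x0 r \<Longrightarrow> a \<le> u y \<and> u y \<le> a + 2 * B * r powr \<alpha>"
      and gr: "\<And>y. y \<notin> ball x0 r \<Longrightarrow> u y \<le> a + 2 * B * (2 * norm (y - x0)) powr \<alpha> \<and>
          a + 2 * B * r powr \<alpha> - 2 * B * (2 * norm (y - x0)) powr \<alpha> \<le> u y"
    define w where "w = B * r powr \<alpha>"
    define m where "m = a + w"
    have w: "0 < w" using B r by (simp add: w_def)
    have \<alpha>1: "\<alpha> \<le> a1" using \<alpha> by (simp add: a0_def)
    have "log 2 (1 - \<theta> / 2) \<le> - \<alpha>" using \<alpha> by (simp add: a0_def)
    then have "1 - \<theta> / 2 \<le> 2 powr (- \<alpha>)" using \<theta> by (simp add: log_le_iff)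
    then have half: "(1 - \<theta> / 2) * w \<le> 2 powr (- \<alpha>) * w" using w by (intro mult_right_mono) auto
    have rw: "B * (r / 2) powr \<alpha> = 2 powr (- \<alpha>) * w"
      using r by (simp add: w_def powr_divide powr_minus field_simps)
    have rle: "B * (r / 2) powr \<alpha> \<le> w" using r B \<alpha> unfolding w_def by (intro mult_left_mono powr_mono2) auto
    have scale: "w * (2 * t / r) powr \<alpha> = B * (2 * t) powr \<alpha>" if "0 \<le> t" for t
      using r that by (simp add: w_def powr_divide)
    have scale2: "w * (2 * (2 * norm (y - x0) / r) powr \<alpha> - 1) = 2 * B * (2 * norm (y - x0)) powr \<alpha> - w" for y
      using scale[of "norm (y - x0)"] by (simp add: right_diff_distrib mult.left_commute[of w 2])
    have ring: "w \<le> B * (2 * norm (y - x0)) powr \<alpha>" if "y \<notin> ball x0 (r / 2)" for y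
      using that r B \<alpha> unfolding w_def by (intro mult_left_mono powr_mono2) (auto simp: dist_norm norm_minus_commute)
    have ball2: "y \<in> ball x0 (r / 2) \<Longrightarrow> y \<in> ball x0 r" for y using r by auto
    let ?A = "{y\<in>ball x0 r. u y \<le> m}" and ?B = "{y\<in>ball x0 r. - u y \<le> - m}"
    have AB: "measure lebesgue (ball x0 r) \<le> measure lebesgue ?A + measure lebesgue ?B"
    proof -
      have "{y \<in> space lebesgue. u y \<le> m} \<in> sets lebesgue" "{y \<in> space lebesgue. m \<le> u y} \<in> sets lebesgue" using meas by measurable
      then have "ball x0 r \<inter> {y. u y \<le> m} \<in> sets lebesgue" "ball x0 r \<inter> {y. m \<le> u y} \<in> sets lebesgue" by (auto intro!: sets.Int)
      then have m: "?A \<in> sets lebesgue" "?B \<in> sets lebesgue" by (simp_all add: Int_def)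
      have l: "?A \<in> lmeasurable" "?B \<in> lmeasurable"
        by (rule fmeasurableI2[of "ball x0 r"]; use m in auto)+
      have "ball x0 r = ?A \<union> ?B" by auto
      then show ?thesis using measure_Un_le[OF m] by metis
    qed
    show "\<exists>a'. (\<forall>y\<in>ball x0 (r / 2). a' \<le> u y \<and> u y \<le> a' + 2 * B * (r / 2) powr \<alpha>) \<and>
          (\<forall>y. y \<notin> ball x0 (r / 2) \<longrightarrow> u y \<le> a' + 2 * B * (2 * norm (y - x0)) powr \<alpha> \<and>
          a' + 2 * B * (r / 2) powr \<alpha> - 2 * B * (2 * norm (y - x0)) powr \<alpha> \<le> u y)"
    proof (cases "measure lebesgue (ball x0 r) / 2 \<le> measure lebesgue ?A")
      case True
      have up: "u y \<le> m + (1 - \<theta>) * w" if "y \<in> ball x0 (r / 2)" for y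
      proof (rule decay[OF K Kl \<alpha>(1) \<alpha>1 r w sub(1) cont meas _ _ True that])
        show "u y \<le> m + w" if "y \<in> ball x0 r" for y using bd[OF that] by (simp add: m_def w_def)
        show "u y \<le> m + w * (2 * (2 * norm (y - x0) / r) powr \<alpha> - 1)" if "y \<notin> ball x0 r" for y
          using gr[OF that] unfolding scale2 by (simp add: m_def)
      qed auto
      show ?thesis
      proof (intro exI[of _ a] conjI ballI allI impI)
        fix y assume y: "y \<in> ball x0 (r / 2)"
        show "a \<le> u y" using bd[OF ball2[OF y]] by simp
        have "u y \<le> a + 2 * ((1 - \<theta> / 2) * w)" using up[OF y] by (simp add: m_def algebra_simps)
        also have "\<dots> \<le> a + 2 * (B * (r / 2) powr \<alpha>)" using half rw by simp
        finally show "u y \<le> a + 2 * B * (r / 2) powr \<alpha>" by simp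
      next
        fix y assume y: "y \<notin> ball x0 (r / 2)"
        show "u y \<le> a + 2 * B * (2 * norm (y - x0)) powr \<alpha>"
          using bd[of y] gr[of y] ring[OF y] by (cases "y \<in> ball x0 r") (auto simp: w_def)
        show "a + 2 * B * (r / 2) powr \<alpha> - 2 * B * (2 * norm (y - x0)) powr \<alpha> \<le> u y"
          using bd[of y] gr[of y] ring[OF y] rle by (cases "y \<in> ball x0 r") (auto simp: w_def)
      qed
    next
      case False
      then have True: "measure lebesgue (ball x0 r) / 2 \<le> measure lebesgue ?B" using AB by simp
      have up: "- u y \<le> - m + (1 - \<theta>) * w" if "y \<in> ball x0 (r / 2)" for y
      proof (rule decay[OF K Kl \<alpha>(1) \<alpha>1 r w sub(2) _ _ _ _ True that])
        show "- u y \<le> - m + w" if "y \<in> ball x0 r" for y using bd[OF that] by (simp add: m_def w_def)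
        show "- u y \<le> - m + w * (2 * (2 * norm (y - x0) / r) powr \<alpha> - 1)" if "y \<notin> ball x0 r" for y
          using gr[OF that] unfolding scale2 by (simp add: m_def w_def)
      qed (use meas cont in \<open>auto intro: continuous_intros\<close>)
      define a' where "a' = a + 2 * w - 2 * B * (r / 2) powr \<alpha>"
      have aa: "a \<le> a'" using rle by (simp add: a'_def)
      show ?thesis
      proof (intro exI[of _ a'] conjI ballI allI impI)
        fix y assume y: "y \<in> ball x0 (r / 2)"
        show "u y \<le> a' + 2 * B * (r / 2) powr \<alpha>" using bd[OF ball2[OF y]] by (simp add: a'_def w_def)
        have "a' \<le> a + 2 * w - 2 * ((1 - \<theta> / 2) * w)" using half rw by (simp add: a'_def)
        also have "\<dots> = m - (1 - \<theta>) * w" by (simp add: m_def algebra_simps)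
        also have "\<dots> \<le> u y" using up[OF y] by simp
        finally show "a' \<le> u y" .
      next
        fix y assume y: "y \<notin> ball x0 (r / 2)"
        show "u y \<le> a' + 2 * B * (2 * norm (y - x0)) powr \<alpha>"
          using bd[of y] gr[of y] ring[OF y] aa by (cases "y \<in> ball x0 r") (auto simp: w_def)
        show "a' + 2 * B * (r / 2) powr \<alpha> - 2 * B * (2 * norm (y - x0)) powr \<alpha> \<le> u y"
          using bd[of y] gr[of y] ring[OF y] by (cases "y \<in> ball x0 r") (auto simp: w_def a'_def)
      qed
    qed
  qed
qed

text \<open>Iterate \<open>oscillation_halving\<close> over the balls of radius \<open>R / 2 ^ k\<close> and pick the \<open>k\<close> with
\<open>norm (y - x0)\<close> between \<open>R / 2 ^ Suc k\<close> and \<open>R / 2 ^ k\<close>.\<close>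
lemma interior_holder:
  fixes s lam Lam :: real
  assumes s: "0 < s" "s < 1" and lam: "0 < lam" "0 < Lam"
  obtains a0 where "0 < a0"
    "\<And>(K :: 'a::euclidean_space \<Rightarrow> real) \<alpha> u x0 R B c y.
      \<lbrakk>upper_kernel s Lam K; \<And>y. y \<noteq> 0 \<Longrightarrow> lam * sing_kernel s y \<le> K y;
       0 < \<alpha>; \<alpha> \<le> a0; 0 < R; 0 < B; nonlocal_subsolution K (ball x0 R) u; nonlocal_subsolution K (ball x0 R) (\<lambda>x. - u x);
       continuous_on (ball x0 R) u; u \<in> borel_measurable lebesgue;
       \<And>y. \<bar>u y - c\<bar> \<le> B * (max R (norm (y - x0))) powr \<alpha>; y \<in> ball x0 R\<rbrakk>
      \<Longrightarrow> \<bar>u y - u x0\<bar> \<le> 2 * 2 powr \<alpha> * B * norm (y - x0) powr \<alpha>"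
proof -
  obtain a0 where a0: "0 < a0" and step:
    "\<And>(K :: 'a \<Rightarrow> real) \<alpha> u x0 r B a.
      \<lbrakk>upper_kernel s Lam K; \<And>y. y \<noteq> 0 \<Longrightarrow> lam * sing_kernel s y \<le> K y;
       0 < \<alpha>; \<alpha> \<le> a0; 0 < r; 0 < B; nonlocal_subsolution K (ball x0 r) u; nonlocal_subsolution K (ball x0 r) (\<lambda>x. - u x);
       continuous_on (ball x0 r) u; u \<in> borel_measurable lebesgue;
       \<And>y. y \<in> ball x0 r \<Longrightarrow> a \<le> u y \<and> u y \<le> a + 2 * B * r powr \<alpha>;
       \<And>y. y \<notin> ball x0 r \<Longrightarrow> u y \<le> a + 2 * B * (2 * norm (y - x0)) powr \<alpha> \<and>
          a + 2 * B * r powr \<alpha> - 2 * B * (2 * norm (y - x0)) powr \<alpha> \<le> u y\<rbrakk>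
      \<Longrightarrow> \<exists>a'. (\<forall>y\<in>ball x0 (r / 2). a' \<le> u y \<and> u y \<le> a' + 2 * B * (r / 2) powr \<alpha>) \<and>
          (\<forall>y. y \<notin> ball x0 (r / 2) \<longrightarrow> u y \<le> a' + 2 * B * (2 * norm (y - x0)) powr \<alpha> \<and>
          a' + 2 * B * (r / 2) powr \<alpha> - 2 * B * (2 * norm (y - x0)) powr \<alpha> \<le> u y)"
    using oscillation_halving[OF s lam, where 'a='a] by blast
  show thesis
  proof (rule that[OF a0])
    fix K :: "'a \<Rightarrow> real" and \<alpha> u x0 R B c y
    assume K: "upper_kernel s Lam K" and Kl: "\<And>y. y \<noteq> 0 \<Longrightarrow> lam * sing_kernel s y \<le> K y"
      and \<alpha>: "0 < \<alpha>" "\<alpha> \<le> a0" and R: "0 < R" and B: "0 < B"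
      and sub: "nonlocal_subsolution K (ball x0 R) u" "nonlocal_subsolution K (ball x0 R) (\<lambda>x. - u x)"
      and cont: "continuous_on (ball x0 R) u" and meas: "u \<in> borel_measurable lebesgue"
      and gr: "\<And>y. \<bar>u y - c\<bar> \<le> B * (max R (norm (y - x0))) powr \<alpha>" and y: "y \<in> ball x0 R"
    have osc: "\<exists>a. (\<forall>y\<in>ball x0 (R / 2^k). a \<le> u y \<and> u y \<le> a + 2 * B * (R / 2^k) powr \<alpha>) \<and>
          (\<forall>y. y \<notin> ball x0 (R / 2^k) \<longrightarrow> u y \<le> a + 2 * B * (2 * norm (y - x0)) powr \<alpha> \<and>
          a + 2 * B * (R / 2^k) powr \<alpha> - 2 * B * (2 * norm (y - x0)) powr \<alpha> \<le> u y)" for k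
    proof (induction k)
      case 0
      show ?case
      proof (intro exI[of _ "c - B * R powr \<alpha>"] conjI ballI allI impI)
        fix y assume "y \<in> ball x0 (R / 2 ^ 0)"
        then have "max R (norm (y - x0)) = R" by (auto simp: dist_norm norm_minus_commute)
        then show "c - B * R powr \<alpha> \<le> u y" "u y \<le> c - B * R powr \<alpha> + 2 * B * (R / 2 ^ 0) powr \<alpha>"
          using gr[of y] by auto
      next
        fix y assume out: "y \<notin> ball x0 (R / 2 ^ 0)"
        let ?t = "norm (y - x0)"
        have t: "R \<le> ?t" using out by (auto simp: dist_norm norm_minus_commute)
        then have "max R ?t = ?t" by simp
        then have g: "\<bar>u y - c\<bar> \<le> B * ?t powr \<alpha>" using gr[of y] by simp
        have "B * R powr \<alpha> \<le> B * (2 * ?t) powr \<alpha>" "B * ?t powr \<alpha> \<le> B * (2 * ?t) powr \<alpha>"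
          "B * R powr \<alpha> \<le> B * ?t powr \<alpha>"
          using t R B \<alpha> by (auto intro!: mult_left_mono powr_mono2)
        then show "u y \<le> c - B * R powr \<alpha> + 2 * B * (2 * ?t) powr \<alpha>"
          "c - B * R powr \<alpha> + 2 * B * (R / 2 ^ 0) powr \<alpha> - 2 * B * (2 * ?t) powr \<alpha> \<le> u y"
          using g by auto
      qed
    next
      case (Suc k)
      then obtain a where a: "\<And>y. y \<in> ball x0 (R / 2^k) \<Longrightarrow> a \<le> u y \<and> u y \<le> a + 2 * B * (R / 2^k) powr \<alpha>"
        "\<And>y. y \<notin> ball x0 (R / 2^k) \<Longrightarrow> u y \<le> a + 2 * B * (2 * norm (y - x0)) powr \<alpha> \<and>
          a + 2 * B * (R / 2^k) powr \<alpha> - 2 * B * (2 * norm (y - x0)) powr \<alpha> \<le> u y" by blast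
      have sb: "ball x0 (R / 2^k) \<subseteq> ball x0 R"
        using R by (intro subset_ball) (simp add: divide_le_eq)
      have R2: "R / 2 ^ Suc k = R / 2^k / 2" by simp
      show ?case unfolding R2
        by (rule step[OF K Kl \<alpha> _ B sub[THEN nonlocal_subsolution_mono, OF sb] continuous_on_subset[OF cont sb] meas a])
           (use R in auto)
    qed
    show "\<bar>u y - u x0\<bar> \<le> 2 * 2 powr \<alpha> * B * norm (y - x0) powr \<alpha>"
    proof (cases "y = x0")
      case False
      then have pos: "0 < norm (y - x0)" by simp
      have ex: "\<exists>k. R / 2^k \<le> norm (y - x0)"
      proof -
        obtain k where "R / norm (y - x0) < 2^k" using real_arch_pow[of 2 "R / norm (y - x0)"] by auto
        then show ?thesis using pos by (intro exI[of _ k]) (simp add: field_simps)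
      qed
      define k where "k = (LEAST k. R / 2^k \<le> norm (y - x0))"
      have k1: "R / 2^k \<le> norm (y - x0)" unfolding k_def using ex by (rule LeastI_ex)
      have "k \<noteq> 0" using k1 y by (intro notI) (auto simp: dist_norm norm_minus_commute)
      then obtain j where j: "k = Suc j" using not0_implies_Suc by blast
      have k2: "norm (y - x0) < R / 2^j"
        using not_less_Least[of j "\<lambda>k. R / 2^k \<le> norm (y - x0)"] j k_def by auto
      obtain a where a: "\<And>y. y \<in> ball x0 (R / 2^j) \<Longrightarrow> a \<le> u y \<and> u y \<le> a + 2 * B * (R / 2^j) powr \<alpha>"
        using osc[of j] by blast
      have "\<bar>u y - u x0\<bar> \<le> 2 * B * (R / 2^j) powr \<alpha>"
        using a[of y] a[of x0] k2 R by (auto simp: dist_norm norm_minus_commute abs_le_iff)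
      also have "\<dots> \<le> 2 * B * (2 * norm (y - x0)) powr \<alpha>"
        using k1 j R B \<alpha> by (intro mult_left_mono powr_mono2) (auto simp: field_simps)
      finally show ?thesis by (simp add: powr_mult mult_ac)
    qed simp
  qed
qed

section \<open>A barrier from exterior corkscrews\<close>

definition exterior_corkscrew :: "real \<Rightarrow> 'a::euclidean_space set \<Rightarrow> bool" where
  "exterior_corkscrew \<kappa> \<Omega> \<longleftrightarrow> 0 < \<kappa> \<and>
     (\<forall>z\<in>frontier \<Omega>. \<forall>\<rho>>0. \<exists>q. ball q (\<kappa> * \<rho>) \<subseteq> ball z \<rho> - \<Omega>)"

text \<open>The factor 2 inside \<open>\<Omega>\<close> creates the downward jump across the boundary that makes this a strict supersolution,
and it is the factor 2 of the final boundary estimate.\<close>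
definition barrier :: "'a::euclidean_space set \<Rightarrow> real \<Rightarrow> 'a \<Rightarrow> 'a \<Rightarrow> real" where
  "barrier \<Omega> \<alpha> z x = (if x \<in> \<Omega> then 2 else 1) * norm (x - z) powr \<alpha>"

text \<open>Concavity of \<open>t powr b\<close> at 1.\<close>
lemma powr_le_tangent:
  fixes t b :: real
  assumes "0 \<le> t" "0 < b" "b < 1"
  shows "t powr b \<le> 1 + b * (t - 1)"
proof (cases "t = 0")
  case False
  then have t: "0 < t" using assms by simp
  have "t powr b = exp (b * ln t)" using t by (simp add: powr_def)
  also have "b * ln t = (1 - b) *\<^sub>R 0 + b *\<^sub>R ln t" by simp
  also have "exp \<dots> \<le> (1 - b) * exp 0 + b * exp (ln t)"
    using assms by (intro convex_onD[OF exp_convex, of b]) auto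
  finally show ?thesis using t by (simp add: algebra_simps)
qed (use assms in simp)

text \<open>The function \<open>\<lambda>v. norm v powr \<alpha>\<close> is a concave function of \<open>(norm v)\<^sup>2\<close>, so replacing it by its tangent
gives a global quadratic majorant.\<close>
lemma norm_powr_le_tangent:
  fixes v y :: "'a::euclidean_space"
  assumes "v \<noteq> 0" "0 < \<alpha>" "\<alpha> < 2"
  shows "norm (v + y) powr \<alpha> \<le> norm v powr \<alpha> + (\<alpha> / 2) * norm v powr (\<alpha> - 2) * (2 * (v \<bullet> y) + (norm y)\<^sup>2)"
proof -
  define t where "t = (norm (v + y) / norm v)\<^sup>2"
  have v: "0 < norm v" using assms by simp
  have sq: "(norm (v + y))\<^sup>2 = (norm v)\<^sup>2 + (2 * (v \<bullet> y) + (norm y)\<^sup>2)"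
    using dot_norm[of v y] by (simp add: algebra_simps)
  have t1: "(norm v)\<^sup>2 * (t - 1) = 2 * (v \<bullet> y) + (norm y)\<^sup>2"
    using v sq by (simp add: t_def power_divide field_simps)
  have "t powr (\<alpha> / 2) \<le> 1 + (\<alpha> / 2) * (t - 1)" using assms by (intro powr_le_tangent) (auto simp: t_def)
  then have "norm v powr \<alpha> * t powr (\<alpha> / 2) \<le> norm v powr \<alpha> * (1 + (\<alpha> / 2) * (t - 1))" by (intro mult_left_mono) auto
  also have "norm v powr \<alpha> * t powr (\<alpha> / 2) = norm (v + y) powr \<alpha>"
  proof -
    have "t powr (\<alpha> / 2) = (norm (v + y) / norm v) powr \<alpha>"
    proof (cases "v + y = 0")
      case False
      then have "0 < norm (v + y) / norm v" using v by simp
      then have "t = (norm (v + y) / norm v) powr 2" by (simp add: t_def powr_numeral)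
      then show ?thesis by (simp only: powr_powr) simp
    qed (use assms in \<open>simp add: t_def\<close>)
    then show ?thesis using v by (simp add: powr_divide)
  qed
  also have "norm v powr \<alpha> * (1 + (\<alpha> / 2) * (t - 1)) = norm v powr \<alpha> + (\<alpha> / 2) * norm v powr (\<alpha> - 2) * ((norm v)\<^sup>2 * (t - 1))"
  proof -
    have "norm v powr (\<alpha> - 2) * (norm v)\<^sup>2 = norm v powr \<alpha>"
      using v by (simp add: powr_diff powr_numeral)
    then have "(\<alpha> / 2) * norm v powr (\<alpha> - 2) * ((norm v)\<^sup>2 * (t - 1)) = (\<alpha> / 2) * norm v powr \<alpha> * (t - 1)"
      by (metis mult.assoc)
    then show ?thesis by (simp only: distrib_left mult.right_neutral) (simp only: mult_ac)
  qed
  finally show ?thesis unfolding t1 .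
qed

text \<open>Let \<open>\<rho> = norm (x - z)\<close>. The increments of \<open>norm (x - z) powr \<alpha>\<close> are bounded by a quadratic function of
opening \<open>O(\<alpha>)\<close> up to scale \<open>\<rho>\<close> and by \<open>powr_minus_one_le\<close> beyond, altogether \<open>O(\<alpha> * \<rho> powr \<alpha>)\<close> in terms of the
weight at scale \<open>\<rho>\<close>. On the corkscrew ball at scale \<open>\<rho>\<close> the barrier loses one copy of \<open>norm (x + y - z) powr \<alpha>\<close>, which is at least
\<open>\<kappa> / 2 * \<rho> powr \<alpha>\<close> on the concentric ball of half the radius, since this stays away from \<open>z\<close>. The lower bound on the
kernel is only assumed where \<open>x + y\<close> lies outside \<open>\<Omega>\<close>, so that the lemma also covers kernels truncated at a radius
below the distance to the boundary.\<close>
lemma barrier_supersolution: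
  fixes s lam Lam \<kappa> :: real
  assumes s: "0 < s" "s < 1" and lam: "0 < lam" "0 < Lam" and \<kappa>: "0 < \<kappa>" "\<kappa> \<le> 1"
  obtains a0 c0 where "0 < a0" "0 < c0" "a0 \<le> s / 2"
    "\<And>(K :: 'a::euclidean_space \<Rightarrow> real) \<Omega> \<alpha> z x.
      \<lbrakk>upper_kernel s Lam K; \<And>y. x + y \<notin> \<Omega> \<Longrightarrow> lam * sing_kernel s y \<le> K y;
       0 < \<alpha>; \<alpha> \<le> a0; open \<Omega>; exterior_corkscrew \<kappa> \<Omega>; z \<in> frontier \<Omega>; x \<in> \<Omega>\<rbrakk>
      \<Longrightarrow> \<exists>r>0. \<exists>p c H. (\<forall>y. norm y < r \<longrightarrow> H y = p \<bullet> y + c * (norm y)\<^sup>2) \<and>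
            (\<forall>y. barrier \<Omega> \<alpha> z (x + y) - barrier \<Omega> \<alpha> z x \<le> H y) \<and>
            H \<in> borel_measurable borel \<and> integrable lebesgue (\<lambda>y. (H y + H (- y)) * K y) \<and>
            (\<integral>y. (H y + H (- y)) * K y \<partial>lebesgue) \<le> - c0 * norm (x - z) powr (\<alpha> - 2 * s)"
proof -
  let ?N = "real DIM('a)" and ?V = "unit_ball_vol (real DIM('a))" and ?J = "weight_const TYPE('a) s"
  have J: "0 < ?J" using weight_const_pos s by blast
  define mu where "mu = ?V * (\<kappa> / 2) ^ DIM('a)"
  define q0 where "q0 = \<kappa> / 2 * lam * mu * 2 powr (- (?N + 2 * s))"
  have q0: "0 < q0" using lam \<kappa> by (simp add: q0_def mu_def)
  define a0 where "a0 = min (s / 2) (q0 * s / (32 * Lam * ?J))"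
  have a0: "0 < a0" "a0 \<le> s / 2" "a0 \<le> q0 * s / (32 * Lam * ?J)" using q0 lam J s by (auto simp: a0_def)
  show thesis
  proof (rule that[of a0 "q0 / 2"])
    fix K :: "'a \<Rightarrow> real" and \<Omega> \<alpha> z x
    assume K: "upper_kernel s Lam K" and Kl: "\<And>y. x + y \<notin> \<Omega> \<Longrightarrow> lam * sing_kernel s y \<le> K y"
      and \<alpha>: "0 < \<alpha>" "\<alpha> \<le> a0" and \<Omega>: "open \<Omega>" and cork: "exterior_corkscrew \<kappa> \<Omega>"
      and z: "z \<in> frontier \<Omega>" and x: "x \<in> \<Omega>"
    define \<rho> where "\<rho> = norm (x - z)"
    have zn: "z \<notin> \<Omega>" using z \<Omega> by (simp add: frontier_def interior_open)
    then have \<rho>: "0 < \<rho>" using x by (auto simp: \<rho>_def)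
    have \<alpha>s: "\<alpha> \<le> s / 2" "\<alpha> < 1" "\<alpha> \<le> s" using \<alpha> a0 s by auto
    have \<alpha>q: "16 * \<alpha> / s * Lam * ?J \<le> q0 / 2"
    proof -
      have "\<alpha> \<le> q0 * s / (32 * Lam * ?J)" using \<alpha> a0 by simp
      then show ?thesis using lam J s by (simp add: field_simps)
    qed
    obtain r0 where r0: "0 < r0" "ball x r0 \<subseteq> \<Omega>" using \<Omega> x openE by blast
    define r where "r = min r0 \<rho>"
    have r: "0 < r" "ball x r \<subseteq> \<Omega>" "r \<le> \<rho>" using r0 \<rho> by (auto simp: r_def)
    define h where "h = (\<lambda>y. norm (y - z) powr \<alpha>)"
    have h0: "0 \<le> h y" for y by (simp add: h_def)
    have hx: "h x = \<rho> powr \<alpha>" by (simp add: h_def \<rho>_def)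
    define p where "p = (\<alpha> * \<rho> powr (\<alpha> - 2)) *\<^sub>R (x - z)"
    define c where "c = \<alpha> / 2 * \<rho> powr (\<alpha> - 2)"
    \<comment> \<open>Beyond \<open>\<rho>\<close> the triangle inequality gives \<open>norm (x + y - z) \<le> 2 * norm y\<close>.\<close>
    define T where "T = (\<lambda>y. if norm y < \<rho> then p \<bullet> y + c * (norm y)\<^sup>2 else (2 * norm y) powr \<alpha> - \<rho> powr \<alpha>)"
    define H where "H = (\<lambda>y. 2 * T y - indicator (- \<Omega>) (x + y) * h (x + y))"
    have hT: "h (x + y) - h x \<le> T y" for y
    proof (cases "norm y < \<rho>")
      case True
      have "norm ((x - z) + y) powr \<alpha> \<le> norm (x - z) powr \<alpha> + (\<alpha> / 2) * norm (x - z) powr (\<alpha> - 2) * (2 * ((x - z) \<bullet> y) + (norm y)\<^sup>2)"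
        using \<rho> \<alpha> \<alpha>s by (intro norm_powr_le_tangent) (auto simp: \<rho>_def)
      then show ?thesis using True by (simp add: h_def T_def p_def c_def \<rho>_def algebra_simps add_divide_distrib)
    next
      case False
      have "norm (x + y - z) \<le> \<rho> + norm y" unfolding \<rho>_def using norm_triangle_ineq[of "x - z" y] by (simp add: algebra_simps)
      then have "h (x + y) \<le> (2 * norm y) powr \<alpha>" unfolding h_def using False \<alpha> by (intro powr_mono2) auto
      then show ?thesis using False hx by (simp add: T_def)
    qed
    have bar: "barrier \<Omega> \<alpha> z (x + y) - barrier \<Omega> \<alpha> z x \<le> H y" for y
      using hT[of y] x by (auto simp: barrier_def H_def h_def)
    have Hquad: "H y = (2 *\<^sub>R p) \<bullet> y + (2 * c) * (norm y)\<^sup>2" if "norm y < r" for y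
    proof -
      have "x + y \<in> \<Omega>" using r(2) that by (auto simp: dist_norm)
      then show ?thesis using that r(3) by (simp add: H_def T_def algebra_simps)
    qed
    have Hm: "H \<in> borel_measurable borel"
    proof -
      have [measurable]: "\<Omega> \<in> sets borel" using \<Omega> by simp
      show ?thesis unfolding H_def T_def h_def by measurable
    qed
    obtain q where q: "ball q (\<kappa> * \<rho>) \<subseteq> ball z \<rho> - \<Omega>"
      using cork z \<rho> unfolding exterior_corkscrew_def by blast
    define S where "S = (\<lambda>y. y - x) ` ball q (\<kappa> * \<rho> / 2)"
    have SI: "x + y \<in> ball q (\<kappa> * \<rho> / 2)" if "y \<in> S" for y using that by (auto simp: S_def)
    have S: "S \<in> lmeasurable" unfolding S_def by (intro measurable_translation_subtract) simp
    have mS: "mu * \<rho> ^ DIM('a) \<le> measure lebesgue S"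
      unfolding S_def measure_translation_subtract using \<kappa> \<rho>
      by (simp add: content_ball mu_def power_mult_distrib power_divide)
    have half: "ball q (\<kappa> * \<rho> / 2) \<subseteq> ball q (\<kappa> * \<rho>)" using \<kappa> \<rho> by (intro subset_ball) simp
    have S\<Omega>: "x + y \<notin> \<Omega>" if "y \<in> S" for y using SI[OF that] q half by blast
    have Sb: "S \<subseteq> cball 0 (2 * \<rho>)"
    proof
      fix y assume "y \<in> S"
      then have "norm (x + y - z) < \<rho>" using SI q half by (fastforce simp: dist_norm norm_minus_commute)
      then show "y \<in> cball 0 (2 * \<rho>)" using norm_triangle_ineq4[of "x + y - z" "x - z"] by (simp add: \<rho>_def)
    qed
    have Sh: "\<kappa> / 2 * \<rho> powr \<alpha> \<le> h (x + y)" if "y \<in> S" for y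
    proof -
      have "z \<notin> ball q (\<kappa> * \<rho>)"
      proof
        assume "z \<in> ball q (\<kappa> * \<rho>)"
        then have "ball q (\<kappa> * \<rho>) \<inter> \<Omega> \<noteq> {}" using z
          by (metis closure_iff_nhds_not_empty frontier_def DiffD1 open_ball order_refl inf_commute)
        then show False using q by blast
      qed
      then have "\<kappa> * \<rho> \<le> norm (q - z)" by (simp add: dist_norm)
      moreover have "norm (q - (x + y)) < \<kappa> * \<rho> / 2" using SI[OF that] by (simp add: dist_norm)
      moreover have "norm (q - z) \<le> norm (q - (x + y)) + norm (x + y - z)" using norm_triangle_ineq[of "q - (x + y)" "x + y - z"] by simp
      ultimately have "\<kappa> / 2 * \<rho> \<le> norm (x + y - z)" by simp
      then have "(\<kappa> / 2 * \<rho>) powr \<alpha> \<le> h (x + y)" unfolding h_def using \<kappa> \<rho> \<alpha> by (intro powr_mono2) auto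
      moreover have "(\<kappa> / 2) powr 1 \<le> (\<kappa> / 2) powr \<alpha>" using \<kappa> \<alpha>s by (intro powr_mono') auto
      then have "\<kappa> / 2 * \<rho> powr \<alpha> \<le> (\<kappa> / 2) powr \<alpha> * \<rho> powr \<alpha>" using \<kappa> by (intro mult_right_mono) auto
      moreover have "(\<kappa> / 2 * \<rho>) powr \<alpha> = (\<kappa> / 2) powr \<alpha> * \<rho> powr \<alpha>" by (rule powr_mult)
      ultimately show ?thesis by linarith
    qed
    define e where "e = 16 * \<alpha> / s * \<rho> powr \<alpha>"
    have e0: "0 \<le> e" using \<alpha> s by (simp add: e_def)
    let ?W = "\<lambda>y::'a. scale_weight s \<rho> y"
    have TT: "0 \<le> T y + T (- y) \<and> 2 * (T y + T (- y)) \<le> e * ?W y" for y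
    proof (cases "norm y < \<rho>")
      case True
      then have W: "?W y = (norm y / \<rho>)\<^sup>2" using \<rho> s by (intro scale_weight_inner) auto
      have r2: "\<rho> powr (\<alpha> - 2) = \<rho> powr \<alpha> / \<rho>\<^sup>2" using \<rho> by (simp add: powr_diff powr_numeral)
      have "T y + T (- y) = 2 * c * (norm y)\<^sup>2" using True by (simp add: T_def)
      also have "\<dots> = \<alpha> * \<rho> powr \<alpha> * ?W y" by (simp add: c_def W r2 power_divide)
      finally have eq: "T y + T (- y) = \<alpha> * \<rho> powr \<alpha> * ?W y" .
      have "2 * \<alpha> \<le> 16 * \<alpha> / s" using s \<alpha> by (simp add: field_simps)
      then have "2 * \<alpha> * \<rho> powr \<alpha> * ?W y \<le> 16 * \<alpha> / s * \<rho> powr \<alpha> * ?W y" by (intro mult_right_mono scale_weight_nonneg) auto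
      then show ?thesis using eq \<alpha> by (simp add: e_def scale_weight_nonneg)
    next
      case False
      then have W: "?W y = (norm y / \<rho>) powr s" using \<rho> s by (intro scale_weight_outer) auto
      have t: "1 \<le> 2 * norm y / \<rho>" using False \<rho> by (simp add: field_simps)
      have "(2 * norm y / \<rho>) powr \<alpha> - 1 \<le> (2 * \<alpha> / s) * (2 * norm y / \<rho>) powr s"
        using \<alpha> \<alpha>s t by (intro powr_minus_one_le) auto
      also have "(2 * norm y / \<rho>) powr s = 2 powr s * ?W y" unfolding W using \<rho> by (simp add: powr_mult[symmetric])
      also have "(2 * \<alpha> / s) * (2 powr s * ?W y) \<le> (2 * \<alpha> / s) * (2 powr 1 * ?W y)"
        using s \<alpha> by (intro mult_left_mono mult_right_mono powr_mono scale_weight_nonneg) auto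
      finally have g: "(2 * norm y / \<rho>) powr \<alpha> - 1 \<le> 4 * \<alpha> / s * ?W y" by simp
      have ge: "0 \<le> (2 * norm y / \<rho>) powr \<alpha> - 1" using \<alpha> t ge_one_powr_ge_zero by fastforce
      have eq: "T y + T (- y) = 2 * \<rho> powr \<alpha> * ((2 * norm y / \<rho>) powr \<alpha> - 1)"
        using False \<rho> by (simp add: T_def powr_divide algebra_simps)
      have "4 * \<rho> powr \<alpha> * ((2 * norm y / \<rho>) powr \<alpha> - 1) \<le> 4 * \<rho> powr \<alpha> * (4 * \<alpha> / s * ?W y)"
        using g by (intro mult_left_mono) auto
      then show ?thesis using eq ge by (simp add: e_def mult_ac)
    qed
    \<comment> \<open>A crude lower bound, only used for integrability; it may degenerate as \<open>x\<close> approaches the boundary.\<close>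
    define B where "B = (2 * \<rho>) powr \<alpha> * (\<rho> / r)\<^sup>2"
    have hB: "indicator (- \<Omega>) (x + y) * h (x + y) \<le> B * ?W y" for y
    proof (cases "norm y < r")
      case True
      then have "x + y \<in> \<Omega>" using r(2) by (auto simp: dist_norm)
      then show ?thesis by (simp add: B_def scale_weight_nonneg)
    next
      case False
      have rr: "1 \<le> (\<rho> / r)\<^sup>2" using r by simp
      have nle: "norm (x + y - z) \<le> \<rho> + norm y" unfolding \<rho>_def using norm_triangle_ineq[of "x - z" y] by (simp add: algebra_simps)
      have "h (x + y) \<le> B * ?W y"
      proof (cases "norm y \<le> \<rho>")
        case True
        have "(r / \<rho>)\<^sup>2 \<le> ?W y" using r \<rho> False s by (intro scale_weight_ge_power2) auto
        then have "(\<rho> / r)\<^sup>2 * (r / \<rho>)\<^sup>2 \<le> (\<rho> / r)\<^sup>2 * ?W y" by (intro mult_left_mono) auto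
        then have "1 \<le> (\<rho> / r)\<^sup>2 * ?W y" using r \<rho> by (simp add: power_divide)
        then have "(2 * \<rho>) powr \<alpha> * 1 \<le> (2 * \<rho>) powr \<alpha> * ((\<rho> / r)\<^sup>2 * ?W y)" by (intro mult_left_mono) auto
        moreover have "h (x + y) \<le> (2 * \<rho>) powr \<alpha>" unfolding h_def using nle True \<alpha> by (intro powr_mono2) auto
        ultimately show ?thesis by (simp add: B_def mult_ac)
      next
        case out: False
        then have W: "?W y = (norm y / \<rho>) powr s" using \<rho> s by (intro scale_weight_outer) auto
        have "h (x + y) \<le> (2 * norm y) powr \<alpha>" unfolding h_def using nle out \<alpha> by (intro powr_mono2) auto
        also have "(2 * norm y) powr \<alpha> = (2 * \<rho>) powr \<alpha> * (norm y / \<rho>) powr \<alpha>"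
          using \<rho> by (simp add: powr_mult powr_divide)
        also have "\<dots> \<le> (2 * \<rho>) powr \<alpha> * (norm y / \<rho>) powr s"
          using out \<alpha>s \<rho> by (intro mult_left_mono powr_mono) auto
        also have "\<dots> = ((2 * \<rho>) powr \<alpha> * 1) * ?W y" by (simp add: W)
        also have "\<dots> \<le> B * ?W y" unfolding B_def using rr by (intro mult_right_mono mult_left_mono scale_weight_nonneg) auto
        finally show ?thesis .
      qed
      then show ?thesis using h0[of "x + y"] by (auto split: split_indicator simp: B_def scale_weight_nonneg)
    qed
    have B0: "0 \<le> B" by (simp add: B_def)
    have Hup: "H y + H (- y) \<le> e * ?W y - (\<kappa> / 2 * \<rho> powr \<alpha>) * indicator S y" for y
    proof -
      have "(\<kappa> / 2 * \<rho> powr \<alpha>) * indicator S y \<le> indicator (- \<Omega>) (x + y) * h (x + y)"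
        using Sh[of y] S\<Omega>[of y] h0 by (cases "y \<in> S") (auto split: split_indicator)
      moreover have "0 \<le> indicator (- \<Omega>) (x + - y) * h (x + - y)" using h0 by (simp split: split_indicator)
      ultimately show ?thesis using TT[of y] by (simp add: H_def)
    qed
    have "(\<lambda>y. H (- y)) \<in> borel_measurable borel"
      by (rule measurable_compose[OF _ Hm]) simp
    then have mm: "(\<lambda>y. H y + H (- y)) \<in> borel_measurable lebesgue"
      using Hm by (intro measurable_completion) simp
    have int: "integrable lebesgue (\<lambda>y. (H y + H (- y)) * K y)"
    proof (rule integrable_mult_kernel[OF s \<rho> K mm])
      fix y
      have "0 \<le> (\<kappa> / 2 * \<rho> powr \<alpha>) * indicator S y" using \<kappa> by simp
      moreover have "- (B * ?W y + B * ?W y) \<le> H y + H (- y)"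
        using hB[of y] hB[of "- y"] TT[of y] by (simp add: H_def)
      moreover have "0 \<le> e * ?W y" "0 \<le> B * ?W y" using e0 B0 by (auto simp: scale_weight_nonneg)
      ultimately show "\<bar>H y + H (- y)\<bar> \<le> (e + 2 * B) * ?W y"
        using Hup[of y] by (simp add: distrib_right abs_le_iff)
    qed
    have "(\<integral>y. (H y + H (- y)) * K y \<partial>lebesgue)
      \<le> (e * Lam * ?J - (\<kappa> / 2 * \<rho> powr \<alpha>) * lam * mu * 2 powr (- (?N + 2 * s))) * \<rho> powr (- 2 * s)"
      using lam \<kappa> e0 by (intro kernel_integral_le[OF s \<rho> K _ _ _ _ int S Sb mS Kl Hup] S\<Omega>) auto
    also have "e * Lam * ?J - (\<kappa> / 2 * \<rho> powr \<alpha>) * lam * mu * 2 powr (- (?N + 2 * s))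
       = \<rho> powr \<alpha> * (16 * \<alpha> / s * Lam * ?J - q0)" by (simp add: e_def q0_def algebra_simps)
    also have "\<rho> powr \<alpha> * (16 * \<alpha> / s * Lam * ?J - q0) * \<rho> powr (- 2 * s) \<le> \<rho> powr \<alpha> * (- (q0 / 2)) * \<rho> powr (- 2 * s)"
      using \<alpha>q by (intro mult_left_mono mult_right_mono) auto
    also have "\<dots> = - (q0 / 2) * \<rho> powr (\<alpha> - 2 * s)" by (simp add: powr_add[symmetric] mult_ac)
    finally have fin: "(\<integral>y. (H y + H (- y)) * K y \<partial>lebesgue) \<le> - (q0 / 2) * norm (x - z) powr (\<alpha> - 2 * s)"
      by (simp add: \<rho>_def)
    show "\<exists>r>0. \<exists>p c H. (\<forall>y. norm y < r \<longrightarrow> H y = p \<bullet> y + c * (norm y)\<^sup>2) \<and>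
            (\<forall>y. barrier \<Omega> \<alpha> z (x + y) - barrier \<Omega> \<alpha> z x \<le> H y) \<and>
            H \<in> borel_measurable borel \<and> integrable lebesgue (\<lambda>y. (H y + H (- y)) * K y) \<and>
            (\<integral>y. (H y + H (- y)) * K y \<partial>lebesgue) \<le> - (q0 / 2) * norm (x - z) powr (\<alpha> - 2 * s)"
      using r(1) Hquad bar Hm int fin
      by (intro exI[of _ r] conjI exI[of _ "2 *\<^sub>R p"] exI[of _ "2 * c"] exI[of _ H]) auto
  qed (use a0 q0 in auto)
qed

text \<open>Comparison with the barrier by the maximum principle. If the bound fails, then \<open>u - 2 * C0 * norm (x - z) powr \<alpha>\<close>
has its maximum over \<open>closure \<Omega>\<close> at an interior point, with a value above \<open>u z\<close>; outside \<open>\<Omega>\<close> the hypothesis keeps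
\<open>u\<close> below \<open>u z + C0 * barrier\<close>. So the barrier touches \<open>u\<close> from above, which contradicts \<open>barrier_supersolution\<close>.\<close>
lemma sub_boundary_bound:
  fixes s lam Lam \<kappa> :: real
  assumes s: "0 < s" "s < 1" and lam: "0 < lam" "0 < Lam" and \<kappa>: "0 < \<kappa>" "\<kappa> \<le> 1"
  obtains a0 where "0 < a0"
    "\<And>(K :: 'a::euclidean_space \<Rightarrow> real) \<Omega> \<alpha> z x u C0.
      \<lbrakk>upper_kernel s Lam K; \<And>y. y \<noteq> 0 \<Longrightarrow> lam * sing_kernel s y \<le> K y;
       0 < \<alpha>; \<alpha> \<le> a0; open \<Omega>; bounded \<Omega>; exterior_corkscrew \<kappa> \<Omega>; z \<in> frontier \<Omega>; x \<in> \<Omega>;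
       nonlocal_subsolution K \<Omega> u; continuous_on (closure \<Omega>) u; 0 < C0;
       \<And>y. y \<notin> \<Omega> \<Longrightarrow> u y - u z \<le> C0 * norm (y - z) powr \<alpha>\<rbrakk>
      \<Longrightarrow> u x \<le> u z + 2 * C0 * norm (x - z) powr \<alpha>"
proof -
  obtain a0 c0 where a0: "0 < a0" "0 < c0" "a0 \<le> s / 2" and barr:
    "\<And>(K :: 'a \<Rightarrow> real) \<Omega> \<alpha> z x.
      \<lbrakk>upper_kernel s Lam K; \<And>y. x + y \<notin> \<Omega> \<Longrightarrow> lam * sing_kernel s y \<le> K y;
       0 < \<alpha>; \<alpha> \<le> a0; open \<Omega>; exterior_corkscrew \<kappa> \<Omega>; z \<in> frontier \<Omega>; x \<in> \<Omega>\<rbrakk>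
      \<Longrightarrow> \<exists>r>0. \<exists>p c H. (\<forall>y. norm y < r \<longrightarrow> H y = p \<bullet> y + c * (norm y)\<^sup>2) \<and>
            (\<forall>y. barrier \<Omega> \<alpha> z (x + y) - barrier \<Omega> \<alpha> z x \<le> H y) \<and>
            H \<in> borel_measurable borel \<and> integrable lebesgue (\<lambda>y. (H y + H (- y)) * K y) \<and>
            (\<integral>y. (H y + H (- y)) * K y \<partial>lebesgue) \<le> - c0 * norm (x - z) powr (\<alpha> - 2 * s)"
    using barrier_supersolution[OF s lam \<kappa>, where 'a='a] by blast
  show thesis
  proof (rule that[OF a0(1)])
    fix K :: "'a \<Rightarrow> real" and \<Omega> \<alpha> z x u C0
    assume K: "upper_kernel s Lam K" and Kl: "\<And>y. y \<noteq> 0 \<Longrightarrow> lam * sing_kernel s y \<le> K y"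
      and \<alpha>: "0 < \<alpha>" "\<alpha> \<le> a0" and \<Omega>: "open \<Omega>" "bounded \<Omega>" and cork: "exterior_corkscrew \<kappa> \<Omega>"
      and z: "z \<in> frontier \<Omega>" and x: "x \<in> \<Omega>" and sub: "nonlocal_subsolution K \<Omega> u"
      and cont: "continuous_on (closure \<Omega>) u" and C0: "0 < C0"
      and bd: "\<And>y. y \<notin> \<Omega> \<Longrightarrow> u y - u z \<le> C0 * norm (y - z) powr \<alpha>"
    define f where "f = (\<lambda>y. u y - 2 * C0 * norm (y - z) powr \<alpha>)"
    have "continuous_on (closure \<Omega>) f" unfolding f_def using cont \<alpha>
      by (intro continuous_intros continuous_on_powr') (auto intro!: continuous_intros)
    then obtain x2 where x2: "x2 \<in> closure \<Omega>" "\<And>y. y \<in> closure \<Omega> \<Longrightarrow> f y \<le> f x2"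
      using continuous_attains_sup[of "closure \<Omega>" f] \<Omega> x closure_subset[of \<Omega>] by (auto simp: compact_closure)
    show "u x \<le> u z + 2 * C0 * norm (x - z) powr \<alpha>"
    proof (rule ccontr)
      assume "\<not> ?thesis"
      moreover have "x \<in> closure \<Omega>" using x closure_subset by blast
      ultimately have big: "u z < f x2" using x2(2)[of x] by (simp add: f_def)
      have x2\<Omega>: "x2 \<in> \<Omega>"
      proof (rule ccontr)
        assume "x2 \<notin> \<Omega>"
        then have "f x2 \<le> u z - C0 * norm (x2 - z) powr \<alpha>" using bd[of x2] by (simp add: f_def)
        moreover have "0 \<le> C0 * norm (x2 - z) powr \<alpha>" using C0 by simp
        ultimately show False using big by simp
      qed
      have Kl': "lam * sing_kernel s y \<le> K y" if "x2 + y \<notin> \<Omega>" for y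
        using that x2\<Omega> by (intro Kl) auto
      obtain r p c H where r: "0 < r" and H: "\<forall>y. norm y < r \<longrightarrow> H y = p \<bullet> y + c * (norm y)\<^sup>2"
        and bH: "\<forall>y. barrier \<Omega> \<alpha> z (x2 + y) - barrier \<Omega> \<alpha> z x2 \<le> H y"
        and Hm: "H \<in> borel_measurable borel" and int: "integrable lebesgue (\<lambda>y. (H y + H (- y)) * K y)"
        and le: "(\<integral>y. (H y + H (- y)) * K y \<partial>lebesgue) \<le> - c0 * norm (x2 - z) powr (\<alpha> - 2 * s)"
        using barr[OF K Kl' \<alpha> \<Omega>(1) cork z x2\<Omega>] by blast
      have inc: "u (x2 + y) - u x2 \<le> C0 * H y" for y
      proof -
        have "u (x2 + y) - u x2 \<le> C0 * (barrier \<Omega> \<alpha> z (x2 + y) - barrier \<Omega> \<alpha> z x2)"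
        proof (cases "x2 + y \<in> \<Omega>")
          case True
          then have "x2 + y \<in> closure \<Omega>" using closure_subset by blast
          then show ?thesis using x2(2)[of "x2 + y"] True x2\<Omega> by (simp add: f_def barrier_def algebra_simps)
        next
          case False
          then show ?thesis using bd[OF False] big x2\<Omega> by (simp add: f_def barrier_def algebra_simps)
        qed
        also have "\<dots> \<le> C0 * H y" using bH C0 by (intro mult_left_mono) auto
        finally show ?thesis .
      qed
      have fac: "(C0 * H y + C0 * H (- y)) * K y = C0 * ((H y + H (- y)) * K y)" for y by (simp add: algebra_simps)
      have "0 \<le> (\<integral>y. (C0 * H y + C0 * H (- y)) * K y \<partial>lebesgue)"
      proof (rule nonlocal_subsolutionD[OF sub x2\<Omega> r, of "\<lambda>y. C0 * H y" "C0 *\<^sub>R p" "C0 * c"])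
        show "(\<lambda>y. C0 * H y) \<in> borel_measurable lebesgue" using Hm by (intro measurable_completion) simp
        show "integrable lebesgue (\<lambda>y. (C0 * H y + C0 * H (- y)) * K y)" unfolding fac using int by simp
      qed (use H inc in \<open>auto simp: algebra_simps\<close>)
      also have "\<dots> = C0 * (\<integral>y. (H y + H (- y)) * K y \<partial>lebesgue)" unfolding fac by simp
      finally have "0 \<le> (\<integral>y. (H y + H (- y)) * K y \<partial>lebesgue)" using C0 by (simp add: zero_le_mult_iff)
      moreover have "x2 \<noteq> z" using x2\<Omega> z \<Omega> by (auto simp: frontier_def interior_open)
      then have "0 < c0 * norm (x2 - z) powr (\<alpha> - 2 * s)" using a0 by simp
      ultimately show False using le by linarith
    qed
  qed
qed

text \<open>Below the graph of an \<open>M\<close>-Lipschitz function there is a cone with vertex at the boundary point; it contains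
balls of radius proportional to \<open>1 / (M + 2)\<close>. Compactness of the boundary makes the constants uniform for small radii.
Radii between the uniform one and four diameters lose a bounded factor, and beyond that a ball far away from the
bounded set \<open>\<Omega>\<close> will do.\<close>
lemma lipschitz_exterior_corkscrew:
  fixes \<Omega> :: "'a::euclidean_space set"
  assumes "bounded_lipschitz_domain \<Omega>"
  obtains \<kappa> where "0 < \<kappa>" "\<kappa> \<le> 1" "exterior_corkscrew \<kappa> \<Omega>"
proof -
  have \<Omega>: "open \<Omega>" "bounded \<Omega>" "\<Omega> \<noteq> {}" using assms by (auto simp: bounded_lipschitz_domain_def)
  have local: "\<exists>r>0. \<exists>k>0. \<forall>z\<in>frontier \<Omega> \<inter> ball x0 r. \<forall>\<rho>. 0 < \<rho> \<and> \<rho> \<le> r \<longrightarrow> (\<exists>q. ball q (k * \<rho>) \<subseteq> ball z \<rho> - \<Omega>)"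
    if "x0 \<in> frontier \<Omega>" for x0
  proof -
    obtain r \<nu> M and \<gamma> :: "'a \<Rightarrow> real" where r: "0 < r" and \<nu>: "norm \<nu> = 1" and lip: "M-lipschitz_on {v. v \<bullet> \<nu> = 0} \<gamma>"
      and graph: "\<forall>x\<in>ball x0 r. x \<in> \<Omega> \<longleftrightarrow> \<gamma> (x - (x \<bullet> \<nu>) *\<^sub>R \<nu>) < x \<bullet> \<nu>"
      using assms \<open>x0 \<in> frontier \<Omega>\<close> unfolding bounded_lipschitz_domain_def by blast
    have M: "0 \<le> M" using lip lipschitz_on_nonneg by blast
    define P where "P = (\<lambda>x. x - (x \<bullet> \<nu>) *\<^sub>R \<nu>)"
    have \<nu>\<nu>: "\<nu> \<bullet> \<nu> = 1" using \<nu> by (simp add: dot_square_norm)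
    have P0: "P x \<bullet> \<nu> = 0" for x by (simp add: P_def inner_simps \<nu>\<nu>)
    have Pn: "norm (P x) \<le> norm x" for x
    proof -
      have "(norm (P x))\<^sup>2 = (norm x)\<^sup>2 - (x \<bullet> \<nu>)\<^sup>2"
        unfolding power2_norm_eq_inner P_def by (simp add: inner_simps \<nu>\<nu> inner_commute power2_eq_square)
      then have "(norm (P x))\<^sup>2 \<le> (norm x)\<^sup>2" by simp
      then show ?thesis by (simp add: power2_le_iff_abs_le)
    qed
    \<comment> \<open>With \<open>k * (M + 1) \<le> 1\<close> a displacement of size \<open>k * t\<close> cannot climb back over the graph from depth \<open>t\<close>.\<close>
    define k where "k = 1 / (M + 2)"
    have k: "0 < k" "k \<le> 1/2" "k * (M + 2) = 1" using M by (auto simp: k_def field_simps)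
    have main: "\<forall>z\<in>frontier \<Omega> \<inter> ball x0 (r / 2). \<forall>\<rho>. 0 < \<rho> \<and> \<rho> \<le> r / 2 \<longrightarrow> (\<exists>q. ball q (k / 2 * \<rho>) \<subseteq> ball z \<rho> - \<Omega>)"
    proof (intro ballI allI impI)
      fix z \<rho> assume z: "z \<in> frontier \<Omega> \<inter> ball x0 (r / 2)" and \<rho>: "0 < \<rho> \<and> \<rho> \<le> r / 2"
      define t where "t = \<rho> / 2"
      have t: "0 < t" using \<rho> by (simp add: t_def)
      have zn: "z \<notin> \<Omega>" using z \<Omega> by (simp add: frontier_def interior_open)
      have zb: "z \<in> ball x0 r" using z r by auto
      have \<gamma>z: "z \<bullet> \<nu> \<le> \<gamma> (P z)" using graph[rule_format, OF zb] zn by (simp add: P_def)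
      show "\<exists>q. ball q (k / 2 * \<rho>) \<subseteq> ball z \<rho> - \<Omega>"
      proof (intro exI[of _ "z - t *\<^sub>R \<nu>"] subsetI)
        fix x assume x: "x \<in> ball (z - t *\<^sub>R \<nu>) (k / 2 * \<rho>)"
        define q where "q = x - (z - t *\<^sub>R \<nu>)"
        have q: "norm q < k * t" using x by (simp add: q_def dist_norm norm_minus_commute t_def)
        have xq: "x - z = q - t *\<^sub>R \<nu>" by (simp add: q_def)
        have "norm (x - z) \<le> norm q + t" unfolding xq using norm_triangle_ineq4[of q "t *\<^sub>R \<nu>"] \<nu> t by simp
        also have "\<dots> < 2 * t" using q t mult_right_mono[OF k(2) less_imp_le[OF t]] by linarith
        finally have xz: "norm (x - z) < \<rho>" by (simp add: t_def)
        then have "x \<in> ball z \<rho>" by (simp add: dist_norm norm_minus_commute)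
        moreover have "x \<in> ball x0 r"
          using xz z \<rho> dist_triangle[of x0 x z] by (auto simp: dist_norm norm_minus_commute)
        moreover have "x \<bullet> \<nu> \<le> \<gamma> (P x)"
        proof -
          have "dist (\<gamma> (P x)) (\<gamma> (P z)) \<le> M * dist (P x) (P z)"
            using lipschitz_onD[OF lip] P0 by simp
          also have "P x - P z = P q" unfolding P_def q_def by (simp add: inner_simps \<nu>\<nu> algebra_simps)
          then have "dist (P x) (P z) = norm (P q)" by (simp add: dist_norm)
          also have "M * norm (P q) \<le> M * (k * t)" using Pn[of q] q M by (intro mult_left_mono) auto
          finally have "\<gamma> (P z) - M * (k * t) \<le> \<gamma> (P x)" by (simp add: dist_real_def)
          moreover have "x \<bullet> \<nu> = z \<bullet> \<nu> + (q \<bullet> \<nu> - t)"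
            unfolding q_def by (simp add: inner_simps \<nu>\<nu>)
          moreover have "q \<bullet> \<nu> \<le> k * t" using norm_cauchy_schwarz[of q \<nu>] \<nu> q by simp
          moreover have "k * t + M * (k * t) \<le> t"
          proof -
            have "k * t + M * (k * t) = (k * (M + 1)) * t" by (simp add: algebra_simps)
            also have "\<dots> \<le> (k * (M + 2)) * t"
              using less_imp_le[OF k(1)] less_imp_le[OF t] by (intro mult_right_mono mult_left_mono) auto
            finally show ?thesis using k by simp
          qed
          ultimately show ?thesis using \<gamma>z by linarith
        qed
        ultimately show "x \<in> ball z \<rho> - \<Omega>" using graph by (auto simp: P_def)
      qed
    qed
    have "0 < r / 2" "0 < k / 2" using r k by auto
    with main show ?thesis by blast
  qed
  then obtain r k where rk: "\<And>x0. x0 \<in> frontier \<Omega> \<Longrightarrow> 0 < r x0 \<and> 0 < k x0 \<and>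
     (\<forall>z\<in>frontier \<Omega> \<inter> ball x0 (r x0). \<forall>\<rho>. 0 < \<rho> \<and> \<rho> \<le> r x0 \<longrightarrow> (\<exists>q. ball q (k x0 * \<rho>) \<subseteq> ball z \<rho> - \<Omega>))"
    by metis
  have cpt: "compact (frontier \<Omega>)" using \<Omega>(2) by (simp add: compact_frontier_bounded)
  obtain F where F: "F \<subseteq> frontier \<Omega>" "finite F" "frontier \<Omega> \<subseteq> (\<Union>x\<in>F. ball x (r x))"
    by (rule compactE_image[OF cpt, of "frontier \<Omega>" "\<lambda>x. ball x (r x)"]) (use rk in \<open>auto 4 4\<close>)
  define r0 where "r0 = Min (insert 1 (r ` F))"
  define k0 where "k0 = Min (insert 1 (k ` F))"
  have r0: "0 < r0" "\<And>x. x \<in> F \<Longrightarrow> r0 \<le> r x" using F rk by (auto simp: r0_def)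
  have k0: "0 < k0" "k0 \<le> 1" "\<And>x. x \<in> F \<Longrightarrow> k0 \<le> k x" using F rk by (auto simp: k0_def)
  have small: "\<exists>q. ball q (k0 * \<rho>) \<subseteq> ball z \<rho> - \<Omega>" if z: "z \<in> frontier \<Omega>" and \<rho>: "0 < \<rho>" "\<rho> \<le> r0" for z \<rho>
  proof -
    obtain x where x: "x \<in> F" "z \<in> ball x (r x)" using F z by blast
    then obtain q where q: "ball q (k x * \<rho>) \<subseteq> ball z \<rho> - \<Omega>"
      using rk[of x] F z \<rho> r0(2)[OF x(1)] by force
    have "ball q (k0 * \<rho>) \<subseteq> ball q (k x * \<rho>)" using k0(3)[OF x(1)] \<rho> by (intro subset_ball mult_right_mono) auto
    then show ?thesis using q by blast
  qed
  obtain D where D: "0 < D" "\<And>x y. x \<in> closure \<Omega> \<Longrightarrow> y \<in> closure \<Omega> \<Longrightarrow> norm (x - y) < D"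
  proof -
    have "bounded (closure \<Omega>)" using \<Omega> by (intro bounded_closure)
    then obtain b where b: "0 < b" "\<And>x. x \<in> closure \<Omega> \<Longrightarrow> norm x \<le> b" by (metis bounded_pos)
    show ?thesis
    proof (rule that[of "2 * b + 1"])
      fix x y assume "x \<in> closure \<Omega>" "y \<in> closure \<Omega>"
      then show "norm (x - y) < 2 * b + 1" using b(2)[of x] b(2)[of y] norm_triangle_ineq4[of x y] by simp
    qed (use b in simp)
  qed
  define R where "R = max (4 * D) r0"
  define \<kappa> where "\<kappa> = min (k0 * (r0 / R)) (1/4)"
  have R: "0 < R" "r0 \<le> R" "4 * D \<le> R" using D by (auto simp: R_def)
  have "0 < k0 * (r0 / R)" using k0 r0 R by simp
  then have \<kappa>: "0 < \<kappa>" "\<kappa> \<le> 1/4" "\<kappa> \<le> k0 * (r0 / R)"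
    unfolding \<kappa>_def by (auto simp only: min_less_iff_conj min.cobounded1 min.cobounded2)
  then have "\<kappa> \<le> 1" by simp
  have "\<exists>q. ball q (\<kappa> * \<rho>) \<subseteq> ball z \<rho> - \<Omega>" if z: "z \<in> frontier \<Omega>" and \<rho>: "0 < \<rho>" for z \<rho>
  proof (cases "\<rho> \<le> R")
    case True
    define \<rho>' where "\<rho>' = min \<rho> r0"
    have \<rho>': "0 < \<rho>'" "\<rho>' \<le> r0" "\<rho>' \<le> \<rho>" using \<rho> r0 by (auto simp: \<rho>'_def)
    obtain q where q: "ball q (k0 * \<rho>') \<subseteq> ball z \<rho>' - \<Omega>" using small[OF z \<rho>'(1,2)] by blast
    have "(r0 / R) * \<rho> \<le> \<rho>'"
    proof (cases "\<rho> \<le> r0")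
      case True
      have "(r0 / R) * \<rho> \<le> 1 * \<rho>" using R r0 \<rho> by (intro mult_right_mono) auto
      then show ?thesis using True by (simp add: \<rho>'_def)
    next
      case False
      have "(r0 / R) * \<rho> \<le> (r0 / R) * R" using True R r0 by (intro mult_left_mono) auto
      then show ?thesis using False R by (simp add: \<rho>'_def)
    qed
    then have "k0 * ((r0 / R) * \<rho>) \<le> k0 * \<rho>'" using k0 by (intro mult_left_mono) auto
    moreover have "\<kappa> * \<rho> \<le> k0 * (r0 / R) * \<rho>" using \<kappa> \<rho> by (intro mult_right_mono) auto
    ultimately have "ball q (\<kappa> * \<rho>) \<subseteq> ball q (k0 * \<rho>')" by (intro subset_ball) simp
    moreover have "ball z \<rho>' \<subseteq> ball z \<rho>" using \<rho>' by (intro subset_ball)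
    ultimately show ?thesis using q by blast
  next
    case False
    obtain e :: 'a where e: "norm e = 1" using vector_choose_size[of 1] by auto
    define q where "q = z + (\<rho> / 2) *\<^sub>R e"
    have qz: "norm (q - z) = \<rho> / 2" using e \<rho> by (simp add: q_def)
    have "ball q (\<kappa> * \<rho>) \<subseteq> ball z \<rho> - \<Omega>"
    proof
      fix x assume "x \<in> ball q (\<kappa> * \<rho>)"
      then have "norm (x - q) < \<kappa> * \<rho>" by (simp add: dist_norm norm_minus_commute)
      also have "\<dots> \<le> 1/4 * \<rho>" using \<kappa> \<rho> by (intro mult_right_mono) auto
      finally have xq: "norm (x - q) < \<rho> / 4" by simp
      have "norm (x - z) \<le> norm (x - q) + norm (q - z)" using norm_triangle_ineq[of "x - q" "q - z"] by simp
      then have "norm (x - z) < \<rho>" using xq qz \<rho> by simp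
      moreover have "norm (q - z) \<le> norm (x - q) + norm (x - z)" using norm_triangle_ineq4[of "x - z" "x - q"] by (simp add: norm_minus_commute)
      then have "D < norm (x - z)" using xq qz \<rho> False R by simp
      then have "x \<notin> \<Omega>" using D(2)[of x z] z closure_subset by (fastforce simp: frontier_def)
      ultimately show "x \<in> ball z \<rho> - \<Omega>" by (simp add: dist_norm norm_minus_commute)
    qed
    then show ?thesis by blast
  qed
  then show thesis using that[of \<kappa>] \<kappa> \<open>\<kappa> \<le> 1\<close> by (auto simp: exterior_corkscrew_def)
qed

section \<open>From pointwise estimates to the Hoelder norm\<close>

lemma nearest_boundary_point:
  fixes \<Omega> :: "'a::euclidean_space set"
  assumes "open \<Omega>" "bounded \<Omega>" "x \<in> \<Omega>"
  obtains z where "z \<in> frontier \<Omega>" "norm (x - z) = infdist x (- \<Omega>)" "ball x (infdist x (- \<Omega>)) \<subseteq> \<Omega>" "0 < infdist x (- \<Omega>)"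
proof -
  let ?d = "infdist x (- \<Omega>)"
  have ne: "- \<Omega> \<noteq> {}" using assms(2) not_bounded_UNIV by (metis Compl_empty_eq double_complement)
  have cl: "closed (- \<Omega>)" using assms(1) by (simp add: closed_Compl)
  obtain z where z: "z \<in> - \<Omega>" "?d = dist x z" using infdist_attains_inf[OF cl ne] by blast
  have pos: "0 < ?d" using z assms(3) by auto
  have sub: "ball x ?d \<subseteq> \<Omega>"
  proof
    fix y assume "y \<in> ball x ?d"
    then show "y \<in> \<Omega>" using infdist_le[of y "- \<Omega>" x] by auto
  qed
  have "z \<in> cball x ?d" using z by simp
  also have "cball x ?d = closure (ball x ?d)" using pos by simp
  also have "\<dots> \<subseteq> closure \<Omega>" using sub by (rule closure_mono)
  finally have "z \<in> frontier \<Omega>" using z assms(1) by (simp add: frontier_def interior_open)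
  then show thesis using that z sub pos by (simp add: dist_norm)
qed

lemma frontier_nonempty:
  fixes \<Omega> :: "'a::euclidean_space set"
  assumes "open \<Omega>" "bounded \<Omega>" "\<Omega> \<noteq> {}"
  shows "frontier \<Omega> \<noteq> {}"
  using assms nearest_boundary_point by (metis ex_in_conv)

text \<open>For two points closer than half the distance of the first one to the boundary, use the interior bound. Otherwise the
nearest boundary point \<open>z\<close> of \<open>x\<close> is within \<open>2 * norm (x - y)\<close> of \<open>x\<close> and \<open>3 * norm (x - y)\<close> of \<open>y\<close>, and two
applications of the boundary bound give the constant \<open>2 * 2 + 2 * 3 = 10\<close>.\<close>
lemma holder_norm_le_of_boundary_interior:
  fixes \<Omega> :: "'a::euclidean_space set"
  assumes \<Omega>: "open \<Omega>" "bounded \<Omega>" "\<Omega> \<noteq> {}" and \<alpha>: "0 < \<alpha>" "\<alpha> < 1" and "0 < A"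
  obtains C where "0 < C"
    "\<And>v C0. \<lbrakk>0 < C0;
      \<And>y z. y \<in> closure \<Omega> \<Longrightarrow> z \<in> frontier \<Omega> \<Longrightarrow> \<bar>v y - v z\<bar> \<le> 2 * C0 * norm (y - z) powr \<alpha>;
      \<And>x y. x \<in> \<Omega> \<Longrightarrow> y \<in> ball x (infdist x (- \<Omega>) / 2) \<Longrightarrow> \<bar>v y - v x\<bar> \<le> A * C0 * norm (y - x) powr \<alpha>;
      \<And>z. z \<in> frontier \<Omega> \<Longrightarrow> \<bar>v z\<bar> \<le> C0 * (1 + norm z powr \<alpha>)\<rbrakk>
     \<Longrightarrow> holder_norm \<alpha> (closure \<Omega>) v \<le> ennreal (C * C0)"
proof -
  have "bounded (closure \<Omega>)" using \<Omega> by (intro bounded_closure)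
  then obtain b where b: "0 < b" "\<And>x. x \<in> closure \<Omega> \<Longrightarrow> norm x \<le> b" by (metis bounded_pos)
  define A' where "A' = max A 10"
  define S where "S = 1 + b powr \<alpha> + 2 * (2 * b) powr \<alpha>"
  have A': "0 < A'" "A \<le> A'" "10 \<le> A'" by (auto simp: A'_def)
  have S: "0 < S" by (simp add: S_def add_pos_nonneg)
  show thesis
  proof (rule that[of "S + A'"])
    show "0 < S + A'" using S A' by simp
    fix v :: "'a \<Rightarrow> real" and C0 :: real
    assume C0: "0 < C0" and bd: "\<And>y z. y \<in> closure \<Omega> \<Longrightarrow> z \<in> frontier \<Omega> \<Longrightarrow> \<bar>v y - v z\<bar> \<le> 2 * C0 * norm (y - z) powr \<alpha>"
      and int: "\<And>x y. x \<in> \<Omega> \<Longrightarrow> y \<in> ball x (infdist x (- \<Omega>) / 2) \<Longrightarrow> \<bar>v y - v x\<bar> \<le> A * C0 * norm (y - x) powr \<alpha>"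
      and gz: "\<And>z. z \<in> frontier \<Omega> \<Longrightarrow> \<bar>v z\<bar> \<le> C0 * (1 + norm z powr \<alpha>)"
    have fc: "frontier \<Omega> \<subseteq> closure \<Omega>" by (auto simp: frontier_def)
    obtain z0 where z0: "z0 \<in> frontier \<Omega>" using frontier_nonempty[OF \<Omega>] by blast
    have sup: "\<bar>v x\<bar> \<le> S * C0" if x: "x \<in> closure \<Omega>" for x
    proof -
      have "norm z0 powr \<alpha> \<le> b powr \<alpha>" using b z0 fc \<alpha> by (intro powr_mono2) auto
      then have 1: "C0 * (1 + norm z0 powr \<alpha>) \<le> C0 * (1 + b powr \<alpha>)" using C0 by (intro mult_left_mono) auto
      have "norm (x - z0) \<le> norm x + norm z0" by (rule norm_triangle_ineq4)
      then have "norm (x - z0) \<le> 2 * b" using b(2)[OF x] b(2)[of z0] z0 fc by auto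
      then have "norm (x - z0) powr \<alpha> \<le> (2 * b) powr \<alpha>" using \<alpha> by (intro powr_mono2) auto
      then have 2: "2 * C0 * norm (x - z0) powr \<alpha> \<le> 2 * C0 * (2 * b) powr \<alpha>" using C0 by (intro mult_left_mono) auto
      have "\<bar>v x\<bar> \<le> \<bar>v z0\<bar> + \<bar>v x - v z0\<bar>" by linarith
      also have "\<dots> \<le> C0 * (1 + b powr \<alpha>) + 2 * C0 * (2 * b) powr \<alpha>" using 1 2 gz[OF z0] bd[OF x z0] by linarith
      finally show ?thesis by (simp add: S_def algebra_simps)
    qed
    have two: "(c * t) powr \<alpha> \<le> c * t powr \<alpha>" if "1 \<le> c" "0 \<le> t" for c t :: real
    proof -
      have "(c * t) powr \<alpha> = c powr \<alpha> * t powr \<alpha>" by (rule powr_mult)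
      also have "\<dots> \<le> c powr 1 * t powr \<alpha>" using that \<alpha> by (intro mult_right_mono powr_mono) auto
      finally show ?thesis using that by simp
    qed
    have semi: "\<bar>v x - v y\<bar> \<le> A' * C0 * norm (x - y) powr \<alpha>" if x: "x \<in> closure \<Omega>" and y: "y \<in> closure \<Omega>" for x y
    proof -
      have up: "c * C0 * norm (x - y) powr \<alpha> \<le> A' * C0 * norm (x - y) powr \<alpha>" if "c \<le> A'" for c
        using that C0 by (intro mult_right_mono) auto
      consider "x \<in> frontier \<Omega>" | "y \<in> frontier \<Omega>" | "x \<in> \<Omega>" "y \<in> \<Omega>" using x y \<Omega> by (auto simp: frontier_def interior_open)
      then show ?thesis
      proof cases
        case 1
        then show ?thesis using bd[OF y 1] up[of 2] A' by (simp add: norm_minus_commute abs_minus_commute)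
      next
        case 2
        then show ?thesis using bd[OF x 2] up[of 2] A' by simp
      next
        case 3
        let ?d = "infdist x (- \<Omega>)"
        show ?thesis
        proof (cases "norm (x - y) < ?d / 2")
          case True
          then show ?thesis using int[OF 3(1), of y] up[OF A'(2)] by (simp add: dist_norm norm_minus_commute abs_minus_commute)
        next
          case False
          obtain z where z: "z \<in> frontier \<Omega>" "norm (x - z) = ?d" using nearest_boundary_point[OF \<Omega>(1,2) 3(1)] by metis
          let ?t = "norm (x - y)"
          have xz: "norm (x - z) \<le> 2 * ?t" using z False by simp
          have "norm (y - z) \<le> norm (y - x) + norm (x - z)" using norm_triangle_ineq[of "y - x" "x - z"] by simp
          then have yz: "norm (y - z) \<le> 3 * ?t" using xz by (simp add: norm_minus_commute)
          have "norm (x - z) powr \<alpha> \<le> (2 * ?t) powr \<alpha>" using xz \<alpha> by (intro powr_mono2) auto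
          also have "\<dots> \<le> 2 * ?t powr \<alpha>" by (rule two) auto
          finally have "2 * C0 * norm (x - z) powr \<alpha> \<le> 2 * C0 * (2 * ?t powr \<alpha>)" using C0 by (intro mult_left_mono) auto
          moreover have "norm (y - z) powr \<alpha> \<le> (3 * ?t) powr \<alpha>" using yz \<alpha> by (intro powr_mono2) auto
          then have "norm (y - z) powr \<alpha> \<le> 3 * ?t powr \<alpha>" using two[of 3 ?t] by simp
          then have "2 * C0 * norm (y - z) powr \<alpha> \<le> 2 * C0 * (3 * ?t powr \<alpha>)" using C0 by (intro mult_left_mono) auto
          ultimately have "\<bar>v x - v y\<bar> \<le> 10 * C0 * ?t powr \<alpha>"
            using bd[OF x z(1)] bd[OF y z(1)] by linarith
          then show ?thesis using up[OF A'(3)] by linarith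
        qed
      qed
    qed
    have "(SUP x\<in>closure \<Omega>. ennreal \<bar>v x\<bar>) \<le> ennreal (S * C0)"
      using sup by (intro SUP_least ennreal_leI)
    moreover have "(SUP p\<in>{p\<in>closure \<Omega> \<times> closure \<Omega>. fst p \<noteq> snd p}.
        ennreal (\<bar>v (fst p) - v (snd p)\<bar> / norm (fst p - snd p) powr \<alpha>)) \<le> ennreal (A' * C0)"
      using semi by (intro SUP_least ennreal_leI) (auto simp: divide_le_eq)
    ultimately have "holder_norm \<alpha> (closure \<Omega>) v \<le> ennreal (S * C0) + ennreal (A' * C0)"
      unfolding holder_norm_def by (rule add_mono)
    also have "\<dots> = ennreal ((S + A') * C0)" using S A' C0 by (simp add: ennreal_plus[symmetric] distrib_right del: ennreal_plus)
    finally show "holder_norm \<alpha> (closure \<Omega>) v \<le> ennreal ((S + A') * C0)" .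
  qed
qed

text \<open>The form of \<open>interior_holder\<close> needed near the boundary: the growth is measured from a boundary point \<open>z\<close> at
distance at most \<open>2 * R\<close>. The constant is \<open>2 * 2 powr \<alpha> * (2 * 4 powr \<alpha>) \<le> 32\<close>.\<close>
lemma interior_estimate:
  fixes s lam Lam :: real
  assumes s: "0 < s" "s < 1" and lam: "0 < lam" "0 < Lam"
  obtains a0 where "0 < a0"
    "\<And>(K :: 'a::euclidean_space \<Rightarrow> real) \<alpha> u x0 z R C0 c y.
      \<lbrakk>upper_kernel s Lam K; \<And>y. y \<noteq> 0 \<Longrightarrow> lam * sing_kernel s y \<le> K y;
       0 < \<alpha>; \<alpha> \<le> a0; \<alpha> < 1; 0 < R; 0 < C0; nonlocal_subsolution K (ball x0 R) u; nonlocal_subsolution K (ball x0 R) (\<lambda>x. - u x);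
       continuous_on (ball x0 R) u; u \<in> borel_measurable lebesgue; norm (x0 - z) \<le> 2 * R;
       \<And>y. \<bar>u y - c\<bar> \<le> 2 * C0 * (norm (y - z) + R) powr \<alpha>; y \<in> ball x0 R\<rbrakk>
      \<Longrightarrow> \<bar>u y - u x0\<bar> \<le> 32 * C0 * norm (y - x0) powr \<alpha>"
proof -
  obtain a0 where a0: "0 < a0" and holder:
    "\<And>(K :: 'a \<Rightarrow> real) \<alpha> u x0 R B c y.
      \<lbrakk>upper_kernel s Lam K; \<And>y. y \<noteq> 0 \<Longrightarrow> lam * sing_kernel s y \<le> K y;
       0 < \<alpha>; \<alpha> \<le> a0; 0 < R; 0 < B; nonlocal_subsolution K (ball x0 R) u; nonlocal_subsolution K (ball x0 R) (\<lambda>x. - u x);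
       continuous_on (ball x0 R) u; u \<in> borel_measurable lebesgue;
       \<And>y. \<bar>u y - c\<bar> \<le> B * (max R (norm (y - x0))) powr \<alpha>; y \<in> ball x0 R\<rbrakk>
      \<Longrightarrow> \<bar>u y - u x0\<bar> \<le> 2 * 2 powr \<alpha> * B * norm (y - x0) powr \<alpha>"
    using interior_holder[OF s lam, where 'a='a] by blast
  show thesis
  proof (rule that[OF a0])
    fix K :: "'a \<Rightarrow> real" and \<alpha> u x0 z R C0 c y
    assume K: "upper_kernel s Lam K" and Kl: "\<And>y. y \<noteq> 0 \<Longrightarrow> lam * sing_kernel s y \<le> K y"
      and \<alpha>: "0 < \<alpha>" "\<alpha> \<le> a0" "\<alpha> < 1" and R: "0 < R" and C0: "0 < C0"
      and sub: "nonlocal_subsolution K (ball x0 R) u" "nonlocal_subsolution K (ball x0 R) (\<lambda>x. - u x)"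
      and cont: "continuous_on (ball x0 R) u" and meas: "u \<in> borel_measurable lebesgue"
      and z: "norm (x0 - z) \<le> 2 * R"
      and gr: "\<And>y. \<bar>u y - c\<bar> \<le> 2 * C0 * (norm (y - z) + R) powr \<alpha>" and y: "y \<in> ball x0 R"
    define B where "B = 2 * C0 * 4 powr \<alpha>"
    have B: "0 < B" using C0 by (simp add: B_def)
    have g: "\<bar>u y - c\<bar> \<le> B * (max R (norm (y - x0))) powr \<alpha>" for y
    proof -
      have "norm (y - z) \<le> norm (y - x0) + norm (x0 - z)" using norm_triangle_ineq[of "y - x0" "x0 - z"] by simp
      then have "norm (y - z) + R \<le> 4 * max R (norm (y - x0))" using z by (auto simp: max_def)
      then have "(norm (y - z) + R) powr \<alpha> \<le> (4 * max R (norm (y - x0))) powr \<alpha>" using R \<alpha> by (intro powr_mono2) auto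
      then have "2 * C0 * (norm (y - z) + R) powr \<alpha> \<le> 2 * C0 * (4 * max R (norm (y - x0))) powr \<alpha>" using C0 by (intro mult_left_mono) auto
      then show ?thesis using gr[of y] by (simp add: B_def powr_mult)
    qed
    have "\<bar>u y - u x0\<bar> \<le> 2 * 2 powr \<alpha> * B * norm (y - x0) powr \<alpha>"
      by (rule holder[OF K Kl \<alpha>(1,2) R B sub cont meas g y])
    also have "\<dots> \<le> 32 * C0 * norm (y - x0) powr \<alpha>"
    proof (rule mult_right_mono)
      have "2 powr \<alpha> \<le> 2 powr (1::real)" "4 powr \<alpha> \<le> 4 powr (1::real)" using \<alpha> by (intro powr_mono; simp)+
      then have "2 powr \<alpha> * 4 powr \<alpha> \<le> 2 * (4::real)" by (intro mult_mono) auto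
      then have "4 * C0 * (2 powr \<alpha> * 4 powr \<alpha>) \<le> 4 * C0 * (2 * 4)" using C0 by (intro mult_left_mono) auto
      then show "2 * 2 powr \<alpha> * B \<le> 32 * C0" by (simp add: B_def mult_ac)
    qed auto
    finally show "\<bar>u y - u x0\<bar> \<le> 32 * C0 * norm (y - x0) powr \<alpha>" .
  qed
qed

lemma admissible_kernelD:
  fixes K :: "'a::euclidean_space \<Rightarrow> real"
  assumes "admissible_kernel s lam Lam K" "0 < lam"
  shows "upper_kernel s Lam K" "y \<noteq> 0 \<Longrightarrow> lam * sing_kernel s y \<le> K y"
proof -
  have adm: "K \<in> borel_measurable lebesgue"
    "\<And>y. y \<noteq> 0 \<Longrightarrow> K y = K (- y)"
    "\<And>y. y \<noteq> 0 \<Longrightarrow> lam / norm y powr (real DIM('a) + 2 * s) \<le> K y"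
    "\<And>y. y \<noteq> 0 \<Longrightarrow> K y \<le> Lam / norm y powr (real DIM('a) + 2 * s)"
    using assms(1) unfolding admissible_kernel_def by blast+
  have pos: "0 \<le> K y" if "y \<noteq> 0" for y
  proof -
    have "0 \<le> lam / norm y powr (real DIM('a) + 2 * s)" using assms(2) by simp
    then show ?thesis using adm(3)[OF that] by linarith
  qed
  show "upper_kernel s Lam K"
    unfolding upper_kernel_def sing_kernel_def
  proof (intro conjI allI impI adm(1))
    fix y :: 'a assume y: "y \<noteq> 0"
    show "K (- y) = K y" "0 \<le> K y" using adm(2)[OF y] pos[OF y] by simp_all
    show "K y \<le> Lam * (1 / norm y powr (real DIM('a) + 2 * s))" using adm(4)[OF y] by simp
  qed
  show "y \<noteq> 0 \<Longrightarrow> lam * sing_kernel s y \<le> K y" using adm(3)[of y] by (simp add: sing_kernel_def)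
qed

text \<open>Both estimates for \<open>u\<close> and \<open>- u\<close>; the boundary estimate supplies the growth bound that the interior estimate needs.\<close>
lemma viscosity_estimates:
  fixes s lam Lam \<kappa> :: real
  assumes s: "0 < s" "s < 1" and lam: "0 < lam" "0 < Lam" and \<kappa>: "0 < \<kappa>" "\<kappa> \<le> 1"
  obtains a0 where "0 < a0"
    "\<And>(K :: 'a::euclidean_space \<Rightarrow> real) \<Omega> \<alpha> u g C0.
      \<lbrakk>admissible_kernel s lam Lam K; 0 < \<alpha>; \<alpha> \<le> a0; \<alpha> < 1; open \<Omega>; bounded \<Omega>; exterior_corkscrew \<kappa> \<Omega>;
       viscosity_solution K \<Omega> g u; 0 < C0;
       \<And>y z. y \<notin> \<Omega> \<Longrightarrow> z \<in> frontier \<Omega> \<Longrightarrow> \<bar>g y - g z\<bar> \<le> C0 * norm (y - z) powr \<alpha>\<rbrakk>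
      \<Longrightarrow> (\<forall>y. \<forall>z\<in>frontier \<Omega>. \<bar>u y - u z\<bar> \<le> 2 * C0 * norm (y - z) powr \<alpha>) \<and>
          (\<forall>x\<in>\<Omega>. \<forall>y\<in>ball x (infdist x (- \<Omega>) / 2). \<bar>u y - u x\<bar> \<le> 32 * C0 * norm (y - x) powr \<alpha>)"
proof -
  obtain a1 where a1: "0 < a1" and bdry:
    "\<And>(K :: 'a \<Rightarrow> real) \<Omega> \<alpha> z x u C0.
      \<lbrakk>upper_kernel s Lam K; \<And>y. y \<noteq> 0 \<Longrightarrow> lam * sing_kernel s y \<le> K y;
       0 < \<alpha>; \<alpha> \<le> a1; open \<Omega>; bounded \<Omega>; exterior_corkscrew \<kappa> \<Omega>; z \<in> frontier \<Omega>; x \<in> \<Omega>;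
       nonlocal_subsolution K \<Omega> u; continuous_on (closure \<Omega>) u; 0 < C0;
       \<And>y. y \<notin> \<Omega> \<Longrightarrow> u y - u z \<le> C0 * norm (y - z) powr \<alpha>\<rbrakk>
      \<Longrightarrow> u x \<le> u z + 2 * C0 * norm (x - z) powr \<alpha>"
    using sub_boundary_bound[OF s lam \<kappa>, where 'a='a] by blast
  obtain a2 where a2: "0 < a2" and inter:
    "\<And>(K :: 'a \<Rightarrow> real) \<alpha> u x0 z R C0 c y.
      \<lbrakk>upper_kernel s Lam K; \<And>y. y \<noteq> 0 \<Longrightarrow> lam * sing_kernel s y \<le> K y;
       0 < \<alpha>; \<alpha> \<le> a2; \<alpha> < 1; 0 < R; 0 < C0; nonlocal_subsolution K (ball x0 R) u; nonlocal_subsolution K (ball x0 R) (\<lambda>x. - u x);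
       continuous_on (ball x0 R) u; u \<in> borel_measurable lebesgue; norm (x0 - z) \<le> 2 * R;
       \<And>y. \<bar>u y - c\<bar> \<le> 2 * C0 * (norm (y - z) + R) powr \<alpha>; y \<in> ball x0 R\<rbrakk>
      \<Longrightarrow> \<bar>u y - u x0\<bar> \<le> 32 * C0 * norm (y - x0) powr \<alpha>"
    using interior_estimate[OF s lam, where 'a='a] by blast
  show thesis
  proof (rule that[of "min a1 a2"])
    show "0 < min a1 a2" using a1 a2 by simp
    fix K :: "'a \<Rightarrow> real" and \<Omega> \<alpha> u g C0
    assume adm: "admissible_kernel s lam Lam K" and \<alpha>: "0 < \<alpha>" "\<alpha> \<le> min a1 a2" "\<alpha> < 1"
      and \<Omega>: "open \<Omega>" "bounded \<Omega>" and cork: "exterior_corkscrew \<kappa> \<Omega>"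
      and visc: "viscosity_solution K \<Omega> g u" and C0: "0 < C0"
      and g: "\<And>y z. y \<notin> \<Omega> \<Longrightarrow> z \<in> frontier \<Omega> \<Longrightarrow> \<bar>g y - g z\<bar> \<le> C0 * norm (y - z) powr \<alpha>"
    note K = admissible_kernelD[OF adm lam(1)]
    have \<alpha>1: "\<alpha> \<le> a1" "\<alpha> \<le> a2" using \<alpha> by auto
    have K0: "y \<noteq> 0 \<Longrightarrow> 0 \<le> K y" for y using K(1) by (auto simp: upper_kernel_def)
    have ug: "u y = g y" if "y \<notin> \<Omega>" for y using visc that by (auto simp: viscosity_solution_def)
    have fn: "z \<notin> \<Omega>" if "z \<in> frontier \<Omega>" for z using that \<Omega> by (simp add: frontier_def interior_open)
    have ext: "\<bar>u y - u z\<bar> \<le> C0 * norm (y - z) powr \<alpha>" if "y \<notin> \<Omega>" "z \<in> frontier \<Omega>" for y z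
      using g[OF that] ug[OF that(1)] ug[OF fn[OF that(2)]] by simp
    have cont: "continuous_on (closure \<Omega>) u" and meas: "u \<in> borel_measurable lebesgue"
      using visc by (auto simp: viscosity_solution_def)
    have sub: "nonlocal_subsolution K \<Omega> u" "nonlocal_subsolution K \<Omega> (\<lambda>x. - u x)"
      using viscosity_imp_subsolution[OF visc K0 \<Omega>(1)]
        viscosity_imp_subsolution[OF viscosity_solution_uminus[OF visc] K0 \<Omega>(1)] by auto
    have bd: "\<bar>u y - u z\<bar> \<le> 2 * C0 * norm (y - z) powr \<alpha>" if z: "z \<in> frontier \<Omega>" for y z
    proof (cases "y \<in> \<Omega>")
      case True
      have up: "u y - u z \<le> C0 * norm (y - z) powr \<alpha>" and lo: "(- u y) - (- u z) \<le> C0 * norm (y - z) powr \<alpha>"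
        if "y \<notin> \<Omega>" for y using ext[OF that z] by linarith+
      have cont': "continuous_on (closure \<Omega>) (\<lambda>x. - u x)" using cont by (rule continuous_on_minus)
      have "u y \<le> u z + 2 * C0 * norm (y - z) powr \<alpha>"
        by (rule bdry[OF K \<alpha>(1) \<alpha>1(1) \<Omega> cork z True sub(1) cont C0 up])
      moreover have "- u y \<le> - u z + 2 * C0 * norm (y - z) powr \<alpha>"
        by (rule bdry[OF K \<alpha>(1) \<alpha>1(1) \<Omega> cork z True sub(2) cont' C0 lo])
      ultimately show ?thesis by (simp add: abs_le_iff)
    next
      case False
      have "C0 * norm (y - z) powr \<alpha> \<le> 2 * C0 * norm (y - z) powr \<alpha>" using C0 by (intro mult_right_mono) auto
      then show ?thesis using ext[OF False z] by linarith
    qed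
    have "\<bar>u y - u x\<bar> \<le> 32 * C0 * norm (y - x) powr \<alpha>" if x: "x \<in> \<Omega>" and y: "y \<in> ball x (infdist x (- \<Omega>) / 2)" for x y
    proof -
      define R where "R = infdist x (- \<Omega>) / 2"
      obtain z where z: "z \<in> frontier \<Omega>" "norm (x - z) = 2 * R" and b: "ball x (2 * R) \<subseteq> \<Omega>" and R: "0 < R"
      proof (rule nearest_boundary_point[OF \<Omega> x])
        fix z assume "z \<in> frontier \<Omega>" "norm (x - z) = infdist x (- \<Omega>)" "ball x (infdist x (- \<Omega>)) \<subseteq> \<Omega>" "0 < infdist x (- \<Omega>)"
        then show thesis by (intro that) (auto simp: R_def)
      qed
      have sb: "ball x R \<subseteq> \<Omega>" using b R subset_ball[of R "2 * R" x] by auto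
      have gr: "\<bar>u y - u z\<bar> \<le> 2 * C0 * (norm (y - z) + R) powr \<alpha>" for y
      proof -
        have "norm (y - z) powr \<alpha> \<le> (norm (y - z) + R) powr \<alpha>" using R \<alpha> by (intro powr_mono2) auto
        then have "2 * C0 * norm (y - z) powr \<alpha> \<le> 2 * C0 * (norm (y - z) + R) powr \<alpha>" using C0 by (intro mult_left_mono) auto
        then show ?thesis using bd[OF z(1), of y] by linarith
      qed
      have "ball x R \<subseteq> closure \<Omega>" using sb closure_subset by (rule order_trans)
      then have c: "continuous_on (ball x R) u" by (rule continuous_on_subset[OF cont])
      have yR: "y \<in> ball x R" using y by (simp add: R_def)
      show ?thesis
        by (rule inter[OF K \<alpha>(1) \<alpha>1(2) \<alpha>(3) R C0 sub[THEN nonlocal_subsolution_mono, OF sb] c meas eq_refl[OF z(2)] gr yR])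
    qed
    with bd show "(\<forall>y. \<forall>z\<in>frontier \<Omega>. \<bar>u y - u z\<bar> \<le> 2 * C0 * norm (y - z) powr \<alpha>) \<and>
          (\<forall>x\<in>\<Omega>. \<forall>y\<in>ball x (infdist x (- \<Omega>) / 2). \<bar>u y - u x\<bar> \<le> 32 * C0 * norm (y - x) powr \<alpha>)"
      by (intro conjI allI ballI)
  qed
qed

section \<open>A smooth bump function\<close>

text \<open>The functions \<open>t powr (- j) * exp (- 1 / t)\<close>, extended by 0. Their derivatives are linear combinations
of functions of the same kind, which makes smoothness at 0 a finite computation.\<close>
definition exp_flat :: "nat \<Rightarrow> real \<Rightarrow> real" where
  "exp_flat j t = (if 0 < t then (1 / t) ^ j * exp (- (1 / t)) else 0)"

lemma exp_flat_tendsto_0: "(exp_flat j \<longlongrightarrow> 0) (at_right 0)"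
proof -
  have "((\<lambda>t. (inverse t) ^ j / exp (inverse t :: real)) \<longlongrightarrow> 0) (at_right 0)"
    by (rule filterlim_compose[OF tendsto_power_div_exp_0 filterlim_inverse_at_top_right])
  then show ?thesis
    by (rule Lim_transform_eventually)
       (auto simp: exp_flat_def eventually_at_right_less exp_minus field_simps
         intro!: eventually_mono[OF eventually_at_right_less[of 0]])
qed

lemma exp_flat_deriv:
  "(exp_flat j has_real_derivative (exp_flat (j + 2) t - real j * exp_flat (j + 1) t)) (at t)"
proof -
  consider "t < 0" | "t = 0" | "0 < t" by linarith
  then show ?thesis
  proof cases
    case 1
    have "((\<lambda>_. 0) has_real_derivative 0) (at t)" by simp
    then have "(exp_flat j has_real_derivative 0) (at t)"
      by (rule has_field_derivative_transform_within_open[of _ _ _ "{..<0}"]) (use 1 in \<open>auto simp: exp_flat_def\<close>)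
    then show ?thesis using 1 by (simp add: exp_flat_def)
  next
    case 2
    have r: "((\<lambda>h. exp_flat j h / h) \<longlongrightarrow> 0) (at_right 0)"
      by (rule Lim_transform_eventually[OF exp_flat_tendsto_0[of "Suc j"]])
         (auto simp: exp_flat_def intro!: eventually_mono[OF eventually_at_right_less[of 0]])
    have l: "((\<lambda>h. exp_flat j h / h) \<longlongrightarrow> 0) (at_left 0)"
    proof (rule Lim_transform_eventually[of "\<lambda>_. 0"])
      show "\<forall>\<^sub>F h in at_left 0. 0 = exp_flat j h / h"
        using eventually_at_left_real[of "- 1" "0::real"] by (auto simp: exp_flat_def elim!: eventually_mono)
    qed simp
    have "((\<lambda>h. (exp_flat j (0 + h) - exp_flat j 0) / h) \<longlongrightarrow> 0) (at 0)"
      using l r by (simp add: filterlim_split_at exp_flat_def[of _ 0])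
    then show ?thesis unfolding 2 by (simp add: DERIV_def exp_flat_def[of _ 0])
  next
    case 3
    define x where "x = 1 / t"
    have dx: "((\<lambda>t. 1 / t) has_real_derivative - (x\<^sup>2)) (at t)"
      using 3 by (auto intro!: derivative_eq_intros simp: x_def power2_eq_square)
    have "((\<lambda>x. x ^ j * exp (- x)) has_real_derivative (real j * x ^ (j - 1) - x ^ j) * exp (- x)) (at x)"
      by (auto intro!: derivative_eq_intros simp: algebra_simps)
    then have "((\<lambda>t. (1 / t) ^ j * exp (- (1 / t))) has_real_derivative
       (real j * x ^ (j - 1) - x ^ j) * exp (- x) * - (x\<^sup>2)) (at t)"
      unfolding x_def by (rule DERIV_chain2[OF _ dx[unfolded x_def]])
    also have "(real j * x ^ (j - 1) - x ^ j) * exp (- x) * - (x\<^sup>2) = exp_flat (j + 2) t - real j * exp_flat (j + 1) t"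
      using 3 by (cases j) (simp_all add: exp_flat_def x_def[symmetric] power2_eq_square algebra_simps)
    finally have "((\<lambda>t. (1 / t) ^ j * exp (- (1 / t))) has_real_derivative
       (exp_flat (j + 2) t - real j * exp_flat (j + 1) t)) (at t)" .
    then show ?thesis
      by (rule has_field_derivative_transform_within_open[of _ _ _ "{0<..}"]) (use 3 in \<open>auto simp: exp_flat_def\<close>)
  qed
qed

text \<open>A class of functions containing the bump function and closed under partial derivatives. Smoothness of all its members
is then a single induction over the order of differentiation.\<close>
inductive bump_class :: "'a::euclidean_space \<Rightarrow> real \<Rightarrow> ('a \<Rightarrow> real) \<Rightarrow> bool" for a \<delta> where
  base: "bump_class a \<delta> (\<lambda>x. exp_flat j (\<delta>\<^sup>2 - (norm (x - a))\<^sup>2))"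
| add: "bump_class a \<delta> f \<Longrightarrow> bump_class a \<delta> g \<Longrightarrow> bump_class a \<delta> (\<lambda>x. f x + g x)"
| mult: "bump_class a \<delta> f \<Longrightarrow> bump_class a \<delta> (\<lambda>x. (c * ((x - a) \<bullet> v) + d) * f x)"

lemma bump_class_gradient:
  assumes "bump_class a \<delta> f"
  shows "\<exists>D. (\<forall>x. (f has_derivative (\<lambda>h. D x \<bullet> h)) (at x)) \<and> (\<forall>b. bump_class a \<delta> (\<lambda>x. D x \<bullet> b))"
  using assms
proof induction
  case (base j)
  define t where "t = (\<lambda>x. \<delta>\<^sup>2 - (norm (x - a))\<^sup>2)"
  define D where "D = (\<lambda>x. (exp_flat (j + 2) (t x) - real j * exp_flat (j + 1) (t x)) *\<^sub>R ((- 2) *\<^sub>R (x - a)))"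
  have td: "(t has_derivative (\<lambda>h. ((- 2) *\<^sub>R (x - a)) \<bullet> h)) (at x)" for x
    unfolding t_def power2_norm_eq_inner
    by (auto intro!: derivative_eq_intros simp: inner_simps inner_commute algebra_simps)
  have "((\<lambda>x. exp_flat j (t x)) has_derivative (\<lambda>h. D x \<bullet> h)) (at x)" for x
    using has_derivative_compose[OF td exp_flat_deriv[unfolded has_field_derivative_def, of j]]
    by (simp add: D_def inner_simps algebra_simps)
  moreover have "bump_class a \<delta> (\<lambda>x. D x \<bullet> b)" for b
  proof -
    have "(\<lambda>x. D x \<bullet> b) = (\<lambda>x. ((- 2) * ((x - a) \<bullet> b) + 0) * exp_flat (j + 2) (\<delta>\<^sup>2 - (norm (x - a))\<^sup>2)
        + ((2 * real j) * ((x - a) \<bullet> b) + 0) * exp_flat (j + 1) (\<delta>\<^sup>2 - (norm (x - a))\<^sup>2))"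
      unfolding D_def inner_scaleR_left t_def by (auto simp: algebra_simps)
    show ?thesis unfolding \<open>(\<lambda>x. D x \<bullet> b) = _\<close> by (intro bump_class.add bump_class.mult bump_class.base)
  qed
  ultimately show ?case unfolding t_def by blast
next
  case (add f g)
  then obtain D E where D: "\<forall>x. (f has_derivative (\<lambda>h. D x \<bullet> h)) (at x)" "\<forall>b. bump_class a \<delta> (\<lambda>x. D x \<bullet> b)"
    and E: "\<forall>x. (g has_derivative (\<lambda>h. E x \<bullet> h)) (at x)" "\<forall>b. bump_class a \<delta> (\<lambda>x. E x \<bullet> b)" by blast
  have "((\<lambda>x. f x + g x) has_derivative (\<lambda>h. (D x + E x) \<bullet> h)) (at x)" for x
    unfolding inner_add_left using D(1) E(1) by (intro has_derivative_add) auto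
  moreover have "bump_class a \<delta> (\<lambda>x. (D x + E x) \<bullet> b)" for b
    unfolding inner_add_left using D(2) E(2) by (intro bump_class.add) auto
  ultimately show ?case by (intro exI[of _ "\<lambda>x. D x + E x"]) blast
next
  case (mult f c v d)
  then obtain D where D: "\<forall>x. (f has_derivative (\<lambda>h. D x \<bullet> h)) (at x)" "\<forall>b. bump_class a \<delta> (\<lambda>x. D x \<bullet> b)" by blast
  define E where "E = (\<lambda>x. (c * ((x - a) \<bullet> v) + d) *\<^sub>R D x + (c * f x) *\<^sub>R v)"
  have "((\<lambda>x. (c * ((x - a) \<bullet> v) + d) * f x) has_derivative (\<lambda>h. E x \<bullet> h)) (at x)" for x
    unfolding E_def using D(1)[rule_format, of x]
    by (auto intro!: derivative_eq_intros simp: inner_simps inner_commute algebra_simps)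
  moreover have "bump_class a \<delta> (\<lambda>x. E x \<bullet> b)" for b
  proof -
    have "(\<lambda>x. E x \<bullet> b) = (\<lambda>x. (c * ((x - a) \<bullet> v) + d) * (D x \<bullet> b) + (0 * ((x - a) \<bullet> v) + c * (v \<bullet> b)) * f x)"
      unfolding E_def by (auto simp: inner_simps algebra_simps)
    show ?thesis unfolding \<open>(\<lambda>x. E x \<bullet> b) = _\<close>
      using D(2) mult(1) by (intro bump_class.add[OF bump_class.mult bump_class.mult]) auto
  qed
  ultimately show ?case by blast
qed

lemma bump_class_continuous:
  assumes "bump_class a \<delta> f"
  shows "continuous_on S f"
  using bump_class_gradient[OF assms] by (auto intro!: continuous_at_imp_continuous_on dest: has_derivative_continuous)

lemma bump_class_Ck: "bump_class a \<delta> f \<Longrightarrow> Ck_closure k UNIV f"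
proof (induction k arbitrary: f)
  case 0
  then show ?case using bump_class_continuous by simp
next
  case (Suc k)
  then show ?case using bump_class_gradient[OF Suc.prems] bump_class_continuous[OF Suc.prems] by auto
qed

lemma bump_class_zero:
  assumes "bump_class a \<delta> f" "0 \<le> \<delta>" "\<delta> \<le> norm (x - a)"
  shows "f x = 0"
  using assms(1)
proof induction
  case (base j)
  have "\<delta>\<^sup>2 \<le> (norm (x - a))\<^sup>2" using assms by (intro power_mono) auto
  then show ?case by (simp add: exp_flat_def)
qed auto

lemma bump_class_bounded:
  assumes "bump_class a \<delta> f" "0 \<le> \<delta>"
  obtains B where "0 \<le> B" "\<And>x. \<bar>f x\<bar> \<le> B"
proof -
  have "bounded (f ` cball a \<delta>)"
    by (intro compact_imp_bounded compact_continuous_image bump_class_continuous[OF assms(1)] compact_cball)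
  then have "\<exists>B. \<forall>x\<in>cball a \<delta>. \<bar>f x\<bar> \<le> B" unfolding bounded_iff by simp
  then obtain B where B: "\<And>x. x \<in> cball a \<delta> \<Longrightarrow> \<bar>f x\<bar> \<le> B" by blast
  show thesis
  proof (rule that[of "max B 0"])
    fix x show "\<bar>f x\<bar> \<le> max B 0"
      using B[of x] bump_class_zero[OF assms, of x] by (cases "x \<in> cball a \<delta>") (auto simp: dist_norm norm_minus_commute)
  qed simp
qed

lemma bump_class_lipschitz:
  assumes "bump_class a \<delta> f" "0 \<le> \<delta>"
  obtains L where "0 \<le> L" "\<And>x y. \<bar>f x - f y\<bar> \<le> L * norm (x - y)"
proof -
  obtain D where D: "\<forall>x. (f has_derivative (\<lambda>h. D x \<bullet> h)) (at x)" "\<forall>b. bump_class a \<delta> (\<lambda>x. D x \<bullet> b)"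
    using bump_class_gradient[OF assms(1)] by blast
  have "\<exists>B. \<forall>x. \<bar>D x \<bullet> b\<bar> \<le> B" for b using bump_class_bounded[OF D(2)[rule_format, of b] assms(2)] by blast
  then have "\<forall>b. \<exists>B. \<forall>x. \<bar>D x \<bullet> b\<bar> \<le> B" by blast
  from choice[OF this] obtain B where B: "\<And>x b. \<bar>D x \<bullet> b\<bar> \<le> B b" by blast
  define L where "L = (\<Sum>b\<in>Basis. B b)"
  have DL: "norm (D x) \<le> L" for x
    unfolding L_def using B by (intro order_trans[OF norm_le_l1] sum_mono)
  show thesis
  proof (rule that[of L])
    show "0 \<le> L" using DL[of undefined] norm_ge_zero by (rule order_trans[rotated])
    fix x y
    have "norm (f x - f y) \<le> L * norm (x - y)"
    proof (rule differentiable_bound[of UNIV f "\<lambda>x h. D x \<bullet> h"])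
      fix x
      show "onorm ((\<bullet>) (D x)) \<le> L"
      proof (rule onorm_le)
        fix h
        have "norm (D x \<bullet> h) \<le> norm (D x) * norm h" by (rule Cauchy_Schwarz_ineq2[folded real_norm_def])
        also have "\<dots> \<le> L * norm h" using DL by (intro mult_right_mono) auto
        finally show "norm (D x \<bullet> h) \<le> L * norm h" .
      qed
    qed (use D in \<open>auto intro: has_derivative_at_withinI\<close>)
    then show "\<bar>f x - f y\<bar> \<le> L * norm (x - y)" by simp
  qed
qed

text \<open>Second differences are controlled by applying the Lipschitz bound to the first derivatives, which are again in the class.\<close>
lemma bump_class_second_difference:
  assumes "bump_class a \<delta> f" "0 \<le> \<delta>"
  obtains L where "0 \<le> L" "\<And>x y. \<bar>f (x + y) + f (x - y) - 2 * f x\<bar> \<le> L * (norm y)\<^sup>2"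
proof -
  obtain D where D: "\<forall>x. (f has_derivative (\<lambda>h. D x \<bullet> h)) (at x)" "\<forall>b. bump_class a \<delta> (\<lambda>x. D x \<bullet> b)"
    using bump_class_gradient[OF assms(1)] by blast
  have "\<exists>B. \<forall>x y. \<bar>D x \<bullet> b - D y \<bullet> b\<bar> \<le> B * norm (x - y)" for b
    using bump_class_lipschitz[OF D(2)[rule_format, of b] assms(2)] by blast
  then have "\<forall>b. \<exists>B. \<forall>x y. \<bar>D x \<bullet> b - D y \<bullet> b\<bar> \<le> B * norm (x - y)" by blast
  from choice[OF this] obtain B where B: "\<And>x y b. \<bar>D x \<bullet> b - D y \<bullet> b\<bar> \<le> B b * norm (x - y)" by blast
  define L where "L = \<bar>\<Sum>b\<in>Basis. B b\<bar>"
  have DL: "norm (D x - D y) \<le> L * norm (x - y)" for x y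
  proof -
    have "norm (D x - D y) \<le> (\<Sum>b\<in>Basis. \<bar>(D x - D y) \<bullet> b\<bar>)" by (rule norm_le_l1)
    also have "\<dots> \<le> (\<Sum>b\<in>Basis. B b * norm (x - y))" using B by (intro sum_mono) (simp add: inner_diff_left)
    also have "\<dots> = (\<Sum>b\<in>Basis. B b) * norm (x - y)" by (simp add: sum_distrib_right)
    also have "\<dots> \<le> L * norm (x - y)" unfolding L_def by (intro mult_right_mono) auto
    finally show ?thesis .
  qed
  show thesis
  proof (rule that[of L])
    show "0 \<le> L" by (simp add: L_def)
    fix x y
    define F where "F = (\<lambda>w. f (w + y) - f w)"
    have "norm (F x - F (x - y)) \<le> (L * norm y) * norm (x - (x - y))"
    proof (rule differentiable_bound[of UNIV F "\<lambda>w h. (D (w + y) - D w) \<bullet> h"])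
      fix w
      have "((\<lambda>w. f (w + y)) has_derivative (\<lambda>h. D (w + y) \<bullet> h)) (at w)"
      proof -
        have "((\<lambda>w. w + y) has_derivative (\<lambda>h. h)) (at w)" by (auto intro!: derivative_eq_intros)
        from has_derivative_compose[OF this D(1)[rule_format]] show ?thesis by simp
      qed
      then have "(F has_derivative (\<lambda>h. (D (w + y) - D w) \<bullet> h)) (at w)"
        unfolding F_def inner_diff_left using D(1) by (intro has_derivative_diff) auto
      then show "(F has_derivative (\<lambda>h. (D (w + y) - D w) \<bullet> h)) (at w within UNIV)" by simp
      show "onorm ((\<bullet>) (D (w + y) - D w)) \<le> L * norm y"
      proof (rule onorm_le)
        fix h
        have "norm ((D (w + y) - D w) \<bullet> h) \<le> norm (D (w + y) - D w) * norm h" by (rule Cauchy_Schwarz_ineq2[folded real_norm_def])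
        also have "\<dots> \<le> (L * norm y) * norm h" using DL[of "w + y" w] by (intro mult_right_mono) auto
        finally show "norm ((D (w + y) - D w) \<bullet> h) \<le> L * norm y * norm h" .
      qed
    qed auto
    then show "\<bar>f (x + y) + f (x - y) - 2 * f x\<bar> \<le> L * (norm y)\<^sup>2"
      by (simp add: F_def power2_eq_square algebra_simps)
  qed
qed

definition bump_mass :: "'a::euclidean_space itself \<Rightarrow> real \<Rightarrow> real" where
  "bump_mass _ \<delta> = (\<integral>x. exp_flat 0 (\<delta>\<^sup>2 - (norm (x::'a))\<^sup>2) \<partial>lborel)"

definition bump :: "real \<Rightarrow> 'a::euclidean_space \<Rightarrow> real" where
  "bump \<delta> x = exp_flat 0 (\<delta>\<^sup>2 - (norm x)\<^sup>2) / bump_mass TYPE('a) \<delta>"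

lemma bump_raw_class: "bump_class 0 \<delta> (\<lambda>x. exp_flat 0 (\<delta>\<^sup>2 - (norm x)\<^sup>2))"
  using bump_class.base[of 0 \<delta> 0] by simp

lemma bump_translate_class: "bump_class a \<delta> (\<lambda>x. bump \<delta> (x - a))"
  using bump_class.mult[OF bump_class.base[of a \<delta> 0], of 0 0 "1 / bump_mass TYPE('a::euclidean_space) \<delta>"]
  by (simp add: bump_def)

lemma bump_in_class: "bump_class 0 \<delta> (bump \<delta>)"
  using bump_translate_class[of 0 \<delta>] by simp

lemma bump_class_borel: "bump_class a \<delta> f \<Longrightarrow> f \<in> borel_measurable borel"
  by (intro borel_measurable_continuous_onI bump_class_continuous)

lemma bump_class_integrable:
  assumes "bump_class a \<delta> f" "0 \<le> \<delta>"
  shows "integrable lborel f"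
proof -
  obtain B where B: "0 \<le> B" "\<And>x. \<bar>f x\<bar> \<le> B" using bump_class_bounded[OF assms] by blast
  show ?thesis
  proof (rule Bochner_Integration.integrable_bound)
    show "integrable lborel (\<lambda>x. B * indicator (cball a \<delta>) x :: real)"
      using emeasure_bounded_finite[OF bounded_cball[of a \<delta>]]
      by (intro integrable_mult_right integrable_real_indicator) simp_all
    show "AE x in lborel. norm (f x) \<le> norm (B * indicator (cball a \<delta>) x)"
      using B bump_class_zero[OF assms]
      by (intro AE_I2) (auto split: split_indicator simp: dist_norm norm_minus_commute not_le)
  qed (use bump_class_borel[OF assms(1)] in simp)
qed

lemma bump_mass_pos:
  assumes "0 < \<delta>"
  shows "0 < bump_mass TYPE('a::euclidean_space) \<delta>"
proof -
  let ?f = "\<lambda>x::'a. exp_flat 0 (\<delta>\<^sup>2 - (norm x)\<^sup>2)"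
  have i: "integrable lborel ?f" using bump_class_integrable[OF bump_raw_class[where 'a='a]] assms by simp
  have nn: "0 \<le> ?f x" for x by (simp add: exp_flat_def)
  have "0 \<le> bump_mass TYPE('a) \<delta>" unfolding bump_mass_def using nn by (intro integral_nonneg_AE) auto
  moreover have "bump_mass TYPE('a) \<delta> \<noteq> 0"
  proof
    assume "bump_mass TYPE('a) \<delta> = 0"
    then have "AE x in lborel. ?f x = 0"
      using integral_nonneg_eq_0_iff_AE[OF i] nn by (simp add: bump_mass_def)
    then have "AE x in lborel. x \<notin> ball (0::'a) \<delta>"
    proof eventually_elim
      case (elim x)
      show ?case
      proof
        assume "x \<in> ball 0 \<delta>"
        then have "(norm x)\<^sup>2 < \<delta>\<^sup>2" using assms by (intro power_strict_mono) auto
        then show False using elim by (simp add: exp_flat_def)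
      qed
    qed
    then have "emeasure lborel (ball (0::'a) \<delta>) = 0"
      by (subst (asm) AE_iff_measurable[of "ball 0 \<delta>"]) auto
    then show False using assms unit_ball_vol_pos[of "real DIM('a)"] by (simp add: emeasure_ball)
  qed
  ultimately show ?thesis by simp
qed

lemma bump_nonneg: "0 < \<delta> \<Longrightarrow> 0 \<le> bump \<delta> x"
  unfolding bump_def using bump_mass_pos by (intro divide_nonneg_pos) (auto simp: exp_flat_def)

lemma bump_minus [simp]: "bump \<delta> (- x) = bump \<delta> x"
  by (simp add: bump_def)

lemma bump_minus_commute: "bump \<delta> (x - y) = bump \<delta> (y - x)"
  by (simp add: bump_def norm_minus_commute)

lemma bump_zero: "0 \<le> \<delta> \<Longrightarrow> \<delta> \<le> norm x \<Longrightarrow> bump \<delta> x = 0"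
  using bump_class_zero[OF bump_in_class, of \<delta> x] by simp

lemma bump_measurable [measurable]: "bump \<delta> \<in> borel_measurable borel"
  by (rule bump_class_borel[OF bump_in_class])

lemma bump_integrable: "0 < \<delta> \<Longrightarrow> integrable lborel (bump \<delta>)"
  by (rule bump_class_integrable[OF bump_in_class]) simp

lemma bump_integral:
  assumes "0 < \<delta>"
  shows "(\<integral>x. bump \<delta> (x::'a::euclidean_space) \<partial>lborel) = 1"
proof -
  have "(\<integral>x. bump \<delta> (x::'a) \<partial>lborel) = (\<integral>x. exp_flat 0 (\<delta>\<^sup>2 - (norm (x::'a))\<^sup>2) \<partial>lborel) / bump_mass TYPE('a) \<delta>"
    by (simp add: bump_def)
  moreover have "bump_mass TYPE('a) \<delta> = (\<integral>x. exp_flat 0 (\<delta>\<^sup>2 - (norm (x::'a))\<^sup>2) \<partial>lborel)"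
    by (simp add: bump_mass_def)
  ultimately show ?thesis using bump_mass_pos[OF assms, where 'a='a] by simp
qed

lemma bump_test_function:
  assumes "0 < \<delta>" "cball a \<delta> \<subseteq> \<Omega>"
  shows "(\<lambda>x. bump \<delta> (x - a)) \<in> test_functions \<Omega>"
proof -
  have "{x. bump \<delta> (x - a) \<noteq> 0} \<subseteq> cball a \<delta>"
    using bump_zero[of \<delta> "_ - a"] assms(1) by (force simp: dist_norm norm_minus_commute)
  then have c: "closure {x. bump \<delta> (x - a) \<noteq> 0} \<subseteq> cball a \<delta>"
    by (rule closure_minimal) simp
  then have "bounded (closure {x. bump \<delta> (x - a) \<noteq> 0})" using bounded_cball bounded_subset by blast
  then have "compact (closure {x. bump \<delta> (x - a) \<noteq> 0})" by (simp add: compact_eq_bounded_closed)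
  then show ?thesis using c assms(2) bump_class_Ck[OF bump_translate_class] by (auto simp: test_functions_def)
qed

section \<open>Mollification\<close>

lemma lborel_distr_translate: "distr lborel borel (\<lambda>x. t + x) = (lborel :: 'a::euclidean_space measure)"
  using lborel_distr_plus[of t] .

lemma lborel_distr_reflect: "distr lborel borel (\<lambda>x. t - x) = (lborel :: 'a::euclidean_space measure)"
  using lborel_affine[of "- 1" t] by (simp add: density_1)

lemma nn_integral_translate:
  fixes f :: "'a::euclidean_space \<Rightarrow> ennreal"
  assumes "f \<in> borel_measurable borel"
  shows "(\<integral>\<^sup>+x. f (t + x) \<partial>lborel) = (\<integral>\<^sup>+x. f x \<partial>lborel)"
  by (subst (2) lborel_distr_translate[of t, symmetric]) (simp add: nn_integral_distr assms)

lemma nn_integral_reflect: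
  fixes f :: "'a::euclidean_space \<Rightarrow> ennreal"
  assumes "f \<in> borel_measurable borel"
  shows "(\<integral>\<^sup>+x. f (t - x) \<partial>lborel) = (\<integral>\<^sup>+x. f x \<partial>lborel)"
  by (subst (2) lborel_distr_reflect[of t, symmetric]) (simp add: nn_integral_distr assms)

lemma integral_translate:
  fixes f :: "'a::euclidean_space \<Rightarrow> real"
  assumes "f \<in> borel_measurable borel"
  shows "(\<integral>x. f (t + x) \<partial>lborel) = (\<integral>x. f x \<partial>lborel)"
  by (subst (2) lborel_distr_translate[of t, symmetric]) (simp add: integral_distr assms)

lemma integral_reflect:
  fixes f :: "'a::euclidean_space \<Rightarrow> real"
  assumes "f \<in> borel_measurable borel"
  shows "(\<integral>x. f (t - x) \<partial>lborel) = (\<integral>x. f x \<partial>lborel)"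
  by (subst (2) lborel_distr_reflect[of t, symmetric]) (simp add: integral_distr assms)

lemma integrable_translate:
  fixes f :: "'a::euclidean_space \<Rightarrow> real"
  assumes "integrable lborel f"
  shows "integrable lborel (\<lambda>x. f (t + x))"
proof -
  have "integrable (distr lborel borel (\<lambda>x. t + x)) f" using assms by (simp add: lborel_distr_translate)
  then show ?thesis using borel_measurable_integrable[OF assms] by (subst (asm) integrable_distr_eq) auto
qed

lemma integrable_reflect:
  fixes f :: "'a::euclidean_space \<Rightarrow> real"
  assumes "integrable lborel f"
  shows "integrable lborel (\<lambda>x. f (t - x))"
proof -
  have "integrable (distr lborel borel (\<lambda>x. t - x)) f" using assms by (simp add: lborel_distr_reflect)
  then show ?thesis using borel_measurable_integrable[OF assms] by (subst (asm) integrable_distr_eq) auto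
qed

lemma AE_lborel_reflect:
  fixes P :: "'a::euclidean_space \<Rightarrow> bool"
  assumes "AE x in lborel. P x"
  shows "AE x in lborel. P (t - x)"
proof -
  obtain N where N: "{x. \<not> P x} \<subseteq> N" "N \<in> sets borel" "emeasure lborel N = 0"
    using assms by (auto elim!: AE_E)
  have "AE x in distr lborel borel (\<lambda>x. t - x). x \<notin> N"
    using N by (intro AE_not_in) (auto simp: null_sets_def lborel_distr_reflect)
  then have "AE x in lborel. t - x \<notin> N" using N by (subst (asm) AE_distr_iff) auto
  then show ?thesis using N(1) by (auto elim!: eventually_mono)
qed

lemma integrable_pair_mult:
  fixes a b :: "'a::euclidean_space \<Rightarrow> real"
  assumes a: "integrable lborel a" and b: "integrable lborel b"
  shows "integrable (lborel \<Otimes>\<^sub>M lborel) (\<lambda>(x, y). a x * b y)"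
proof (rule lborel_pair.Fubini_integrable)
  have [measurable]: "a \<in> borel_measurable borel" "b \<in> borel_measurable borel"
    using assms by (auto dest: borel_measurable_integrable)
  show "(\<lambda>(x, y). a x * b y) \<in> borel_measurable (lborel \<Otimes>\<^sub>M lborel)" by measurable
  show "integrable lborel (\<lambda>x. \<integral>y. norm (case (x, y) of (x, y) \<Rightarrow> a x * b y) \<partial>lborel)"
    using a b by (simp add: abs_mult)
qed (use b in simp)

definition locally_integrable :: "('a::euclidean_space \<Rightarrow> real) \<Rightarrow> bool" where
  "locally_integrable u \<longleftrightarrow> u \<in> borel_measurable borel \<and>
     (\<forall>R. integrable lborel (\<lambda>x. indicator (cball 0 R) x * u x))"

lemma locally_integrable_mult:
  fixes u g :: "'a::euclidean_space \<Rightarrow> real"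
  assumes u: "locally_integrable u" and g: "g \<in> borel_measurable borel" "\<And>w. \<bar>g w\<bar> \<le> B" "\<And>w. R < norm w \<Longrightarrow> g w = 0"
  shows "integrable lborel (\<lambda>w. g w * u w)"
proof (rule Bochner_Integration.integrable_bound)
  show "integrable lborel (\<lambda>w. B * (indicator (cball 0 R) w * u w))"
    using u by (simp add: locally_integrable_def)
  have "0 \<le> B" using g(2)[of undefined] by linarith
  then show "AE w in lborel. norm (g w * u w) \<le> norm (B * (indicator (cball 0 R) w * u w))"
    using g(2,3) by (intro AE_I2) (auto simp: abs_mult mult_right_mono not_le split: split_indicator)
qed (use u g in \<open>auto simp: locally_integrable_def\<close>)

lemma locally_integrable_diff:
  assumes "locally_integrable u" "locally_integrable v"
  shows "locally_integrable (\<lambda>x. u x - v x)"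
  using assms by (auto simp: locally_integrable_def right_diff_distrib)

lemma locally_integrable_uminus:
  assumes "locally_integrable u"
  shows "locally_integrable (\<lambda>x. - u x)"
  using assms by (auto simp: locally_integrable_def)

lemma locally_integrable_continuous:
  assumes "continuous_on UNIV u"
  shows "locally_integrable u"
  unfolding locally_integrable_def
proof (intro conjI allI)
  show "u \<in> borel_measurable borel" by (rule borel_measurable_continuous_onI[OF assms])
  fix R
  have "integrable lborel (\<lambda>x. indicator (cball 0 R) x *\<^sub>R u x)"
    by (intro borel_integrable_compact[unfolded set_integrable_def] continuous_on_subset[OF assms]) auto
  then show "integrable lborel (\<lambda>x. indicator (cball 0 R) x * u x)" by simp
qed

definition mollify :: "real \<Rightarrow> ('a::euclidean_space \<Rightarrow> real) \<Rightarrow> 'a \<Rightarrow> real" where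
  "mollify \<delta> u x = (\<integral>w. bump \<delta> (x - w) * u w \<partial>lborel)"

lemma bump_bounded:
  assumes "0 < \<delta>"
  obtains B where "0 \<le> B" "\<And>x::'a::euclidean_space. \<bar>bump \<delta> x\<bar> \<le> B"
  using bump_class_bounded[OF bump_in_class less_imp_le[OF assms], where 'a='a] by blast

lemma bump_shift_zero: "0 < \<delta> \<Longrightarrow> norm x + \<delta> < norm w \<Longrightarrow> bump \<delta> (x - w) = 0"
  using norm_triangle_ineq2[of w x] by (intro bump_zero) (auto simp: norm_minus_commute)

lemma bump_shift_measurable: "(\<lambda>w. bump \<delta> (x - w)) \<in> borel_measurable borel"
  by measurable

lemma mollify_integrable:
  fixes u :: "'a::euclidean_space \<Rightarrow> real"
  assumes "0 < \<delta>" "locally_integrable u"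
  shows "integrable lborel (\<lambda>w. bump \<delta> (x - w) * u w)"
proof -
  obtain B where "\<And>x::'a. \<bar>bump \<delta> x\<bar> \<le> B" using bump_bounded[OF assms(1), where 'a='a] by metis
  then show ?thesis using bump_shift_zero[OF assms(1)]
    by (intro locally_integrable_mult[OF assms(2) bump_shift_measurable, where B=B and R="norm x + \<delta>"]) auto
qed

lemma bump_shift_integrable: "0 < \<delta> \<Longrightarrow> integrable lborel (\<lambda>w. bump \<delta> (x - w))"
  using integrable_reflect[OF bump_integrable] .

lemma bump_shift_integral: "0 < \<delta> \<Longrightarrow> (\<integral>w. bump \<delta> (x - w) \<partial>lborel) = 1"
  using integral_reflect[of "bump \<delta>" x] bump_integral by simp

lemma mollify_diff:
  assumes "0 < \<delta>" "locally_integrable u" "locally_integrable v"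
  shows "mollify \<delta> (\<lambda>x. u x - v x) x = mollify \<delta> u x - mollify \<delta> v x"
  unfolding mollify_def right_diff_distrib
  using mollify_integrable[OF assms(1)] assms by (intro Bochner_Integration.integral_diff) auto

lemma mollify_uminus: "mollify \<delta> (\<lambda>x. - u x) x = - mollify \<delta> u x"
  unfolding mollify_def by simp

lemma mollify_mono_AE:
  assumes "0 < \<delta>" "locally_integrable u" "locally_integrable v" "AE x in lborel. u x \<le> v x"
  shows "mollify \<delta> u x \<le> mollify \<delta> v x"
  unfolding mollify_def
  using assms(4) bump_nonneg[OF assms(1)]
  by (intro integral_mono_AE mollify_integrable assms) (auto elim!: eventually_mono intro: mult_left_mono)

lemma mollify_le:
  assumes "0 < \<delta>" "locally_integrable u" "AE w in lborel. norm (w - x) < \<delta> \<longrightarrow> u w \<le> c"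
  shows "mollify \<delta> u x \<le> c"
proof -
  have "mollify \<delta> u x \<le> (\<integral>w. bump \<delta> (x - w) * c \<partial>lborel)"
    unfolding mollify_def
  proof (rule integral_mono_AE[OF mollify_integrable[OF assms(1,2)]])
    show "integrable lborel (\<lambda>w. bump \<delta> (x - w) * c)" using bump_shift_integrable[OF assms(1), of x] by simp
    show "AE w in lborel. bump \<delta> (x - w) * u w \<le> bump \<delta> (x - w) * c"
      using assms(3)
    proof eventually_elim
      case (elim w)
      then show ?case
        using bump_nonneg[OF assms(1), of "x - w"] bump_zero[of \<delta> "x - w"] assms(1)
        by (cases "norm (w - x) < \<delta>") (auto intro: mult_left_mono simp: norm_minus_commute)
    qed
  qed
  also have "\<dots> = c" using bump_shift_integral[OF assms(1), of x] by simp
  finally show ?thesis .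
qed

lemma mollify_abs_diff_le:
  assumes "0 < \<delta>" "locally_integrable u" "AE w in lborel. norm (w - x) < \<delta> \<longrightarrow> \<bar>u w - a\<bar> \<le> c"
  shows "\<bar>mollify \<delta> u x - a\<bar> \<le> c"
proof -
  have "mollify \<delta> u x \<le> a + c" using assms(3) by (intro mollify_le assms) (auto elim!: eventually_mono)
  moreover have "mollify \<delta> (\<lambda>x. - u x) x \<le> - a + c"
    using assms(3) by (intro mollify_le locally_integrable_uminus assms) (auto elim!: eventually_mono)
  ultimately show ?thesis unfolding mollify_uminus by linarith
qed

text \<open>A uniformly small, compactly supported factor makes a pairing with \<open>u\<close> small.\<close>
lemma mollify_difference_bound:
  fixes u :: "'a::euclidean_space \<Rightarrow> real"
  assumes \<delta>: "0 < \<delta>" and u: "locally_integrable u" and f: "f \<in> borel_measurable borel"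
    and f0: "\<And>w. R < norm w \<Longrightarrow> f w = 0" and fB: "\<And>w. \<bar>f w\<bar> \<le> B"
  shows "\<bar>\<integral>w. f w * u w \<partial>lborel\<bar> \<le> B * (\<integral>w. indicator (cball 0 R) w * \<bar>u w\<bar> \<partial>lborel)"
proof -
  have B: "0 \<le> B" using fB[of undefined] by linarith
  have i: "integrable lborel (\<lambda>w. indicator (cball 0 R) w * \<bar>u w\<bar>)"
  proof -
    have "integrable lborel (\<lambda>w. \<bar>indicator (cball 0 R) w * u w\<bar>)"
      using u by (intro integrable_abs) (simp add: locally_integrable_def)
    then show ?thesis by (simp add: abs_mult)
  qed
  have "\<bar>\<integral>w. f w * u w \<partial>lborel\<bar> \<le> (\<integral>w. \<bar>f w * u w\<bar> \<partial>lborel)" by (rule integral_abs_bound)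
  also have "\<dots> \<le> (\<integral>w. B * (indicator (cball 0 R) w * \<bar>u w\<bar>) \<partial>lborel)"
  proof (rule integral_mono)
    show "integrable lborel (\<lambda>w. \<bar>f w * u w\<bar>)"
      by (intro integrable_abs locally_integrable_mult[OF u f fB f0])
    show "integrable lborel (\<lambda>w. B * (indicator (cball 0 R) w * \<bar>u w\<bar>))" using i by simp
    fix w show "\<bar>f w * u w\<bar> \<le> B * (indicator (cball 0 R) w * \<bar>u w\<bar>)"
      using fB[of w] f0[of w] by (auto simp: abs_mult mult_right_mono not_le split: split_indicator)
  qed
  also have "\<dots> = B * (\<integral>w. indicator (cball 0 R) w * \<bar>u w\<bar> \<partial>lborel)" by simp
  finally show ?thesis .
qed

lemma mollify_continuous:
  fixes u :: "'a::euclidean_space \<Rightarrow> real"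
  assumes \<delta>: "0 < \<delta>" and u: "locally_integrable u"
  shows "continuous_on S (mollify \<delta> u)"
proof -
  obtain L where L: "0 \<le> L" "\<And>x y::'a. \<bar>bump \<delta> x - bump \<delta> y\<bar> \<le> L * norm (x - y)"
    using bump_class_lipschitz[OF bump_in_class, of \<delta>] \<delta> by (metis less_imp_le)
  have "isCont (mollify \<delta> u) a" for a
  proof -
    define R where "R = norm a + 1 + \<delta>"
    define M where "M = (\<integral>w. indicator (cball 0 R) w * \<bar>u w\<bar> \<partial>lborel)"
    have M: "0 \<le> M" unfolding M_def by (intro integral_nonneg_AE) (auto split: split_indicator)
    have "(L * M)-lipschitz_on (ball a 1) (mollify \<delta> u)"
    proof (rule lipschitz_onI)
      fix x y assume xy: "x \<in> ball a 1" "y \<in> ball a 1"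
      have n: "norm x < norm a + 1" "norm y < norm a + 1"
        using xy norm_triangle_ineq2[of x a] norm_triangle_ineq2[of y a] by (auto simp: dist_norm norm_minus_commute)
      have "mollify \<delta> u x - mollify \<delta> u y = (\<integral>w. (bump \<delta> (x - w) - bump \<delta> (y - w)) * u w \<partial>lborel)"
        unfolding mollify_def left_diff_distrib
        by (rule Bochner_Integration.integral_diff[symmetric]) (intro mollify_integrable \<delta> u)+
      also have "\<bar>\<dots>\<bar> \<le> (L * norm (x - y)) * M" unfolding M_def
      proof (rule mollify_difference_bound[OF \<delta> u])
        show "(\<lambda>w. bump \<delta> (x - w) - bump \<delta> (y - w)) \<in> borel_measurable borel" by measurable
        show "bump \<delta> (x - w) - bump \<delta> (y - w) = 0" if "R < norm w" for w
          using n that \<delta> by (simp add: bump_shift_zero R_def)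
        show "\<bar>bump \<delta> (x - w) - bump \<delta> (y - w)\<bar> \<le> L * norm (x - y)" for w using L(2)[of "x - w" "y - w"] by simp
      qed
      finally show "dist (mollify \<delta> u x) (mollify \<delta> u y) \<le> L * M * dist x y"
        by (simp add: dist_real_def dist_norm mult_ac)
    qed (use L M in simp)
    then have "continuous_on (ball a 1) (mollify \<delta> u)" by (rule lipschitz_on_continuous_on)
    then show ?thesis by (simp add: continuous_on_eq_continuous_at)
  qed
  then show ?thesis by (intro continuous_at_imp_continuous_on) auto
qed

lemma mollify_measurable [measurable]:
  "0 < \<delta> \<Longrightarrow> locally_integrable u \<Longrightarrow> mollify \<delta> u \<in> borel_measurable borel"
  by (intro borel_measurable_continuous_onI mollify_continuous)

text \<open>The second difference falls on the bump function, where it is quadratic.\<close>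
lemma mollify_second_difference:
  fixes u :: "'a::euclidean_space \<Rightarrow> real"
  assumes \<delta>: "0 < \<delta>" and u: "locally_integrable u"
  obtains C where "0 \<le> C" "\<And>x y. norm x \<le> R \<Longrightarrow> norm y \<le> 1 \<Longrightarrow>
     \<bar>mollify \<delta> u (x + y) + mollify \<delta> u (x - y) - 2 * mollify \<delta> u x\<bar> \<le> C * (norm y)\<^sup>2"
proof -
  obtain L where L: "0 \<le> L" "\<And>x y::'a. \<bar>bump \<delta> (x + y) + bump \<delta> (x - y) - 2 * bump \<delta> x\<bar> \<le> L * (norm y)\<^sup>2"
    using bump_class_second_difference[OF bump_in_class, of \<delta>] \<delta> by (metis less_imp_le)
  define M where "M = (\<integral>w. indicator (cball 0 (R + 1 + \<delta>)) w * \<bar>u w\<bar> \<partial>lborel)"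
  have M: "0 \<le> M" unfolding M_def by (intro integral_nonneg_AE) (auto split: split_indicator)
  show thesis
  proof (rule that[of "L * M"])
    show "0 \<le> L * M" using L M by simp
    fix x y :: 'a assume xy: "norm x \<le> R" "norm y \<le> 1"
    have n: "norm (x + y) \<le> R + 1" "norm (x - y) \<le> R + 1"
      using xy norm_triangle_ineq[of x y] norm_triangle_ineq4[of x y] by auto
    have "mollify \<delta> u (x + y) + mollify \<delta> u (x - y) - 2 * mollify \<delta> u x
        = (\<integral>w. (bump \<delta> (x + y - w) + bump \<delta> (x - y - w) - 2 * bump \<delta> (x - w)) * u w \<partial>lborel)"
      unfolding mollify_def left_diff_distrib distrib_right
      using mollify_integrable[OF \<delta> u] by (simp add: mult.assoc)
    also have "\<bar>\<dots>\<bar> \<le> (L * (norm y)\<^sup>2) * M" unfolding M_def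
    proof (rule mollify_difference_bound[OF \<delta> u])
      show "(\<lambda>w. bump \<delta> (x + y - w) + bump \<delta> (x - y - w) - 2 * bump \<delta> (x - w)) \<in> borel_measurable borel" by measurable
      show "bump \<delta> (x + y - w) + bump \<delta> (x - y - w) - 2 * bump \<delta> (x - w) = 0" if "R + 1 + \<delta> < norm w" for w
        using n xy that \<delta> by (simp add: bump_shift_zero)
      show "\<bar>bump \<delta> (x + y - w) + bump \<delta> (x - y - w) - 2 * bump \<delta> (x - w)\<bar> \<le> L * (norm y)\<^sup>2" for w
        using L(2)[of "x - w" y] by (simp add: algebra_simps)
    qed
    finally show "\<bar>mollify \<delta> u (x + y) + mollify \<delta> u (x - y) - 2 * mollify \<delta> u x\<bar> \<le> L * M * (norm y)\<^sup>2"
      by (simp add: mult_ac)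
  qed
qed

text \<open>Jensen's inequality for the probability density \<open>bump\<close>, obtained from the variance being nonnegative.\<close>
lemma mollify_square_le:
  fixes u :: "'a::euclidean_space \<Rightarrow> real"
  assumes \<delta>: "0 < \<delta>" and u: "locally_integrable u" and u2: "locally_integrable (\<lambda>x. (u x)\<^sup>2)"
  shows "(mollify \<delta> u x)\<^sup>2 \<le> mollify \<delta> (\<lambda>x. (u x)\<^sup>2) x"
proof -
  define m where "m = mollify \<delta> u x"
  have i: "integrable lborel (\<lambda>w. bump \<delta> (x - w) * (u w)\<^sup>2)" "integrable lborel (\<lambda>w. 2 * m * (bump \<delta> (x - w) * u w))"
    "integrable lborel (\<lambda>w. m\<^sup>2 * bump \<delta> (x - w))"
    using mollify_integrable[OF \<delta> u2] mollify_integrable[OF \<delta> u] bump_shift_integrable[OF \<delta>] by auto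
  have "0 \<le> (\<integral>w. bump \<delta> (x - w) * (u w - m)\<^sup>2 \<partial>lborel)"
    using bump_nonneg[OF \<delta>, where 'a='a] by (intro integral_nonneg_AE AE_I2) auto
  also have "(\<lambda>w. bump \<delta> (x - w) * (u w - m)\<^sup>2) = (\<lambda>w. bump \<delta> (x - w) * (u w)\<^sup>2 - 2 * m * (bump \<delta> (x - w) * u w) + m\<^sup>2 * bump \<delta> (x - w))"
    by (auto simp: power2_eq_square algebra_simps)
  also have "(\<integral>w. \<dots> w \<partial>lborel) = mollify \<delta> (\<lambda>x. (u x)\<^sup>2) x - 2 * m * m + m\<^sup>2"
    using i bump_shift_integral[OF \<delta>, of x] by (simp add: mollify_def m_def)
  finally show ?thesis by (simp add: m_def power2_eq_square)
qed

lemma mollify_integrable_pair: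
  fixes u \<zeta> :: "'a::euclidean_space \<Rightarrow> real"
  assumes \<delta>: "0 < \<delta>" and u: "locally_integrable u" and z: "\<zeta> \<in> borel_measurable borel" "\<And>x. \<bar>\<zeta> x\<bar> \<le> M" "\<And>x. R < norm x \<Longrightarrow> \<zeta> x = 0"
  shows "integrable (lborel \<Otimes>\<^sub>M lborel) (\<lambda>(x, w). \<zeta> x * (bump \<delta> (x - w) * u w))"
proof -
  obtain B where B: "0 \<le> B" "\<And>x::'a. \<bar>bump \<delta> x\<bar> \<le> B" using bump_bounded[OF \<delta>] by metis
  have [measurable]: "\<zeta> \<in> borel_measurable borel" "u \<in> borel_measurable borel"
    using z u by (auto simp: locally_integrable_def)
  have zi: "integrable lborel \<zeta>"
  proof (rule Bochner_Integration.integrable_bound)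
    show "integrable lborel (\<lambda>x::'a. M * indicator (cball 0 R) x :: real)"
      using emeasure_bounded_finite[OF bounded_cball[of "0::'a" R]]
      by (intro integrable_mult_right integrable_real_indicator) simp_all
    show "AE x in lborel. norm (\<zeta> x) \<le> norm (M * indicator (cball 0 R) x)"
      using z(2,3) by (intro AE_I2) (force split: split_indicator intro: order_trans[OF z(2)])
  qed simp
  have ui: "integrable lborel (\<lambda>w. indicator (cball 0 (R + \<delta>)) w * u w)" using u by (simp add: locally_integrable_def)
  have "integrable (lborel \<Otimes>\<^sub>M lborel) (\<lambda>(x, w). (B * \<zeta> x) * (indicator (cball 0 (R + \<delta>)) w * u w))"
    by (rule integrable_pair_mult) (use zi ui in auto)
  then show ?thesis
  proof (rule Bochner_Integration.integrable_bound)
    show "(\<lambda>(x, w). \<zeta> x * (bump \<delta> (x - w) * u w)) \<in> borel_measurable (lborel \<Otimes>\<^sub>M lborel)" by measurable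
    have "norm (\<zeta> x * (bump \<delta> (x - w) * u w)) \<le> norm ((B * \<zeta> x) * (indicator (cball 0 (R + \<delta>)) w * u w))" for x w
    proof (cases "\<zeta> x = 0 \<or> R + \<delta> < norm w")
      case True
      then have "\<zeta> x = 0 \<or> (norm x \<le> R \<and> R + \<delta> < norm w)" using z(3)[of x] by force
      then have "\<zeta> x * (bump \<delta> (x - w) * u w) = 0" using bump_shift_zero[OF \<delta>, of x w] by auto
      then show ?thesis by (simp only: norm_zero norm_ge_zero)
    next
      case False
      have "\<bar>\<zeta> x\<bar> * (\<bar>bump \<delta> (x - w)\<bar> * \<bar>u w\<bar>) \<le> \<bar>\<zeta> x\<bar> * (B * \<bar>u w\<bar>)"
        using B by (intro mult_left_mono mult_right_mono) auto
      then show ?thesis using False B by (simp add: abs_mult mult_ac)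
    qed
    then show "AE p in lborel \<Otimes>\<^sub>M lborel. norm (case p of (x, w) \<Rightarrow> \<zeta> x * (bump \<delta> (x - w) * u w))
       \<le> norm (case p of (x, w) \<Rightarrow> (B * \<zeta> x) * (indicator (cball 0 (R + \<delta>)) w * u w))"
      by (intro AE_I2) auto
  qed
qed

text \<open>The bump function is even, so mollification is symmetric.\<close>
lemma mollify_adjoint:
  fixes u \<zeta> :: "'a::euclidean_space \<Rightarrow> real"
  assumes \<delta>: "0 < \<delta>" and u: "locally_integrable u" and z: "\<zeta> \<in> borel_measurable borel" "\<And>x. \<bar>\<zeta> x\<bar> \<le> M" "\<And>x. R < norm x \<Longrightarrow> \<zeta> x = 0"
  shows "(\<integral>x. \<zeta> x * mollify \<delta> u x \<partial>lborel) = (\<integral>w. mollify \<delta> \<zeta> w * u w \<partial>lborel)"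
proof -
  have "(\<integral>x. \<zeta> x * mollify \<delta> u x \<partial>lborel) = (\<integral>x. (\<integral>w. \<zeta> x * (bump \<delta> (x - w) * u w) \<partial>lborel) \<partial>lborel)"
    by (simp add: mollify_def)
  also have "\<dots> = (\<integral>w. (\<integral>x. \<zeta> x * (bump \<delta> (x - w) * u w) \<partial>lborel) \<partial>lborel)"
    by (rule lborel_pair.Fubini_integral[symmetric]) (use mollify_integrable_pair[OF assms] in simp)
  also have "\<dots> = (\<integral>w. mollify \<delta> \<zeta> w * u w \<partial>lborel)"
  proof (rule Bochner_Integration.integral_cong)
    fix w
    have "(\<integral>x. \<zeta> x * (bump \<delta> (x - w) * u w) \<partial>lborel) = (\<integral>x. (bump \<delta> (w - x) * \<zeta> x) * u w \<partial>lborel)"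
      by (simp add: mult_ac bump_minus_commute[of \<delta> w])
    also have "\<dots> = mollify \<delta> \<zeta> w * u w" by (simp add: mollify_def)
    finally show "(\<integral>x. \<zeta> x * (bump \<delta> (x - w) * u w) \<partial>lborel) = mollify \<delta> \<zeta> w * u w" .
  qed simp
  finally show ?thesis .
qed

text \<open>Two convolutions commute; by this the mollifications at two scales can be compared with each other.\<close>
lemma mollify_commute:
  fixes u :: "'a::euclidean_space \<Rightarrow> real"
  assumes d: "0 < \<delta>" "0 < \<epsilon>" and u: "locally_integrable u"
  shows "mollify \<delta> (mollify \<epsilon> u) x = mollify \<epsilon> (mollify \<delta> u) x"
proof -
  have A: "mollify \<delta> (mollify \<epsilon> u) x = (\<integral>v. mollify \<epsilon> (\<lambda>w. bump \<delta> (x - w)) v * u v \<partial>lborel)"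
    if d: "0 < \<delta>" "0 < \<epsilon>" for \<delta> \<epsilon>
  proof -
    obtain B where B: "\<And>x::'a. \<bar>bump \<delta> x\<bar> \<le> B" using bump_bounded[OF d(1)] by metis
    have "mollify \<delta> (mollify \<epsilon> u) x = (\<integral>w. bump \<delta> (x - w) * mollify \<epsilon> u w \<partial>lborel)" by (simp add: mollify_def)
    also have "\<dots> = (\<integral>v. mollify \<epsilon> (\<lambda>w. bump \<delta> (x - w)) v * u v \<partial>lborel)"
      by (rule mollify_adjoint[OF d(2) u bump_shift_measurable B, where R="norm x + \<delta>"]) (simp add: bump_shift_zero[OF d(1)])
    finally show ?thesis .
  qed
  have "mollify \<epsilon> (\<lambda>w. bump \<delta> (x - w)) v = mollify \<delta> (\<lambda>w. bump \<epsilon> (x - w)) v" for v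
  proof -
    have "mollify \<epsilon> (\<lambda>w. bump \<delta> (x - w)) v = (\<integral>w. bump \<epsilon> (v - w) * bump \<delta> (x - w) \<partial>lborel)" by (simp add: mollify_def)
    moreover have e: "bump \<epsilon> (v - ((x + v) - w)) = bump \<epsilon> (x - w)" "bump \<delta> (x - ((x + v) - w)) = bump \<delta> (v - w)" for w
      using bump_minus_commute[of \<epsilon> w x] bump_minus_commute[of \<delta> w v] by simp_all
    moreover have "(\<integral>w. bump \<epsilon> (v - w) * bump \<delta> (x - w) \<partial>lborel) = (\<integral>w. bump \<epsilon> (v - ((x + v) - w)) * bump \<delta> (x - ((x + v) - w)) \<partial>lborel)"
      by (rule integral_reflect[symmetric]) measurable
    ultimately show ?thesis by (simp add: mollify_def mult.commute)
  qed
  then show ?thesis using A[OF d] A[OF d(2,1)] by simp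
qed

section \<open>Weak solutions and a Hardy inequality\<close>

text \<open>Changing a Borel function on a null set leaves it measurable for the completion.\<close>
lemma measurable_completion_cong_AE:
  fixes f g :: "'a \<Rightarrow> real"
  assumes g: "g \<in> borel_measurable M" and ae: "AE x in M. f x = g x"
  shows "f \<in> borel_measurable (completion M)"
proof (rule measurableI)
  fix A :: "real set" assume A: "A \<in> sets borel"
  show "f -` A \<inter> space (completion M) \<in> sets (completion M)"
  proof (rule completion.in_sets_AE)
    show "AE x in completion M. (x \<in> g -` A \<inter> space M) \<longleftrightarrow> (x \<in> f -` A \<inter> space (completion M))"
      using AE_completion[OF ae] by (auto elim!: eventually_mono)
    show "g -` A \<inter> space M \<in> sets (completion M)" using measurable_sets[OF g A] by simp
  qed simp
qed simp

lemma AE_lborel_null_set: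
  assumes "AE x in lborel. P x"
  obtains N where "N \<in> sets borel" "{x. \<not> P x} \<subseteq> N" "AE x in lborel. x \<notin> N"
proof -
  obtain N where N: "{x. \<not> P x} \<subseteq> N" "N \<in> sets borel" "emeasure lborel N = 0"
    using assms by (auto elim!: AE_E)
  then have "N \<in> null_sets lborel" by (auto simp: null_sets_def)
  then show thesis by (rule that[OF N(2,1) AE_not_in])
qed

text \<open>Each of the three maps pulls null sets back to null sets. So modifying \<open>u\<close> and \<open>K\<close> on null sets changes neither
the energy nor the bilinear form.\<close>
lemma AE_pair_fst_snd_diff:
  fixes P :: "'a::euclidean_space \<Rightarrow> bool"
  assumes "AE x in lborel. P x"
  shows "AE p in lborel \<Otimes>\<^sub>M lborel. P (fst p) \<and> P (snd p) \<and> P (fst p - snd p)"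
proof -
  obtain N where N: "N \<in> sets borel" "{x. \<not> P x} \<subseteq> N" "AE x in lborel. x \<notin> N"
    using AE_lborel_null_set[OF assms] by blast
  note [measurable] = N(1)
  have "AE p in lborel \<Otimes>\<^sub>M lborel. fst p \<notin> N \<and> snd p \<notin> N \<and> fst p - snd p \<notin> N"
  proof (rule lborel_pair.AE_pair_measure)
    show "{p \<in> space (lborel \<Otimes>\<^sub>M lborel). fst p \<notin> N \<and> snd p \<notin> N \<and> fst p - snd p \<notin> N} \<in> sets (lborel \<Otimes>\<^sub>M lborel)"
      by measurable
    show "AE x in lborel. AE y in lborel. fst (x, y) \<notin> N \<and> snd (x, y) \<notin> N \<and> fst (x, y) - snd (x, y) \<notin> N"
      using N(3)
    proof eventually_elim
      case (elim x)
      show ?case using N(3) AE_lborel_reflect[OF N(3), of x] by eventually_elim (use elim in auto)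
    qed
  qed
  then show ?thesis by (rule eventually_mono) (use N(2) in blast)
qed

definition energy_region :: "'a set \<Rightarrow> ('a \<times> 'a) set" where
  "energy_region \<Omega> = - ((- \<Omega>) \<times> (- \<Omega>))"

text \<open>A weak solution after Borel modification of the solution and of the kernel. The exterior condition is only required
almost everywhere, and with the datum \<open>G\<close> at boundary points, because \<open>U\<close> agrees with the given solution
only up to a null set, which may contain boundary points. The energy is taken over the product measure, where Fubini's theorem is available.\<close>
locale weak_setting =
  fixes s lam Lam \<kappa> C0 \<alpha> :: real and k :: "'a::euclidean_space \<Rightarrow> real" and \<Omega> :: "'a set"
    and U G :: "'a \<Rightarrow> real"
  assumes s: "0 < s" "s < 1" and lam: "0 < lam" "0 < Lam" and \<kappa>: "0 < \<kappa>" "\<kappa> \<le> 1"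
    and C0: "0 < C0" and \<alpha>: "0 < \<alpha>" "\<alpha> \<le> 1 / 2" "\<alpha> \<le> s / 2"
    and k_borel [measurable]: "k \<in> borel_measurable borel" and k_even: "k (- y) = k y"
    and k_low: "lam * sing_kernel s y \<le> k y" and k_up: "k y \<le> Lam * sing_kernel s y"
    and \<Omega>: "open \<Omega>" "bounded \<Omega>" "\<Omega> \<noteq> {}" and cork: "exterior_corkscrew \<kappa> \<Omega>"
    and U_borel [measurable]: "U \<in> borel_measurable borel"
    and energy: "(\<integral>\<^sup>+p. ennreal (\<bar>U (fst p) - U (snd p)\<bar>\<^sup>2 * k (fst p - snd p)) * indicator (energy_region \<Omega>) p \<partial>(lborel \<Otimes>\<^sub>M lborel)) < \<infinity>"
    and weak_eq: "\<eta> \<in> test_functions \<Omega> \<Longrightarrow>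
      (\<integral>p. (U (fst p) - U (snd p)) * (\<eta> (fst p) - \<eta> (snd p)) * k (fst p - snd p) \<partial>(lborel \<Otimes>\<^sub>M lborel)) = 0"
    and exterior: "AE y in lborel. y \<notin> \<Omega> \<longrightarrow> (\<forall>z\<in>frontier \<Omega>. \<bar>U y - G z\<bar> \<le> C0 * norm (y - z) powr \<alpha>)"
begin

text \<open>The setting is symmetric, so that every one-sided bound holds on both sides.\<close>
lemma weak_setting_uminus: "weak_setting s lam Lam \<kappa> C0 \<alpha> k \<Omega> (\<lambda>x. - U x) (\<lambda>x. - G x)"
proof
  show "(\<integral>\<^sup>+p. ennreal (\<bar>- U (fst p) - - U (snd p)\<bar>\<^sup>2 * k (fst p - snd p)) * indicator (energy_region \<Omega>) p \<partial>(lborel \<Otimes>\<^sub>M lborel)) < \<infinity>"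
    using energy by (simp add: abs_minus_commute)
  show "(\<integral>p. (- U (fst p) - - U (snd p)) * (\<eta> (fst p) - \<eta> (snd p)) * k (fst p - snd p) \<partial>(lborel \<Otimes>\<^sub>M lborel)) = 0"
    if "\<eta> \<in> test_functions \<Omega>" for \<eta>
  proof -
    have "(\<integral>p. (- U (fst p) - - U (snd p)) * (\<eta> (fst p) - \<eta> (snd p)) * k (fst p - snd p) \<partial>(lborel \<Otimes>\<^sub>M lborel))
      = (\<integral>p. - ((U (fst p) - U (snd p)) * (\<eta> (fst p) - \<eta> (snd p)) * k (fst p - snd p)) \<partial>(lborel \<Otimes>\<^sub>M lborel))"
      by (intro Bochner_Integration.integral_cong) (auto simp: algebra_simps)
    then show ?thesis using weak_eq[OF that] by simp
  qed
  show "AE y in lborel. y \<notin> \<Omega> \<longrightarrow> (\<forall>z\<in>frontier \<Omega>. \<bar>- U y - - G z\<bar> \<le> C0 * norm (y - z) powr \<alpha>)"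
    using exterior by (simp add: abs_minus_commute)
qed (use s lam \<kappa> C0 \<alpha> k_even k_low k_up \<Omega> cork in auto)

lemma k_nonneg: "0 \<le> k y"
proof -
  have "0 \<le> lam * sing_kernel s y" using lam sing_kernel_nonneg[of s y] by simp
  then show ?thesis using k_low[of y] by linarith
qed

lemma k_upper: "upper_kernel s Lam k"
  unfolding upper_kernel_def using k_even k_nonneg k_up by (auto intro!: measurable_completion)

lemma Omega_borel [measurable]: "\<Omega> \<in> sets borel"
  using \<Omega> by simp

lemma energy_region_borel [measurable]: "energy_region \<Omega> \<in> sets (lborel \<Otimes>\<^sub>M lborel)"
proof -
  have "energy_region \<Omega> = {p \<in> space (lborel \<Otimes>\<^sub>M lborel). fst p \<in> \<Omega> \<or> snd p \<in> \<Omega>}"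
    by (auto simp: energy_region_def space_pair_measure)
  also have "\<dots> \<in> sets (lborel \<Otimes>\<^sub>M lborel)" by measurable
  finally show ?thesis .
qed

lemma frontier_notin: "z \<in> frontier \<Omega> \<Longrightarrow> z \<notin> \<Omega>"
  using \<Omega> by (simp add: frontier_def interior_open)

definition dist_bdry :: "'a \<Rightarrow> real" where
  "dist_bdry x = infdist x (- \<Omega>)"

lemma dist_bdry_borel [measurable]: "dist_bdry \<in> borel_measurable borel"
  unfolding dist_bdry_def by (intro borel_measurable_continuous_onI continuous_intros)

lemma dist_bdry_pos: "x \<in> \<Omega> \<Longrightarrow> 0 < dist_bdry x"
  unfolding dist_bdry_def by (rule nearest_boundary_point[OF \<Omega>(1,2)])

lemma dist_bdry_zero: "x \<notin> \<Omega> \<Longrightarrow> dist_bdry x = 0"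
  by (simp add: dist_bdry_def)

lemma dist_bdry_le: "y \<notin> \<Omega> \<Longrightarrow> dist_bdry x \<le> norm (x - y)"
  unfolding dist_bdry_def using infdist_le[of y "- \<Omega>" x] by (simp add: dist_norm)

lemma dist_bdry_lipschitz: "\<bar>dist_bdry x - dist_bdry y\<bar> \<le> norm (x - y)"
  unfolding dist_bdry_def using infdist_triangle_abs[of x "- \<Omega>" y] by (simp add: dist_norm)

lemma ball_dist_bdry: "norm (y - x) < dist_bdry x \<Longrightarrow> y \<in> \<Omega>"
  using dist_bdry_le[of y x] by (force simp: norm_minus_commute)

lemma bounded_diam:
  "\<exists>D>0. (\<forall>x\<in>\<Omega>. dist_bdry x \<le> D) \<and> (\<forall>x\<in>closure \<Omega>. norm x \<le> D) \<and>
     (\<forall>x\<in>\<Omega>. \<forall>z\<in>frontier \<Omega>. norm (x - z) \<le> D)"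
proof -
  have "bounded (closure \<Omega>)" using \<Omega> by (intro bounded_closure)
  then obtain b where b: "0 < b" "\<And>x. x \<in> closure \<Omega> \<Longrightarrow> norm x \<le> b" by (metis bounded_pos)
  obtain z0 where z0: "z0 \<in> frontier \<Omega>" using frontier_nonempty[OF \<Omega>] by blast
  have fc: "frontier \<Omega> \<subseteq> closure \<Omega>" by (auto simp: frontier_def)
  have xz: "norm (x - z) \<le> 2 * b" if "x \<in> \<Omega>" "z \<in> frontier \<Omega>" for x z
  proof -
    have "norm x \<le> b" "norm z \<le> b" using b(2) that fc closure_subset by blast+
    then show ?thesis using norm_triangle_ineq4[of x z] by linarith
  qed
  show ?thesis
  proof (intro exI[of _ "2 * b"] conjI ballI)
    show "dist_bdry x \<le> 2 * b" if "x \<in> \<Omega>" for x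
      using dist_bdry_le[OF frontier_notin[OF z0], of x] xz[OF that z0] by linarith
    show "norm x \<le> 2 * b" if "x \<in> closure \<Omega>" for x using b(2)[OF that] b(1) by linarith
  qed (use b xz in auto)
qed

text \<open>The corkscrew ball at the nearest boundary point, at the scale of the distance.\<close>
lemma exterior_mass:
  assumes x: "x \<in> \<Omega>"
  obtains q where "ball q (\<kappa> * dist_bdry x) \<subseteq> - \<Omega>"
    "\<And>y. y \<in> ball q (\<kappa> * dist_bdry x) \<Longrightarrow> norm (x - y) \<le> 2 * dist_bdry x"
proof -
  obtain z where z: "z \<in> frontier \<Omega>" "norm (x - z) = dist_bdry x"
    unfolding dist_bdry_def by (rule nearest_boundary_point[OF \<Omega>(1,2) x])
  obtain q where q: "ball q (\<kappa> * dist_bdry x) \<subseteq> ball z (dist_bdry x) - \<Omega>"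
    using cork z dist_bdry_pos[OF x] unfolding exterior_corkscrew_def by blast
  show thesis
  proof (rule that)
    show "ball q (\<kappa> * dist_bdry x) \<subseteq> - \<Omega>" using q by blast
    fix y assume "y \<in> ball q (\<kappa> * dist_bdry x)"
    then have "norm (z - y) < dist_bdry x" using q by (auto simp: dist_norm)
    moreover have "norm (x - y) \<le> norm (x - z) + norm (z - y)" using norm_triangle_ineq[of "x - z" "z - y"] by simp
    ultimately show "norm (x - y) \<le> 2 * dist_bdry x" using z(2) by linarith
  qed
qed

text \<open>The lower bound of the kernel at distance \<open>2 * d\<close> times the volume of the corkscrew ball at scale \<open>d\<close>, with
\<open>d powr (- 2 * s)\<close> split off.\<close>
definition killing_const :: real where
  "killing_const = lam * 2 powr (- (real DIM('a) + 2 * s)) * (unit_ball_vol (real DIM('a)) * \<kappa> ^ DIM('a))"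

lemma killing_const_pos: "0 < killing_const"
  using lam \<kappa> by (simp add: killing_const_def)

text \<open>Integrate only over the corkscrew ball. The kernel \<open>K\<close> may be the truncation of \<open>k\<close>, which agrees
with it outside \<open>\<Omega>\<close> when the truncation radius is small.\<close>
lemma exterior_integral_ge:
  assumes x: "x \<in> \<Omega>" and m: "0 \<le> m"
    and f: "AE y in lborel. y \<notin> \<Omega> \<and> norm (x - y) \<le> 2 * dist_bdry x \<longrightarrow> m \<le> f y"
    and K: "\<And>y. y \<notin> \<Omega> \<Longrightarrow> K (x - y) = k (x - y)"
  shows "ennreal (killing_const * m * dist_bdry x powr (- 2 * s)) \<le> (\<integral>\<^sup>+y. ennreal (f y * K (x - y)) * indicator (- \<Omega>) y \<partial>lborel)"
proof -
  let ?N = "real DIM('a)" and ?d = "dist_bdry x" and ?V = "unit_ball_vol (real DIM('a))"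
  have d: "0 < ?d" by (rule dist_bdry_pos[OF x])
  obtain q where q: "ball q (\<kappa> * ?d) \<subseteq> - \<Omega>" "\<And>y. y \<in> ball q (\<kappa> * ?d) \<Longrightarrow> norm (x - y) \<le> 2 * ?d"
    using exterior_mass[OF x] by blast
  define c where "c = m * (lam * (2 * ?d) powr (- (?N + 2 * s)))"
  have "killing_const * m * ?d powr (- 2 * s) = c * (?V * (\<kappa> * ?d) ^ DIM('a))"
  proof -
    have "c * (?V * (\<kappa> * ?d) ^ DIM('a))
      = m * lam * 2 powr (- (?N + 2 * s)) * ?V * \<kappa> ^ DIM('a) * (?d powr (- (?N + 2 * s)) * ?d ^ DIM('a))"
      unfolding c_def power_mult_distrib powr_mult by (simp only: mult_ac)
    also have "?d powr (- (?N + 2 * s)) * ?d ^ DIM('a) = ?d powr (- 2 * s)"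
      using d by (simp add: powr_realpow[symmetric] powr_add[symmetric])
    finally have "c * (?V * (\<kappa> * ?d) ^ DIM('a)) = m * lam * 2 powr (- (?N + 2 * s)) * ?V * \<kappa> ^ DIM('a) * ?d powr (- 2 * s)" .
    then show ?thesis unfolding killing_const_def by (simp only: mult_ac)
  qed
  then have "ennreal (killing_const * m * ?d powr (- 2 * s)) = ennreal c * emeasure lborel (ball q (\<kappa> * ?d))"
  proof -
    assume eq: "killing_const * m * ?d powr (- 2 * s) = c * (?V * (\<kappa> * ?d) ^ DIM('a))"
    have "0 \<le> c" using m lam by (simp add: c_def)
    moreover have "emeasure lborel (ball q (\<kappa> * ?d)) = ennreal (?V * (\<kappa> * ?d) ^ DIM('a))"
      using d \<kappa> by (intro emeasure_ball) simp
    ultimately show ?thesis unfolding eq by (simp only: ennreal_mult')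
  qed
  also have "\<dots> = (\<integral>\<^sup>+y. ennreal c * indicator (ball q (\<kappa> * ?d)) y \<partial>lborel)"
    by (simp add: nn_integral_cmult_indicator)
  also have "\<dots> \<le> (\<integral>\<^sup>+y. ennreal (f y * K (x - y)) * indicator (- \<Omega>) y \<partial>lborel)"
  proof (rule nn_integral_mono_AE)
    show "AE y in lborel. ennreal c * indicator (ball q (\<kappa> * ?d)) y \<le> ennreal (f y * K (x - y)) * indicator (- \<Omega>) y"
      using f
    proof eventually_elim
      case (elim y)
      show ?case
      proof (cases "y \<in> ball q (\<kappa> * ?d)")
        case True
        then have y: "y \<notin> \<Omega>" "norm (x - y) \<le> 2 * ?d" using q by auto
        have "x - y \<noteq> 0" using x y by auto
        then have "lam * (2 * ?d) powr (- (?N + 2 * s)) \<le> lam * sing_kernel s (x - y)"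
          using y lam s by (intro mult_left_mono sing_kernel_ge) auto
        also have "\<dots> \<le> K (x - y)" using k_low K y by simp
        finally have "c \<le> f y * K (x - y)" unfolding c_def using elim y m lam by (intro mult_mono) auto
        then show ?thesis using True y by (auto intro: ennreal_leI)
      qed simp
    qed
  qed
  finally show ?thesis .
qed

text \<open>How far \<open>U\<close> exceeds the barrier at the boundary point \<open>z\<close>. The aim is to show that it vanishes almost everywhere.\<close>
definition excess :: "'a \<Rightarrow> 'a \<Rightarrow> real" where
  "excess z x = indicator \<Omega> x * max 0 (U x - (G z + C0 * barrier \<Omega> \<alpha> z x))"

lemma barrier_borel [measurable]: "barrier \<Omega> \<alpha> z \<in> borel_measurable borel"
  unfolding barrier_def by measurable

lemma excess_borel [measurable]: "excess z \<in> borel_measurable borel"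
  unfolding excess_def by measurable

lemma excess_nonneg: "0 \<le> excess z x"
  by (simp add: excess_def split: split_indicator)

text \<open>In the corkscrew ball of \<open>x\<close> the exterior values of \<open>U\<close> are at most \<open>G z + C0 * norm (y - z) powr \<alpha>\<close> with
\<open>norm (y - z) \<le> 3 * norm (x - z)\<close>, and \<open>3 powr \<alpha> \<le> 2\<close> because \<open>\<alpha> \<le> 1 / 2\<close>. So \<open>U x - U y\<close> is at least the excess
there, and the energy controls the excess with the weight \<open>dist_bdry x powr (- 2 * s)\<close>.\<close>
lemma excess_hardy_pointwise:
  assumes z: "z \<in> frontier \<Omega>" and x: "x \<in> \<Omega>"
  shows "ennreal (killing_const * (excess z x)\<^sup>2 * dist_bdry x powr (- 2 * s))
    \<le> (\<integral>\<^sup>+y. ennreal (\<bar>U x - U y\<bar>\<^sup>2 * k (x - y)) * indicator (- \<Omega>) y \<partial>lborel)"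
proof (rule exterior_integral_ge[OF x])
  show "AE y in lborel. y \<notin> \<Omega> \<and> norm (x - y) \<le> 2 * dist_bdry x \<longrightarrow> (excess z x)\<^sup>2 \<le> \<bar>U x - U y\<bar>\<^sup>2"
    using exterior
  proof eventually_elim
    case (elim y)
    show ?case
    proof
      assume y: "y \<notin> \<Omega> \<and> norm (x - y) \<le> 2 * dist_bdry x"
      have "dist_bdry x \<le> norm (x - z)" by (rule dist_bdry_le[OF frontier_notin[OF z]])
      moreover have "norm (y - z) \<le> norm (x - y) + norm (x - z)"
        using norm_triangle_ineq4[of "x - z" "x - y"] by simp
      ultimately have "norm (y - z) \<le> 3 * norm (x - z)" using y by linarith
      then have "norm (y - z) powr \<alpha> \<le> (3 * norm (x - z)) powr \<alpha>" using \<alpha> by (intro powr_mono2) auto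
      also have "\<dots> = 3 powr \<alpha> * norm (x - z) powr \<alpha>" by (rule powr_mult)
      also have "\<dots> \<le> 2 * norm (x - z) powr \<alpha>"
      proof (rule mult_right_mono)
        have "3 powr \<alpha> \<le> 3 powr (1/2 :: real)" using \<alpha> by (intro powr_mono) auto
        also have "\<dots> \<le> 2" by (simp add: powr_half_sqrt real_le_lsqrt)
        finally show "3 powr \<alpha> \<le> 2" .
      qed simp
      finally have "C0 * norm (y - z) powr \<alpha> \<le> C0 * (2 * norm (x - z) powr \<alpha>)" using C0 by (intro mult_left_mono) auto
      then have "U y \<le> G z + C0 * barrier \<Omega> \<alpha> z x" using elim y z x by (force simp: barrier_def abs_le_iff)
      then have "excess z x \<le> \<bar>U x - U y\<bar>" using x by (auto simp: excess_def)
      then show "(excess z x)\<^sup>2 \<le> \<bar>U x - U y\<bar>\<^sup>2" by (intro power_mono excess_nonneg)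
    qed
  qed
qed auto

text \<open>A Hardy inequality for the excess. It replaces the statement that the excess belongs to the closure of
the test functions.\<close>
lemma excess_hardy:
  assumes z: "z \<in> frontier \<Omega>"
  shows "(\<integral>\<^sup>+x. ennreal ((excess z x)\<^sup>2 * dist_bdry x powr (- 2 * s)) \<partial>lborel) < \<infinity>"
proof -
  let ?E = "\<lambda>p. ennreal (\<bar>U (fst p) - U (snd p)\<bar>\<^sup>2 * k (fst p - snd p)) * indicator (energy_region \<Omega>) p"
  have "ennreal killing_const * (\<integral>\<^sup>+x. ennreal ((excess z x)\<^sup>2 * dist_bdry x powr (- 2 * s)) \<partial>lborel)
     = (\<integral>\<^sup>+x. ennreal (killing_const * (excess z x)\<^sup>2 * dist_bdry x powr (- 2 * s)) \<partial>lborel)"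
    using killing_const_pos by (subst nn_integral_cmult[symmetric]) (auto simp: ennreal_mult'[symmetric] mult.assoc)
  also have "\<dots> \<le> (\<integral>\<^sup>+x. (\<integral>\<^sup>+y. ?E (x, y) \<partial>lborel) \<partial>lborel)"
  proof (rule nn_integral_mono)
    fix x
    show "ennreal (killing_const * (excess z x)\<^sup>2 * dist_bdry x powr (- 2 * s)) \<le> (\<integral>\<^sup>+y. ?E (x, y) \<partial>lborel)"
    proof (cases "x \<in> \<Omega>")
      case True
      have "(\<integral>\<^sup>+y. ennreal (\<bar>U x - U y\<bar>\<^sup>2 * k (x - y)) * indicator (- \<Omega>) y \<partial>lborel) \<le> (\<integral>\<^sup>+y. ?E (x, y) \<partial>lborel)"
        using True by (intro nn_integral_mono) (auto simp: energy_region_def split: split_indicator)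
      then show ?thesis using excess_hardy_pointwise[OF z True] by (rule order_trans[rotated])
    qed (simp add: excess_def)
  qed
  also have "\<dots> = (\<integral>\<^sup>+p. ?E p \<partial>(lborel \<Otimes>\<^sub>M lborel))"
    by (rule lborel.nn_integral_fst) measurable
  also have "\<dots> < \<infinity>" by (rule energy)
  finally show ?thesis using killing_const_pos by (auto simp: ennreal_mult_less_top less_top)
qed

lemma excess_square_integrable:
  assumes z: "z \<in> frontier \<Omega>"
  shows "integrable lborel (\<lambda>x. (excess z x)\<^sup>2)"
proof (rule integrableI_bounded)
  obtain D where D: "0 < D" "\<And>x. x \<in> \<Omega> \<Longrightarrow> dist_bdry x \<le> D" using bounded_diam by blast
  have "(\<integral>\<^sup>+x. ennreal (norm ((excess z x)\<^sup>2)) \<partial>lborel)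
     \<le> (\<integral>\<^sup>+x. ennreal (D powr (2 * s)) * ennreal ((excess z x)\<^sup>2 * dist_bdry x powr (- 2 * s)) \<partial>lborel)"
  proof (rule nn_integral_mono)
    fix x
    show "ennreal (norm ((excess z x)\<^sup>2)) \<le> ennreal (D powr (2 * s)) * ennreal ((excess z x)\<^sup>2 * dist_bdry x powr (- 2 * s))"
    proof (cases "x \<in> \<Omega>")
      case True
      have "D powr (- 2 * s) \<le> dist_bdry x powr (- 2 * s)" using D(2)[OF True] dist_bdry_pos[OF True] s by (intro powr_mono2') auto
      then have "D powr (2 * s) * D powr (- 2 * s) \<le> D powr (2 * s) * dist_bdry x powr (- 2 * s)" by (intro mult_left_mono) auto
      moreover have "D powr (2 * s) * D powr (- 2 * s) = 1" using D by (simp only: powr_add[symmetric]) simp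
      ultimately have "1 \<le> D powr (2 * s) * dist_bdry x powr (- 2 * s)" by (simp only:)
      then have "(excess z x)\<^sup>2 * 1 \<le> (excess z x)\<^sup>2 * (D powr (2 * s) * dist_bdry x powr (- 2 * s))" by (intro mult_left_mono) auto
      then have "(excess z x)\<^sup>2 \<le> D powr (2 * s) * ((excess z x)\<^sup>2 * dist_bdry x powr (- 2 * s))"
        by (simp only: mult_ac mult_1_left)
      then have "ennreal ((excess z x)\<^sup>2) \<le> ennreal (D powr (2 * s) * ((excess z x)\<^sup>2 * dist_bdry x powr (- 2 * s)))"
        by (rule ennreal_leI)
      also have "\<dots> = ennreal (D powr (2 * s)) * ennreal ((excess z x)\<^sup>2 * dist_bdry x powr (- 2 * s))"
        by (rule ennreal_mult') simp
      finally show ?thesis by simp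
    qed (simp add: excess_def)
  qed
  also have "\<dots> = ennreal (D powr (2 * s)) * (\<integral>\<^sup>+x. ennreal ((excess z x)\<^sup>2 * dist_bdry x powr (- 2 * s)) \<partial>lborel)"
    by (rule nn_integral_cmult) measurable
  also have "\<dots> < \<infinity>" using excess_hardy[OF z] by (simp add: ennreal_mult_less_top)
  finally show "(\<integral>\<^sup>+x. ennreal (norm ((excess z x)\<^sup>2)) \<partial>lborel) < \<infinity>" .
  show "(\<lambda>x. (excess z x)\<^sup>2) \<in> borel_measurable lborel" by measurable
qed

lemma excess_integrable:
  assumes z: "z \<in> frontier \<Omega>"
  shows "integrable lborel (excess z)"
proof (rule Bochner_Integration.integrable_bound)
  have "emeasure lborel \<Omega> < \<infinity>" by (rule emeasure_bounded_finite[OF \<Omega>(2)])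
  then show "integrable lborel (\<lambda>x. indicator \<Omega> x + (excess z x)\<^sup>2)"
    using excess_square_integrable[OF z] by (intro Bochner_Integration.integrable_add integrable_real_indicator) auto
  show "AE x in lborel. norm (excess z x) \<le> norm (indicator \<Omega> x + (excess z x)\<^sup>2)"
  proof (rule AE_I2)
    fix x
    have "0 \<le> (excess z x - 1)\<^sup>2" by simp
    then have "2 * excess z x \<le> 1 + (excess z x)\<^sup>2" by (simp add: power2_diff)
    then have "excess z x \<le> 1 + (excess z x)\<^sup>2" using excess_nonneg[of z x] by linarith
    moreover have "excess z x = 0" if "x \<notin> \<Omega>" using that by (simp add: excess_def)
    ultimately show "norm (excess z x) \<le> norm (indicator \<Omega> x + (excess z x)\<^sup>2)"
      using excess_nonneg[of z x] by (cases "x \<in> \<Omega>") auto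
  qed
qed simp

lemma excess_locally_integrable: "z \<in> frontier \<Omega> \<Longrightarrow> locally_integrable (excess z)"
  unfolding locally_integrable_def using integrable_mult_indicator[OF _ excess_integrable, of "cball 0 _" z] by auto

lemma excess_square_locally_integrable: "z \<in> frontier \<Omega> \<Longrightarrow> locally_integrable (\<lambda>x. (excess z x)\<^sup>2)"
  unfolding locally_integrable_def using integrable_mult_indicator[OF _ excess_square_integrable, of "cball 0 _" z] by auto

text \<open>Inside \<open>\<Omega>\<close> the excess of \<open>U\<close> and of \<open>- U\<close> over their barriers is integrable, and the barriers are locally bounded.\<close>
lemma U_locally_integrable: "locally_integrable U"
  unfolding locally_integrable_def
proof (intro conjI allI U_borel)
  fix R
  interpret neg: weak_setting s lam Lam \<kappa> C0 \<alpha> k \<Omega> "\<lambda>x. - U x" "\<lambda>x. - G x" by (rule weak_setting_uminus)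
  obtain z where z: "z \<in> frontier \<Omega>" using frontier_nonempty[OF \<Omega>] by blast
  define M where "M = \<bar>G z\<bar> + 2 * C0 * (\<bar>R\<bar> + norm z) powr \<alpha>"
  have M: "0 \<le> M" using C0 by (simp add: M_def)
  show "integrable lborel (\<lambda>x. indicator (cball 0 R) x * U x)"
  proof (rule Bochner_Integration.integrable_bound)
    show "integrable lborel (\<lambda>x. M * indicator (cball 0 R) x + excess z x + neg.excess z x)"
      using excess_integrable[OF z] neg.excess_integrable[OF z] emeasure_bounded_finite[OF bounded_cball[of "0::'a" R]]
      by (intro Bochner_Integration.integrable_add integrable_mult_right integrable_real_indicator) auto
    show "AE x in lborel. norm (indicator (cball 0 R) x * U x) \<le> norm (M * indicator (cball 0 R) x + excess z x + neg.excess z x)"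
      using exterior
    proof eventually_elim
      case (elim x)
      show ?case
      proof (cases "x \<in> cball 0 R")
        case True
        have "norm (x - z) \<le> \<bar>R\<bar> + norm z" using True norm_triangle_ineq4[of x z] by simp
        then have "norm (x - z) powr \<alpha> \<le> (\<bar>R\<bar> + norm z) powr \<alpha>" using \<alpha> by (intro powr_mono2) auto
        then have h: "2 * C0 * norm (x - z) powr \<alpha> \<le> 2 * C0 * (\<bar>R\<bar> + norm z) powr \<alpha>" using C0 by (intro mult_left_mono) auto
        have h1: "0 \<le> C0 * norm (x - z) powr \<alpha>" using C0 by simp
        have "\<bar>U x\<bar> \<le> M + excess z x + neg.excess z x"
        proof (cases "x \<in> \<Omega>")
          case True
          then have "U x - (G z + C0 * barrier \<Omega> \<alpha> z x) \<le> excess z x" "- U x - (- G z + C0 * barrier \<Omega> \<alpha> z x) \<le> neg.excess z x"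
            by (auto simp: excess_def neg.excess_def)
          moreover have "C0 * barrier \<Omega> \<alpha> z x = 2 * C0 * norm (x - z) powr \<alpha>" using True by (simp add: barrier_def)
          ultimately show ?thesis using h excess_nonneg[of z x] neg.excess_nonneg[of z x] by (auto simp: M_def abs_le_iff)
        next
          case False
          then have "\<bar>U x - G z\<bar> \<le> C0 * norm (x - z) powr \<alpha>" using elim z by blast
          then show ?thesis using h h1 excess_nonneg[of z x] neg.excess_nonneg[of z x] by (auto simp: M_def abs_le_iff)
        qed
        then show ?thesis using True M excess_nonneg[of z x] neg.excess_nonneg[of z x] by simp
      qed simp
    qed
    have "(\<lambda>x. indicator (cball 0 R) x * U x) \<in> borel_measurable borel"
      using U_borel by (intro borel_measurable_times borel_measurable_indicator) auto
    then show "(\<lambda>x. indicator (cball 0 R) x * U x) \<in> borel_measurable lborel" by simp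
  qed
qed

end

section \<open>Passing from mollifications to the function\<close>

text \<open>If the mollifications exceed \<open>f\<close> by little in the mean on compact sets, then \<open>w \<le> f\<close> almost everywhere. The
mollification is moved to continuous test functions, where it converges uniformly; the test functions then shrink to
indicators of compact sets, and inner regularity concludes.\<close>
lemma mollify_limit_le:
  fixes w f :: "'a::euclidean_space \<Rightarrow> real"
  assumes \<Omega>: "open \<Omega>" "bounded \<Omega>" and w: "locally_integrable w" and f: "locally_integrable f"
    and lim: "\<And>C e. compact C \<Longrightarrow> C \<subseteq> \<Omega> \<Longrightarrow> 0 < e \<Longrightarrow>
      \<exists>d>0. \<forall>\<delta>. 0 < \<delta> \<and> \<delta> < d \<longrightarrow> (\<integral>x. indicator C x * max 0 (mollify \<delta> w x - f x) \<partial>lborel) \<le> e"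
  shows "AE x in lborel. x \<in> \<Omega> \<longrightarrow> w x \<le> f x"
proof -
  have wf: "locally_integrable (\<lambda>x. w x - f x)" by (rule locally_integrable_diff[OF w f])
  have [measurable]: "w \<in> borel_measurable borel" "f \<in> borel_measurable borel"
    using w f by (auto simp: locally_integrable_def)
  have step1: "(\<integral>x. \<zeta> x * (w x - f x) \<partial>lborel) \<le> 0"
    if C: "compact C" "C \<subseteq> \<Omega>" and \<zeta>: "continuous_on UNIV \<zeta>" "\<And>x. 0 \<le> \<zeta> x" "\<And>x. \<zeta> x \<le> 1" "\<And>x. x \<notin> C \<Longrightarrow> \<zeta> x = 0"
    for C and \<zeta> :: "'a \<Rightarrow> real"
  proof (rule field_le_epsilon)
    fix e :: real assume e: "0 < e"
    obtain R where R: "\<And>x. x \<in> C \<Longrightarrow> norm x \<le> R" using compact_imp_bounded[OF C(1)] by (auto simp: bounded_iff)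
    have zR: "\<zeta> x = 0" if "R < norm x" for x using \<zeta>(4)[of x] R[of x] that by force
    have [measurable]: "\<zeta> \<in> borel_measurable borel" by (rule borel_measurable_continuous_onI[OF \<zeta>(1)])
    have zb: "\<bar>\<zeta> x\<bar> \<le> 1" for x using \<zeta>(2,3)[of x] by simp
    have zl: "locally_integrable \<zeta>" by (rule locally_integrable_continuous[OF \<zeta>(1)])
    define M where "M = (\<integral>x. indicator (cball 0 (R + 1)) x * \<bar>w x\<bar> \<partial>lborel)"
    have M: "0 \<le> M" unfolding M_def by (intro integral_nonneg_AE) (auto split: split_indicator)
    define e' where "e' = e / (2 * (M + 1))"
    have e': "0 < e'" "e' * M \<le> e / 2" using e M by (auto simp: e'_def field_simps)
    have "uniformly_continuous_on (cball 0 (R + 2)) \<zeta>"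
      by (rule compact_uniformly_continuous[OF continuous_on_subset[OF \<zeta>(1)]]) auto
    then obtain d1 where d1: "0 < d1" "\<And>x y. x \<in> cball 0 (R + 2) \<Longrightarrow> y \<in> cball 0 (R + 2) \<Longrightarrow> dist y x < d1 \<Longrightarrow> dist (\<zeta> y) (\<zeta> x) < e'"
      using e'(1) unfolding uniformly_continuous_on_def by metis
    obtain d2 where d2: "0 < d2" "\<forall>\<delta>. 0 < \<delta> \<and> \<delta> < d2 \<longrightarrow> (\<integral>x. indicator C x * max 0 (mollify \<delta> w x - f x) \<partial>lborel) \<le> e / 2"
      using lim[OF C, of "e / 2"] e by auto
    define \<delta> where "\<delta> = min 1 (min d1 d2) / 2"
    have \<delta>: "0 < \<delta>" "\<delta> < 1" "\<delta> < d1" "\<delta> < d2" using d1 d2 by (auto simp: \<delta>_def)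
    have close: "\<bar>mollify \<delta> \<zeta> x - \<zeta> x\<bar> \<le> e'" for x
    proof (rule mollify_abs_diff_le[OF \<delta>(1) zl AE_I2], rule impI)
      fix y assume y: "norm (y - x) < \<delta>"
      show "\<bar>\<zeta> y - \<zeta> x\<bar> \<le> e'"
      proof (cases "norm x \<le> R + 1")
        case True
        then have "norm y \<le> R + 2" using y \<delta> norm_triangle_ineq2[of y x] by linarith
        then show ?thesis using d1(2)[of x y] True y \<delta> by (auto simp: dist_norm dist_real_def)
      next
        case False
        then have "R < norm y" using y \<delta> norm_triangle_ineq3[of y x] by linarith
        then show ?thesis using zR[of x] zR[of y] False e' by simp
      qed
    qed
    have supp: "mollify \<delta> \<zeta> x = 0" if "R + 1 < norm x" for x
    proof -
      have "bump \<delta> (x - v) * \<zeta> v = 0" for v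
      proof (cases "norm v \<le> R")
        case True
        then have "\<delta> \<le> norm (x - v)" using that \<delta> norm_triangle_ineq2[of x v] by linarith
        then show ?thesis using bump_zero[of \<delta> "x - v"] \<delta> by simp
      qed (simp add: zR)
      then show ?thesis unfolding mollify_def by (simp only: integral_zero)
    qed
    have mz: "mollify \<delta> \<zeta> \<in> borel_measurable borel" by (rule mollify_measurable[OF \<delta>(1) zl])
    have zw: "integrable lborel (\<lambda>x. \<zeta> x * w x)" by (rule locally_integrable_mult[OF w _ zb zR]) simp_all
    have zf: "integrable lborel (\<lambda>x. \<zeta> x * f x)" by (rule locally_integrable_mult[OF f _ zb zR]) simp_all
    have mzb: "\<bar>mollify \<delta> \<zeta> x\<bar> \<le> 1 + e'" for x using close[of x] zb[of x] by linarith
    have mzw: "integrable lborel (\<lambda>x. mollify \<delta> \<zeta> x * w x)" by (rule locally_integrable_mult[OF w mz mzb supp])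
    have ml: "locally_integrable (mollify \<delta> w)" by (rule locally_integrable_continuous[OF mollify_continuous[OF \<delta>(1) w]])
    have zmw: "integrable lborel (\<lambda>x. \<zeta> x * mollify \<delta> w x)" by (rule locally_integrable_mult[OF ml _ zb zR]) simp_all
    have "\<bar>\<integral>x. (\<zeta> x - mollify \<delta> \<zeta> x) * w x \<partial>lborel\<bar> \<le> e' * M"
      unfolding M_def
    proof (rule mollify_difference_bound[OF \<delta>(1) w])
      show "\<zeta> x - mollify \<delta> \<zeta> x = 0" if "R + 1 < norm x" for x using supp[OF that] zR[of x] that by simp
      show "\<bar>\<zeta> x - mollify \<delta> \<zeta> x\<bar> \<le> e'" for x using close[of x] by (simp add: abs_minus_commute)
    qed (use mz in simp)
    then have 1: "(\<integral>x. \<zeta> x * w x \<partial>lborel) \<le> (\<integral>x. mollify \<delta> \<zeta> x * w x \<partial>lborel) + e / 2"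
      using e'(2) zw mzw by (simp add: left_diff_distrib)
    have "(\<integral>x. mollify \<delta> \<zeta> x * w x \<partial>lborel) - (\<integral>x. \<zeta> x * f x \<partial>lborel) = (\<integral>x. \<zeta> x * mollify \<delta> w x - \<zeta> x * f x \<partial>lborel)"
      using mollify_adjoint[OF \<delta>(1) w _ zb zR] zmw zf by simp
    also have "\<dots> \<le> (\<integral>x. indicator C x * max 0 (mollify \<delta> w x - f x) \<partial>lborel)"
    proof (rule integral_mono)
      show "integrable lborel (\<lambda>x. \<zeta> x * mollify \<delta> w x - \<zeta> x * f x)" using zmw zf by simp
      have "integrable lborel (\<lambda>x. indicator C x * (mollify \<delta> w x - f x))"
        by (rule locally_integrable_mult[OF locally_integrable_diff[OF ml f], of _ 1 R])
           (use C in \<open>auto simp: compact_imp_closed not_le split: split_indicator dest!: R\<close>)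
      then show "integrable lborel (\<lambda>x. indicator C x * max 0 (mollify \<delta> w x - f x))"
        by (rule Bochner_Integration.integrable_bound)
           (use mollify_measurable[OF \<delta>(1) w] C in \<open>auto simp: compact_imp_closed split: split_indicator\<close>)
      fix x
      have "\<zeta> x * (mollify \<delta> w x - f x) \<le> indicator C x * max 0 (mollify \<delta> w x - f x)"
      proof (cases "x \<in> C")
        case True
        have "\<zeta> x * (mollify \<delta> w x - f x) \<le> \<zeta> x * max 0 (mollify \<delta> w x - f x)" using \<zeta>(2)[of x] by (intro mult_left_mono) auto
        also have "\<dots> \<le> 1 * max 0 (mollify \<delta> w x - f x)" using \<zeta>(3)[of x] by (intro mult_right_mono) auto
        finally show ?thesis using True by simp
      qed (simp add: \<zeta>(4))
      then show "\<zeta> x * mollify \<delta> w x - \<zeta> x * f x \<le> indicator C x * max 0 (mollify \<delta> w x - f x)" by (simp add: right_diff_distrib)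
    qed
    also have "\<dots> \<le> e / 2" using d2(2) \<delta> by blast
    finally have "(\<integral>x. mollify \<delta> \<zeta> x * w x \<partial>lborel) \<le> (\<integral>x. \<zeta> x * f x \<partial>lborel) + e / 2" by simp
    then show "(\<integral>x. \<zeta> x * (w x - f x) \<partial>lborel) \<le> 0 + e"
      using 1 zw zf by (simp add: right_diff_distrib)
  qed
  have step2: "(\<integral>x. indicator T x * (w x - f x) \<partial>lborel) \<le> 0" if T: "compact T" "T \<subseteq> \<Omega>" for T
  proof (cases "T = {}")
    case False
    obtain r where r: "0 < r" "{x. infdist x T \<le> r} \<subseteq> \<Omega>"
    proof -
      obtain e where e: "0 < e" "{x. infdist x T \<le> e} \<subseteq> \<Omega>"
        using compact_in_open_separated[OF False T(1) \<Omega>(1) T(2)] by (auto intro: that)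
      then show thesis using that by blast
    qed
    define C where "C = {x. infdist x T \<le> r}"
    have cC: "compact C" unfolding C_def by (rule compact_infdist_le[OF False T(1) r(1)])
    obtain R where R: "\<And>x. x \<in> C \<Longrightarrow> norm x \<le> R" using compact_imp_bounded[OF cC] by (auto simp: bounded_iff)
    define \<zeta> where "\<zeta> = (\<lambda>n::nat. \<lambda>x. max 0 (1 - (real n + 1) / r * infdist x T))"
    have z01: "0 \<le> \<zeta> n x" "\<zeta> n x \<le> 1" for n x using r by (auto simp: \<zeta>_def infdist_nonneg)
    have zC: "\<zeta> n x = 0" if "x \<notin> C" for n x
    proof -
      have "1 \<le> infdist x T / r" using that r by (simp add: C_def)
      also have "\<dots> \<le> (real n + 1) * (infdist x T / r)" using infdist_nonneg[of x T] r mult_right_mono[of 1 "real n + 1" "infdist x T / r"] by simp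
      finally show ?thesis by (simp add: \<zeta>_def)
    qed
    have zc: "continuous_on UNIV (\<zeta> n)" for n unfolding \<zeta>_def by (intro continuous_intros)
    have le0: "(\<integral>x. \<zeta> n x * (w x - f x) \<partial>lborel) \<le> 0" for n
      using step1[OF cC r(2)[folded C_def] zc z01 zC] .
    have "(\<lambda>n. \<integral>x. \<zeta> n x * (w x - f x) \<partial>lborel) \<longlonglongrightarrow> (\<integral>x. indicator T x * (w x - f x) \<partial>lborel)"
    proof (rule integral_dominated_convergence[where w="\<lambda>x. \<bar>indicator C x * (w x - f x)\<bar>"])
      have [measurable]: "C \<in> sets borel" "T \<in> sets borel" using cC T by (auto simp: compact_imp_closed)
      show "(\<lambda>x. indicator T x * (w x - f x)) \<in> borel_measurable lborel" by measurable
      show "(\<lambda>x. \<zeta> n x * (w x - f x)) \<in> borel_measurable lborel" for n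
        using borel_measurable_continuous_onI[OF zc[of n]] by measurable
      show "integrable lborel (\<lambda>x. \<bar>indicator C x * (w x - f x)\<bar>)"
        by (intro integrable_abs locally_integrable_mult[OF wf, of _ 1 R]) (auto simp: not_le split: split_indicator dest!: R)
      show "AE x in lborel. (\<lambda>n. \<zeta> n x * (w x - f x)) \<longlonglongrightarrow> indicator T x * (w x - f x)"
      proof (intro AE_I2 tendsto_mult_right)
        fix x
        show "(\<lambda>n. \<zeta> n x) \<longlonglongrightarrow> indicator T x"
        proof (cases "x \<in> T")
          case True
          then show ?thesis by (simp add: \<zeta>_def)
        next
          case F: False
          have pos: "0 < infdist x T" using infdist_pos_not_in_closed[OF compact_imp_closed[OF T(1)] False F] .
          obtain n0 where n0: "r / infdist x T < real n0" using reals_Archimedean2 by blast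
          have "\<zeta> n x = 0" if "n0 \<le> n" for n
          proof -
            have "r / infdist x T \<le> real n + 1" using n0 that by linarith
            then have "1 \<le> (real n + 1) / r * infdist x T" using r pos by (simp add: field_simps)
            then show ?thesis by (simp add: \<zeta>_def)
          qed
          then have "\<forall>\<^sub>F n in sequentially. \<zeta> n x = 0" using eventually_sequentially by auto
          then show ?thesis using F by (simp add: tendsto_eventually)
        qed
      qed
      show "AE x in lborel. norm (\<zeta> n x * (w x - f x)) \<le> \<bar>indicator C x * (w x - f x)\<bar>" for n
      proof (rule AE_I2)
        fix x show "norm (\<zeta> n x * (w x - f x)) \<le> \<bar>indicator C x * (w x - f x)\<bar>"
          using z01[of n x] zC[of x n] mult_right_mono[of "\<zeta> n x" 1 "\<bar>w x - f x\<bar>"] by (cases "x \<in> C") (auto simp: abs_mult)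
      qed
    qed
    then show ?thesis by (rule LIMSEQ_le_const2) (use le0 in auto)
  qed simp
  define A where "A = {x \<in> \<Omega>. f x < w x}"
  have Am: "A \<in> sets borel"
  proof -
    have [measurable]: "\<Omega> \<in> sets borel" using \<Omega> by simp
    have "A = {x \<in> space borel. x \<in> \<Omega> \<and> f x < w x}" by (auto simp: A_def)
    also have "\<dots> \<in> sets borel" by measurable
    finally show ?thesis .
  qed
  have small: "emeasure lebesgue A \<le> ennreal e" if e: "0 < e" for e
  proof -
    have "A \<in> sets lebesgue" using Am by auto
    from sets_lebesgue_inner_closed[OF this e] obtain T where T: "closed T" "T \<subseteq> A" "A - T \<in> lmeasurable" "emeasure lebesgue (A - T) < ennreal e"
      by blast
    have cT: "compact T" using T \<Omega> by (auto simp: compact_eq_bounded_closed A_def intro: bounded_subset)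
    have T\<Omega>: "T \<subseteq> \<Omega>" using T by (auto simp: A_def)
    obtain R where R: "\<And>x. x \<in> T \<Longrightarrow> norm x \<le> R" using compact_imp_bounded[OF cT] by (auto simp: bounded_iff)
    have [measurable]: "T \<in> sets borel" using T by simp
    have iT: "integrable lborel (\<lambda>x. indicator T x * (w x - f x))"
      by (rule locally_integrable_mult[OF wf, of _ 1 R]) (auto simp: not_le split: split_indicator dest!: R)
    have pos: "0 \<le> indicator T x * (w x - f x)" for x using T(2) by (auto simp: A_def split: split_indicator)
    have "(\<integral>x. indicator T x * (w x - f x) \<partial>lborel) = 0"
    proof (rule antisym[OF step2[OF cT T\<Omega>]])
      show "0 \<le> (\<integral>x. indicator T x * (w x - f x) \<partial>lborel)" by (intro integral_nonneg_AE AE_I2 pos)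
    qed
    then have "AE x in lborel. indicator T x * (w x - f x) = 0"
      using integral_nonneg_eq_0_iff_AE[OF iT AE_I2[OF pos]] by simp
    then have "AE x in lborel. x \<notin> T"
      by eventually_elim (use T(2) in \<open>auto simp: A_def\<close>)
    then have "emeasure lborel T = 0"
      by (subst (asm) AE_iff_measurable[of T]) auto
    then have "emeasure lebesgue T = 0" using T by simp
    moreover have "emeasure lebesgue A \<le> emeasure lebesgue T + emeasure lebesgue (A - T)"
    proof -
      have "T \<in> sets lebesgue" using T(1) by (intro sets_completionI_sets) simp
      moreover have "A - T \<in> sets lebesgue" by (rule fmeasurableD[OF T(3)])
      ultimately have "emeasure lebesgue (T \<union> (A - T)) \<le> emeasure lebesgue T + emeasure lebesgue (A - T)"
        by (rule emeasure_subadditive)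
      moreover have "T \<union> (A - T) = A" using T(2) by blast
      ultimately show ?thesis by (simp only:)
    qed
    ultimately have "emeasure lebesgue A \<le> emeasure lebesgue (A - T)" by (simp only: add_0)
    then show ?thesis using less_imp_le[OF T(4)] by (rule order_trans)
  qed
  have "emeasure lebesgue A \<le> 0"
  proof (rule ennreal_le_epsilon)
    fix e :: real assume "0 < e"
    then show "emeasure lebesgue A \<le> 0 + ennreal e" unfolding add_0 by (rule small)
  qed
  then have "emeasure lebesgue A = 0" by (rule le_zero_eq[THEN iffD1])
  moreover have "A \<in> sets lebesgue" using Am by (intro sets_completionI_sets) simp
  ultimately have "A \<in> null_sets lebesgue" by (rule null_setsI)
  then have "AE x in lebesgue. x \<notin> A" by (rule AE_not_in)
  then have "AE x in lborel. x \<notin> A" by (simp only: AE_completion_iff)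
  then show ?thesis by eventually_elim (auto simp: A_def)
qed

section \<open>The equation for mollified weak solutions\<close>

text \<open>The substitution \<open>y = x + h\<close> in a double integral.\<close>
lemma integrable_pair_translate:
  fixes F :: "'a::euclidean_space \<times> 'a \<Rightarrow> real"
  assumes F: "integrable (lborel \<Otimes>\<^sub>M lborel) F"
  shows "integrable (lborel \<Otimes>\<^sub>M lborel) (\<lambda>(x, h). F (x, x + h))"
    and "(\<integral>p. (case p of (x, h) \<Rightarrow> F (x, x + h)) \<partial>(lborel \<Otimes>\<^sub>M lborel)) = (\<integral>p. F p \<partial>(lborel \<Otimes>\<^sub>M lborel))"
proof -
  have [measurable]: "F \<in> borel_measurable (lborel \<Otimes>\<^sub>M lborel)" using F by (rule borel_measurable_integrable)
  have Fx: "(\<lambda>y. F (x, y)) \<in> borel_measurable borel" for x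
    using measurable_Pair2[of F lborel lborel borel x] by simp
  have m: "(\<lambda>(x, h). F (x, x + h)) \<in> borel_measurable (lborel \<Otimes>\<^sub>M lborel)" by measurable
  have "(\<integral>\<^sup>+p. ennreal (norm (case p of (x, h) \<Rightarrow> F (x, x + h))) \<partial>(lborel \<Otimes>\<^sub>M lborel))
      = (\<integral>\<^sup>+x. (\<integral>\<^sup>+h. ennreal (norm (F (x, x + h))) \<partial>lborel) \<partial>lborel)"
    by (subst lborel.nn_integral_fst[symmetric]) (use m in auto)
  also have "\<dots> = (\<integral>\<^sup>+x. (\<integral>\<^sup>+y. ennreal (norm (F (x, y))) \<partial>lborel) \<partial>lborel)"
  proof (rule nn_integral_cong)
    fix x
    show "(\<integral>\<^sup>+h. ennreal (norm (F (x, x + h))) \<partial>lborel) = (\<integral>\<^sup>+y. ennreal (norm (F (x, y))) \<partial>lborel)"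
      using nn_integral_translate[of "\<lambda>y. ennreal (norm (F (x, y)))" x] Fx[of x] by simp
  qed
  also have "\<dots> = (\<integral>\<^sup>+p. ennreal (norm (F p)) \<partial>(lborel \<Otimes>\<^sub>M lborel))"
    by (subst lborel.nn_integral_fst) auto
  also have "\<dots> < \<infinity>" using F by (simp add: integrable_iff_bounded)
  finally show i: "integrable (lborel \<Otimes>\<^sub>M lborel) (\<lambda>(x, h). F (x, x + h))"
    using m by (intro integrableI_bounded)
  have "(\<integral>p. (case p of (x, h) \<Rightarrow> F (x, x + h)) \<partial>(lborel \<Otimes>\<^sub>M lborel)) = (\<integral>x. (\<integral>h. F (x, x + h) \<partial>lborel) \<partial>lborel)"
    using lborel_pair.integral_fst'[OF i] by simp
  also have "\<dots> = (\<integral>x. (\<integral>y. F (x, y) \<partial>lborel) \<partial>lborel)"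
    using integral_translate[OF Fx] by simp
  also have "\<dots> = (\<integral>p. F p \<partial>(lborel \<Otimes>\<^sub>M lborel))" by (rule lborel_pair.integral_fst'[OF F])
  finally show "(\<integral>p. (case p of (x, h) \<Rightarrow> F (x, x + h)) \<partial>(lborel \<Otimes>\<^sub>M lborel)) = (\<integral>p. F p \<partial>(lborel \<Otimes>\<^sub>M lborel))" .
qed

context weak_setting
begin

lemma weight_kernel_nn:
  assumes r: "0 < r" and B: "0 \<le> B" and f: "\<And>y. f y \<le> B * scale_weight s r y"
  shows "(\<integral>\<^sup>+y. ennreal (f y * k y) \<partial>lborel) \<le> ennreal (B * Lam * weight_const TYPE('a) s * r powr (- 2 * s))"
proof -
  have "(\<integral>\<^sup>+y. ennreal (f y * k y) \<partial>lborel) \<le> (\<integral>\<^sup>+y. ennreal (B * Lam) * ennreal (scale_weight s r y * sing_kernel s (y::'a)) \<partial>lborel)"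
  proof (rule nn_integral_mono)
    fix y
    have "f y * k y \<le> (B * scale_weight s r y) * k y" using f k_nonneg by (intro mult_right_mono) auto
    also have "\<dots> \<le> (B * scale_weight s r y) * (Lam * sing_kernel s y)"
      using k_up B by (intro mult_left_mono) (auto simp: scale_weight_nonneg)
    finally have "f y * k y \<le> (B * Lam) * (scale_weight s r y * sing_kernel s y)" by (simp add: mult_ac)
    then have "ennreal (f y * k y) \<le> ennreal ((B * Lam) * (scale_weight s r y * sing_kernel s y))" by (rule ennreal_leI)
    also have "\<dots> = ennreal (B * Lam) * ennreal (scale_weight s r y * sing_kernel s y)" using B lam by (intro ennreal_mult') simp
    finally show "ennreal (f y * k y) \<le> ennreal (B * Lam) * ennreal (scale_weight s r y * sing_kernel s y)" .
  qed
  also have "\<dots> = ennreal (B * Lam) * (\<integral>\<^sup>+y. ennreal (scale_weight s r y * sing_kernel s (y::'a)) \<partial>lborel)"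
    by (rule nn_integral_cmult) measurable
  also have "\<dots> \<le> ennreal (B * Lam) * ennreal (weight_const TYPE('a) s * r powr (- 2 * s))"
    by (intro mult_left_mono nn_integral_weight_le s r) simp
  also have "\<dots> = ennreal (B * Lam * weight_const TYPE('a) s * r powr (- 2 * s))"
    using B lam by (subst ennreal_mult'[symmetric]) (simp_all add: mult_ac)
  finally show ?thesis .
qed

text \<open>The Lipschitz bound is used below scale \<open>r\<close> and the bound on the oscillation above it.\<close>
lemma square_difference_weight:
  fixes f :: "'a \<Rightarrow> real"
  assumes L: "0 \<le> L" "\<And>x y. \<bar>f x - f y\<bar> \<le> L * norm (x - y)" and B: "0 \<le> B" "\<And>x y. \<bar>f x - f y\<bar> \<le> B" and r: "0 < r"
  shows "(f x - f (x + h))\<^sup>2 \<le> ((L * r)\<^sup>2 + B\<^sup>2) * scale_weight s r h"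
proof (cases "norm h \<le> r")
  case True
  have "\<bar>f x - f (x + h)\<bar> \<le> (L * r) * (norm h / r)" using L(2)[of x "x + h"] r by simp
  then have "(f x - f (x + h))\<^sup>2 \<le> ((L * r) * (norm h / r))\<^sup>2" using power_mono[of "\<bar>f x - f (x + h)\<bar>" _ 2] by simp
  also have "\<dots> = (L * r)\<^sup>2 * scale_weight s r h" unfolding scale_weight_inner[OF s r True] by (rule power_mult_distrib)
  also have "\<dots> \<le> ((L * r)\<^sup>2 + B\<^sup>2) * scale_weight s r h" by (intro mult_right_mono scale_weight_nonneg) auto
  finally show ?thesis .
next
  case False
  have "1 \<le> scale_weight s r h" using scale_weight_ge_power2[of s r 1 h] s r False by simp
  then have "B\<^sup>2 * 1 \<le> B\<^sup>2 * scale_weight s r h" by (intro mult_left_mono) auto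
  moreover have "(f x - f (x + h))\<^sup>2 \<le> B\<^sup>2" using B(2)[of x "x + h"] power_mono[of "\<bar>f x - f (x + h)\<bar>" B 2] by simp
  moreover have "0 \<le> (L * r)\<^sup>2 * scale_weight s r h" by (intro mult_nonneg_nonneg scale_weight_nonneg) auto
  ultimately show ?thesis by (simp add: distrib_right)
qed

text \<open>The difference of the test function vanishes unless one of the points is in the bounded set \<open>\<Omega>\<close>, and integrating over the other
one costs a constant.\<close>
lemma test_energy_finite:
  fixes \<eta> :: "'a \<Rightarrow> real"
  assumes L: "0 \<le> L" "\<And>x y. \<bar>\<eta> x - \<eta> y\<bar> \<le> L * norm (x - y)" and B: "0 \<le> B" "\<And>x y. \<bar>\<eta> x - \<eta> y\<bar> \<le> B"
    and \<eta>: "\<eta> \<in> borel_measurable borel" "\<And>x. x \<notin> \<Omega> \<Longrightarrow> \<eta> x = 0"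
  shows "(\<integral>\<^sup>+p. ennreal ((\<eta> (fst p) - \<eta> (snd p))\<^sup>2 * k (fst p - snd p)) \<partial>(lborel \<Otimes>\<^sub>M lborel)) < \<infinity>"
proof -
  note [measurable] = \<eta>(1)
  define J where "J = ennreal (((L * 1)\<^sup>2 + B\<^sup>2) * Lam * weight_const TYPE('a) s * 1 powr (- 2 * s))"
  have fin: "emeasure lborel \<Omega> < \<infinity>" by (rule emeasure_bounded_finite[OF \<Omega>(2)])
  let ?g = "\<lambda>x y. ennreal ((\<eta> x - \<eta> y)\<^sup>2 * k (x - y))"
  have gJ: "(\<integral>\<^sup>+y. ?g x y \<partial>lborel) \<le> J" for x
  proof -
    have "(\<integral>\<^sup>+y. ?g x y \<partial>lborel) = (\<integral>\<^sup>+h. ?g x (x + h) \<partial>lborel)"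
      by (rule nn_integral_translate[symmetric]) measurable
    also have "\<dots> = (\<integral>\<^sup>+h. ennreal ((\<eta> x - \<eta> (x + h))\<^sup>2 * k h) \<partial>lborel)"
      using k_even by simp
    also have "\<dots> \<le> J" unfolding J_def
      by (rule weight_kernel_nn[OF _ _ square_difference_weight[OF L B]]) simp_all
    finally show ?thesis .
  qed
  have sym: "?g x y = ?g y x" for x y
    using k_even[of "x - y"] by (simp add: power2_commute)
  have "(\<integral>\<^sup>+p. ennreal ((\<eta> (fst p) - \<eta> (snd p))\<^sup>2 * k (fst p - snd p)) \<partial>(lborel \<Otimes>\<^sub>M lborel))
     \<le> (\<integral>\<^sup>+p. indicator \<Omega> (fst p) * ?g (fst p) (snd p) + indicator \<Omega> (snd p) * ?g (fst p) (snd p) \<partial>(lborel \<Otimes>\<^sub>M lborel))"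
    using \<eta>(2) by (intro nn_integral_mono) (auto split: split_indicator)
  also have "\<dots> = (\<integral>\<^sup>+p. indicator \<Omega> (fst p) * ?g (fst p) (snd p) \<partial>(lborel \<Otimes>\<^sub>M lborel))
      + (\<integral>\<^sup>+p. indicator \<Omega> (snd p) * ?g (fst p) (snd p) \<partial>(lborel \<Otimes>\<^sub>M lborel))"
    by (rule nn_integral_add) measurable
  also have "(\<integral>\<^sup>+p. indicator \<Omega> (fst p) * ?g (fst p) (snd p) \<partial>(lborel \<Otimes>\<^sub>M lborel))
      = (\<integral>\<^sup>+x. (\<integral>\<^sup>+y. indicator \<Omega> x * ?g x y \<partial>lborel) \<partial>lborel)"
    by (subst lborel.nn_integral_fst[symmetric]) auto
  also have "(\<integral>\<^sup>+p. indicator \<Omega> (snd p) * ?g (fst p) (snd p) \<partial>(lborel \<Otimes>\<^sub>M lborel))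
      = (\<integral>\<^sup>+x. (\<integral>\<^sup>+y. indicator \<Omega> x * ?g x y \<partial>lborel) \<partial>lborel)"
    by (subst lborel_pair.nn_integral_snd[symmetric]) (auto simp: sym)
  also have "(\<integral>\<^sup>+x. (\<integral>\<^sup>+y. indicator \<Omega> x * ?g x y \<partial>lborel) \<partial>lborel) \<le> (\<integral>\<^sup>+x. J * indicator \<Omega> x \<partial>lborel)"
    using gJ by (intro nn_integral_mono) (auto simp: nn_integral_cmult split: split_indicator)
  also have "\<dots> = J * emeasure lborel \<Omega>" by (simp add: nn_integral_cmult_indicator)
  finally have "(\<integral>\<^sup>+p. ennreal ((\<eta> (fst p) - \<eta> (snd p))\<^sup>2 * k (fst p - snd p)) \<partial>(lborel \<Otimes>\<^sub>M lborel))
     \<le> J * emeasure lborel \<Omega> + J * emeasure lborel \<Omega>" by (simp add: add_mono)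
  also have "\<dots> < \<infinity>" using fin by (simp add: J_def ennreal_mult_less_top)
  finally show ?thesis .
qed

text \<open>By \<open>a * b \<le> a\<^sup>2 + b\<^sup>2\<close> and the two finite energies; outside of \<open>energy_region \<Omega>\<close> the difference of the
test function vanishes.\<close>
lemma weak_form_integrable:
  fixes \<eta> :: "'a \<Rightarrow> real"
  assumes L: "0 \<le> L" "\<And>x y. \<bar>\<eta> x - \<eta> y\<bar> \<le> L * norm (x - y)" and B: "0 \<le> B" "\<And>x y. \<bar>\<eta> x - \<eta> y\<bar> \<le> B"
    and \<eta>: "\<eta> \<in> borel_measurable borel" "\<And>x. x \<notin> \<Omega> \<Longrightarrow> \<eta> x = 0"
  shows "integrable (lborel \<Otimes>\<^sub>M lborel) (\<lambda>p. (U (fst p) - U (snd p)) * (\<eta> (fst p) - \<eta> (snd p)) * k (fst p - snd p))"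
proof (rule integrableI_bounded)
  note [measurable] = \<eta>(1)
  show "(\<lambda>p. (U (fst p) - U (snd p)) * (\<eta> (fst p) - \<eta> (snd p)) * k (fst p - snd p)) \<in> borel_measurable (lborel \<Otimes>\<^sub>M lborel)"
    by measurable
  have "(\<integral>\<^sup>+p. ennreal (norm ((U (fst p) - U (snd p)) * (\<eta> (fst p) - \<eta> (snd p)) * k (fst p - snd p))) \<partial>(lborel \<Otimes>\<^sub>M lborel))
     \<le> (\<integral>\<^sup>+p. ennreal (\<bar>U (fst p) - U (snd p)\<bar>\<^sup>2 * k (fst p - snd p)) * indicator (energy_region \<Omega>) p
          + ennreal ((\<eta> (fst p) - \<eta> (snd p))\<^sup>2 * k (fst p - snd p)) \<partial>(lborel \<Otimes>\<^sub>M lborel))"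
  proof (rule nn_integral_mono)
    fix p :: "'a \<times> 'a"
    let ?a = "U (fst p) - U (snd p)" and ?b = "\<eta> (fst p) - \<eta> (snd p)" and ?k = "k (fst p - snd p)"
    show "ennreal (norm (?a * ?b * ?k)) \<le> ennreal (\<bar>?a\<bar>\<^sup>2 * ?k) * indicator (energy_region \<Omega>) p + ennreal (?b\<^sup>2 * ?k)"
    proof (cases "p \<in> energy_region \<Omega>")
      case True
      have "0 \<le> (\<bar>?a\<bar> - \<bar>?b\<bar>)\<^sup>2" by simp
      then have "2 * (\<bar>?a\<bar> * \<bar>?b\<bar>) \<le> \<bar>?a\<bar>\<^sup>2 + ?b\<^sup>2" by (simp add: power2_diff)
      moreover have "0 \<le> \<bar>?a\<bar> * \<bar>?b\<bar>" by simp
      ultimately have "\<bar>?a\<bar> * \<bar>?b\<bar> \<le> \<bar>?a\<bar>\<^sup>2 + ?b\<^sup>2" by linarith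
      then have "\<bar>?a\<bar> * \<bar>?b\<bar> * ?k \<le> (\<bar>?a\<bar>\<^sup>2 + ?b\<^sup>2) * ?k" using k_nonneg by (intro mult_right_mono) auto
      then have "norm (?a * ?b * ?k) \<le> \<bar>?a\<bar>\<^sup>2 * ?k + ?b\<^sup>2 * ?k" using k_nonneg by (simp add: abs_mult distrib_right)
      then have "ennreal (norm (?a * ?b * ?k)) \<le> ennreal (\<bar>?a\<bar>\<^sup>2 * ?k + ?b\<^sup>2 * ?k)" by (rule ennreal_leI)
      also have "\<dots> = ennreal (\<bar>?a\<bar>\<^sup>2 * ?k) + ennreal (?b\<^sup>2 * ?k)" using k_nonneg by (intro ennreal_plus) auto
      finally show ?thesis using True by simp
    next
      case False
      then have "?b = 0" using \<eta>(2) by (cases p) (auto simp: energy_region_def)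
      then show ?thesis by simp
    qed
  qed
  also have "\<dots> = (\<integral>\<^sup>+p. ennreal (\<bar>U (fst p) - U (snd p)\<bar>\<^sup>2 * k (fst p - snd p)) * indicator (energy_region \<Omega>) p \<partial>(lborel \<Otimes>\<^sub>M lborel))
     + (\<integral>\<^sup>+p. ennreal ((\<eta> (fst p) - \<eta> (snd p))\<^sup>2 * k (fst p - snd p)) \<partial>(lborel \<Otimes>\<^sub>M lborel))"
    by (rule nn_integral_add) measurable
  also have "\<dots> < \<infinity>" using energy test_energy_finite[OF assms] by simp
  finally show "(\<integral>\<^sup>+p. ennreal (norm ((U (fst p) - U (snd p)) * (\<eta> (fst p) - \<eta> (snd p)) * k (fst p - snd p))) \<partial>(lborel \<Otimes>\<^sub>M lborel)) < \<infinity>" .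
qed

text \<open>Test the equation with the bump function centred at \<open>x0\<close>. Substituting \<open>y = x + h\<close> and integrating first in
\<open>x\<close> turns the four products into values of the mollification at \<open>x0\<close> and \<open>x0 \<plusminus> h\<close>.\<close>
lemma mollified_equation:
  assumes \<delta>: "0 < \<delta>" and x0: "cball x0 \<delta> \<subseteq> \<Omega>"
  shows "integrable lborel (\<lambda>h. (2 * mollify \<delta> U x0 - mollify \<delta> U (x0 + h) - mollify \<delta> U (x0 - h)) * k h)" (is ?int)
    and "(\<integral>h. (2 * mollify \<delta> U x0 - mollify \<delta> U (x0 + h) - mollify \<delta> U (x0 - h)) * k h \<partial>lborel) = 0" (is ?eq)
proof -
  define \<eta> where "\<eta> = (\<lambda>x. bump \<delta> (x - x0))"
  have \<eta>test: "\<eta> \<in> test_functions \<Omega>" unfolding \<eta>_def by (rule bump_test_function[OF \<delta> x0])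
  have [measurable]: "\<eta> \<in> borel_measurable borel" unfolding \<eta>_def by measurable
  have \<eta>0: "\<eta> x = 0" if "x \<notin> \<Omega>" for x
  proof -
    have "\<delta> \<le> norm (x - x0)" using that x0 by (force simp: dist_norm norm_minus_commute)
    then show ?thesis using bump_zero[of \<delta> "x - x0"] \<delta> by (simp add: \<eta>_def)
  qed
  obtain L where L: "0 \<le> L" "\<And>x y::'a. \<bar>bump \<delta> x - bump \<delta> y\<bar> \<le> L * norm (x - y)"
    using bump_class_lipschitz[OF bump_in_class less_imp_le[OF \<delta>], where 'a='a] by blast
  obtain B where B: "0 \<le> B" "\<And>x::'a. \<bar>bump \<delta> x\<bar> \<le> B" using bump_bounded[OF \<delta>, where 'a='a] by blast
  have L': "\<bar>\<eta> x - \<eta> y\<bar> \<le> L * norm (x - y)" for x y using L(2)[of "x - x0" "y - x0"] by (simp add: \<eta>_def)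
  have B': "\<bar>\<eta> x - \<eta> y\<bar> \<le> 2 * B" for x y using B(2)[of "x - x0"] B(2)[of "y - x0"] by (simp add: \<eta>_def)
  define F where "F = (\<lambda>p. (U (fst p) - U (snd p)) * (\<eta> (fst p) - \<eta> (snd p)) * k (fst p - snd p))"
  have iF: "integrable (lborel \<Otimes>\<^sub>M lborel) F" unfolding F_def
    using B(1) by (intro weak_form_integrable[OF L(1) L' _ B'] \<eta>0) auto
  have F0: "(\<integral>p. F p \<partial>(lborel \<Otimes>\<^sub>M lborel)) = 0" unfolding F_def by (rule weak_eq[OF \<eta>test])
  note T = integrable_pair_translate[OF iF]
  have inner: "(\<integral>x. F (x, x + h) \<partial>lborel) = (2 * mollify \<delta> U x0 - mollify \<delta> U (x0 + h) - mollify \<delta> U (x0 - h)) * k h" for h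
  proof -
    define P where "P = (\<lambda>a x. bump \<delta> (a - x) * U x)"
    have Pi: "integrable lborel (P a)" "(\<integral>x. P a x \<partial>lborel) = mollify \<delta> U a" for a
      using mollify_integrable[OF \<delta> U_locally_integrable, of a] by (simp_all add: P_def mollify_def)
    have Pt: "integrable lborel (\<lambda>x. P a (h + x))" "(\<integral>x. P a (h + x) \<partial>lborel) = mollify \<delta> U a" for a
    proof -
      show "integrable lborel (\<lambda>x. P a (h + x))" by (rule integrable_translate[OF Pi(1)])
      show "(\<integral>x. P a (h + x) \<partial>lborel) = mollify \<delta> U a"
        using integral_translate[of "P a" h] borel_measurable_integrable[OF Pi(1)[of a]] Pi(2)[of a] by simp
    qed
    have "F (x, x + h) = (P x0 x + P x0 (h + x) - P (x0 - h) x - P (x0 + h) (h + x)) * k h" for x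
    proof -
      have e: "\<eta> x = bump \<delta> (x0 - x)" "\<eta> (x + h) = bump \<delta> (x0 - (h + x))" "\<eta> (x + h) = bump \<delta> (x0 - h - x)" "\<eta> x = bump \<delta> (x0 + h - (h + x))"
        unfolding \<eta>_def using bump_minus_commute[of \<delta> x x0] bump_minus_commute[of \<delta> "x + h" x0] by (simp_all add: algebra_simps)
      have "P x0 x = \<eta> x * U x" "P x0 (h + x) = \<eta> (x + h) * U (x + h)" "P (x0 - h) x = \<eta> (x + h) * U x" "P (x0 + h) (h + x) = \<eta> x * U (x + h)"
        unfolding P_def using e by (simp_all add: add.commute)
      then show ?thesis using k_even[of h] by (simp add: F_def algebra_simps)
    qed
    then have "(\<integral>x. F (x, x + h) \<partial>lborel) = (\<integral>x. (P x0 x + P x0 (h + x) - P (x0 - h) x - P (x0 + h) (h + x)) * k h \<partial>lborel)" by simp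
    also have "\<dots> = (\<integral>x. (P x0 x + P x0 (h + x) - P (x0 - h) x - P (x0 + h) (h + x)) \<partial>lborel) * k h" by simp
    also have "(\<integral>x. (P x0 x + P x0 (h + x) - P (x0 - h) x - P (x0 + h) (h + x)) \<partial>lborel)
       = mollify \<delta> U x0 + mollify \<delta> U x0 - mollify \<delta> U (x0 - h) - mollify \<delta> U (x0 + h)"
      using Pi Pt by simp
    finally show ?thesis by (simp add: algebra_simps)
  qed
  show ?int using lborel_pair.integrable_snd[OF T(1)] by (simp add: inner)
  show ?eq using lborel_pair.integral_snd[OF T(1)] T(2) F0 by (simp add: inner)
qed

text \<open>At a touching point the second difference of the mollification lies below \<open>H y + H (- y)\<close>, and its integral is 0.\<close>
lemma mollified_subsolution:
  assumes \<delta>: "0 < \<delta>"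
  shows "nonlocal_subsolution k {x. cball x \<delta> \<subseteq> \<Omega>} (mollify \<delta> U)"
  unfolding nonlocal_subsolution_def
proof (intro ballI allI impI)
  fix x r p c H
  assume x: "x \<in> {x. cball x \<delta> \<subseteq> \<Omega>}" and uH: "\<forall>y. mollify \<delta> U (x + y) - mollify \<delta> U x \<le> H y"
    and int: "integrable lebesgue (\<lambda>y. (H y + H (- y)) * k y)"
  let ?g = "\<lambda>h. (2 * mollify \<delta> U x - mollify \<delta> U (x + h) - mollify \<delta> U (x - h)) * k h"
  have ig: "integrable lborel ?g" and g0: "(\<integral>h. ?g h \<partial>lborel) = 0" using mollified_equation[OF \<delta>, of x] x by auto
  have m: "?g \<in> borel_measurable lborel" using ig by (rule borel_measurable_integrable)
  have "0 = (\<integral>h. - ?g h \<partial>lebesgue)" using g0 m by (simp add: integral_completion)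
  also have "\<dots> \<le> (\<integral>y. (H y + H (- y)) * k y \<partial>lebesgue)"
  proof (rule integral_mono)
    show "integrable lebesgue (\<lambda>h. - ?g h)" using ig m by (simp add: integrable_completion)
    fix h
    have "(mollify \<delta> U (x + h) - mollify \<delta> U x) + (mollify \<delta> U (x + - h) - mollify \<delta> U x) \<le> H h + H (- h)"
      using uH[rule_format, of h] uH[rule_format, of "- h"] by linarith
    then have "((mollify \<delta> U (x + h) - mollify \<delta> U x) + (mollify \<delta> U (x + - h) - mollify \<delta> U x)) * k h \<le> (H h + H (- h)) * k h"
      using k_nonneg by (intro mult_right_mono) auto
    then show "- ?g h \<le> (H h + H (- h)) * k h" by (simp add: algebra_simps)
  qed (rule int)
  finally show "0 \<le> (\<integral>y. (H y + H (- y)) * k y \<partial>lebesgue)" .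
qed

end

section \<open>A Caccioppoli inequality and cutoff functions\<close>

text \<open>Testing the subsolution property with \<open>p * \<psi>\<^sup>2\<close>. For an integrable kernel everything splits into absolutely
convergent integrals, and the pointwise identity
\<open>(p x)\<^sup>2 (\<psi> x)\<^sup>2 + (p y)\<^sup>2 (\<psi> y)\<^sup>2 + p x p y (\<psi> x - \<psi> y)\<^sup>2 = (p x \<psi> x - p y \<psi> y)\<^sup>2 + p x p y ((\<psi> x)\<^sup>2 + (\<psi> y)\<^sup>2)\<close>
gives the result after cancelling the finite diagonal terms.\<close>
lemma caccioppoli_inequality:
  fixes p \<psi> kk :: "'a::euclidean_space \<Rightarrow> real"
  assumes [measurable]: "p \<in> borel_measurable borel" "\<psi> \<in> borel_measurable borel" "kk \<in> borel_measurable borel"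
    and p: "\<And>x. 0 \<le> p x" and \<psi>: "\<And>x. 0 \<le> \<psi> x" "\<And>x. \<psi> x \<le> 1"
    and kk: "\<And>y. 0 \<le> kk y" "\<And>y. kk (- y) = kk y"
    and M: "(\<integral>\<^sup>+y. ennreal (kk y) \<partial>lborel) = ennreal M" and p2: "(\<integral>\<^sup>+x. ennreal ((p x)\<^sup>2) \<partial>lborel) < \<infinity>"
    and sub: "\<And>x. \<psi> x \<noteq> 0 \<Longrightarrow> ennreal (p x) * ennreal M \<le> (\<integral>\<^sup>+y. ennreal (p y * kk (x - y)) \<partial>lborel)"
  shows "(\<integral>\<^sup>+x. \<integral>\<^sup>+y. ennreal ((p x * \<psi> x - p y * \<psi> y)\<^sup>2 * kk (x - y)) \<partial>lborel \<partial>lborel)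
       \<le> (\<integral>\<^sup>+x. \<integral>\<^sup>+y. ennreal (p x * p y * (\<psi> x - \<psi> y)\<^sup>2 * kk (x - y)) \<partial>lborel \<partial>lborel)"
proof -
  define a where "a = (\<lambda>x y. ennreal ((p x * \<psi> x)\<^sup>2 * kk (x - y)))"
  define b where "b = (\<lambda>x y. ennreal (p x * p y * (\<psi> x)\<^sup>2 * kk (x - y)))"
  define E where "E = (\<lambda>x y. ennreal ((p x * \<psi> x - p y * \<psi> y)\<^sup>2 * kk (x - y)))"
  define T where "T = (\<lambda>x y. ennreal (p x * p y * (\<psi> x - \<psi> y)\<^sup>2 * kk (x - y)))"
  have sym: "kk (y - x) = kk (x - y)" for x y using kk(2)[of "x - y"] by simp
  have [measurable]: "(\<lambda>p. a (fst p) (snd p)) \<in> borel_measurable (lborel \<Otimes>\<^sub>M lborel)"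
    "(\<lambda>p. b (fst p) (snd p)) \<in> borel_measurable (lborel \<Otimes>\<^sub>M lborel)"
    "(\<lambda>p. E (fst p) (snd p)) \<in> borel_measurable (lborel \<Otimes>\<^sub>M lborel)"
    "(\<lambda>p. T (fst p) (snd p)) \<in> borel_measurable (lborel \<Otimes>\<^sub>M lborel)"
    "(\<lambda>p. a (snd p) (fst p)) \<in> borel_measurable (lborel \<Otimes>\<^sub>M lborel)"
    "(\<lambda>p. b (snd p) (fst p)) \<in> borel_measurable (lborel \<Otimes>\<^sub>M lborel)"
    unfolding a_def b_def E_def T_def by measurable
  define I where "I = (\<lambda>f :: 'a \<Rightarrow> 'a \<Rightarrow> ennreal. \<integral>\<^sup>+q. f (fst q) (snd q) \<partial>(lborel \<Otimes>\<^sub>M lborel))"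
  have I_iter: "I f = (\<integral>\<^sup>+x. \<integral>\<^sup>+y. f x y \<partial>lborel \<partial>lborel)"
    if "(\<lambda>p. f (fst p) (snd p)) \<in> borel_measurable (lborel \<Otimes>\<^sub>M lborel)" for f :: "'a \<Rightarrow> 'a \<Rightarrow> ennreal"
    unfolding I_def using lborel.nn_integral_fst[OF that] by simp
  have I_swap: "I (\<lambda>x y. f y x) = I f"
    if m: "(\<lambda>p. f (fst p) (snd p)) \<in> borel_measurable (lborel \<Otimes>\<^sub>M lborel)"
      "(\<lambda>p. f (snd p) (fst p)) \<in> borel_measurable (lborel \<Otimes>\<^sub>M lborel)" for f :: "'a \<Rightarrow> 'a \<Rightarrow> ennreal"
    unfolding I_def using lborel.nn_integral_fst[OF m(1)] lborel_pair.nn_integral_snd[OF m(2)] by simp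
  have ident: "(a x y + a y x) + T x y = E x y + (b x y + b y x)" for x y
  proof -
    have k0: "0 \<le> kk (x - y)" by (rule kk(1))
    have e1: "a x y + a y x = ennreal ((p x * \<psi> x)\<^sup>2 * kk (x - y) + (p y * \<psi> y)\<^sup>2 * kk (x - y))"
      unfolding a_def sym[of y x] using k0 by (intro ennreal_plus[symmetric]) auto
    have e2: "b x y + b y x = ennreal (p x * p y * (\<psi> x)\<^sup>2 * kk (x - y) + p y * p x * (\<psi> y)\<^sup>2 * kk (x - y))"
      unfolding b_def sym[of y x] using k0 p by (intro ennreal_plus[symmetric]) auto
    have e3: "(a x y + a y x) + T x y = ennreal (((p x * \<psi> x)\<^sup>2 * kk (x - y) + (p y * \<psi> y)\<^sup>2 * kk (x - y)) + p x * p y * (\<psi> x - \<psi> y)\<^sup>2 * kk (x - y))"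
      unfolding e1 T_def using k0 p by (intro ennreal_plus[symmetric]) auto
    have e4: "E x y + (b x y + b y x) = ennreal ((p x * \<psi> x - p y * \<psi> y)\<^sup>2 * kk (x - y) + (p x * p y * (\<psi> x)\<^sup>2 * kk (x - y) + p y * p x * (\<psi> y)\<^sup>2 * kk (x - y)))"
      unfolding e2 E_def using k0 p by (intro ennreal_plus[symmetric]) auto
    show ?thesis unfolding e3 e4 by (rule arg_cong[of _ _ ennreal]) (simp add: power2_eq_square algebra_simps)
  qed
  have sums: "I (\<lambda>x y. (a x y + a y x) + T x y) = (I a + I a) + I T"
  proof -
    have "I (\<lambda>x y. (a x y + a y x) + T x y) = I (\<lambda>x y. a x y + a y x) + I T"
      unfolding I_def by (rule nn_integral_add) measurable
    also have "I (\<lambda>x y. a x y + a y x) = I a + I (\<lambda>x y. a y x)"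
      unfolding I_def by (rule nn_integral_add) measurable
    also have "I (\<lambda>x y. a y x) = I a" by (rule I_swap) measurable
    finally show ?thesis .
  qed
  have sums2: "I (\<lambda>x y. E x y + (b x y + b y x)) = I E + (I b + I b)"
  proof -
    have "I (\<lambda>x y. E x y + (b x y + b y x)) = I E + I (\<lambda>x y. b x y + b y x)"
      unfolding I_def by (rule nn_integral_add) measurable
    also have "I (\<lambda>x y. b x y + b y x) = I b + I (\<lambda>x y. b y x)"
      unfolding I_def by (rule nn_integral_add) measurable
    also have "I (\<lambda>x y. b y x) = I b" by (rule I_swap) measurable
    finally show ?thesis .
  qed
  have kM: "(\<integral>\<^sup>+y. ennreal (kk (x - y)) \<partial>lborel) = ennreal M" for x
    using nn_integral_reflect[of "\<lambda>y. ennreal (kk y)" x] M by simp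
  have Ia: "I a = (\<integral>\<^sup>+x. ennreal ((p x * \<psi> x)\<^sup>2) * ennreal M \<partial>lborel)"
  proof -
    have "I a = (\<integral>\<^sup>+x. \<integral>\<^sup>+y. ennreal ((p x * \<psi> x)\<^sup>2) * ennreal (kk (x - y)) \<partial>lborel \<partial>lborel)"
      by (subst I_iter) (simp_all add: a_def ennreal_mult')
    then show ?thesis by (simp add: nn_integral_cmult kM)
  qed
  have Ib: "I b = (\<integral>\<^sup>+x. ennreal (p x * (\<psi> x)\<^sup>2) * (\<integral>\<^sup>+y. ennreal (p y * kk (x - y)) \<partial>lborel) \<partial>lborel)"
  proof -
    have e: "b x y = ennreal (p x * (\<psi> x)\<^sup>2) * ennreal (p y * kk (x - y))" for x y
    proof -
      have "p x * p y * (\<psi> x)\<^sup>2 * kk (x - y) = (p x * (\<psi> x)\<^sup>2) * (p y * kk (x - y))" by (simp only: mult_ac)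
      then show ?thesis unfolding b_def using p[of x] by (simp only: ennreal_mult' mult_nonneg_nonneg zero_le_power2)
    qed
    have "I b = (\<integral>\<^sup>+x. \<integral>\<^sup>+y. ennreal (p x * (\<psi> x)\<^sup>2) * ennreal (p y * kk (x - y)) \<partial>lborel \<partial>lborel)"
    proof -
      have "I b = (\<integral>\<^sup>+x. \<integral>\<^sup>+y. b x y \<partial>lborel \<partial>lborel)" by (rule I_iter) measurable
      also have "\<dots> = (\<integral>\<^sup>+x. \<integral>\<^sup>+y. ennreal (p x * (\<psi> x)\<^sup>2) * ennreal (p y * kk (x - y)) \<partial>lborel \<partial>lborel)"
        by (intro nn_integral_cong e)
      finally show ?thesis .
    qed
    then show ?thesis by (simp add: nn_integral_cmult)
  qed
  have ab: "I a \<le> I b"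
    unfolding Ia Ib
  proof (rule nn_integral_mono)
    fix x
    show "ennreal ((p x * \<psi> x)\<^sup>2) * ennreal M \<le> ennreal (p x * (\<psi> x)\<^sup>2) * (\<integral>\<^sup>+y. ennreal (p y * kk (x - y)) \<partial>lborel)"
    proof (cases "\<psi> x = 0")
      case False
      have "ennreal ((p x * \<psi> x)\<^sup>2) = ennreal (p x * (\<psi> x)\<^sup>2) * ennreal (p x)"
      proof -
        have "(p x * \<psi> x)\<^sup>2 = (p x * (\<psi> x)\<^sup>2) * p x" by (simp add: power2_eq_square)
        moreover have "0 \<le> p x * (\<psi> x)\<^sup>2" using p[of x] by simp
        ultimately show ?thesis by (simp only: ennreal_mult')
      qed
      then have "ennreal ((p x * \<psi> x)\<^sup>2) * ennreal M = ennreal (p x * (\<psi> x)\<^sup>2) * (ennreal (p x) * ennreal M)" by (simp only: mult.assoc)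
      also have "\<dots> \<le> ennreal (p x * (\<psi> x)\<^sup>2) * (\<integral>\<^sup>+y. ennreal (p y * kk (x - y)) \<partial>lborel)"
        by (rule mult_left_mono[OF sub[OF False]]) simp
      finally show ?thesis .
    qed simp
  qed
  have afin: "I a < \<infinity>"
  proof -
    have "I a \<le> (\<integral>\<^sup>+x. ennreal ((p x)\<^sup>2) * ennreal M \<partial>lborel)"
      unfolding Ia
    proof (intro nn_integral_mono mult_right_mono ennreal_leI)
      fix x
      have "p x * \<psi> x \<le> p x * 1" using p \<psi> by (intro mult_left_mono) auto
      then show "(p x * \<psi> x)\<^sup>2 \<le> (p x)\<^sup>2" using p \<psi> by (intro power_mono) auto
    qed simp
    also have "\<dots> = (\<integral>\<^sup>+x. ennreal ((p x)\<^sup>2) \<partial>lborel) * ennreal M" by (rule nn_integral_multc) measurable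
    also have "\<dots> < \<infinity>" using p2 by (simp add: ennreal_mult_less_top)
    finally show ?thesis .
  qed
  have "(I a + I a) + I E \<le> I E + (I b + I b)"
    using ab by (metis add.commute add_mono order_refl)
  also have "\<dots> = (I a + I a) + I T" unfolding sums[symmetric] sums2[symmetric] ident ..
  finally have "I E \<le> I T" using afin by (auto simp: ennreal_add_left_cancel_le)
  then show ?thesis using I_iter[of E] I_iter[of T] by (simp add: E_def T_def)
qed

context weak_setting
begin

text \<open>Removing the singularity makes the kernel integrable, at an error of order \<open>\<tau> powr (2 - 2 * s)\<close> on functions with bounded
second differences.\<close>
definition trunc :: "real \<Rightarrow> 'a \<Rightarrow> real" where
  "trunc \<tau> y = (if \<tau> < norm y then k y else 0)"

lemma trunc_borel [measurable]: "trunc \<tau> \<in> borel_measurable borel"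
  unfolding trunc_def by measurable

lemma trunc_even: "trunc \<tau> (- y) = trunc \<tau> y"
  by (simp add: trunc_def k_even)

lemma trunc_nonneg: "0 \<le> trunc \<tau> y"
  by (simp add: trunc_def k_nonneg)

lemma trunc_upper: "upper_kernel s Lam (trunc \<tau>)"
  unfolding upper_kernel_def
proof (intro conjI allI impI trunc_even trunc_nonneg)
  show "trunc \<tau> \<in> borel_measurable lebesgue" by (intro measurable_completion) simp
  fix y :: 'a
  have "0 \<le> Lam * sing_kernel s y" using lam sing_kernel_nonneg[of s y] by simp
  then show "trunc \<tau> y \<le> Lam * sing_kernel s y" using k_up[of y] by (simp add: trunc_def)
qed

lemma trunc_integrable_mult:
  fixes f :: "'a \<Rightarrow> real"
  assumes \<tau>: "0 < \<tau>" and f: "f \<in> borel_measurable borel" and b: "\<And>y. \<tau> < norm y \<Longrightarrow> \<bar>f y\<bar> \<le> A * scale_weight s \<tau> y" and A: "0 \<le> A"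
  shows "integrable lborel (\<lambda>y. f y * trunc \<tau> y)"
proof -
  let ?h = "\<lambda>y. if \<tau> < norm y then f y else 0"
  have hm: "?h \<in> borel_measurable borel" using f by measurable
  have "integrable lebesgue (\<lambda>y. ?h y * trunc \<tau> y)"
  proof (rule integrable_mult_kernel[OF s \<tau> trunc_upper])
    show "?h \<in> borel_measurable lebesgue" using hm by (intro measurable_completion) simp
    show "\<bar>?h y\<bar> \<le> A * scale_weight s \<tau> y" for y using b[of y] A by (auto simp: scale_weight_nonneg)
  qed
  moreover have "(\<lambda>y. ?h y * trunc \<tau> y) = (\<lambda>y. f y * trunc \<tau> y)" by (auto simp: trunc_def)
  ultimately show ?thesis using f by (subst (asm) integrable_completion) auto
qed

lemma trunc_integrable:
  assumes "0 < \<tau>"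
  shows "integrable lborel (trunc \<tau>)"
proof -
  have "integrable lborel (\<lambda>y. 1 * trunc \<tau> y)"
  proof (rule trunc_integrable_mult[OF assms, of _ 1])
    fix y :: 'a assume "\<tau> < norm y"
    then show "\<bar>1\<bar> \<le> 1 * scale_weight s \<tau> y" using scale_weight_ge_power2[of s \<tau> 1 y] s assms by simp
  qed auto
  then show ?thesis by simp
qed

definition upper_barrier :: "'a \<Rightarrow> 'a \<Rightarrow> real" where
  "upper_barrier z x = G z + C0 * barrier \<Omega> \<alpha> z x"

lemma upper_barrier_borel [measurable]: "upper_barrier z \<in> borel_measurable borel"
  unfolding upper_barrier_def by measurable

lemma upper_barrier_bound: "\<bar>upper_barrier z x\<bar> \<le> \<bar>G z\<bar> + 2 * C0 * norm (x - z) powr \<alpha>"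
proof -
  have 0: "0 \<le> norm (x - z) powr \<alpha>" by simp
  have "0 \<le> barrier \<Omega> \<alpha> z x" "barrier \<Omega> \<alpha> z x \<le> 2 * norm (x - z) powr \<alpha>" by (auto simp: barrier_def)
  then have "0 \<le> C0 * barrier \<Omega> \<alpha> z x" "C0 * barrier \<Omega> \<alpha> z x \<le> C0 * (2 * norm (x - z) powr \<alpha>)"
    using C0 by (auto intro: mult_left_mono)
  moreover have "C0 * (2 * norm (x - z) powr \<alpha>) = 2 * C0 * norm (x - z) powr \<alpha>" by simp
  ultimately show ?thesis unfolding upper_barrier_def by linarith
qed

lemma upper_barrier_locally_integrable: "locally_integrable (upper_barrier z)"
  unfolding locally_integrable_def
proof (intro conjI allI upper_barrier_borel)
  fix R
  define M where "M = \<bar>G z\<bar> + 2 * C0 * (\<bar>R\<bar> + norm z) powr \<alpha>"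
  have m: "(\<lambda>x. indicator (cball 0 R) x * upper_barrier z x) \<in> borel_measurable borel"
    by (intro borel_measurable_times borel_measurable_indicator) auto
  show "integrable lborel (\<lambda>x. indicator (cball 0 R) x * upper_barrier z x)"
  proof (rule Bochner_Integration.integrable_bound)
    show "integrable lborel (\<lambda>x::'a. M * indicator (cball 0 R) x :: real)"
      using emeasure_bounded_finite[OF bounded_cball[of "0::'a" R]]
      by (intro integrable_mult_right integrable_real_indicator) auto
    show "AE x in lborel. norm (indicator (cball 0 R) x * upper_barrier z x) \<le> norm (M * indicator (cball 0 R) x)"
    proof (rule AE_I2)
      fix x
      show "norm (indicator (cball 0 R) x * upper_barrier z x) \<le> norm (M * indicator (cball 0 R) x)"
      proof (cases "x \<in> cball 0 R")
        case True
        have "norm (x - z) \<le> \<bar>R\<bar> + norm z" using True norm_triangle_ineq4[of x z] by simp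
        then have "norm (x - z) powr \<alpha> \<le> (\<bar>R\<bar> + norm z) powr \<alpha>" using \<alpha> by (intro powr_mono2) auto
        then have "2 * C0 * norm (x - z) powr \<alpha> \<le> 2 * C0 * (\<bar>R\<bar> + norm z) powr \<alpha>" using C0 by (intro mult_left_mono) auto
        then have "\<bar>upper_barrier z x\<bar> \<le> M" using upper_barrier_bound[of z x] by (simp add: M_def)
        then show ?thesis using True by simp
      qed simp
    qed
  qed (use m in simp)
qed

lemma upper_barrier_growth:
  assumes \<tau>: "0 < \<tau>"
  obtains A where "0 \<le> A" "\<And>x y. norm x \<le> R \<Longrightarrow> \<tau> < norm y \<Longrightarrow> \<bar>upper_barrier z (x + y)\<bar> \<le> A * scale_weight s \<tau> y"
    "\<And>x (y::'a). norm x \<le> R \<Longrightarrow> \<tau> < norm y \<Longrightarrow> \<bar>upper_barrier z x\<bar> \<le> A * scale_weight s \<tau> y"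
proof -
  define D where "D = \<bar>R\<bar> + norm z"
  define B where "B = (D + \<tau>) powr \<alpha>"
  define A where "A = \<bar>G z\<bar> + 2 * C0 * B"
  have D: "0 \<le> D" by (simp add: D_def)
  have B: "0 \<le> B" by (simp add: B_def)
  have main: "\<bar>upper_barrier z v\<bar> \<le> A * scale_weight s \<tau> y" if v: "norm (v - z) \<le> D + norm y" and y: "\<tau> < norm y" for v y
  proof -
    have W: "scale_weight s \<tau> y = (norm y / \<tau>) powr s" using s \<tau> y by (intro scale_weight_outer) auto
    have t: "1 \<le> norm y / \<tau>" using y \<tau> by simp
    have W1: "1 \<le> scale_weight s \<tau> y" unfolding W using t s by (intro ge_one_powr_ge_zero) auto
    have "D \<le> D * (norm y / \<tau>)" using t D mult_left_mono[OF t D] by simp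
    moreover have "norm y = \<tau> * (norm y / \<tau>)" using \<tau> by simp
    ultimately have "norm (v - z) \<le> (D + \<tau>) * (norm y / \<tau>)" using v unfolding distrib_right by linarith
    then have "norm (v - z) powr \<alpha> \<le> ((D + \<tau>) * (norm y / \<tau>)) powr \<alpha>" using \<alpha> by (intro powr_mono2) auto
    also have "\<dots> = B * (norm y / \<tau>) powr \<alpha>" unfolding B_def by (rule powr_mult)
    also have "\<dots> \<le> B * scale_weight s \<tau> y" unfolding W using t \<alpha> s B by (intro mult_left_mono powr_mono) auto
    finally have "2 * C0 * norm (v - z) powr \<alpha> \<le> 2 * C0 * (B * scale_weight s \<tau> y)" using C0 by (intro mult_left_mono) auto
    moreover have "\<bar>G z\<bar> * 1 \<le> \<bar>G z\<bar> * scale_weight s \<tau> y" using W1 by (intro mult_left_mono) auto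
    ultimately show ?thesis using upper_barrier_bound[of z v] by (simp add: A_def algebra_simps)
  qed
  show thesis
  proof (rule that[of A])
    show "0 \<le> A" using C0 B by (simp add: A_def)
    fix x y :: 'a assume x: "norm x \<le> R" and y: "\<tau> < norm y"
    have "norm (x + y - z) \<le> norm x + norm y + norm z"
      using norm_triangle_ineq4[of "x + y" z] norm_triangle_ineq[of x y] by linarith
    then have "norm (x + y - z) \<le> D + norm y" using x by (simp add: D_def)
    then show "\<bar>upper_barrier z (x + y)\<bar> \<le> A * scale_weight s \<tau> y" using y by (rule main)
    have "norm (x - z) \<le> D + norm y" using x norm_triangle_ineq4[of x z] norm_ge_zero[of y] unfolding D_def by linarith
    then show "\<bar>upper_barrier z x\<bar> \<le> A * scale_weight s \<tau> y" using y by (rule main)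
  qed
qed

text \<open>Vanishes within distance \<open>\<epsilon>\<close> of the complement and equals 1 beyond distance \<open>2 * \<epsilon>\<close>.\<close>
definition cutoff :: "real \<Rightarrow> 'a \<Rightarrow> real" where
  "cutoff \<epsilon> x = min 1 (max 0 (dist_bdry x / \<epsilon> - 1))"

lemma cutoff_borel [measurable]: "cutoff \<epsilon> \<in> borel_measurable borel"
  unfolding cutoff_def by measurable

lemma cutoff_range: "0 \<le> cutoff \<epsilon> x" "cutoff \<epsilon> x \<le> 1"
  by (auto simp: cutoff_def)

lemma cutoff_zero: "0 < \<epsilon> \<Longrightarrow> dist_bdry x \<le> \<epsilon> \<Longrightarrow> cutoff \<epsilon> x = 0"
  by (simp add: cutoff_def)

lemma cutoff_one: "0 < \<epsilon> \<Longrightarrow> 2 * \<epsilon> \<le> dist_bdry x \<Longrightarrow> cutoff \<epsilon> x = 1"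
  by (simp add: cutoff_def field_simps)

lemma cutoff_lipschitz:
  assumes \<epsilon>: "0 < \<epsilon>"
  shows "\<bar>cutoff \<epsilon> x - cutoff \<epsilon> y\<bar> \<le> (1 / \<epsilon>) * norm (x - y)"
proof -
  have "\<bar>cutoff \<epsilon> x - cutoff \<epsilon> y\<bar> \<le> \<bar>dist_bdry x / \<epsilon> - dist_bdry y / \<epsilon>\<bar>" by (simp add: cutoff_def min_def max_def)
  also have "\<dots> = \<bar>dist_bdry x - dist_bdry y\<bar> / \<epsilon>" using \<epsilon> by (simp add: diff_divide_distrib[symmetric])
  also have "\<dots> \<le> norm (x - y) / \<epsilon>" using \<epsilon> dist_bdry_lipschitz by (intro divide_right_mono) auto
  finally show ?thesis by simp
qed

definition cutoff_energy :: "real \<Rightarrow> 'a \<Rightarrow> ennreal" where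
  "cutoff_energy \<epsilon> x = (\<integral>\<^sup>+y. ennreal ((cutoff \<epsilon> x - cutoff \<epsilon> y)\<^sup>2 * k (x - y)) \<partial>lborel)"

lemma cutoff_energy_borel [measurable]: "cutoff_energy \<epsilon> \<in> borel_measurable borel"
  unfolding cutoff_energy_def by measurable

definition cutoff_const :: real where
  "cutoff_const = 2 * Lam * weight_const TYPE('a) s * 8 powr (2 * s)"

lemma cutoff_const_pos: "0 < cutoff_const"
  using lam weight_const_pos[OF s, where 'a='a] by (simp add: cutoff_const_def)

text \<open>The energy density of the cutoff is bounded by the Hardy weight, and the bound may be evaluated at a point
\<open>y\<close> near \<open>x\<close>, which absorbs the mollification. Near the boundary layer use the Lipschitz constant \<open>1 / \<epsilon>\<close>; far from it the cutoff is constant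
on a ball of radius comparable to the distance.\<close>
lemma cutoff_energy_bound:
  assumes \<epsilon>: "0 < \<epsilon>" and y: "y \<in> \<Omega>" and xy: "norm (x - y) < \<epsilon>"
  shows "cutoff_energy \<epsilon> x \<le> ennreal (cutoff_const * dist_bdry y powr (- 2 * s))"
proof -
  let ?J = "weight_const TYPE('a) s"
  have J: "0 < ?J" using weight_const_pos[OF s] .
  have d: "0 < dist_bdry y" by (rule dist_bdry_pos[OF y])
  have shift: "cutoff_energy \<epsilon> x = (\<integral>\<^sup>+h. ennreal ((cutoff \<epsilon> x - cutoff \<epsilon> (x + h))\<^sup>2 * k h) \<partial>lborel)"
    unfolding cutoff_energy_def
    using nn_integral_translate[of "\<lambda>y. ennreal ((cutoff \<epsilon> x - cutoff \<epsilon> y)\<^sup>2 * k (x - y))" x] k_even by simp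
  have key: "cutoff_energy \<epsilon> x \<le> ennreal (2 * Lam * ?J * r powr (- 2 * s))"
    if r: "0 < r" and le: "\<And>h. (cutoff \<epsilon> x - cutoff \<epsilon> (x + h))\<^sup>2 \<le> 2 * scale_weight s r h" for r
    unfolding shift by (rule weight_kernel_nn[OF r _ le]) simp
  have fin: "2 * Lam * ?J * r powr (- 2 * s) \<le> cutoff_const * dist_bdry y powr (- 2 * s)" if r: "dist_bdry y / 8 \<le> r" for r
  proof -
    have "r powr (- 2 * s) \<le> (dist_bdry y / 8) powr (- 2 * s)" using r d s by (intro powr_mono2') auto
    also have "\<dots> = 8 powr (2 * s) * dist_bdry y powr (- 2 * s)" using d by (simp add: powr_divide powr_minus field_simps)
    finally have "2 * Lam * ?J * r powr (- 2 * s) \<le> 2 * Lam * ?J * (8 powr (2 * s) * dist_bdry y powr (- 2 * s))"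
      using lam J by (intro mult_left_mono) auto
    then show ?thesis by (simp add: cutoff_const_def mult_ac)
  qed
  show ?thesis
  proof (cases "dist_bdry y \<le> 8 * \<epsilon>")
    case True
    have "(cutoff \<epsilon> x - cutoff \<epsilon> (x + h))\<^sup>2 \<le> ((1 / \<epsilon> * \<epsilon>)\<^sup>2 + 1\<^sup>2) * scale_weight s \<epsilon> h" for h
    proof (rule square_difference_weight[OF _ cutoff_lipschitz[OF \<epsilon>] _ _ \<epsilon>])
      show "\<bar>cutoff \<epsilon> x - cutoff \<epsilon> y\<bar> \<le> 1" for x y using cutoff_range[of \<epsilon> x] cutoff_range[of \<epsilon> y] by (simp add: abs_le_iff)
    qed (use \<epsilon> in auto)
    then have "cutoff_energy \<epsilon> x \<le> ennreal (2 * Lam * ?J * \<epsilon> powr (- 2 * s))" using \<epsilon> by (intro key) auto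
    also have "\<dots> \<le> ennreal (cutoff_const * dist_bdry y powr (- 2 * s))" using True by (intro ennreal_leI fin) simp
    finally show ?thesis .
  next
    case False
    define r where "r = dist_bdry x / 2"
    have dx: "dist_bdry y - \<epsilon> < dist_bdry x" using dist_bdry_lipschitz[of x y] xy by linarith
    then have r: "0 < r" "dist_bdry y / 8 \<le> r" "4 * \<epsilon> \<le> dist_bdry x" using False \<epsilon> by (auto simp: r_def)
    have "(cutoff \<epsilon> x - cutoff \<epsilon> (x + h))\<^sup>2 \<le> 2 * scale_weight s r h" for h
    proof (cases "norm h < r")
      case True
      have "dist_bdry x - norm h \<le> dist_bdry (x + h)" using dist_bdry_lipschitz[of x "x + h"] by simp
      then have "2 * \<epsilon> \<le> dist_bdry (x + h)" using True r(3) unfolding r_def by linarith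
      then have "cutoff \<epsilon> x = 1" "cutoff \<epsilon> (x + h) = 1" using r(3) \<epsilon> by (auto intro!: cutoff_one)
      then show ?thesis by (simp add: scale_weight_nonneg)
    next
      case False
      have "1 \<le> scale_weight s r h" using scale_weight_ge_power2[of s r 1 h] s r False by simp
      moreover have "\<bar>cutoff \<epsilon> x - cutoff \<epsilon> (x + h)\<bar> \<le> 1" using cutoff_range[of \<epsilon> x] cutoff_range[of \<epsilon> "x + h"] by (simp add: abs_le_iff)
      then have "(cutoff \<epsilon> x - cutoff \<epsilon> (x + h))\<^sup>2 \<le> 1" using abs_square_le_1 by blast
      ultimately show ?thesis by linarith
    qed
    then have "cutoff_energy \<epsilon> x \<le> ennreal (2 * Lam * ?J * r powr (- 2 * s))" using r by (intro key) auto
    also have "\<dots> \<le> ennreal (cutoff_const * dist_bdry y powr (- 2 * s))" using r by (intro ennreal_leI fin)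
    finally show ?thesis .
  qed
qed

end

section \<open>Truncated kernels and mollified barriers\<close>

lemma bump_shift_nn_integral:
  fixes y :: "'a::euclidean_space"
  assumes "0 < \<delta>"
  shows "(\<integral>\<^sup>+x. ennreal (bump \<delta> (y - x)) \<partial>lborel) = 1"
  using nn_integral_eq_integral[OF bump_shift_integrable[OF assms, of y] AE_I2[OF bump_nonneg[OF assms]]]
    bump_shift_integral[OF assms, of y] by simp

context weak_setting
begin

text \<open>Jensen's inequality moves the mollification onto the square of the excess, after which \<open>cutoff_energy_bound\<close>
exchanges the cutoff energy at \<open>x\<close> for the Hardy weight at \<open>y\<close>.\<close>
lemma cutoff_energy_mollified:
  assumes \<epsilon>: "0 < \<epsilon>" and \<delta>: "0 < \<delta>" "\<delta> < \<epsilon>" and z: "z \<in> frontier \<Omega>"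
    and S: "S \<in> sets borel" "T \<in> sets borel" and T: "\<And>x y. x \<in> S \<Longrightarrow> y \<in> \<Omega> \<Longrightarrow> norm (x - y) < \<delta> \<Longrightarrow> y \<in> T"
  shows "(\<integral>\<^sup>+x. indicator S x * (ennreal ((mollify \<delta> (excess z) x)\<^sup>2) * cutoff_energy \<epsilon> x) \<partial>lborel)
     \<le> ennreal cutoff_const * (\<integral>\<^sup>+y. indicator T y * ennreal ((excess z y)\<^sup>2 * dist_bdry y powr (- 2 * s)) \<partial>lborel)"
    (is "?lhs \<le> _")
proof -
  note [measurable] = S
  let ?e2 = "\<lambda>y. (excess z y)\<^sup>2"
  have nnm: "ennreal ((mollify \<delta> (excess z) x)\<^sup>2) \<le> (\<integral>\<^sup>+y. ennreal (bump \<delta> (x - y) * ?e2 y) \<partial>lborel)" for x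
  proof -
    have "(mollify \<delta> (excess z) x)\<^sup>2 \<le> mollify \<delta> ?e2 x"
      by (rule mollify_square_le[OF \<delta>(1) excess_locally_integrable[OF z] excess_square_locally_integrable[OF z]])
    moreover have "(\<integral>\<^sup>+y. ennreal (bump \<delta> (x - y) * ?e2 y) \<partial>lborel) = ennreal (mollify \<delta> ?e2 x)"
      unfolding mollify_def using bump_nonneg[OF \<delta>(1), where 'a='a]
      by (intro nn_integral_eq_integral mollify_integrable[OF \<delta>(1) excess_square_locally_integrable[OF z]] AE_I2) auto
    ultimately show ?thesis by (simp add: ennreal_leI)
  qed
  let ?F = "\<lambda>x y. indicator S x * (ennreal (bump \<delta> (x - y) * ?e2 y) * cutoff_energy \<epsilon> x)"
  have "?lhs \<le> (\<integral>\<^sup>+x. (\<integral>\<^sup>+y. ?F x y \<partial>lborel) \<partial>lborel)"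
  proof (rule nn_integral_mono)
    fix x
    have "indicator S x * (ennreal ((mollify \<delta> (excess z) x)\<^sup>2) * cutoff_energy \<epsilon> x)
      \<le> indicator S x * ((\<integral>\<^sup>+y. ennreal (bump \<delta> (x - y) * ?e2 y) \<partial>lborel) * cutoff_energy \<epsilon> x)"
      by (intro mult_left_mono mult_right_mono nnm) auto
    also have "\<dots> = (\<integral>\<^sup>+y. ?F x y \<partial>lborel)"
      by (simp add: nn_integral_cmult nn_integral_multc)
    finally show "indicator S x * (ennreal ((mollify \<delta> (excess z) x)\<^sup>2) * cutoff_energy \<epsilon> x) \<le> (\<integral>\<^sup>+y. ?F x y \<partial>lborel)" .
  qed
  also have "\<dots> = (\<integral>\<^sup>+y. (\<integral>\<^sup>+x. ?F x y \<partial>lborel) \<partial>lborel)"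
    by (rule lborel_pair.Fubini'[symmetric]) measurable
  also have "\<dots> \<le> (\<integral>\<^sup>+y. ennreal cutoff_const * (indicator T y * ennreal (?e2 y * dist_bdry y powr (- 2 * s))) \<partial>lborel)"
  proof (rule nn_integral_mono)
    fix y
    show "(\<integral>\<^sup>+x. ?F x y \<partial>lborel) \<le> ennreal cutoff_const * (indicator T y * ennreal (?e2 y * dist_bdry y powr (- 2 * s)))"
    proof (cases "y \<in> \<Omega>")
      case False
      then show ?thesis by (simp add: excess_def)
    next
      case True
      define c where "c = indicator T y * ennreal (cutoff_const * (?e2 y * dist_bdry y powr (- 2 * s)))"
      have "?F x y \<le> c * ennreal (bump \<delta> (y - x))" for x
      proof (cases "x \<in> S \<and> norm (x - y) < \<delta>")
        case xS: True
        then have yT: "y \<in> T" using T True by blast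
        have "?F x y = ennreal (bump \<delta> (x - y) * ?e2 y) * cutoff_energy \<epsilon> x" using xS by simp
        also have "\<dots> \<le> ennreal (bump \<delta> (x - y) * ?e2 y) * ennreal (cutoff_const * dist_bdry y powr (- 2 * s))"
          using xS \<delta> by (intro mult_left_mono cutoff_energy_bound[OF \<epsilon> True]) auto
        also have "\<dots> = ennreal (bump \<delta> (x - y) * ?e2 y * (cutoff_const * dist_bdry y powr (- 2 * s)))"
          using bump_nonneg[OF \<delta>(1), of "x - y"] by (intro ennreal_mult'[symmetric]) auto
        also have "\<dots> = ennreal (cutoff_const * (?e2 y * dist_bdry y powr (- 2 * s)) * bump \<delta> (y - x))"
          by (simp only: bump_minus_commute[of \<delta> x y] mult_ac)
        also have "\<dots> = c * ennreal (bump \<delta> (y - x))"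
          using yT cutoff_const_pos unfolding c_def by (subst ennreal_mult') auto
        finally show ?thesis .
      next
        case out: False
        then have "?F x y = 0" using bump_zero[of \<delta> "x - y"] \<delta>(1) by (auto split: split_indicator)
        then show ?thesis by (simp only: zero_le)
      qed
      then have "(\<integral>\<^sup>+x. ?F x y \<partial>lborel) \<le> (\<integral>\<^sup>+x. c * ennreal (bump \<delta> (y - x)) \<partial>lborel)" by (rule nn_integral_mono)
      also have "\<dots> = c * (\<integral>\<^sup>+x. ennreal (bump \<delta> (y - x)) \<partial>lborel)" by (rule nn_integral_cmult) measurable
      also have "(\<integral>\<^sup>+x. ennreal (bump \<delta> (y - x)) \<partial>lborel) = 1"
        by (rule bump_shift_nn_integral[OF \<delta>(1)])
      finally show ?thesis using cutoff_const_pos by (simp add: c_def ennreal_mult' mult_ac)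
    qed
  qed
  also have "\<dots> = ennreal cutoff_const * (\<integral>\<^sup>+y. indicator T y * ennreal (?e2 y * dist_bdry y powr (- 2 * s)) \<partial>lborel)"
    by (rule nn_integral_cmult) measurable
  finally show ?thesis .
qed

lemma mollify_alt:
  assumes "0 < \<delta>" "locally_integrable u"
  shows "integrable lborel (\<lambda>w. bump \<delta> w * u (x - w))" "(\<integral>w. bump \<delta> w * u (x - w) \<partial>lborel) = mollify \<delta> u x"
proof -
  have i: "integrable lborel (\<lambda>w. bump \<delta> (x - w) * u w)" by (rule mollify_integrable[OF assms])
  show "integrable lborel (\<lambda>w. bump \<delta> w * u (x - w))" using integrable_reflect[OF i, of x] by simp
  show "(\<integral>w. bump \<delta> w * u (x - w) \<partial>lborel) = mollify \<delta> u x"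
    using integral_reflect[of "\<lambda>w. bump \<delta> (x - w) * u w" x] borel_measurable_integrable[OF i] by (simp add: mollify_def)
qed

definition sym_diff :: "('a \<Rightarrow> real) \<Rightarrow> 'a \<Rightarrow> 'a \<Rightarrow> real" where
  "sym_diff u x y = u (x + y) + u (x - y) - 2 * u x"

lemma sym_diff_barrier_integrable:
  assumes \<tau>: "0 < \<tau>"
  shows "integrable lborel (\<lambda>y. sym_diff (upper_barrier z) x y * trunc \<tau> y)"
proof -
  obtain A where A: "0 \<le> A" "\<And>x' y. norm x' \<le> norm x \<Longrightarrow> \<tau> < norm y \<Longrightarrow> \<bar>upper_barrier z (x' + y)\<bar> \<le> A * scale_weight s \<tau> y"
    "\<And>x' (y::'a). norm x' \<le> norm x \<Longrightarrow> \<tau> < norm y \<Longrightarrow> \<bar>upper_barrier z x'\<bar> \<le> A * scale_weight s \<tau> y"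
    using upper_barrier_growth[OF \<tau>, where R="norm x" and z=z] by blast
  show ?thesis
  proof (rule trunc_integrable_mult[OF \<tau>, of _ "4 * A"])
    show "sym_diff (upper_barrier z) x \<in> borel_measurable borel" unfolding sym_diff_def by measurable
    fix y :: 'a assume y: "\<tau> < norm y"
    show "\<bar>sym_diff (upper_barrier z) x y\<bar> \<le> 4 * A * scale_weight s \<tau> y"
      using A(2)[of x y] A(2)[of x "- y"] A(3)[of x y] y unfolding sym_diff_def by simp
  qed (use A in simp)
qed

text \<open>Apply the barrier lemma to the truncated kernel: it still satisfies the lower bound outside \<open>\<Omega>\<close>, since
\<open>\<tau> < dist_bdry x\<close>.\<close>
lemma sym_diff_barrier_le:
  assumes c0: "0 < c0" and \<tau>: "0 < \<tau>" "\<tau> < dist_bdry x" and x: "x \<in> \<Omega>" and z: "z \<in> frontier \<Omega>"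
    and barr: "\<And>(K :: 'a \<Rightarrow> real). upper_kernel s Lam K \<Longrightarrow> (\<And>y. x + y \<notin> \<Omega> \<Longrightarrow> lam * sing_kernel s y \<le> K y) \<Longrightarrow>
       \<exists>r>0. \<exists>p c H. (\<forall>y. norm y < r \<longrightarrow> H y = p \<bullet> y + c * (norm y)\<^sup>2) \<and>
            (\<forall>y. barrier \<Omega> \<alpha> z (x + y) - barrier \<Omega> \<alpha> z x \<le> H y) \<and>
            H \<in> borel_measurable borel \<and> integrable lebesgue (\<lambda>y. (H y + H (- y)) * K y) \<and>
            (\<integral>y. (H y + H (- y)) * K y \<partial>lebesgue) \<le> - c0 * norm (x - z) powr (\<alpha> - 2 * s)"
    and D: "norm (x - z) \<le> D"
  shows "(\<integral>y. sym_diff (upper_barrier z) x y * trunc \<tau> y \<partial>lborel) \<le> - (C0 * c0 * D powr (\<alpha> - 2 * s))"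
proof -
  have low: "lam * sing_kernel s y \<le> trunc \<tau> y" if "x + y \<notin> \<Omega>" for y
  proof -
    have "dist_bdry x \<le> norm y" using dist_bdry_le[OF that, of x] by simp
    then show ?thesis using \<tau> k_low by (simp add: trunc_def)
  qed
  obtain H where bH: "\<forall>y. barrier \<Omega> \<alpha> z (x + y) - barrier \<Omega> \<alpha> z x \<le> H y"
    and Hm: "H \<in> borel_measurable borel" and int: "integrable lebesgue (\<lambda>y. (H y + H (- y)) * trunc \<tau> y)"
    and le: "(\<integral>y. (H y + H (- y)) * trunc \<tau> y \<partial>lebesgue) \<le> - c0 * norm (x - z) powr (\<alpha> - 2 * s)"
    using barr[OF trunc_upper low] by blast
  have "(\<lambda>y. H (- y)) \<in> borel_measurable borel" by (rule measurable_compose[OF _ Hm]) simp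
  then have m: "(\<lambda>y. (H y + H (- y)) * trunc \<tau> y) \<in> borel_measurable lborel" using Hm by simp
  have xz: "0 < norm (x - z)" using x frontier_notin[OF z] by auto
  have "(\<integral>y. sym_diff (upper_barrier z) x y * trunc \<tau> y \<partial>lborel) \<le> (\<integral>y. C0 * ((H y + H (- y)) * trunc \<tau> y) \<partial>lborel)"
  proof (rule integral_mono)
    show "integrable lborel (\<lambda>y. sym_diff (upper_barrier z) x y * trunc \<tau> y)" by (rule sym_diff_barrier_integrable[OF \<tau>(1)])
    show "integrable lborel (\<lambda>y. C0 * ((H y + H (- y)) * trunc \<tau> y))" using int m by (simp add: integrable_completion)
    fix y
    have "sym_diff (upper_barrier z) x y = C0 * ((barrier \<Omega> \<alpha> z (x + y) - barrier \<Omega> \<alpha> z x) + (barrier \<Omega> \<alpha> z (x + - y) - barrier \<Omega> \<alpha> z x))"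
      by (simp add: sym_diff_def upper_barrier_def algebra_simps)
    also have "\<dots> \<le> C0 * (H y + H (- y))"
      using C0 bH[rule_format, of y] bH[rule_format, of "- y"] by (intro mult_left_mono add_mono) auto
    finally have "sym_diff (upper_barrier z) x y * trunc \<tau> y \<le> C0 * (H y + H (- y)) * trunc \<tau> y"
      using trunc_nonneg by (intro mult_right_mono) auto
    then show "sym_diff (upper_barrier z) x y * trunc \<tau> y \<le> C0 * ((H y + H (- y)) * trunc \<tau> y)" by (simp only: mult.assoc)
  qed
  also have "\<dots> = C0 * (\<integral>y. (H y + H (- y)) * trunc \<tau> y \<partial>lebesgue)" using m by (simp add: integral_completion)
  also have "\<dots> \<le> C0 * (- c0 * norm (x - z) powr (\<alpha> - 2 * s))" using le C0 by (intro mult_left_mono) auto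
  also have "\<dots> \<le> - (C0 * c0 * D powr (\<alpha> - 2 * s))"
  proof -
    have "D powr (\<alpha> - 2 * s) \<le> norm (x - z) powr (\<alpha> - 2 * s)" using xz D \<alpha> s by (intro powr_mono2') auto
    then have "C0 * c0 * D powr (\<alpha> - 2 * s) \<le> C0 * c0 * norm (x - z) powr (\<alpha> - 2 * s)" using C0 c0 by (intro mult_left_mono) auto
    then show ?thesis by (simp add: mult_ac)
  qed
  finally show ?thesis .
qed

text \<open>A convolution averages the pointwise supersolution inequality over the ball of radius \<open>\<delta>\<close>.\<close>
lemma mollified_barrier_le:
  assumes \<delta>: "0 < \<delta>" and \<tau>: "0 < \<tau>" and x: "\<delta> + \<tau> < dist_bdry x"
    and c1: "\<And>x'. x' \<in> \<Omega> \<Longrightarrow> \<tau> < dist_bdry x' \<Longrightarrow> (\<integral>y. sym_diff (upper_barrier z) x' y * trunc \<tau> y \<partial>lborel) \<le> - c1"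
  shows "integrable lborel (\<lambda>y. sym_diff (mollify \<delta> (upper_barrier z)) x y * trunc \<tau> y)"
    and "(\<integral>y. sym_diff (mollify \<delta> (upper_barrier z)) x y * trunc \<tau> y \<partial>lborel) \<le> - c1"
proof -
  let ?u = "upper_barrier z"
  note ul = upper_barrier_locally_integrable[of z]
  define R where "R = norm x + \<delta>"
  obtain A where A: "0 \<le> A" "\<And>x' y. norm x' \<le> R \<Longrightarrow> \<tau> < norm y \<Longrightarrow> \<bar>?u (x' + y)\<bar> \<le> A * scale_weight s \<tau> y"
    "\<And>x' (y::'a). norm x' \<le> R \<Longrightarrow> \<tau> < norm y \<Longrightarrow> \<bar>?u x'\<bar> \<le> A * scale_weight s \<tau> y"
    using upper_barrier_growth[OF \<tau>, where R=R and z=z] by blast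
  define F where "F = (\<lambda>w y. bump \<delta> w * (sym_diff ?u (x - w) y * trunc \<tau> y))"
  have Fm: "(\<lambda>(w, y). F w y) \<in> borel_measurable (lborel \<Otimes>\<^sub>M lborel)"
    unfolding F_def sym_diff_def by measurable
  have Wi: "integrable lborel (\<lambda>y. scale_weight s \<tau> y * trunc \<tau> y)"
    by (rule trunc_integrable_mult[OF \<tau>, of _ 1]) (auto simp: scale_weight_nonneg)
  have "integrable (lborel \<Otimes>\<^sub>M lborel) (\<lambda>(w::'a, y). bump \<delta> w * (4 * A * (scale_weight s \<tau> y * trunc \<tau> y)))"
    by (rule integrable_pair_mult[OF bump_integrable[OF \<delta>]]) (use Wi in simp)
  then have Fi: "integrable (lborel \<Otimes>\<^sub>M lborel) (\<lambda>(w, y). F w y)"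
  proof (rule Bochner_Integration.integrable_bound[OF _ Fm])
    have "norm (F w y) \<le> norm (bump \<delta> w * (4 * A * (scale_weight s \<tau> y * trunc \<tau> y)))" for w y
    proof (cases "norm w < \<delta> \<and> \<tau> < norm y")
      case True
      have xw: "norm (x - w) \<le> R" using True norm_triangle_ineq4[of x w] by (simp add: R_def)
      have "\<bar>sym_diff ?u (x - w) y\<bar> \<le> 4 * A * scale_weight s \<tau> y"
        using A(2)[OF xw, of y] A(2)[OF xw, of "- y"] A(3)[OF xw, of y] True unfolding sym_diff_def by simp
      then have "\<bar>sym_diff ?u (x - w) y\<bar> * trunc \<tau> y \<le> 4 * A * scale_weight s \<tau> y * trunc \<tau> y"
        using trunc_nonneg by (rule mult_right_mono)
      then have "bump \<delta> w * (\<bar>sym_diff ?u (x - w) y\<bar> * trunc \<tau> y) \<le> bump \<delta> w * (4 * A * scale_weight s \<tau> y * trunc \<tau> y)"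
        using bump_nonneg[OF \<delta>] by (rule mult_left_mono)
      then show ?thesis using bump_nonneg[OF \<delta>, of w] trunc_nonneg[of \<tau> y] A(1) scale_weight_nonneg[of s \<tau> y]
        by (simp add: F_def abs_mult mult.assoc)
    next
      case False
      then have "bump \<delta> w = 0 \<or> trunc \<tau> y = 0" using bump_zero[of \<delta> w] \<delta> by (auto simp: trunc_def not_less)
      then have "F w y = 0" by (auto simp: F_def)
      then show ?thesis by (simp only: norm_zero norm_ge_zero)
    qed
    then show "AE p in lborel \<Otimes>\<^sub>M lborel. norm (case p of (w, y) \<Rightarrow> F w y)
       \<le> norm (case p of (w, y) \<Rightarrow> bump \<delta> w * (4 * A * (scale_weight s \<tau> y * trunc \<tau> y)))" by (intro AE_I2) auto
  qed
  have inner: "(\<integral>w. F w y \<partial>lborel) = sym_diff (mollify \<delta> ?u) x y * trunc \<tau> y" for y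
  proof -
    note M = mollify_alt[OF \<delta> ul]
    have "F w y = (bump \<delta> w * ?u (x + y - w) + bump \<delta> w * ?u (x - y - w) - 2 * (bump \<delta> w * ?u (x - w))) * trunc \<tau> y" for w
      by (simp add: F_def sym_diff_def algebra_simps)
    then have "(\<integral>w. F w y \<partial>lborel)
      = (\<integral>w. bump \<delta> w * ?u (x + y - w) + bump \<delta> w * ?u (x - y - w) - 2 * (bump \<delta> w * ?u (x - w)) \<partial>lborel) * trunc \<tau> y"
      by simp
    then show ?thesis using M by (simp add: sym_diff_def)
  qed
  show "integrable lborel (\<lambda>y. sym_diff (mollify \<delta> ?u) x y * trunc \<tau> y)"
    using lborel_pair.integrable_snd[OF Fi] by (simp add: inner)
  have "(\<integral>y. sym_diff (mollify \<delta> ?u) x y * trunc \<tau> y \<partial>lborel) = (\<integral>y. (\<integral>w. F w y \<partial>lborel) \<partial>lborel)" by (simp add: inner)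
  also have "\<dots> = (\<integral>w. (\<integral>y. F w y \<partial>lborel) \<partial>lborel)" by (rule lborel_pair.Fubini_integral[OF Fi])
  also have "\<dots> \<le> (\<integral>w. bump \<delta> (w::'a) * (- c1) \<partial>lborel)"
  proof (rule integral_mono)
    show "integrable lborel (\<lambda>w. \<integral>y. F w y \<partial>lborel)" by (rule lborel_pair.integrable_fst[OF Fi])
    show "integrable lborel (\<lambda>w::'a. bump \<delta> w * (- c1))" using bump_integrable[OF \<delta>, where 'a='a] by simp
    fix w
    have e: "(\<integral>y. F w y \<partial>lborel) = bump \<delta> w * (\<integral>y. sym_diff ?u (x - w) y * trunc \<tau> y \<partial>lborel)" by (simp add: F_def)
    show "(\<integral>y. F w y \<partial>lborel) \<le> bump \<delta> w * (- c1)"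
    proof (cases "norm w < \<delta>")
      case True
      have "\<tau> < dist_bdry (x - w)" using dist_bdry_lipschitz[of x "x - w"] True x by simp
      moreover from this have "x - w \<in> \<Omega>" using \<tau> dist_bdry_zero[of "x - w"] by force
      ultimately show ?thesis unfolding e using bump_nonneg[OF \<delta>] by (intro mult_left_mono c1) auto
    qed (use bump_zero[of \<delta> w] \<delta> e in simp)
  qed
  also have "\<dots> = - c1" using bump_integral[OF \<delta>, where 'a='a] by simp
  finally show "(\<integral>y. sym_diff (mollify \<delta> ?u) x y * trunc \<tau> y \<partial>lborel) \<le> - c1" .
qed

lemma weight_kernel_integral:
  assumes r: "0 < r"
  shows "integrable lborel (\<lambda>y. scale_weight s r y * k y)"
    "(\<integral>y. scale_weight s r y * k y \<partial>lborel) \<le> Lam * weight_const TYPE('a) s * r powr (- 2 * s)"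
proof -
  have nn: "0 \<le> scale_weight s r y * k y" for y :: 'a using k_nonneg[of y] scale_weight_nonneg[of s r y] by simp
  have b: "(\<integral>\<^sup>+y. ennreal (scale_weight s r y * k y) \<partial>lborel) \<le> ennreal (1 * Lam * weight_const TYPE('a) s * r powr (- 2 * s))"
    by (rule weight_kernel_nn[OF r]) simp_all
  show i: "integrable lborel (\<lambda>y. scale_weight s r y * k y)"
    using b nn by (intro integrableI_bounded) (auto intro: le_less_trans)
  have "0 \<le> Lam * weight_const TYPE('a) s * r powr (- 2 * s)"
    using lam weight_const_pos[OF s, where 'a='a] by (intro mult_nonneg_nonneg) auto
  then show "(\<integral>y. scale_weight s r y * k y \<partial>lborel) \<le> Lam * weight_const TYPE('a) s * r powr (- 2 * s)"
    using b nn nn_integral_eq_integral[OF i] by (simp add: ennreal_le_iff)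
qed

text \<open>The full integral vanishes by \<open>mollified_equation\<close>; the part inside radius \<open>\<tau>\<close> is \<open>O(\<tau> powr (2 - 2 * s))\<close> by the
quadratic bound on second differences.\<close>
lemma mollified_solution_trunc:
  assumes \<delta>: "0 < \<delta>" and C: "0 \<le> C" and x: "cball x \<delta> \<subseteq> \<Omega>" and \<tau>: "0 < \<tau>" "\<tau> \<le> 1"
    and sd: "\<And>y. norm y \<le> 1 \<Longrightarrow> \<bar>sym_diff (mollify \<delta> U) x y\<bar> \<le> C * (norm y)\<^sup>2"
  shows "integrable lborel (\<lambda>y. sym_diff (mollify \<delta> U) x y * trunc \<tau> y)"
    and "- (C * Lam * weight_const TYPE('a) s * \<tau> powr (2 - 2 * s)) \<le> (\<integral>y. sym_diff (mollify \<delta> U) x y * trunc \<tau> y \<partial>lborel)"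
proof -
  let ?S = "sym_diff (mollify \<delta> U) x"
  let ?g = "\<lambda>h. (2 * mollify \<delta> U x - mollify \<delta> U (x + h) - mollify \<delta> U (x - h)) * k h"
  have neg: "?S y * k y = - ?g y" for y by (simp add: sym_diff_def algebra_simps)
  have Sk: "integrable lborel (\<lambda>y. ?S y * k y)" "(\<integral>y. ?S y * k y \<partial>lborel) = 0"
    unfolding neg using mollified_equation[OF \<delta> x] by simp_all
  have ind: "?S y * trunc \<tau> y = indicator {y. \<tau> < norm y} y * (?S y * k y)" for y
    by (auto simp: trunc_def)
  have ind2: "?S y * k y - ?S y * trunc \<tau> y = indicator {y. norm y \<le> \<tau>} y * (?S y * k y)" for y
    by (auto simp: trunc_def)
  have "integrable lborel (\<lambda>y. indicator {y. \<tau> < norm y} y *\<^sub>R (?S y * k y))"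
    by (rule integrable_mult_indicator[OF _ Sk(1)]) measurable
  then show i: "integrable lborel (\<lambda>y. ?S y * trunc \<tau> y)" by (simp only: ind real_scaleR_def)
  have "(\<integral>y. ?S y * k y - ?S y * trunc \<tau> y \<partial>lborel) \<le> (\<integral>y. C * \<tau>\<^sup>2 * (scale_weight s \<tau> y * k y) \<partial>lborel)"
  proof (rule integral_mono)
    show "integrable lborel (\<lambda>y. ?S y * k y - ?S y * trunc \<tau> y)" using Sk(1) i by (rule Bochner_Integration.integrable_diff)
    show "integrable lborel (\<lambda>y. C * \<tau>\<^sup>2 * (scale_weight s \<tau> y * k y))" using weight_kernel_integral(1)[OF \<tau>(1)] by simp
    fix y
    have rhs: "0 \<le> C * \<tau>\<^sup>2 * (scale_weight s \<tau> y * k y)"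
      using C k_nonneg[of y] scale_weight_nonneg[of s \<tau> y] by simp
    show "?S y * k y - ?S y * trunc \<tau> y \<le> C * \<tau>\<^sup>2 * (scale_weight s \<tau> y * k y)"
    proof (cases "norm y \<le> \<tau>")
      case True
      then have W: "scale_weight s \<tau> y = (norm y / \<tau>)\<^sup>2" using s \<tau> by (intro scale_weight_inner) auto
      have "?S y \<le> C * (norm y)\<^sup>2" using sd[of y] True \<tau> by (simp add: abs_le_iff)
      then have "?S y * k y \<le> C * (norm y)\<^sup>2 * k y" using k_nonneg by (rule mult_right_mono)
      also have "C * (norm y)\<^sup>2 = C * \<tau>\<^sup>2 * scale_weight s \<tau> y" unfolding W using \<tau> by (simp add: power_divide)
      finally show ?thesis using True by (simp add: trunc_def mult.assoc)
    next
      case False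
      then show ?thesis using rhs by (simp add: trunc_def)
    qed
  qed
  also have "\<dots> = C * \<tau>\<^sup>2 * (\<integral>y. scale_weight s \<tau> y * k y \<partial>lborel)" by simp
  also have "\<dots> \<le> C * \<tau>\<^sup>2 * (Lam * weight_const TYPE('a) s * \<tau> powr (- 2 * s))"
    using C by (intro mult_left_mono weight_kernel_integral(2)[OF \<tau>(1)]) auto
  also have "\<dots> = C * Lam * weight_const TYPE('a) s * (\<tau>\<^sup>2 * \<tau> powr (- 2 * s))" by (simp only: mult_ac)
  also have "\<tau>\<^sup>2 * \<tau> powr (- 2 * s) = \<tau> powr (2 - 2 * s)"
  proof -
    have "\<tau>\<^sup>2 = \<tau> powr 2" using \<tau> by (simp add: powr_numeral)
    then show ?thesis by (simp only: powr_add[symmetric]) simp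
  qed
  finally show "- (C * Lam * weight_const TYPE('a) s * \<tau> powr (2 - 2 * s)) \<le> (\<integral>y. ?S y * trunc \<tau> y \<partial>lborel)"
    using Sk i by simp
qed

text \<open>The subsolution inequality for \<open>v\<close> says that \<open>v x\<close> is at most the kernel average of \<open>v\<close>; replacing \<open>v\<close> by its
positive part only increases the average.\<close>
lemma positive_part_subsolution:
  fixes v :: "'a \<Rightarrow> real"
  assumes v [measurable]: "v \<in> borel_measurable borel" and \<tau>: "0 < \<tau>"
    and i: "integrable lborel (\<lambda>y. sym_diff v x y * trunc \<tau> y)" and nn: "0 \<le> (\<integral>y. sym_diff v x y * trunc \<tau> y \<partial>lborel)"
  shows "ennreal (max 0 (v x)) * ennreal (\<integral>y. trunc \<tau> y \<partial>lborel) \<le> (\<integral>\<^sup>+y. ennreal (max 0 (v y) * trunc \<tau> (x - y)) \<partial>lborel)"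
proof (cases "0 < v x")
  case True
  define M where "M = (\<integral>y. trunc \<tau> y \<partial>lborel)"
  have M0: "0 \<le> M" unfolding M_def using trunc_nonneg by (intro integral_nonneg_AE AE_I2)
  define p where "p = (\<lambda>y. max 0 (v y))"
  have [measurable]: "p \<in> borel_measurable borel" unfolding p_def by measurable
  let ?f = "\<lambda>y. (v (x + y) + v (x - y)) * trunc \<tau> y"
  have fe: "?f y = sym_diff v x y * trunc \<tau> y + 2 * v x * trunc \<tau> y" for y by (simp add: sym_diff_def algebra_simps)
  have fi: "integrable lborel ?f" unfolding fe using i trunc_integrable[OF \<tau>] by simp
  have "(\<integral>y. ?f y \<partial>lborel) = (\<integral>y. sym_diff v x y * trunc \<tau> y \<partial>lborel) + 2 * v x * M"
    unfolding fe M_def using i trunc_integrable[OF \<tau>] by simp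
  then have "2 * v x * M \<le> (\<integral>y. ?f y \<partial>lborel)" using nn by simp
  also have "\<dots> \<le> (\<integral>y. max 0 (?f y) \<partial>lborel)" using fi by (intro integral_mono integrable_max) auto
  finally have "ennreal (2 * v x * M) \<le> ennreal (\<integral>y. max 0 (?f y) \<partial>lborel)" by (rule ennreal_leI)
  also have "\<dots> = (\<integral>\<^sup>+y. ennreal (max 0 (?f y)) \<partial>lborel)"
    using fi by (intro nn_integral_eq_integral[symmetric] integrable_max) auto
  also have "\<dots> \<le> (\<integral>\<^sup>+y. ennreal (p (x + y) * trunc \<tau> y) + ennreal (p (x - y) * trunc \<tau> y) \<partial>lborel)"
  proof (rule nn_integral_mono)
    fix y
    have "?f y \<le> (p (x + y) + p (x - y)) * trunc \<tau> y"
      using trunc_nonneg by (intro mult_right_mono add_mono) (auto simp: p_def)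
    moreover have "0 \<le> (p (x + y) + p (x - y)) * trunc \<tau> y" using trunc_nonneg[of \<tau> y] by (simp add: p_def)
    ultimately have "max 0 (?f y) \<le> p (x + y) * trunc \<tau> y + p (x - y) * trunc \<tau> y" by (simp add: distrib_right)
    then have "ennreal (max 0 (?f y)) \<le> ennreal (p (x + y) * trunc \<tau> y + p (x - y) * trunc \<tau> y)" by (rule ennreal_leI)
    also have "\<dots> = ennreal (p (x + y) * trunc \<tau> y) + ennreal (p (x - y) * trunc \<tau> y)"
      using trunc_nonneg by (intro ennreal_plus) (auto simp: p_def)
    finally show "ennreal (max 0 (?f y)) \<le> ennreal (p (x + y) * trunc \<tau> y) + ennreal (p (x - y) * trunc \<tau> y)" .
  qed
  also have "\<dots> = (\<integral>\<^sup>+y. ennreal (p (x + y) * trunc \<tau> y) \<partial>lborel) + (\<integral>\<^sup>+y. ennreal (p (x - y) * trunc \<tau> y) \<partial>lborel)"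
    by (rule nn_integral_add) measurable
  also have "(\<integral>\<^sup>+y. ennreal (p (x + y) * trunc \<tau> y) \<partial>lborel) = (\<integral>\<^sup>+y. ennreal (p y * trunc \<tau> (x - y)) \<partial>lborel)"
    using nn_integral_translate[of "\<lambda>y. ennreal (p y * trunc \<tau> (x - y))" x] by (simp add: trunc_even)
  also have "(\<integral>\<^sup>+y. ennreal (p (x - y) * trunc \<tau> y) \<partial>lborel) = (\<integral>\<^sup>+y. ennreal (p y * trunc \<tau> (x - y)) \<partial>lborel)"
    using nn_integral_reflect[of "\<lambda>y. ennreal (p y * trunc \<tau> (x - y))" x] by simp
  finally have "ennreal (2 * v x * M) \<le> 2 * (\<integral>\<^sup>+y. ennreal (p y * trunc \<tau> (x - y)) \<partial>lborel)" by (simp only: mult_2)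
  moreover have "ennreal (2 * v x * M) = 2 * (ennreal (p x) * ennreal M)"
  proof -
    have "ennreal (2 * v x * M) = ennreal (2 * (p x * M))" using True by (simp add: p_def mult.assoc)
    also have "\<dots> = ennreal 2 * (ennreal (p x) * ennreal M)" by (subst ennreal_mult', simp, subst ennreal_mult', simp add: p_def, simp)
    finally show ?thesis by simp
  qed
  ultimately have "2 * (ennreal (p x) * ennreal M) \<le> 2 * (\<integral>\<^sup>+y. ennreal (p y * trunc \<tau> (x - y)) \<partial>lborel)" by simp
  then have "ennreal (p x) * ennreal M \<le> (\<integral>\<^sup>+y. ennreal (p y * trunc \<tau> (x - y)) \<partial>lborel)"
    by (subst (asm) ennreal_mult_le_mult_iff) auto
  then show ?thesis by (simp add: p_def M_def)
qed (simp add: max_def)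

end

section \<open>The energy estimate for the mollified excess\<close>

context weak_setting
begin

lemma mollified_excess_nonneg:
  assumes "0 < \<delta>"
  shows "0 \<le> mollify \<delta> (excess z) x"
  unfolding mollify_def using bump_nonneg[OF assms, where 'a='a] excess_nonneg by (intro integral_nonneg_AE AE_I2) simp

text \<open>Convolution with a probability density does not increase the integral of the square.\<close>
lemma mollified_excess_square_finite:
  assumes \<delta>: "0 < \<delta>" and z: "z \<in> frontier \<Omega>"
  shows "(\<integral>\<^sup>+x. ennreal ((mollify \<delta> (excess z) x)\<^sup>2) \<partial>lborel) < \<infinity>"
proof -
  let ?e2 = "\<lambda>y. (excess z y)\<^sup>2"
  have "(\<integral>\<^sup>+x. ennreal ((mollify \<delta> (excess z) x)\<^sup>2) \<partial>lborel) \<le> (\<integral>\<^sup>+x. (\<integral>\<^sup>+y. ennreal (bump \<delta> (x - y) * ?e2 y) \<partial>lborel) \<partial>lborel)"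
  proof (rule nn_integral_mono)
    fix x
    have "(mollify \<delta> (excess z) x)\<^sup>2 \<le> mollify \<delta> ?e2 x"
      by (rule mollify_square_le[OF \<delta> excess_locally_integrable[OF z] excess_square_locally_integrable[OF z]])
    moreover have "(\<integral>\<^sup>+y. ennreal (bump \<delta> (x - y) * ?e2 y) \<partial>lborel) = ennreal (mollify \<delta> ?e2 x)"
      unfolding mollify_def using bump_nonneg[OF \<delta>, where 'a='a]
      by (intro nn_integral_eq_integral mollify_integrable[OF \<delta> excess_square_locally_integrable[OF z]] AE_I2) auto
    ultimately show "ennreal ((mollify \<delta> (excess z) x)\<^sup>2) \<le> (\<integral>\<^sup>+y. ennreal (bump \<delta> (x - y) * ?e2 y) \<partial>lborel)"
      by (simp add: ennreal_leI)
  qed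
  also have "\<dots> = (\<integral>\<^sup>+y. (\<integral>\<^sup>+x. ennreal (bump \<delta> (x - y) * ?e2 y) \<partial>lborel) \<partial>lborel)"
    by (rule lborel_pair.Fubini'[symmetric]) measurable
  also have "\<dots> = (\<integral>\<^sup>+y. ennreal (?e2 y) \<partial>lborel)"
  proof (rule nn_integral_cong)
    fix y
    have "(\<integral>\<^sup>+x. ennreal (bump \<delta> (x - y) * ?e2 y) \<partial>lborel) = (\<integral>\<^sup>+x. ennreal (?e2 y) * ennreal (bump \<delta> (y - x)) \<partial>lborel)"
    proof (rule nn_integral_cong)
      fix x
      have "bump \<delta> (x - y) * ?e2 y = ?e2 y * bump \<delta> (y - x)" by (simp only: bump_minus_commute[of \<delta> x y] mult.commute)
      then show "ennreal (bump \<delta> (x - y) * ?e2 y) = ennreal (?e2 y) * ennreal (bump \<delta> (y - x))"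
        by (simp only: ennreal_mult' zero_le_power2)
    qed
    also have "\<dots> = ennreal (?e2 y) * (\<integral>\<^sup>+x. ennreal (bump \<delta> (y - x)) \<partial>lborel)" by (rule nn_integral_cmult) measurable
    also have "(\<integral>\<^sup>+x. ennreal (bump \<delta> (y - x)) \<partial>lborel) = 1"
      by (rule bump_shift_nn_integral[OF \<delta>])
    finally show "(\<integral>\<^sup>+x. ennreal (bump \<delta> (x - y) * ?e2 y) \<partial>lborel) = ennreal (?e2 y)" by simp
  qed
  also have "\<dots> < \<infinity>" using excess_square_integrable[OF z] by (simp add: integrable_iff_bounded)
  finally show ?thesis .
qed

text \<open>The truncation error \<open>B * \<tau> powr (2 - 2 * s)\<close> has to stay below the strictness \<open>c\<close> of the barrier.\<close>
lemma small_truncation_radius: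
  assumes "0 < e" "0 \<le> B" "0 < c"
  obtains \<tau> where "0 < \<tau>" "\<tau> \<le> 1" "\<tau> < e" "B * \<tau> powr (2 - 2 * s) \<le> c"
proof -
  define q where "q = 2 - 2 * s"
  have q: "0 < q" using s by (simp add: q_def)
  define \<tau> where "\<tau> = min (min 1 (e / 2)) ((c / (B + 1)) powr (1 / q))"
  have cB: "0 < c / (B + 1)" using assms by simp
  have \<tau>: "0 < \<tau>" using assms cB by (simp add: \<tau>_def)
  have "\<tau> powr q \<le> ((c / (B + 1)) powr (1 / q)) powr q" using \<tau> q by (intro powr_mono2) (auto simp: \<tau>_def)
  also have "\<dots> = c / (B + 1)" using cB q assms by (simp add: powr_powr)
  finally have "B * \<tau> powr q \<le> B * (c / (B + 1))" using assms by (intro mult_left_mono) auto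
  also have "\<dots> \<le> c" using assms by (simp add: field_simps)
  finally show thesis using that[of \<tau>] \<tau> assms by (auto simp: \<tau>_def q_def)
qed

lemma excess_dominates: 
  assumes z: "z \<in> frontier \<Omega>"
  shows "AE x in lborel. U x - upper_barrier z x \<le> excess z x"
  using exterior
proof eventually_elim
  case (elim x)
  show ?case
  proof (cases "x \<in> \<Omega>")
    case True
    then show ?thesis by (simp add: excess_def upper_barrier_def)
  next
    case False
    then have "\<bar>U x - G z\<bar> \<le> C0 * norm (x - z) powr \<alpha>" using elim z by blast
    then show ?thesis using False by (simp add: excess_def upper_barrier_def barrier_def abs_le_iff)
  qed
qed

text \<open>The mollified difference \<open>v\<close> of solution and barrier has a positive integral of second differences for a small truncation
radius, by the strictness of the barrier, so its positive part \<open>p\<close> is a subsolution where the cutoff is positive. In the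
Caccioppoli inequality the left side is bounded below by restricting \<open>y\<close> to the complement of \<open>\<Omega>\<close>, where the cutoff
vanishes. On the right side one of the two points lies in the boundary layer, and Young's inequality with parameter
\<open>t\<close> separates the integral over the layer, which is small, from the integral over all of \<open>\<Omega>\<close>, which gets
the small factor \<open>t\<close>.\<close>
lemma mollified_excess_estimate:
  fixes z :: 'a and \<delta> :: real
  defines "v \<equiv> mollify \<delta> (\<lambda>x. U x - upper_barrier z x)"
  assumes z: "z \<in> frontier \<Omega>" and \<epsilon>: "0 < \<epsilon>" and \<delta>: "0 < \<delta>" "\<delta> < \<epsilon> / 2" and t: "0 < t" and c1: "0 < c1"
    and bar: "\<And>\<tau> x'. 0 < \<tau> \<Longrightarrow> x' \<in> \<Omega> \<Longrightarrow> \<tau> < dist_bdry x' \<Longrightarrow> (\<integral>y. sym_diff (upper_barrier z) x' y * trunc \<tau> y \<partial>lborel) \<le> - c1"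
    and D: "0 < D" "\<And>x. x \<in> \<Omega> \<Longrightarrow> dist_bdry x \<le> D" "\<And>x. x \<in> \<Omega> \<Longrightarrow> norm x \<le> D"
    and C: "C \<in> sets borel" "C \<subseteq> {x. 2 * \<epsilon> \<le> dist_bdry x}"
  shows "ennreal (killing_const * D powr (- 2 * s)) * (\<integral>\<^sup>+x. indicator C x * ennreal ((max 0 (v x))\<^sup>2) \<partial>lborel)
    \<le> 2 * (ennreal (1 / t) * (ennreal cutoff_const * (\<integral>\<^sup>+y. indicator {y. dist_bdry y < 3 * \<epsilon>} y * ennreal ((excess z y)\<^sup>2 * dist_bdry y powr (- 2 * s)) \<partial>lborel))
       + ennreal t * (ennreal cutoff_const * (\<integral>\<^sup>+y. ennreal ((excess z y)\<^sup>2 * dist_bdry y powr (- 2 * s)) \<partial>lborel)))"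
    (is "_ \<le> 2 * (ennreal (1 / t) * (_ * ?X) + ennreal t * (_ * ?Y))")
proof -
  note [measurable] = C(1)
  note ul = U_locally_integrable and bl = upper_barrier_locally_integrable[of z]
  have ubl: "locally_integrable (\<lambda>x. U x - upper_barrier z x)" by (rule locally_integrable_diff[OF ul bl])
  have vm [measurable]: "v \<in> borel_measurable borel" unfolding v_def by (rule mollify_measurable[OF \<delta>(1) ubl])
  define W where "W = mollify \<delta> (excess z)"
  have Wm [measurable]: "W \<in> borel_measurable borel" unfolding W_def by (rule mollify_measurable[OF \<delta>(1) excess_locally_integrable[OF z]])
  define p where "p = (\<lambda>x. max 0 (v x))"
  have pm [measurable]: "p \<in> borel_measurable borel" unfolding p_def by measurable
  have p0: "0 \<le> p x" for x by (simp add: p_def)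
  \<comment> \<open>The positive part of the mollified difference is at most the mollified positive part, to which the Hardy inequality applies.\<close>
  have W0: "0 \<le> W x" for x unfolding W_def by (rule mollified_excess_nonneg[OF \<delta>(1)])
  have pW: "p x \<le> W x" for x
    using mollify_mono_AE[OF \<delta>(1) ubl excess_locally_integrable[OF z] excess_dominates[OF z], of x] W0[of x]
    by (simp add: p_def v_def W_def)
  have v_eq: "v x = mollify \<delta> U x - mollify \<delta> (upper_barrier z) x" for x
    unfolding v_def by (rule mollify_diff[OF \<delta>(1) ul bl])
  obtain C2 where C2: "0 \<le> C2" "\<And>x y. norm x \<le> D \<Longrightarrow> norm y \<le> 1 \<Longrightarrow>
     \<bar>mollify \<delta> U (x + y) + mollify \<delta> U (x - y) - 2 * mollify \<delta> U x\<bar> \<le> C2 * (norm y)\<^sup>2"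
    using mollify_second_difference[OF \<delta>(1) ul, where R=D] by blast
  define B where "B = C2 * Lam * weight_const TYPE('a) s"
  have B0: "0 \<le> B" using C2 lam weight_const_pos[OF s, where 'a='a] by (simp add: B_def)
  obtain \<tau> where \<tau>: "0 < \<tau>" "\<tau> \<le> 1" "\<tau> < \<epsilon> / 2" "B * \<tau> powr (2 - 2 * s) \<le> c1"
    using small_truncation_radius[of "\<epsilon> / 2" B c1] \<epsilon> B0 c1 by auto
  define M where "M = (\<integral>y. trunc \<tau> y \<partial>lborel)"
  have Mnn: "(\<integral>\<^sup>+y. ennreal (trunc \<tau> y) \<partial>lborel) = ennreal M"
    unfolding M_def using trunc_nonneg by (intro nn_integral_eq_integral trunc_integrable[OF \<tau>(1)] AE_I2)
  have sub: "ennreal (p x) * ennreal M \<le> (\<integral>\<^sup>+y. ennreal (p y * trunc \<tau> (x - y)) \<partial>lborel)" if nz: "cutoff \<epsilon> x \<noteq> 0" for x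
  proof -
    have dx: "\<epsilon> < dist_bdry x" using cutoff_zero[OF \<epsilon>, of x] nz by force
    then have x: "x \<in> \<Omega>" using dist_bdry_zero[of x] \<epsilon> by force
    have cb: "cball x \<delta> \<subseteq> \<Omega>"
    proof
      fix y assume "y \<in> cball x \<delta>"
      then have "norm (y - x) < dist_bdry x" using dx \<delta> \<epsilon> by (simp add: dist_norm norm_minus_commute)
      then show "y \<in> \<Omega>" by (rule ball_dist_bdry)
    qed
    have sd: "\<bar>sym_diff (mollify \<delta> U) x y\<bar> \<le> C2 * (norm y)\<^sup>2" if "norm y \<le> 1" for y
      unfolding sym_diff_def by (rule C2(2)[OF D(3)[OF x] that])
    note u = mollified_solution_trunc[OF \<delta>(1) C2(1) cb \<tau>(1,2) sd]
    have dt: "\<delta> + \<tau> < dist_bdry x" using dx \<delta> \<tau> by linarith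
    note b = mollified_barrier_le[OF \<delta>(1) \<tau>(1) dt bar[OF \<tau>(1)]]
    have e: "sym_diff v x y * trunc \<tau> y = sym_diff (mollify \<delta> U) x y * trunc \<tau> y - sym_diff (mollify \<delta> (upper_barrier z)) x y * trunc \<tau> y" for y
      by (simp add: sym_diff_def v_eq algebra_simps)
    have i: "integrable lborel (\<lambda>y. sym_diff v x y * trunc \<tau> y)"
      unfolding e by (rule Bochner_Integration.integrable_diff[OF u(1) b(1)])
    have "(\<integral>y. sym_diff v x y * trunc \<tau> y \<partial>lborel)
       = (\<integral>y. sym_diff (mollify \<delta> U) x y * trunc \<tau> y \<partial>lborel) - (\<integral>y. sym_diff (mollify \<delta> (upper_barrier z)) x y * trunc \<tau> y \<partial>lborel)"
      unfolding e by (rule Bochner_Integration.integral_diff[OF u(1) b(1)])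
    then have "0 \<le> (\<integral>y. sym_diff v x y * trunc \<tau> y \<partial>lborel)" using u(2) b(2) \<tau>(4) unfolding B_def by linarith
    from positive_part_subsolution[OF vm \<tau>(1) i this] show ?thesis by (simp add: p_def M_def)
  qed
  have p2: "(\<integral>\<^sup>+x. ennreal ((p x)\<^sup>2) \<partial>lborel) < \<infinity>"
  proof -
    have "(\<integral>\<^sup>+x. ennreal ((p x)\<^sup>2) \<partial>lborel) \<le> (\<integral>\<^sup>+x. ennreal ((W x)\<^sup>2) \<partial>lborel)"
      using pW p0 by (intro nn_integral_mono ennreal_leI power_mono) auto
    also have "\<dots> < \<infinity>" unfolding W_def by (rule mollified_excess_square_finite[OF \<delta>(1) z])
    finally show ?thesis .
  qed
  let ?ch = "cutoff \<epsilon>"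
  have cacc: "(\<integral>\<^sup>+x. \<integral>\<^sup>+y. ennreal ((p x * ?ch x - p y * ?ch y)\<^sup>2 * trunc \<tau> (x - y)) \<partial>lborel \<partial>lborel)
       \<le> (\<integral>\<^sup>+x. \<integral>\<^sup>+y. ennreal (p x * p y * (?ch x - ?ch y)\<^sup>2 * trunc \<tau> (x - y)) \<partial>lborel \<partial>lborel)"
    by (rule caccioppoli_inequality[OF pm cutoff_borel trunc_borel p0 cutoff_range trunc_nonneg trunc_even Mnn p2 sub])
  have lower: "ennreal (killing_const * D powr (- 2 * s)) * (\<integral>\<^sup>+x. indicator C x * ennreal ((p x)\<^sup>2) \<partial>lborel)
     \<le> (\<integral>\<^sup>+x. \<integral>\<^sup>+y. ennreal ((p x * ?ch x - p y * ?ch y)\<^sup>2 * trunc \<tau> (x - y)) \<partial>lborel \<partial>lborel)"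
  proof -
    have "ennreal (killing_const * D powr (- 2 * s)) * (\<integral>\<^sup>+x. indicator C x * ennreal ((p x)\<^sup>2) \<partial>lborel)
      = (\<integral>\<^sup>+x. ennreal (killing_const * D powr (- 2 * s)) * (indicator C x * ennreal ((p x)\<^sup>2)) \<partial>lborel)"
      by (rule nn_integral_cmult[symmetric]) measurable
    also have "\<dots> \<le> (\<integral>\<^sup>+x. \<integral>\<^sup>+y. ennreal ((p x * ?ch x - p y * ?ch y)\<^sup>2 * trunc \<tau> (x - y)) \<partial>lborel \<partial>lborel)"
    proof (rule nn_integral_mono)
      fix x
      show "ennreal (killing_const * D powr (- 2 * s)) * (indicator C x * ennreal ((p x)\<^sup>2))
        \<le> (\<integral>\<^sup>+y. ennreal ((p x * ?ch x - p y * ?ch y)\<^sup>2 * trunc \<tau> (x - y)) \<partial>lborel)"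
      proof (cases "x \<in> C")
        case True
        then have dx: "2 * \<epsilon> \<le> dist_bdry x" using C by auto
        then have x: "x \<in> \<Omega>" using dist_bdry_zero[of x] \<epsilon> by force
        have ch1: "?ch x = 1" by (rule cutoff_one[OF \<epsilon> dx])
        have "D powr (- 2 * s) \<le> dist_bdry x powr (- 2 * s)" using D(2)[OF x] dist_bdry_pos[OF x] s by (intro powr_mono2') auto
        then have "killing_const * D powr (- 2 * s) * (p x)\<^sup>2 \<le> killing_const * dist_bdry x powr (- 2 * s) * (p x)\<^sup>2"
          using killing_const_pos by (intro mult_left_mono mult_right_mono) auto
        also have "\<dots> = killing_const * (p x)\<^sup>2 * dist_bdry x powr (- 2 * s)" by (simp only: mult_ac)
        finally have "ennreal (killing_const * D powr (- 2 * s) * (p x)\<^sup>2) \<le> ennreal (killing_const * (p x)\<^sup>2 * dist_bdry x powr (- 2 * s))"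
          by (rule ennreal_leI)
        also have "\<dots> \<le> (\<integral>\<^sup>+y. ennreal ((p x)\<^sup>2 * trunc \<tau> (x - y)) * indicator (- \<Omega>) y \<partial>lborel)"
        proof (rule exterior_integral_ge[OF x])
          show "trunc \<tau> (x - y) = k (x - y)" if "y \<notin> \<Omega>" for y
            using dist_bdry_le[OF that, of x] dx \<tau> \<epsilon> by (simp add: trunc_def)
        qed auto
        also have "\<dots> \<le> (\<integral>\<^sup>+y. ennreal ((p x * ?ch x - p y * ?ch y)\<^sup>2 * trunc \<tau> (x - y)) \<partial>lborel)"
          using cutoff_zero[OF \<epsilon>] dist_bdry_zero \<epsilon> by (intro nn_integral_mono) (auto simp: ch1 split: split_indicator)
        finally show ?thesis using True killing_const_pos by (simp add: ennreal_mult')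
      qed simp
    qed
    finally show ?thesis .
  qed
  \<comment> \<open>If both points lie outside \<open>Z\<close>, the cutoff equals 1 at both and the integrand vanishes.\<close>
  define Z where "Z = {x. dist_bdry x < 2 * \<epsilon>}"
  have Zm [measurable]: "Z \<in> sets borel"
  proof -
    have "Z = {x \<in> space borel. dist_bdry x < 2 * \<epsilon>}" by (simp add: Z_def)
    also have "\<dots> \<in> sets borel" by measurable
    finally show ?thesis .
  qed
  have Tm: "{y. dist_bdry y < 3 * \<epsilon>} \<in> sets borel"
  proof -
    have "{y. dist_bdry y < 3 * \<epsilon>} = {x \<in> space borel. dist_bdry x < 3 * \<epsilon>}" by simp
    also have "\<dots> \<in> sets borel" by measurable
    finally show ?thesis .
  qed
  define g where "g = (\<lambda>x y. ennreal ((?ch x - ?ch y)\<^sup>2 * k (x - y)))"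
  have gsym: "g x y = g y x" for x y using k_even[of "x - y"] by (simp add: g_def power2_commute)
  have gm: "(\<lambda>p. g (fst p) (snd p)) \<in> borel_measurable (lborel \<Otimes>\<^sub>M lborel)" unfolding g_def by measurable
  have gm1 [measurable]: "g x \<in> borel_measurable borel" for x unfolding g_def by measurable
  have ce: "cutoff_energy \<epsilon> x = (\<integral>\<^sup>+y. g x y \<partial>lborel)" for x by (simp add: cutoff_energy_def g_def)
  define f1 where "f1 = (\<lambda>x y. indicator Z x * (ennreal (1 / t) * (ennreal ((W x)\<^sup>2) * g x y)))"
  define f2 where "f2 = (\<lambda>x y. ennreal t * (ennreal ((W x)\<^sup>2) * g x y))"
  have f1m [measurable]: "(\<lambda>p. f1 (fst p) (snd p)) \<in> borel_measurable (lborel \<Otimes>\<^sub>M lborel)" "(\<lambda>p. f1 (snd p) (fst p)) \<in> borel_measurable (lborel \<Otimes>\<^sub>M lborel)"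
    unfolding f1_def g_def by measurable
  have f2m [measurable]: "(\<lambda>p. f2 (fst p) (snd p)) \<in> borel_measurable (lborel \<Otimes>\<^sub>M lborel)" "(\<lambda>p. f2 (snd p) (fst p)) \<in> borel_measurable (lborel \<Otimes>\<^sub>M lborel)"
    unfolding f2_def g_def by measurable
  have pt0: "ennreal (p x * p y * (?ch x - ?ch y)\<^sup>2 * trunc \<tau> (x - y)) \<le> f1 x y + f2 y x" if xZ: "x \<in> Z" for x y
  proof -
    have q: "0 \<le> (?ch x - ?ch y)\<^sup>2 * k (x - y)" using k_nonneg by simp
    have "p x * p y \<le> W x * W y" using pW p0 W0 by (intro mult_mono) auto
    also have "W x * W y \<le> (1 / t) * (W x)\<^sup>2 + t * (W y)\<^sup>2"
    proof -
      define r where "r = sqrt t"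
      have r: "0 < r" "r\<^sup>2 = t" using t by (auto simp: r_def)
      have "0 \<le> (W x / r - r * W y)\<^sup>2" by simp
      also have "\<dots> = (W x)\<^sup>2 / r\<^sup>2 - 2 * (W x * W y) + r\<^sup>2 * (W y)\<^sup>2"
        using r(1) by (simp add: power2_diff power_divide power_mult_distrib)
      finally have "2 * (W x * W y) \<le> (1 / t) * (W x)\<^sup>2 + t * (W y)\<^sup>2" using r by simp
      moreover have "0 \<le> W x * W y" using W0 by simp
      ultimately show ?thesis by linarith
    qed
    finally have "p x * p y * ((?ch x - ?ch y)\<^sup>2 * k (x - y)) \<le> ((1 / t) * (W x)\<^sup>2 + t * (W y)\<^sup>2) * ((?ch x - ?ch y)\<^sup>2 * k (x - y))"
      using q by (rule mult_right_mono)
    moreover have "p x * p y * (?ch x - ?ch y)\<^sup>2 * trunc \<tau> (x - y) \<le> p x * p y * ((?ch x - ?ch y)\<^sup>2 * k (x - y))"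
      using p0 k_nonneg by (simp add: trunc_def mult.assoc)
    ultimately have "p x * p y * (?ch x - ?ch y)\<^sup>2 * trunc \<tau> (x - y)
       \<le> (1 / t) * ((W x)\<^sup>2 * ((?ch x - ?ch y)\<^sup>2 * k (x - y))) + t * ((W y)\<^sup>2 * ((?ch x - ?ch y)\<^sup>2 * k (x - y)))"
      by (simp add: distrib_right)
    then have "ennreal (p x * p y * (?ch x - ?ch y)\<^sup>2 * trunc \<tau> (x - y))
       \<le> ennreal ((1 / t) * ((W x)\<^sup>2 * ((?ch x - ?ch y)\<^sup>2 * k (x - y))) + t * ((W y)\<^sup>2 * ((?ch x - ?ch y)\<^sup>2 * k (x - y))))" by (rule ennreal_leI)
    also have "\<dots> = ennreal ((1 / t) * ((W x)\<^sup>2 * ((?ch x - ?ch y)\<^sup>2 * k (x - y)))) + ennreal (t * ((W y)\<^sup>2 * ((?ch x - ?ch y)\<^sup>2 * k (x - y))))"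
      using t q by (intro ennreal_plus) auto
    also have "\<dots> = ennreal (1 / t) * (ennreal ((W x)\<^sup>2) * g x y) + ennreal t * (ennreal ((W y)\<^sup>2) * g x y)"
    proof -
      have E: "ennreal (a * (b * c)) = ennreal a * (ennreal b * ennreal c)" if "0 \<le> a" "0 \<le> b" for a b c :: real
        using that by (simp only: ennreal_mult')
      have t': "0 \<le> 1 / t" "0 \<le> t" using t by auto
      show ?thesis unfolding g_def by (simp only: E[OF t'(1) zero_le_power2] E[OF t'(2) zero_le_power2])
    qed
    also have "\<dots> = f1 x y + f2 y x" using xZ by (simp add: f1_def f2_def gsym[of y x])
    finally show ?thesis .
  qed
  have pt: "ennreal (p x * p y * (?ch x - ?ch y)\<^sup>2 * trunc \<tau> (x - y)) \<le> (f1 x y + f2 y x) + (f1 y x + f2 x y)" for x y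
  proof -
    consider "x \<in> Z" | "y \<in> Z" | "x \<notin> Z" "y \<notin> Z" by blast
    then show ?thesis
    proof cases
      case 1
      have "ennreal (p x * p y * (?ch x - ?ch y)\<^sup>2 * trunc \<tau> (x - y)) \<le> f1 x y + f2 y x" by (rule pt0[OF 1])
      also have "\<dots> \<le> (f1 x y + f2 y x) + (f1 y x + f2 x y)" by (rule add_increasing2) auto
      finally show ?thesis .
    next
      case 2
      have "p y * p x * (?ch y - ?ch x)\<^sup>2 * trunc \<tau> (y - x) = p x * p y * (?ch x - ?ch y)\<^sup>2 * trunc \<tau> (x - y)"
        using trunc_even[of \<tau> "x - y"] by (simp add: power2_commute mult_ac)
      then have "ennreal (p x * p y * (?ch x - ?ch y)\<^sup>2 * trunc \<tau> (x - y)) = ennreal (p y * p x * (?ch y - ?ch x)\<^sup>2 * trunc \<tau> (y - x))"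
        by (simp only:)
      also have "\<dots> \<le> f1 y x + f2 x y" by (rule pt0[OF 2])
      also have "\<dots> \<le> (f1 x y + f2 y x) + (f1 y x + f2 x y)" by (rule add_increasing) auto
      finally show ?thesis .
    next
      case 3
      then have "?ch x = 1" "?ch y = 1" using cutoff_one[OF \<epsilon>] by (auto simp: Z_def not_less)
      then show ?thesis by simp
    qed
  qed
  define I where "I = (\<lambda>f :: 'a \<Rightarrow> 'a \<Rightarrow> ennreal. \<integral>\<^sup>+q. f (fst q) (snd q) \<partial>(lborel \<Otimes>\<^sub>M lborel))"
  have I_iter: "I f = (\<integral>\<^sup>+x. \<integral>\<^sup>+y. f x y \<partial>lborel \<partial>lborel)"
    if "(\<lambda>p. f (fst p) (snd p)) \<in> borel_measurable (lborel \<Otimes>\<^sub>M lborel)" for f :: "'a \<Rightarrow> 'a \<Rightarrow> ennreal"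
    unfolding I_def using lborel.nn_integral_fst[OF that] by simp
  have I_swap: "I (\<lambda>x y. f y x) = I f"
    if m: "(\<lambda>p. f (fst p) (snd p)) \<in> borel_measurable (lborel \<Otimes>\<^sub>M lborel)"
      "(\<lambda>p. f (snd p) (fst p)) \<in> borel_measurable (lborel \<Otimes>\<^sub>M lborel)" for f :: "'a \<Rightarrow> 'a \<Rightarrow> ennreal"
    unfolding I_def using lborel.nn_integral_fst[OF m(1)] lborel_pair.nn_integral_snd[OF m(2)] by simp
  have I1: "I f1 \<le> ennreal (1 / t) * (ennreal cutoff_const * ?X)"
  proof -
    have "I f1 = (\<integral>\<^sup>+x. \<integral>\<^sup>+y. (ennreal (1 / t) * (indicator Z x * ennreal ((W x)\<^sup>2))) * g x y \<partial>lborel \<partial>lborel)"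
      unfolding I_iter[OF f1m(1)] unfolding f1_def by (intro nn_integral_cong) (simp only: mult_ac)
    also have "\<dots> = (\<integral>\<^sup>+x. ennreal (1 / t) * (indicator Z x * (ennreal ((W x)\<^sup>2) * cutoff_energy \<epsilon> x)) \<partial>lborel)"
      by (simp add: nn_integral_cmult ce mult.assoc)
    also have "\<dots> = ennreal (1 / t) * (\<integral>\<^sup>+x. indicator Z x * (ennreal ((W x)\<^sup>2) * cutoff_energy \<epsilon> x) \<partial>lborel)"
      by (rule nn_integral_cmult) measurable
    also have "\<dots> \<le> ennreal (1 / t) * (ennreal cutoff_const * ?X)"
      unfolding W_def
    proof (intro mult_left_mono cutoff_energy_mollified[OF \<epsilon> \<delta>(1) _ z Zm Tm])
      fix x y assume "x \<in> Z" "norm (x - y) < \<delta>"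
      then show "y \<in> {y. dist_bdry y < 3 * \<epsilon>}" using dist_bdry_lipschitz[of x y] \<delta> \<epsilon> by (simp add: Z_def)
    qed (use \<delta> \<epsilon> in auto)
    finally show ?thesis .
  qed
  have I2: "I f2 \<le> ennreal t * (ennreal cutoff_const * ?Y)"
  proof -
    have "I f2 = (\<integral>\<^sup>+x. \<integral>\<^sup>+y. (ennreal t * ennreal ((W x)\<^sup>2)) * g x y \<partial>lborel \<partial>lborel)"
      unfolding I_iter[OF f2m(1)] unfolding f2_def by (intro nn_integral_cong) (simp only: mult_ac)
    also have "\<dots> = (\<integral>\<^sup>+x. ennreal t * (indicator UNIV x * (ennreal ((W x)\<^sup>2) * cutoff_energy \<epsilon> x)) \<partial>lborel)"
      by (simp add: nn_integral_cmult ce mult.assoc)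
    also have "\<dots> = ennreal t * (\<integral>\<^sup>+x. indicator UNIV x * (ennreal ((W x)\<^sup>2) * cutoff_energy \<epsilon> x) \<partial>lborel)"
      by (rule nn_integral_cmult) measurable
    also have "\<dots> \<le> ennreal t * (ennreal cutoff_const * (\<integral>\<^sup>+y. indicator UNIV y * ennreal ((excess z y)\<^sup>2 * dist_bdry y powr (- 2 * s)) \<partial>lborel))"
      unfolding W_def
      by (intro mult_left_mono cutoff_energy_mollified[OF \<epsilon> \<delta>(1) _ z]) (use \<delta> \<epsilon> in auto)
    finally show ?thesis by simp
  qed
  have "(\<integral>\<^sup>+x. \<integral>\<^sup>+y. ennreal (p x * p y * (?ch x - ?ch y)\<^sup>2 * trunc \<tau> (x - y)) \<partial>lborel \<partial>lborel)
      \<le> (\<integral>\<^sup>+x. \<integral>\<^sup>+y. (f1 x y + f2 y x) + (f1 y x + f2 x y) \<partial>lborel \<partial>lborel)"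
    by (intro nn_integral_mono pt)
  also have "\<dots> = I (\<lambda>x y. (f1 x y + f2 y x) + (f1 y x + f2 x y))"
    by (rule I_iter[symmetric]) measurable
  also have "\<dots> = I (\<lambda>x y. f1 x y + f2 y x) + I (\<lambda>x y. f1 y x + f2 x y)"
    unfolding I_def by (rule nn_integral_add) measurable
  also have "I (\<lambda>x y. f1 x y + f2 y x) = I f1 + I (\<lambda>x y. f2 y x)"
    unfolding I_def by (rule nn_integral_add) measurable
  also have "I (\<lambda>x y. f1 y x + f2 x y) = I (\<lambda>x y. f1 y x) + I f2"
    unfolding I_def by (rule nn_integral_add) measurable
  also have "I (\<lambda>x y. f2 y x) = I f2" by (rule I_swap[OF f2m])
  also have "I (\<lambda>x y. f1 y x) = I f1" by (rule I_swap[OF f1m])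
  also have "(I f1 + I f2) + (I f1 + I f2) = 2 * (I f1 + I f2)" by (simp only: mult_2)
  also have "\<dots> \<le> 2 * (ennreal (1 / t) * (ennreal cutoff_const * ?X) + ennreal t * (ennreal cutoff_const * ?Y))"
    by (intro mult_left_mono add_mono I1 I2) simp
  finally have upper: "(\<integral>\<^sup>+x. \<integral>\<^sup>+y. ennreal (p x * p y * (?ch x - ?ch y)\<^sup>2 * trunc \<tau> (x - y)) \<partial>lborel \<partial>lborel)
     \<le> 2 * (ennreal (1 / t) * (ennreal cutoff_const * ?X) + ennreal t * (ennreal cutoff_const * ?Y))" .
  show ?thesis using order_trans[OF lower order_trans[OF cacc upper]] by (simp only: p_def)
qed

end

section \<open>Comparison of weak solutions with the barrier\<close>

context weak_setting
begin

text \<open>In \<open>mollified_excess_estimate\<close> choose \<open>t\<close> small first and then the width \<open>\<epsilon>\<close> of the boundary layer, over which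
the Hardy integral tends to 0 by dominated convergence. So the positive part of the mollified excess tends to 0 in
mean square on compact subsets of \<open>\<Omega>\<close>, and \<open>mollify_limit_le\<close> applies.\<close>
lemma weak_comparison:
  assumes z: "z \<in> frontier \<Omega>" and c0: "0 < c0"
    and barr: "\<And>(K :: 'a \<Rightarrow> real) x. upper_kernel s Lam K \<Longrightarrow> (\<And>y. x + y \<notin> \<Omega> \<Longrightarrow> lam * sing_kernel s y \<le> K y) \<Longrightarrow> x \<in> \<Omega> \<Longrightarrow>
       \<exists>r>0. \<exists>p c H. (\<forall>y. norm y < r \<longrightarrow> H y = p \<bullet> y + c * (norm y)\<^sup>2) \<and>
            (\<forall>y. barrier \<Omega> \<alpha> z (x + y) - barrier \<Omega> \<alpha> z x \<le> H y) \<and>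
            H \<in> borel_measurable borel \<and> integrable lebesgue (\<lambda>y. (H y + H (- y)) * K y) \<and>
            (\<integral>y. (H y + H (- y)) * K y \<partial>lebesgue) \<le> - c0 * norm (x - z) powr (\<alpha> - 2 * s)"
  shows "AE x in lborel. x \<in> \<Omega> \<longrightarrow> U x \<le> G z + 2 * C0 * norm (x - z) powr \<alpha>"
proof -
  obtain D where D: "0 < D" "\<And>x. x \<in> \<Omega> \<Longrightarrow> dist_bdry x \<le> D" "\<And>x. x \<in> \<Omega> \<Longrightarrow> norm x \<le> D" "\<And>x. x \<in> \<Omega> \<Longrightarrow> norm (x - z) \<le> D"
  proof -
    obtain D where "0 < D" "\<forall>x\<in>\<Omega>. dist_bdry x \<le> D" "\<forall>x\<in>closure \<Omega>. norm x \<le> D" "\<forall>x\<in>\<Omega>. \<forall>z\<in>frontier \<Omega>. norm (x - z) \<le> D"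
      using bounded_diam by blast
    then show thesis using closure_subset[of \<Omega>] z by (intro that[of D]) auto
  qed
  define c1 where "c1 = C0 * c0 * D powr (\<alpha> - 2 * s)"
  have c1: "0 < c1" using C0 c0 D by (simp add: c1_def)
  have bar: "(\<integral>y. sym_diff (upper_barrier z) x y * trunc \<tau> y \<partial>lborel) \<le> - c1"
    if "0 < \<tau>" "x \<in> \<Omega>" "\<tau> < dist_bdry x" for \<tau> x
    unfolding c1_def
    by (rule sym_diff_barrier_le[OF c0 that(1,3,2) z]) (use barr[OF _ _ that(2)] D(4)[OF that(2)] in blast)+
  define f where "f = (\<lambda>y. (excess z y)\<^sup>2 * dist_bdry y powr (- 2 * s))"
  have fm [measurable]: "f \<in> borel_measurable borel" unfolding f_def by measurable
  have f0: "0 \<le> f y" for y by (simp add: f_def)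
  have fi: "integrable lborel f"
    using excess_hardy[OF z] f0 by (intro integrableI_bounded) (auto simp: f_def)
  define Y where "Y = (\<integral>y. f y \<partial>lborel)"
  have Y0: "0 \<le> Y" unfolding Y_def using f0 by (intro integral_nonneg_AE AE_I2)
  have Ynn: "(\<integral>\<^sup>+y. ennreal (f y) \<partial>lborel) = ennreal Y"
    unfolding Y_def using f0 by (intro nn_integral_eq_integral fi AE_I2)
  define X where "X = (\<lambda>\<epsilon>. \<integral>y. indicator {y. dist_bdry y < 3 * \<epsilon>} y * f y \<partial>lborel)"
  have layer [measurable]: "{y. dist_bdry y < 3 * \<epsilon>} \<in> sets borel" for \<epsilon>
  proof -
    have "{y. dist_bdry y < 3 * \<epsilon>} = {x \<in> space borel. dist_bdry x < 3 * \<epsilon>}" by simp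
    also have "\<dots> \<in> sets borel" by measurable
    finally show ?thesis .
  qed
  have Xi: "integrable lborel (\<lambda>y. indicator {y. dist_bdry y < 3 * \<epsilon>} y * f y)" for \<epsilon>
    using integrable_mult_indicator[OF _ fi, of "{y. dist_bdry y < 3 * \<epsilon>}"] layer by simp
  have X0: "0 \<le> X \<epsilon>" for \<epsilon> unfolding X_def using f0 by (intro integral_nonneg_AE AE_I2) simp
  have Xnn: "(\<integral>\<^sup>+y. indicator {y. dist_bdry y < 3 * \<epsilon>} y * ennreal (f y) \<partial>lborel) = ennreal (X \<epsilon>)" for \<epsilon>
  proof -
    have "(\<integral>\<^sup>+y. indicator {y. dist_bdry y < 3 * \<epsilon>} y * ennreal (f y) \<partial>lborel)
      = (\<integral>\<^sup>+y. ennreal (indicator {y. dist_bdry y < 3 * \<epsilon>} y * f y) \<partial>lborel)"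
      by (intro nn_integral_cong) (auto split: split_indicator)
    also have "\<dots> = ennreal (X \<epsilon>)"
      unfolding X_def using f0 by (intro nn_integral_eq_integral Xi AE_I2) simp
    finally show ?thesis .
  qed
  have Xlim: "(\<lambda>n. X (1 / real (Suc n))) \<longlonglongrightarrow> 0"
  proof -
    have "(\<lambda>n. \<integral>y. indicator {y. dist_bdry y < 3 * (1 / real (Suc n))} y * f y \<partial>lborel) \<longlonglongrightarrow> (\<integral>y. 0 \<partial>(lborel :: 'a measure))"
    proof (rule integral_dominated_convergence[where w=f])
      show "AE y in lborel. (\<lambda>n. indicator {y. dist_bdry y < 3 * (1 / real (Suc n))} y * f y) \<longlonglongrightarrow> 0"
      proof (rule AE_I2)
        fix y
        show "(\<lambda>n. indicator {y. dist_bdry y < 3 * (1 / real (Suc n))} y * f y) \<longlonglongrightarrow> 0"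
        proof (cases "y \<in> \<Omega>")
          case True
          then have d: "0 < dist_bdry y" by (rule dist_bdry_pos)
          obtain n0 where n0: "3 / dist_bdry y < real n0" using reals_Archimedean2 by blast
          have "indicator {y. dist_bdry y < 3 * (1 / real (Suc n))} y * f y = 0" if "n0 \<le> n" for n
          proof -
            have "3 / dist_bdry y < real (Suc n)" using n0 that by linarith
            then have "3 < dist_bdry y * real (Suc n)" using d by (simp add: divide_less_eq mult.commute)
            then have "3 * (1 / real (Suc n)) < dist_bdry y" by (simp add: divide_less_eq)
            then show ?thesis by simp
          qed
          then have "\<forall>\<^sub>F n in sequentially. indicator {y. dist_bdry y < 3 * (1 / real (Suc n))} y * f y = 0"
            using eventually_sequentially by blast
          then show ?thesis by (rule tendsto_eventually)
        qed (simp add: f_def excess_def)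
      qed
      show "AE y in lborel. norm (indicator {y. dist_bdry y < 3 * (1 / real (Suc n))} y * f y) \<le> f y" for n
        using f0 by (intro AE_I2) (auto split: split_indicator)
    qed (use fi layer in auto)
    then show ?thesis by (simp add: X_def)
  qed
  define v where "v = (\<lambda>x. U x - upper_barrier z x)"
  have vl: "locally_integrable v" unfolding v_def by (rule locally_integrable_diff[OF U_locally_integrable upper_barrier_locally_integrable])
  have "AE x in lborel. x \<in> \<Omega> \<longrightarrow> v x \<le> 0"
  proof (rule mollify_limit_le[OF \<Omega>(1,2) vl])
    show "locally_integrable (\<lambda>_. 0 :: real)" by (rule locally_integrable_continuous) simp
    fix C :: "'a set" and e :: real
    assume C: "compact C" "C \<subseteq> \<Omega>" and e: "0 < e"
    have Cm [measurable]: "C \<in> sets borel" using C by (simp add: compact_imp_closed)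
    have Cfin: "emeasure lborel C < \<infinity>" by (rule emeasure_bounded_finite[OF compact_imp_bounded[OF C(1)]])
    define m where "m = measure lborel C"
    have m0: "0 \<le> m" by (simp add: m_def)
    \<comment> \<open>From mean square to mean on \<open>C\<close>: \<open>p \<le> \<eta> + p\<^sup>2 / \<eta>\<close>, each term contributing at most \<open>e / 2\<close>.\<close>
    define \<eta> where "\<eta> = e / (2 * (m + 1))"
    have \<eta>: "0 < \<eta>" "\<eta> * m \<le> e / 2" using e m0 by (auto simp: \<eta>_def field_simps)
    define e' where "e' = \<eta> * (e / 2)"
    have e': "0 < e'" using \<eta> e by (simp add: e'_def)
    define kD where "kD = killing_const * D powr (- 2 * s)"
    have kD: "0 < kD" using killing_const_pos D by (simp add: kD_def)
    note cc = cutoff_const_pos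
    define t where "t = kD * e' / (4 * cutoff_const * (Y + 1))"
    have t: "0 < t" using kD e' cc Y0 by (simp add: t_def)
    have tY: "2 * (t * (cutoff_const * Y)) \<le> kD * e' / 2"
    proof -
      have quot: "2 * (a / (4 * b * c) * (b * c)) = a / 2" if "b \<noteq> 0" "c \<noteq> 0" for a b c :: real
        using that by (simp add: field_simps)
      have "2 * (t * (cutoff_const * (Y + 1))) = kD * e' / 2"
        unfolding t_def by (rule quot) (use cc Y0 in auto)
      moreover have "t * (cutoff_const * Y) \<le> t * (cutoff_const * (Y + 1))" using t cc by (intro mult_left_mono) auto
      ultimately show ?thesis by linarith
    qed
    obtain e0 where e0: "0 < e0" "C \<subseteq> {x. 2 * e0 \<le> dist_bdry x}"
    proof (cases "C = {}")
      case False
      have "continuous_on C dist_bdry" unfolding dist_bdry_def by (intro continuous_intros)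
      then obtain x0 where x0: "x0 \<in> C" "\<And>x. x \<in> C \<Longrightarrow> dist_bdry x0 \<le> dist_bdry x"
        using continuous_attains_inf[OF C(1) False] by blast
      have "0 < dist_bdry x0" using x0 C dist_bdry_pos by blast
      then show thesis using x0 by (intro that[of "dist_bdry x0 / 2"]) auto
    qed (use that[of 1] in auto)
    define \<theta> where "\<theta> = kD * e' * t / (4 * cutoff_const)"
    have \<theta>: "0 < \<theta>" using kD e' t cc by (simp add: \<theta>_def)
    have "\<forall>\<^sub>F n in sequentially. X (1 / real (Suc n)) < \<theta>" using Xlim \<theta> by (rule order_tendstoD)
    moreover have "\<forall>\<^sub>F n in sequentially. 1 / real (Suc n) < e0"
      using LIMSEQ_inverse_real_of_nat e0(1) by (simp add: order_tendstoD inverse_eq_divide)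
    ultimately have "\<forall>\<^sub>F n in sequentially. X (1 / real (Suc n)) < \<theta> \<and> 1 / real (Suc n) < e0" by (rule eventually_conj)
    then obtain n where n: "X (1 / real (Suc n)) < \<theta>" "1 / real (Suc n) < e0"
      unfolding eventually_sequentially by blast
    define \<epsilon> where "\<epsilon> = 1 / real (Suc n)"
    have \<epsilon>: "0 < \<epsilon>" "X \<epsilon> < \<theta>" "\<epsilon> < e0" using n by (auto simp: \<epsilon>_def)
    have C\<epsilon>: "C \<subseteq> {x. 2 * \<epsilon> \<le> dist_bdry x}" using e0 \<epsilon> by force
    have tX: "2 * ((1 / t) * (cutoff_const * X \<epsilon>)) \<le> kD * e' / 2"
    proof -
      have "2 * ((1 / t) * (cutoff_const * X \<epsilon>)) \<le> 2 * ((1 / t) * (cutoff_const * \<theta>))"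
        using \<epsilon> t cc by (intro mult_left_mono) auto
      also have "\<dots> = kD * e' / 2" using t cc by (simp add: \<theta>_def field_simps)
      finally show ?thesis .
    qed
    show "\<exists>d>0. \<forall>\<delta>. 0 < \<delta> \<and> \<delta> < d \<longrightarrow> (\<integral>x. indicator C x * max 0 (mollify \<delta> v x - 0) \<partial>lborel) \<le> e"
    proof (intro exI[of _ "\<epsilon> / 2"] conjI allI impI)
      show "0 < \<epsilon> / 2" using \<epsilon> by simp
      fix \<delta> assume "0 < \<delta> \<and> \<delta> < \<epsilon> / 2"
      then have \<delta>: "0 < \<delta>" "\<delta> < \<epsilon> / 2" by auto
      define p where "p = (\<lambda>x. max 0 (mollify \<delta> v x))"
      have mc: "continuous_on UNIV (mollify \<delta> v)" by (rule mollify_continuous[OF \<delta>(1) vl])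
      have pc: "continuous_on UNIV p" unfolding p_def by (intro continuous_intros mc)
      have p0: "0 \<le> p x" for x by (simp add: p_def)
      have [measurable]: "p \<in> borel_measurable borel" by (rule borel_measurable_continuous_onI[OF pc])
      have pi: "integrable lborel (\<lambda>x. indicator C x * p x)"
        using borel_integrable_compact[OF C(1) continuous_on_subset[OF pc]] by (simp add: set_integrable_def)
      have p2i: "integrable lborel (\<lambda>x. indicator C x * (p x)\<^sup>2)"
        using borel_integrable_compact[OF C(1), of "\<lambda>x. (p x)\<^sup>2"] continuous_on_subset[OF pc, of C]
        by (simp add: set_integrable_def continuous_on_power)
      define Q where "Q = (\<integral>x. indicator C x * (p x)\<^sup>2 \<partial>lborel)"
      have Q0: "0 \<le> Q" unfolding Q_def by (intro integral_nonneg_AE AE_I2) simp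
      have Qnn: "(\<integral>\<^sup>+x. indicator C x * ennreal ((p x)\<^sup>2) \<partial>lborel) = ennreal Q"
      proof -
        have "(\<integral>\<^sup>+x. indicator C x * ennreal ((p x)\<^sup>2) \<partial>lborel) = (\<integral>\<^sup>+x. ennreal (indicator C x * (p x)\<^sup>2) \<partial>lborel)"
          by (intro nn_integral_cong) (auto split: split_indicator)
        also have "\<dots> = ennreal Q" unfolding Q_def by (intro nn_integral_eq_integral p2i AE_I2) simp
        finally show ?thesis .
      qed
      have "ennreal kD * (\<integral>\<^sup>+x. indicator C x * ennreal ((p x)\<^sup>2) \<partial>lborel)
        \<le> 2 * (ennreal (1 / t) * (ennreal cutoff_const * ennreal (X \<epsilon>)) + ennreal t * (ennreal cutoff_const * ennreal Y))"
        using mollified_excess_estimate[OF z \<epsilon>(1) \<delta> t c1 bar D(1-3) Cm C\<epsilon>] Xnn[of \<epsilon>] Ynn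
        unfolding p_def kD_def v_def f_def by simp
      also have "\<dots> = ennreal (2 * ((1 / t) * (cutoff_const * X \<epsilon>)) + 2 * (t * (cutoff_const * Y)))"
      proof -
        have a: "ennreal (1 / t) * (ennreal cutoff_const * ennreal (X \<epsilon>)) = ennreal ((1 / t) * (cutoff_const * X \<epsilon>))"
          using t cc by (simp only: ennreal_mult' less_imp_le zero_le_divide_1_iff)
        have b: "ennreal t * (ennreal cutoff_const * ennreal Y) = ennreal (t * (cutoff_const * Y))"
          using t cc by (simp only: ennreal_mult' less_imp_le)
        have "ennreal ((1 / t) * (cutoff_const * X \<epsilon>)) + ennreal (t * (cutoff_const * Y)) = ennreal ((1 / t) * (cutoff_const * X \<epsilon>) + t * (cutoff_const * Y))"
          using t cc X0[of \<epsilon>] Y0 by (intro ennreal_plus[symmetric]) auto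
        then have "2 * (ennreal ((1 / t) * (cutoff_const * X \<epsilon>)) + ennreal (t * (cutoff_const * Y))) = ennreal 2 * ennreal ((1 / t) * (cutoff_const * X \<epsilon>) + t * (cutoff_const * Y))"
          by simp
        also have "\<dots> = ennreal (2 * ((1 / t) * (cutoff_const * X \<epsilon>) + t * (cutoff_const * Y)))" by (rule ennreal_mult'[symmetric]) simp
        finally show ?thesis unfolding a b by (simp only: distrib_left)
      qed
      also have "\<dots> \<le> ennreal (kD * e')" using tX tY by (intro ennreal_leI) linarith
      finally have "ennreal kD * ennreal Q \<le> ennreal (kD * e')" unfolding Qnn .
      then have "ennreal (kD * Q) \<le> ennreal (kD * e')" using kD by (simp only: ennreal_mult' less_imp_le)
      then have "kD * Q \<le> kD * e'" using kD e' by (simp add: ennreal_le_iff)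
      then have Qe: "Q \<le> e'" using kD by simp
      have "(\<integral>x. indicator C x * p x \<partial>lborel) \<le> (\<integral>x. \<eta> * indicator C x + (1 / \<eta>) * (indicator C x * (p x)\<^sup>2) \<partial>lborel)"
      proof (rule integral_mono[OF pi])
        have iC: "integrable lborel (\<lambda>x. indicator C x :: real)" using Cfin by (intro integrable_real_indicator) auto
        show "integrable lborel (\<lambda>x. \<eta> * indicator C x + (1 / \<eta>) * (indicator C x * (p x)\<^sup>2))"
          using iC p2i by (intro Bochner_Integration.integrable_add integrable_mult_right)
        fix x
        have "p x \<le> \<eta> + (1 / \<eta>) * (p x)\<^sup>2"
        proof (cases "p x \<le> \<eta>")
          case True
          then show ?thesis using \<eta> by (simp add: add_increasing2)
        next
          case False
          then have "\<eta> * p x \<le> p x * p x" using p0[of x] by (intro mult_right_mono) auto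
          then have "p x \<le> (1 / \<eta>) * (p x)\<^sup>2" using \<eta> by (simp add: power2_eq_square field_simps)
          then show ?thesis using \<eta> by simp
        qed
        then show "indicator C x * p x \<le> \<eta> * indicator C x + (1 / \<eta>) * (indicator C x * (p x)\<^sup>2)"
          by (simp split: split_indicator)
      qed
      also have "\<dots> = \<eta> * m + (1 / \<eta>) * Q"
      proof -
        have iC: "integrable lborel (\<lambda>x. indicator C x :: real)" using Cfin by (intro integrable_real_indicator) auto
        have "(\<integral>x. \<eta> * indicator C x + (1 / \<eta>) * (indicator C x * (p x)\<^sup>2) \<partial>lborel)
          = (\<integral>x. \<eta> * indicator C x \<partial>lborel) + (\<integral>x. (1 / \<eta>) * (indicator C x * (p x)\<^sup>2) \<partial>lborel)"
          using iC p2i by (intro Bochner_Integration.integral_add integrable_mult_right)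
        then show ?thesis by (simp add: Q_def m_def)
      qed
      also have "\<dots> \<le> e / 2 + e / 2"
      proof (rule add_mono[OF \<eta>(2)])
        have "(1 / \<eta>) * Q \<le> (1 / \<eta>) * e'" using Qe \<eta> by (intro mult_left_mono) auto
        also have "\<dots> = e / 2" using \<eta> by (simp add: e'_def)
        finally show "(1 / \<eta>) * Q \<le> e / 2" .
      qed
      finally show "(\<integral>x. indicator C x * max 0 (mollify \<delta> v x - 0) \<partial>lborel) \<le> e" by (simp add: p_def)
    qed
  qed
  then show ?thesis
    by eventually_elim (auto simp: v_def upper_barrier_def barrier_def)
qed

end

section \<open>The continuous representative of a weak solution\<close>

text \<open>A Borel version of \<open>K\<close>, clamped between the two bounds and symmetrised, so that the bounds and the symmetry hold
everywhere and not only almost everywhere.\<close>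
lemma kernel_borel_version:
  fixes K :: "'a::euclidean_space \<Rightarrow> real"
  assumes adm: "admissible_kernel s lam Lam K" and lam: "0 < lam" "lam \<le> Lam"
  obtains k where "k \<in> borel_measurable borel" "\<And>y. k (- y) = k y" "\<And>y. lam * sing_kernel s y \<le> k y"
    "\<And>y. k y \<le> Lam * sing_kernel s y" "AE y in lborel. K y = k y"
proof -
  have Km: "K \<in> borel_measurable lebesgue" using adm by (simp add: admissible_kernel_def)
  obtain k0 where k0: "k0 \<in> borel_measurable borel" "AE y in lborel. K y = k0 y"
    using completion_ex_borel_measurable_real[OF Km] by auto
  define m where "m = (\<lambda>y. min (Lam * sing_kernel s y) (max (lam * sing_kernel s y) (k0 y)))"
  define k where "k = (\<lambda>y. (m y + m (- y)) / 2)"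
  have le: "lam * sing_kernel s y \<le> Lam * sing_kernel s y" for y :: 'a
    using lam sing_kernel_nonneg by (intro mult_right_mono) auto
  have mb: "lam * sing_kernel s y \<le> m y" "m y \<le> Lam * sing_kernel s y" for y using le[of y] by (auto simp: m_def)
  have mm: "m \<in> borel_measurable borel" unfolding m_def using k0(1) by measurable
  have mm': "(\<lambda>y. m (- y)) \<in> borel_measurable borel" by (rule measurable_compose[OF _ mm]) simp
  show thesis
  proof (rule that[of k])
    show "k \<in> borel_measurable borel" unfolding k_def using mm mm' by simp
    show "k (- y) = k y" for y by (simp add: k_def add.commute)
    show "lam * sing_kernel s y \<le> k y" for y using mb(1)[of y] mb(1)[of "- y"] by (simp add: k_def)
    show "k y \<le> Lam * sing_kernel s y" for y using mb(2)[of y] mb(2)[of "- y"] by (simp add: k_def)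
    have "AE y in lborel. K (- y) = k0 (- y)" using AE_lborel_reflect[OF k0(2), of 0] by simp
    then show "AE y in lborel. K y = k y"
      using k0(2) AE_lborel_singleton[of 0]
    proof eventually_elim
      case (elim y)
      have K: "K (- y) = K y" "K y \<le> Lam * sing_kernel s y"
        using admissible_kernelD(1)[OF adm lam(1)] elim(3) by (auto simp: upper_kernel_def)
      have Kl: "lam * sing_kernel s y \<le> K y" using admissible_kernelD(2)[OF adm lam(1)] elim(3) by blast
      have "m y = K y" using K Kl elim(2) by (simp add: m_def)
      moreover have "m (- y) = K y" using K Kl elim(1) by (simp add: m_def)
      ultimately show ?case by (simp add: k_def)
    qed
  qed
qed

lemma weak_solution_setting:
  fixes \<Omega> :: "'a::euclidean_space set"
  assumes s: "0 < s" "s < 1" and lam: "0 < lam" "lam \<le> Lam" and \<kappa>: "0 < \<kappa>" "\<kappa> \<le> 1"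
    and \<Omega>: "open \<Omega>" "bounded \<Omega>" "\<Omega> \<noteq> {}" "exterior_corkscrew \<kappa> \<Omega>"
    and \<alpha>: "0 < \<alpha>" "\<alpha> \<le> 1 / 2" "\<alpha> \<le> s / 2" and C0: "0 < C0" and adm: "admissible_kernel s lam Lam K"
    and g: "\<forall>x\<in>-\<Omega>. \<forall>z\<in>frontier \<Omega>. \<bar>g x - g z\<bar> \<le> C0 * norm (x - z) powr \<alpha>"
    and weak: "weak_solution K \<Omega> g u"
  obtains k U where "weak_setting s lam Lam \<kappa> C0 \<alpha> k \<Omega> U g" "AE x in lborel. u x = U x"
proof -
  obtain k where k: "k \<in> borel_measurable borel" "\<And>y. k (- y) = k y" "\<And>y. lam * sing_kernel s y \<le> k y"
    "\<And>y. k y \<le> Lam * sing_kernel s y" "AE y in lborel. K y = k y"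
    using kernel_borel_version[OF adm lam] by blast
  have um: "u \<in> borel_measurable lebesgue" and ug: "\<And>x. x \<notin> \<Omega> \<Longrightarrow> u x = g x"
    using weak by (auto simp: weak_solution_def)
  obtain U where U: "U \<in> borel_measurable borel" "AE x in lborel. u x = U x"
    using completion_ex_borel_measurable_real[OF um] by auto
  note [measurable] = k(1) U(1)
  have pairU: "AE p in lborel \<Otimes>\<^sub>M lborel. u (fst p) = U (fst p) \<and> u (snd p) = U (snd p) \<and> u (fst p - snd p) = U (fst p - snd p)"
    by (rule AE_pair_fst_snd_diff[OF U(2)])
  have pairK: "AE p in lborel \<Otimes>\<^sub>M lborel. K (fst p) = k (fst p) \<and> K (snd p) = k (snd p) \<and> K (fst p - snd p) = k (fst p - snd p)"
    by (rule AE_pair_fst_snd_diff[OF k(5)])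
  have "weak_setting s lam Lam \<kappa> C0 \<alpha> k \<Omega> U g"
  proof
    have "(\<integral>\<^sup>+p. ennreal (\<bar>U (fst p) - U (snd p)\<bar>\<^sup>2 * k (fst p - snd p)) * indicator (energy_region \<Omega>) p \<partial>(lborel \<Otimes>\<^sub>M lborel))
      = (\<integral>\<^sup>+p. ennreal (\<bar>u (fst p) - u (snd p)\<bar>\<^sup>2 * K (fst p - snd p)) * indicator (energy_region \<Omega>) p \<partial>(lborel \<Otimes>\<^sub>M lborel))"
      using pairU pairK by (intro nn_integral_cong_AE) (auto elim: eventually_elim2)
    also have "\<dots> = (\<integral>\<^sup>+p. ennreal (\<bar>u (fst p) - u (snd p)\<bar>\<^sup>2 * K (fst p - snd p)) * indicator (energy_region \<Omega>) p \<partial>lebesgue)"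
      by (simp add: nn_integral_completion lborel_prod)
    also have "\<dots> < \<infinity>" using weak by (simp add: weak_solution_def energy_region_def)
    finally show "(\<integral>\<^sup>+p. ennreal (\<bar>U (fst p) - U (snd p)\<bar>\<^sup>2 * k (fst p - snd p)) * indicator (energy_region \<Omega>) p \<partial>(lborel \<Otimes>\<^sub>M lborel)) < \<infinity>" .
    show "(\<integral>p. (U (fst p) - U (snd p)) * (\<eta> (fst p) - \<eta> (snd p)) * k (fst p - snd p) \<partial>(lborel \<Otimes>\<^sub>M lborel)) = 0"
      if \<eta>: "\<eta> \<in> test_functions \<Omega>" for \<eta>
    proof -
      have "Ck_closure 0 UNIV \<eta>" using \<eta> by (simp add: test_functions_def)
      then have [measurable]: "\<eta> \<in> borel_measurable borel" by (intro borel_measurable_continuous_onI) simp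
      let ?F = "\<lambda>p. (U (fst p) - U (snd p)) * (\<eta> (fst p) - \<eta> (snd p)) * k (fst p - snd p)"
      let ?f = "\<lambda>p. (u (fst p) - u (snd p)) * (\<eta> (fst p) - \<eta> (snd p)) * K (fst p - snd p)"
      have Fm: "?F \<in> borel_measurable (lborel \<Otimes>\<^sub>M lborel)" by measurable
      have ae: "AE p in lborel \<Otimes>\<^sub>M lborel. ?f p = ?F p" using pairU pairK by eventually_elim simp
      have fm: "?f \<in> borel_measurable (completion (lborel \<Otimes>\<^sub>M lborel))" by (rule measurable_completion_cong_AE[OF Fm ae])
      have "integral\<^sup>L (lborel \<Otimes>\<^sub>M lborel) ?F = integral\<^sup>L (completion (lborel \<Otimes>\<^sub>M lborel)) ?F"
        by (rule integral_completion[OF Fm, symmetric])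
      also have "\<dots> = integral\<^sup>L (completion (lborel \<Otimes>\<^sub>M lborel)) ?f"
        using AE_completion[OF ae] by (intro integral_cong_AE fm measurable_completion[OF Fm]) (auto elim!: eventually_mono)
      also have "\<dots> = 0" using weak \<eta> by (simp add: weak_solution_def lborel_prod)
      finally show ?thesis .
    qed
    show "AE y in lborel. y \<notin> \<Omega> \<longrightarrow> (\<forall>z\<in>frontier \<Omega>. \<bar>U y - g z\<bar> \<le> C0 * norm (y - z) powr \<alpha>)"
      using U(2)
    proof eventually_elim
      case (elim y)
      show ?case using g ug[of y] elim by auto
    qed
  qed (use s lam \<kappa> \<Omega> \<alpha> C0 k U in auto)
  then show thesis using U(2) by (rule that)
qed

context weak_setting
begin

text \<open>The average of a function over a ball of radius \<open>\<delta>\<close> inherits its bound with \<open>norm (x - z)\<close> enlarged by \<open>\<delta>\<close>.\<close>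
lemma mollified_boundary_growth:
  assumes z: "z \<in> frontier \<Omega>" and \<delta>: "0 < \<delta>"
    and up: "AE x in lborel. x \<in> \<Omega> \<longrightarrow> U x \<le> G z + 2 * C0 * norm (x - z) powr \<alpha>"
    and low: "AE x in lborel. x \<in> \<Omega> \<longrightarrow> - U x \<le> - G z + 2 * C0 * norm (x - z) powr \<alpha>"
  shows "\<bar>mollify \<delta> U x - G z\<bar> \<le> 2 * C0 * (norm (x - z) + \<delta>) powr \<alpha>"
proof (rule mollify_abs_diff_le[OF \<delta> U_locally_integrable])
  show "AE w in lborel. norm (w - x) < \<delta> \<longrightarrow> \<bar>U w - G z\<bar> \<le> 2 * C0 * (norm (x - z) + \<delta>) powr \<alpha>"
    using up low exterior
  proof eventually_elim
    case (elim w)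
    show ?case
    proof
      assume w: "norm (w - x) < \<delta>"
      have "norm (w - z) \<le> norm (w - x) + norm (x - z)" using norm_triangle_ineq[of "w - x" "x - z"] by simp
      then have "norm (w - z) powr \<alpha> \<le> (norm (x - z) + \<delta>) powr \<alpha>" using w \<alpha> by (intro powr_mono2) auto
      then have m: "2 * C0 * norm (w - z) powr \<alpha> \<le> 2 * C0 * (norm (x - z) + \<delta>) powr \<alpha>" using C0 by (intro mult_left_mono) auto
      have "\<bar>U w - G z\<bar> \<le> 2 * C0 * norm (w - z) powr \<alpha>"
      proof (cases "w \<in> \<Omega>")
        case True
        then show ?thesis using elim(1,2) by linarith
      next
        case False
        then have "\<bar>U w - G z\<bar> \<le> C0 * norm (w - z) powr \<alpha>" using elim(3) z by blast
        also have "\<dots> \<le> 2 * C0 * norm (w - z) powr \<alpha>" using C0 by (intro mult_right_mono) auto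
        finally show ?thesis .
      qed
      then show "\<bar>U w - G z\<bar> \<le> 2 * C0 * (norm (x - z) + \<delta>) powr \<alpha>" using m by linarith
    qed
  qed
qed

text \<open>The mollifications at scales \<open>\<delta>\<close> and \<open>\<epsilon>\<close> both differ from the iterated mollification by at most
\<open>32 * C0 * \<epsilon> powr \<alpha>\<close> and \<open>32 * C0 * \<delta> powr \<alpha>\<close>, by the uniform Hoelder bound. Hence they form a Cauchy sequence,
and the limit inherits both estimates.\<close>
lemma continuous_representative:
  assumes grow: "\<And>z \<delta> x. z \<in> frontier \<Omega> \<Longrightarrow> 0 < \<delta> \<Longrightarrow> \<bar>mollify \<delta> U x - G z\<bar> \<le> 2 * C0 * (norm (x - z) + \<delta>) powr \<alpha>"
    and holder: "\<And>x y \<delta>. x \<in> \<Omega> \<Longrightarrow> 0 < \<delta> \<Longrightarrow> \<delta> < dist_bdry x / 2 \<Longrightarrow> y \<in> ball x (dist_bdry x / 2) \<Longrightarrow>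
       \<bar>mollify \<delta> U y - mollify \<delta> U x\<bar> \<le> 32 * C0 * norm (y - x) powr \<alpha>"
  obtains r where "AE x in lborel. x \<in> \<Omega> \<longrightarrow> r x = U x"
    "\<And>x z. x \<in> \<Omega> \<Longrightarrow> z \<in> frontier \<Omega> \<Longrightarrow> \<bar>r x - G z\<bar> \<le> 2 * C0 * norm (x - z) powr \<alpha>"
    "\<And>x y. x \<in> \<Omega> \<Longrightarrow> y \<in> ball x (dist_bdry x / 2) \<Longrightarrow> \<bar>r y - r x\<bar> \<le> 32 * C0 * norm (y - x) powr \<alpha>"
proof -
  define u where "u = (\<lambda>n::nat. mollify (1 / real (Suc n)) U)"
  have \<delta>n: "0 < 1 / real (Suc n)" for n by simp
  have \<delta>lim: "(\<lambda>n. 1 / real (Suc n)) \<longlonglongrightarrow> 0" using LIMSEQ_inverse_real_of_nat by (simp add: inverse_eq_divide)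
  have powlim: "(\<lambda>n. 32 * C0 * (1 / real (Suc n)) powr \<alpha>) \<longlonglongrightarrow> 0"
  proof -
    have "(\<lambda>n. (1 / real (Suc n)) powr \<alpha>) \<longlonglongrightarrow> 0 powr \<alpha>" using \<alpha> by (intro tendsto_powr' \<delta>lim tendsto_const) auto
    then show ?thesis using tendsto_mult_right_zero[of _ _ "32 * C0"] \<alpha> by simp
  qed
  have cau: "\<bar>mollify \<delta> U x - mollify \<epsilon> U x\<bar> \<le> 32 * C0 * \<delta> powr \<alpha> + 32 * C0 * \<epsilon> powr \<alpha>"
    if x: "x \<in> \<Omega>" and d: "0 < \<delta>" "\<delta> < dist_bdry x / 2" "0 < \<epsilon>" "\<epsilon> < dist_bdry x / 2" for x \<delta> \<epsilon>
  proof -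
    have A: "\<bar>mollify \<epsilon> (mollify \<delta> U) x - mollify \<delta> U x\<bar> \<le> 32 * C0 * \<epsilon> powr \<alpha>"
      if d: "0 < \<delta>" "\<delta> < dist_bdry x / 2" "0 < \<epsilon>" "\<epsilon> < dist_bdry x / 2" for \<delta> \<epsilon>
    proof (rule mollify_abs_diff_le[OF d(3) locally_integrable_continuous[OF mollify_continuous[OF d(1) U_locally_integrable]] AE_I2], rule impI)
      fix w assume w: "norm (w - x) < \<epsilon>"
      have "\<bar>mollify \<delta> U w - mollify \<delta> U x\<bar> \<le> 32 * C0 * norm (w - x) powr \<alpha>"
        using w d by (intro holder[OF x d(1,2)]) (simp add: dist_norm norm_minus_commute)
      also have "\<dots> \<le> 32 * C0 * \<epsilon> powr \<alpha>" using w C0 \<alpha> by (intro mult_left_mono powr_mono2) auto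
      finally show "\<bar>mollify \<delta> U w - mollify \<delta> U x\<bar> \<le> 32 * C0 * \<epsilon> powr \<alpha>" .
    qed
    have "mollify \<epsilon> (mollify \<delta> U) x = mollify \<delta> (mollify \<epsilon> U) x" by (rule mollify_commute[OF d(3,1) U_locally_integrable])
    then show ?thesis using A[OF d] A[OF d(3,4,1,2)] by linarith
  qed
  have small: "\<exists>N. \<forall>n\<ge>N. 1 / real (Suc n) < dist_bdry x / 2" if "x \<in> \<Omega>" for x
    using order_tendstoD(2)[OF \<delta>lim, of "dist_bdry x / 2"] dist_bdry_pos[OF that] by (simp add: eventually_sequentially)
  have conv: "convergent (\<lambda>n. u n x)" if x: "x \<in> \<Omega>" for x
  proof (rule Cauchy_convergent, rule CauchyI)
    fix e :: real assume e: "0 < e"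
    obtain N1 where N1: "\<forall>n\<ge>N1. 1 / real (Suc n) < dist_bdry x / 2" using small[OF x] by blast
    obtain N2 where N2: "\<forall>n\<ge>N2. 32 * C0 * (1 / real (Suc n)) powr \<alpha> < e / 2"
      using order_tendstoD(2)[OF powlim, of "e / 2"] e by (auto simp: eventually_sequentially)
    show "\<exists>M. \<forall>m\<ge>M. \<forall>n\<ge>M. norm (u m x - u n x) < e"
    proof (intro exI[of _ "max N1 N2"] allI impI)
      fix m n assume "max N1 N2 \<le> m" "max N1 N2 \<le> n"
      then have h: "1 / real (Suc m) < dist_bdry x / 2" "1 / real (Suc n) < dist_bdry x / 2"
        "32 * C0 * (1 / real (Suc m)) powr \<alpha> < e / 2" "32 * C0 * (1 / real (Suc n)) powr \<alpha> < e / 2"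
        using N1 N2 by auto
      have "norm (u m x - u n x) \<le> 32 * C0 * (1 / real (Suc m)) powr \<alpha> + 32 * C0 * (1 / real (Suc n)) powr \<alpha>"
        unfolding u_def real_norm_def by (rule cau[OF x \<delta>n h(1) \<delta>n h(2)])
      then show "norm (u m x - u n x) < e" using h(3,4) by linarith
    qed
  qed
  define r where "r = (\<lambda>x. lim (\<lambda>n. u n x))"
  have lim: "(\<lambda>n. u n x) \<longlonglongrightarrow> r x" if "x \<in> \<Omega>" for x
    using conv[OF that] by (simp add: r_def convergent_LIMSEQ_iff)
  have near: "\<bar>mollify \<delta> U x - r x\<bar> \<le> 32 * C0 * \<delta> powr \<alpha>" if x: "x \<in> \<Omega>" and d: "0 < \<delta>" "\<delta> < dist_bdry x / 2" for x \<delta>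
  proof (rule LIMSEQ_le)
    show "(\<lambda>n. \<bar>mollify \<delta> U x - u n x\<bar>) \<longlonglongrightarrow> \<bar>mollify \<delta> U x - r x\<bar>" by (intro tendsto_intros lim x)
    show "(\<lambda>n. 32 * C0 * \<delta> powr \<alpha> + 32 * C0 * (1 / real (Suc n)) powr \<alpha>) \<longlonglongrightarrow> 32 * C0 * \<delta> powr \<alpha>"
      using tendsto_add[OF tendsto_const powlim, of "32 * C0 * \<delta> powr \<alpha>"] by simp
    show "\<exists>N. \<forall>n\<ge>N. \<bar>mollify \<delta> U x - u n x\<bar> \<le> 32 * C0 * \<delta> powr \<alpha> + 32 * C0 * (1 / real (Suc n)) powr \<alpha>"
      using small[OF x] cau[OF x d \<delta>n] unfolding u_def by blast
  qed
  have bdry: "\<bar>r x - G z\<bar> \<le> 2 * C0 * norm (x - z) powr \<alpha>" if x: "x \<in> \<Omega>" and z: "z \<in> frontier \<Omega>" for x z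
  proof (rule LIMSEQ_le)
    show "(\<lambda>n. \<bar>u n x - G z\<bar>) \<longlonglongrightarrow> \<bar>r x - G z\<bar>" by (intro tendsto_intros lim x)
    have nz: "norm (x - z) \<noteq> 0" using x frontier_notin[OF z] by auto
    have "(\<lambda>n. norm (x - z) + 1 / real (Suc n)) \<longlonglongrightarrow> norm (x - z) + 0" by (intro tendsto_add tendsto_const \<delta>lim)
    then have "(\<lambda>n. (norm (x - z) + 1 / real (Suc n)) powr \<alpha>) \<longlonglongrightarrow> norm (x - z) powr \<alpha>"
      using nz by (intro tendsto_powr tendsto_const) simp_all
    then show "(\<lambda>n. 2 * C0 * (norm (x - z) + 1 / real (Suc n)) powr \<alpha>) \<longlonglongrightarrow> 2 * C0 * norm (x - z) powr \<alpha>"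
      by (intro tendsto_mult tendsto_const)
    show "\<exists>N. \<forall>n\<ge>N. \<bar>u n x - G z\<bar> \<le> 2 * C0 * (norm (x - z) + 1 / real (Suc n)) powr \<alpha>"
      using grow[OF z \<delta>n] unfolding u_def by blast
  qed
  have hold: "\<bar>r y - r x\<bar> \<le> 32 * C0 * norm (y - x) powr \<alpha>" if x: "x \<in> \<Omega>" and y: "y \<in> ball x (dist_bdry x / 2)" for x y
  proof (rule LIMSEQ_le_const2)
    have "norm (y - x) < dist_bdry x" using y dist_bdry_pos[OF x] by (auto simp: dist_norm norm_minus_commute)
    then have y\<Omega>: "y \<in> \<Omega>" by (rule ball_dist_bdry)
    show "(\<lambda>n. \<bar>u n y - u n x\<bar>) \<longlonglongrightarrow> \<bar>r y - r x\<bar>" by (intro tendsto_intros lim x y\<Omega>)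
    show "\<exists>N. \<forall>n\<ge>N. \<bar>u n y - u n x\<bar> \<le> 32 * C0 * norm (y - x) powr \<alpha>"
      using small[OF x] holder[OF x \<delta>n _ y] unfolding u_def by blast
  qed
  define F where "F = (\<lambda>x. if x \<in> \<Omega> then r x else 0)"
  have um [measurable]: "u n \<in> borel_measurable borel" for n
    unfolding u_def by (rule mollify_measurable[OF \<delta>n U_locally_integrable])
  have Fm: "F \<in> borel_measurable borel"
  proof (rule borel_measurable_LIMSEQ_real[where u="\<lambda>n x. indicator \<Omega> x * u n x"])
    show "(\<lambda>n. indicator \<Omega> x * u n x) \<longlonglongrightarrow> F x" for x using lim[of x] by (cases "x \<in> \<Omega>") (auto simp: F_def)
    show "(\<lambda>x. indicator \<Omega> x * u n x) \<in> borel_measurable borel" for n by (intro borel_measurable_times borel_measurable_indicator) auto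
  qed
  obtain z0 where z0: "z0 \<in> frontier \<Omega>" using frontier_nonempty[OF \<Omega>] by blast
  obtain D where D: "0 < D" "\<forall>x\<in>\<Omega>. \<forall>z\<in>frontier \<Omega>. norm (x - z) \<le> D" using bounded_diam by blast
  have Fb: "\<bar>F x\<bar> \<le> \<bar>G z0\<bar> + 2 * C0 * D powr \<alpha>" for x
  proof (cases "x \<in> \<Omega>")
    case True
    have "norm (x - z0) powr \<alpha> \<le> D powr \<alpha>" using D True z0 \<alpha> by (intro powr_mono2) auto
    then have "2 * C0 * norm (x - z0) powr \<alpha> \<le> 2 * C0 * D powr \<alpha>" using C0 by (intro mult_left_mono) auto
    then show ?thesis using bdry[OF True z0] True by (simp add: F_def)
  qed (use C0 in \<open>simp add: F_def\<close>)
  have one: "locally_integrable (\<lambda>_. 1 :: real)" by (rule locally_integrable_continuous) simp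
  have Fl: "locally_integrable F"
    unfolding locally_integrable_def
  proof (intro conjI allI Fm)
    fix R
    have "integrable lborel (\<lambda>x. (indicator (cball 0 R) x * F x) * 1)"
    proof (rule locally_integrable_mult[OF one, where B="\<bar>G z0\<bar> + 2 * C0 * D powr \<alpha>" and R=R])
      show "(\<lambda>x. indicator (cball 0 R) x * F x) \<in> borel_measurable borel"
        using Fm by (intro borel_measurable_times borel_measurable_indicator) auto
      show "\<bar>indicator (cball 0 R) x * F x\<bar> \<le> \<bar>G z0\<bar> + 2 * C0 * D powr \<alpha>" for x
        using Fb[of x] C0 by (auto split: split_indicator)
    qed auto
    then show "integrable lborel (\<lambda>x. indicator (cball 0 R) x * F x)" by simp
  qed
  have limC: "\<exists>d>0. \<forall>\<delta>. 0 < \<delta> \<and> \<delta> < d \<longrightarrow> (\<integral>x. indicator C x * max 0 (q * (mollify \<delta> U x - F x)) \<partial>lborel) \<le> e"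
    if C: "compact C" "C \<subseteq> \<Omega>" and e: "0 < e" and q: "\<bar>q\<bar> = 1" for C e and q :: real
  proof -
    have Cfin: "emeasure lborel C < \<infinity>" by (rule emeasure_bounded_finite[OF compact_imp_bounded[OF C(1)]])
    have Cm: "C \<in> sets borel" using C by (simp add: compact_imp_closed)
    define m where "m = measure lborel C"
    have m0: "0 \<le> m" by (simp add: m_def)
    obtain d0 where d0: "0 < d0" "\<And>x. x \<in> C \<Longrightarrow> d0 < dist_bdry x / 2"
    proof (cases "C = {}")
      case False
      have "continuous_on C dist_bdry" unfolding dist_bdry_def by (intro continuous_intros)
      then obtain x0 where x0: "x0 \<in> C" "\<And>x. x \<in> C \<Longrightarrow> dist_bdry x0 \<le> dist_bdry x"
        using continuous_attains_inf[OF C(1) False] by blast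
      have p: "0 < dist_bdry x0" using x0 C dist_bdry_pos by blast
      show thesis
      proof (rule that[of "dist_bdry x0 / 4"])
        fix x assume "x \<in> C"
        from x0(2)[OF this] p show "dist_bdry x0 / 4 < dist_bdry x / 2" by linarith
      qed (use p in simp)
    qed (use that[of 1] in auto)
    define b where "b = e / (32 * C0 * (m + 1))"
    have b: "0 < b" using e C0 m0 by (simp add: b_def)
    define d where "d = min d0 (b powr (1 / \<alpha>))"
    show ?thesis
    proof (intro exI[of _ d] conjI allI impI)
      show "0 < d" using d0 b by (simp add: d_def)
      fix \<delta> assume "0 < \<delta> \<and> \<delta> < d"
      then have \<delta>: "0 < \<delta>" "\<delta> < d0" "\<delta> < b powr (1 / \<alpha>)" by (auto simp: d_def)
      have "\<delta> powr \<alpha> \<le> (b powr (1 / \<alpha>)) powr \<alpha>" using \<delta> \<alpha> by (intro powr_mono2) auto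
      also have "\<dots> = b" using b \<alpha> by (simp add: powr_powr)
      finally have pb: "32 * C0 * \<delta> powr \<alpha> \<le> 32 * C0 * b" using C0 by (intro mult_left_mono) auto
      have ml: "locally_integrable (mollify \<delta> U)" by (rule locally_integrable_continuous[OF mollify_continuous[OF \<delta>(1) U_locally_integrable]])
      have "(\<integral>x. indicator C x * max 0 (q * (mollify \<delta> U x - F x)) \<partial>lborel) \<le> (\<integral>x. indicator C x * (32 * C0 * b) \<partial>lborel)"
      proof (rule integral_mono')
        show "integrable lborel (\<lambda>x. indicator C x * (32 * C0 * b))" using Cfin Cm by (intro integrable_mult_left integrable_real_indicator) auto
        fix x
        show "indicator C x * max 0 (q * (mollify \<delta> U x - F x)) \<le> indicator C x * (32 * C0 * b)"
        proof (cases "x \<in> C")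
          case True
          have x: "x \<in> \<Omega>" using True C by blast
          have "q * (mollify \<delta> U x - F x) \<le> \<bar>q * (mollify \<delta> U x - F x)\<bar>" by simp
          also have "\<dots> = \<bar>mollify \<delta> U x - r x\<bar>" using q x by (simp add: abs_mult F_def)
          also have "\<dots> \<le> 32 * C0 * \<delta> powr \<alpha>" using \<delta> d0(2)[OF True] by (intro near[OF x]) auto
          also have "\<dots> \<le> 32 * C0 * b" by (rule pb)
          finally show ?thesis using True C0 b by simp
        qed simp
        show "0 \<le> indicator C x * (32 * C0 * b)" using C0 b by simp
      qed
      also have "\<dots> = m * (32 * C0 * b)" by (simp add: m_def)
      also have "\<dots> = e * (m / (m + 1))" using C0 m0 by (simp add: b_def)
      also have "\<dots> \<le> e * 1" using e m0 by (intro mult_left_mono) auto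
      finally show "(\<integral>x. indicator C x * max 0 (q * (mollify \<delta> U x - F x)) \<partial>lborel) \<le> e" by simp
    qed
  qed
  have up: "AE x in lborel. x \<in> \<Omega> \<longrightarrow> U x \<le> F x"
    by (rule mollify_limit_le[OF \<Omega>(1,2) U_locally_integrable Fl]) (use limC[of _ _ 1] in simp)
  have low: "AE x in lborel. x \<in> \<Omega> \<longrightarrow> - U x \<le> - F x"
  proof (rule mollify_limit_le[OF \<Omega>(1,2) locally_integrable_uminus[OF U_locally_integrable] locally_integrable_uminus[OF Fl]])
    fix C :: "'a set" and e :: real
    assume "compact C" "C \<subseteq> \<Omega>" "0 < e"
    from limC[OF this, of "- 1"]
    show "\<exists>d>0. \<forall>\<delta>. 0 < \<delta> \<and> \<delta> < d \<longrightarrow> (\<integral>x. indicator C x * max 0 (mollify \<delta> (\<lambda>x. - U x) x - - F x) \<partial>lborel) \<le> e"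
      by (simp add: mollify_uminus)
  qed
  show thesis
  proof (rule that[of r])
    show "AE x in lborel. x \<in> \<Omega> \<longrightarrow> r x = U x" using up low by eventually_elim (auto simp: F_def)
  qed (use bdry hold in auto)
qed

end

section \<open>Boundary regularity of viscosity and weak solutions\<close>

context weak_setting
begin

text \<open>Apply the interior estimate in the ball of radius \<open>dist_bdry x / 2\<close>. The mollification radius is smaller than that, so
the equation holds in this ball and the growth bound is not worsened by more than the radius.\<close>
lemma mollified_interior_holder:
  assumes inter: "\<And>u x0 z R c y. \<lbrakk>0 < R; nonlocal_subsolution k (ball x0 R) u; nonlocal_subsolution k (ball x0 R) (\<lambda>x. - u x);
       continuous_on (ball x0 R) u; u \<in> borel_measurable lebesgue; norm (x0 - z) \<le> 2 * R;
       \<And>y. \<bar>u y - c\<bar> \<le> 2 * C0 * (norm (y - z) + R) powr \<alpha>; y \<in> ball x0 R\<rbrakk>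
      \<Longrightarrow> \<bar>u y - u x0\<bar> \<le> 32 * C0 * norm (y - x0) powr \<alpha>"
    and grow: "\<And>z \<delta> x. z \<in> frontier \<Omega> \<Longrightarrow> 0 < \<delta> \<Longrightarrow> \<bar>mollify \<delta> U x - G z\<bar> \<le> 2 * C0 * (norm (x - z) + \<delta>) powr \<alpha>"
    and x: "x \<in> \<Omega>" and \<delta>: "0 < \<delta>" "\<delta> < dist_bdry x / 2" and y: "y \<in> ball x (dist_bdry x / 2)"
  shows "\<bar>mollify \<delta> U y - mollify \<delta> U x\<bar> \<le> 32 * C0 * norm (y - x) powr \<alpha>"
proof -
  obtain z where z: "z \<in> frontier \<Omega>" "norm (x - z) = dist_bdry x"
    unfolding dist_bdry_def using nearest_boundary_point[OF \<Omega>(1,2) x] by blast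
  have sub: "ball x (dist_bdry x / 2) \<subseteq> {x'. cball x' \<delta> \<subseteq> \<Omega>}"
  proof (intro subsetI CollectI)
    fix x' w assume x': "x' \<in> ball x (dist_bdry x / 2)" and w: "w \<in> cball x' \<delta>"
    have "dist x w \<le> dist x x' + dist x' w" by (rule dist_triangle)
    then have "norm (w - x) < dist_bdry x" using x' w \<delta> by (simp add: dist_norm norm_minus_commute)
    then show "w \<in> \<Omega>" by (rule ball_dist_bdry)
  qed
  note mc = mollify_continuous[OF \<delta>(1) U_locally_integrable]
  show ?thesis
  proof (rule inter[where R="dist_bdry x / 2" and z=z and c="G z"])
    show "0 < dist_bdry x / 2" using dist_bdry_pos[OF x] by simp
    show "nonlocal_subsolution k (ball x (dist_bdry x / 2)) (mollify \<delta> U)"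
      by (rule nonlocal_subsolution_mono[OF mollified_subsolution[OF \<delta>(1)] sub])
    show "nonlocal_subsolution k (ball x (dist_bdry x / 2)) (\<lambda>x. - mollify \<delta> U x)"
      using nonlocal_subsolution_mono[OF weak_setting.mollified_subsolution[OF weak_setting_uminus \<delta>(1)] sub]
      by (simp add: mollify_uminus[abs_def])
    show "continuous_on (ball x (dist_bdry x / 2)) (mollify \<delta> U)" by (rule mc)
    have "mollify \<delta> U \<in> borel_measurable borel" by (rule borel_measurable_continuous_onI[OF mc])
    then show "mollify \<delta> U \<in> borel_measurable lebesgue" by (intro measurable_completion) simp
    show "norm (x - z) \<le> 2 * (dist_bdry x / 2)" using z by simp
    show "\<bar>mollify \<delta> U w - G z\<bar> \<le> 2 * C0 * (norm (w - z) + dist_bdry x / 2) powr \<alpha>" for w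
    proof -
      have "(norm (w - z) + \<delta>) powr \<alpha> \<le> (norm (w - z) + dist_bdry x / 2) powr \<alpha>"
        using \<delta> \<alpha> by (intro powr_mono2) auto
      then have "2 * C0 * (norm (w - z) + \<delta>) powr \<alpha> \<le> 2 * C0 * (norm (w - z) + dist_bdry x / 2) powr \<alpha>"
        using C0 by (intro mult_left_mono) auto
      then show ?thesis using grow[OF z(1) \<delta>(1), of w] by linarith
    qed
  qed (rule y)
qed

end

text \<open>The counterpart of \<open>viscosity_estimates\<close>. Only the representative \<open>r\<close> satisfies the estimates at every point, so it is
part of the conclusion.\<close>
lemma weak_estimates:
  fixes s lam Lam \<kappa> :: real
  assumes s: "0 < s" "s < 1" and lam: "0 < lam" "lam \<le> Lam" and \<kappa>: "0 < \<kappa>" "\<kappa> \<le> 1"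
  obtains a0 where "0 < a0"
    "\<And>(K :: 'a::euclidean_space \<Rightarrow> real) \<Omega> \<alpha> u g C0.
      \<lbrakk>admissible_kernel s lam Lam K; 0 < \<alpha>; \<alpha> \<le> a0; open \<Omega>; bounded \<Omega>; \<Omega> \<noteq> {}; exterior_corkscrew \<kappa> \<Omega>;
       weak_solution K \<Omega> g u; 0 < C0;
       \<forall>x\<in>-\<Omega>. \<forall>z\<in>frontier \<Omega>. \<bar>g x - g z\<bar> \<le> C0 * norm (x - z) powr \<alpha>\<rbrakk>
      \<Longrightarrow> \<exists>r. (AE x in lborel. x \<in> \<Omega> \<longrightarrow> r x = u x) \<and>
            (\<forall>x\<in>\<Omega>. \<forall>z\<in>frontier \<Omega>. \<bar>r x - g z\<bar> \<le> 2 * C0 * norm (x - z) powr \<alpha>) \<and>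
            (\<forall>x\<in>\<Omega>. \<forall>y\<in>ball x (infdist x (- \<Omega>) / 2). \<bar>r y - r x\<bar> \<le> 32 * C0 * norm (y - x) powr \<alpha>)"
proof -
  have Lam: "0 < Lam" using lam by linarith
  obtain a1 c0 where a1: "0 < a1" "0 < c0" "a1 \<le> s / 2" and barr:
    "\<And>(K :: 'a \<Rightarrow> real) \<Omega> \<alpha> z x.
      \<lbrakk>upper_kernel s Lam K; \<And>y. x + y \<notin> \<Omega> \<Longrightarrow> lam * sing_kernel s y \<le> K y;
       0 < \<alpha>; \<alpha> \<le> a1; open \<Omega>; exterior_corkscrew \<kappa> \<Omega>; z \<in> frontier \<Omega>; x \<in> \<Omega>\<rbrakk>
      \<Longrightarrow> \<exists>r>0. \<exists>p c H. (\<forall>y. norm y < r \<longrightarrow> H y = p \<bullet> y + c * (norm y)\<^sup>2) \<and>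
            (\<forall>y. barrier \<Omega> \<alpha> z (x + y) - barrier \<Omega> \<alpha> z x \<le> H y) \<and>
            H \<in> borel_measurable borel \<and> integrable lebesgue (\<lambda>y. (H y + H (- y)) * K y) \<and>
            (\<integral>y. (H y + H (- y)) * K y \<partial>lebesgue) \<le> - c0 * norm (x - z) powr (\<alpha> - 2 * s)"
    using barrier_supersolution[OF s lam(1) Lam \<kappa>, where 'a='a] by blast
  obtain a2 where a2: "0 < a2" and inter:
    "\<And>(K :: 'a::euclidean_space \<Rightarrow> real) \<alpha> u x0 z R C0 c y.
      \<lbrakk>upper_kernel s Lam K; \<And>y. y \<noteq> 0 \<Longrightarrow> lam * sing_kernel s y \<le> K y;
       0 < \<alpha>; \<alpha> \<le> a2; \<alpha> < 1; 0 < R; 0 < C0; nonlocal_subsolution K (ball x0 R) u; nonlocal_subsolution K (ball x0 R) (\<lambda>x. - u x);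
       continuous_on (ball x0 R) u; u \<in> borel_measurable lebesgue; norm (x0 - z) \<le> 2 * R;
       \<And>y. \<bar>u y - c\<bar> \<le> 2 * C0 * (norm (y - z) + R) powr \<alpha>; y \<in> ball x0 R\<rbrakk>
      \<Longrightarrow> \<bar>u y - u x0\<bar> \<le> 32 * C0 * norm (y - x0) powr \<alpha>"
    using interior_estimate[OF s lam(1) Lam, where 'a='a] by blast
  show thesis
  proof (rule that[of "min (min a1 a2) (1 / 2)"])
    show "0 < min (min a1 a2) (1 / 2)" using a1 a2 by simp
    fix K :: "'a \<Rightarrow> real" and \<Omega> \<alpha> u g C0
    assume adm: "admissible_kernel s lam Lam K" and \<alpha>: "0 < \<alpha>" "\<alpha> \<le> min (min a1 a2) (1 / 2)"
      and \<Omega>: "open \<Omega>" "bounded \<Omega>" "\<Omega> \<noteq> {}" "exterior_corkscrew \<kappa> \<Omega>"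
      and weak: "weak_solution K \<Omega> g u" and C0: "0 < C0"
      and g: "\<forall>x\<in>-\<Omega>. \<forall>z\<in>frontier \<Omega>. \<bar>g x - g z\<bar> \<le> C0 * norm (x - z) powr \<alpha>"
    have \<alpha>': "\<alpha> \<le> a1" "\<alpha> \<le> a2" "\<alpha> \<le> 1 / 2" "\<alpha> \<le> s / 2" "\<alpha> < 1" using \<alpha> a1 by auto
    obtain k U where ws: "weak_setting s lam Lam \<kappa> C0 \<alpha> k \<Omega> U g" and uU: "AE x in lborel. u x = U x"
      by (rule weak_solution_setting[OF s lam \<kappa> \<Omega> \<alpha>(1) \<alpha>'(3,4) C0 adm g weak])
    interpret weak_setting s lam Lam \<kappa> C0 \<alpha> k \<Omega> U g by (rule ws)
    have up: "AE x in lborel. x \<in> \<Omega> \<longrightarrow> U x \<le> g z + 2 * C0 * norm (x - z) powr \<alpha>" if z: "z \<in> frontier \<Omega>" for z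
      by (rule weak_comparison[OF z a1(2)], rule barr[OF _ _ \<alpha>(1) \<alpha>'(1) \<Omega>(1) cork z]) blast+
    have low: "AE x in lborel. x \<in> \<Omega> \<longrightarrow> - U x \<le> - g z + 2 * C0 * norm (x - z) powr \<alpha>" if z: "z \<in> frontier \<Omega>" for z
      by (rule weak_setting.weak_comparison[OF weak_setting_uminus z a1(2)], rule barr[OF _ _ \<alpha>(1) \<alpha>'(1) \<Omega>(1) cork z]) blast+
    have grow: "\<bar>mollify \<delta> U x - g z\<bar> \<le> 2 * C0 * (norm (x - z) + \<delta>) powr \<alpha>" if "z \<in> frontier \<Omega>" "0 < \<delta>" for z \<delta> x
      by (rule mollified_boundary_growth[OF that up[OF that(1)] low[OF that(1)]])
    have holder: "\<bar>mollify \<delta> U y - mollify \<delta> U x\<bar> \<le> 32 * C0 * norm (y - x) powr \<alpha>"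
      if "x \<in> \<Omega>" "0 < \<delta>" "\<delta> < dist_bdry x / 2" "y \<in> ball x (dist_bdry x / 2)" for x y \<delta>
      by (rule mollified_interior_holder[OF inter[OF k_upper k_low \<alpha>(1) \<alpha>'(2,5) _ C0] grow that])
    show "\<exists>r. (AE x in lborel. x \<in> \<Omega> \<longrightarrow> r x = u x) \<and>
            (\<forall>x\<in>\<Omega>. \<forall>z\<in>frontier \<Omega>. \<bar>r x - g z\<bar> \<le> 2 * C0 * norm (x - z) powr \<alpha>) \<and>
            (\<forall>x\<in>\<Omega>. \<forall>y\<in>ball x (infdist x (- \<Omega>) / 2). \<bar>r y - r x\<bar> \<le> 32 * C0 * norm (y - x) powr \<alpha>)"
    proof (rule continuous_representative[OF grow holder])
      fix r
      assume r: "AE x in lborel. x \<in> \<Omega> \<longrightarrow> r x = U x"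
        "\<And>x z. x \<in> \<Omega> \<Longrightarrow> z \<in> frontier \<Omega> \<Longrightarrow> \<bar>r x - g z\<bar> \<le> 2 * C0 * norm (x - z) powr \<alpha>"
        "\<And>x y. x \<in> \<Omega> \<Longrightarrow> y \<in> ball x (dist_bdry x / 2) \<Longrightarrow> \<bar>r y - r x\<bar> \<le> 32 * C0 * norm (y - x) powr \<alpha>"
      have "AE x in lborel. x \<in> \<Omega> \<longrightarrow> r x = u x" using r(1) uU by eventually_elim auto
      then show ?thesis using r(2) r(3)[unfolded dist_bdry_def] by (intro exI[of _ r] conjI ballI) auto
    qed
  qed
qed

theorem theorem1p4:
  fixes \<Omega> :: "'a::euclidean_space set" and s lam Lam :: real
  assumes "bounded_lipschitz_domain \<Omega>"
    and "0 < s" and "s < 1"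
    and "0 < lam" and "lam \<le> Lam"
  shows "\<exists>\<beta>\<^sub>0>0. \<forall>\<alpha>. 0 < \<alpha> \<and> \<alpha> < 1 \<and> \<alpha> \<le> \<beta>\<^sub>0 \<longrightarrow>
    (\<exists>C>0. \<forall>(K :: 'a \<Rightarrow> real) (C\<^sub>0 :: real) (g :: 'a \<Rightarrow> real) (u :: 'a \<Rightarrow> real).
       admissible_kernel s lam Lam K \<and> 0 < C\<^sub>0 \<and>
       g \<in> borel_measurable (lebesgue_on (-\<Omega>)) \<and>
       (\<forall>x\<in>-\<Omega>. \<forall>z\<in>frontier \<Omega>. \<bar>g x - g z\<bar> \<le> C\<^sub>0 * norm (x - z) powr \<alpha>) \<and>
       (\<forall>x\<in>-\<Omega>. \<bar>g x\<bar> \<le> C\<^sub>0 * (1 + norm x powr \<alpha>)) \<longrightarrow>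
       (viscosity_solution K \<Omega> g u \<longrightarrow>
          u \<in> holder_class \<alpha> (closure \<Omega>) \<and>
          holder_norm \<alpha> (closure \<Omega>) u \<le> ennreal (C * C\<^sub>0)) \<and>
       (weak_solution K \<Omega> g u \<longrightarrow>
          (\<exists>v. (AE x in lebesgue. v x = u x) \<and> (\<forall>x\<in>-\<Omega>. v x = g x) \<and>
             v \<in> holder_class \<alpha> (closure \<Omega>) \<and>
             holder_norm \<alpha> (closure \<Omega>) v \<le> ennreal (C * C\<^sub>0))))"
proof -
  have \<Omega>: "open \<Omega>" "bounded \<Omega>" "\<Omega> \<noteq> {}" using assms(1) by (auto simp: bounded_lipschitz_domain_def)
  have fr: "frontier \<Omega> \<subseteq> - \<Omega>" using \<Omega>(1) by (auto simp: frontier_def interior_open)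
  have Lam: "0 < Lam" using assms(4,5) by linarith
  obtain \<kappa> where \<kappa>: "0 < \<kappa>" "\<kappa> \<le> 1" and cork: "exterior_corkscrew \<kappa> \<Omega>"
    by (rule lipschitz_exterior_corkscrew[OF assms(1)])
  obtain a1 where a1: "0 < a1" and visc:
    "\<And>(K :: 'a::euclidean_space \<Rightarrow> real) \<Omega> \<alpha> u g C0.
      \<lbrakk>admissible_kernel s lam Lam K; 0 < \<alpha>; \<alpha> \<le> a1; \<alpha> < 1; open \<Omega>; bounded \<Omega>; exterior_corkscrew \<kappa> \<Omega>;
       viscosity_solution K \<Omega> g u; 0 < C0;
       \<And>y z. y \<notin> \<Omega> \<Longrightarrow> z \<in> frontier \<Omega> \<Longrightarrow> \<bar>g y - g z\<bar> \<le> C0 * norm (y - z) powr \<alpha>\<rbrakk>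
      \<Longrightarrow> (\<forall>y. \<forall>z\<in>frontier \<Omega>. \<bar>u y - u z\<bar> \<le> 2 * C0 * norm (y - z) powr \<alpha>) \<and>
          (\<forall>x\<in>\<Omega>. \<forall>y\<in>ball x (infdist x (- \<Omega>) / 2). \<bar>u y - u x\<bar> \<le> 32 * C0 * norm (y - x) powr \<alpha>)"
    using viscosity_estimates[OF assms(2-4) Lam \<kappa>, where 'a='a] by blast
  obtain a2 where a2: "0 < a2" and weak:
    "\<And>(K :: 'a::euclidean_space \<Rightarrow> real) \<Omega> \<alpha> u g C0.
      \<lbrakk>admissible_kernel s lam Lam K; 0 < \<alpha>; \<alpha> \<le> a2; open \<Omega>; bounded \<Omega>; \<Omega> \<noteq> {}; exterior_corkscrew \<kappa> \<Omega>;
       weak_solution K \<Omega> g u; 0 < C0;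
       \<forall>x\<in>-\<Omega>. \<forall>z\<in>frontier \<Omega>. \<bar>g x - g z\<bar> \<le> C0 * norm (x - z) powr \<alpha>\<rbrakk>
      \<Longrightarrow> \<exists>r. (AE x in lborel. x \<in> \<Omega> \<longrightarrow> r x = u x) \<and>
            (\<forall>x\<in>\<Omega>. \<forall>z\<in>frontier \<Omega>. \<bar>r x - g z\<bar> \<le> 2 * C0 * norm (x - z) powr \<alpha>) \<and>
            (\<forall>x\<in>\<Omega>. \<forall>y\<in>ball x (infdist x (- \<Omega>) / 2). \<bar>r y - r x\<bar> \<le> 32 * C0 * norm (y - x) powr \<alpha>)"
    using weak_estimates[OF assms(2-5) \<kappa>, where 'a='a] by blast
  show ?thesis
  proof (rule exI[of _ "min a1 a2"], rule conjI[OF _ allI[OF impI]])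
    show "0 < min a1 a2" using a1 a2 by simp
    fix \<alpha> assume "0 < \<alpha> \<and> \<alpha> < 1 \<and> \<alpha> \<le> min a1 a2"
    then have \<alpha>: "0 < \<alpha>" "\<alpha> < 1" "\<alpha> \<le> a1" "\<alpha> \<le> a2" by auto
    obtain C where C: "0 < C" and est: "\<And>v C0. \<lbrakk>0 < C0;
      \<And>y z. y \<in> closure \<Omega> \<Longrightarrow> z \<in> frontier \<Omega> \<Longrightarrow> \<bar>v y - v z\<bar> \<le> 2 * C0 * norm (y - z) powr \<alpha>;
      \<And>x y. x \<in> \<Omega> \<Longrightarrow> y \<in> ball x (infdist x (- \<Omega>) / 2) \<Longrightarrow> \<bar>v y - v x\<bar> \<le> 32 * C0 * norm (y - x) powr \<alpha>;
      \<And>z. z \<in> frontier \<Omega> \<Longrightarrow> \<bar>v z\<bar> \<le> C0 * (1 + norm z powr \<alpha>)\<rbrakk>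
     \<Longrightarrow> holder_norm \<alpha> (closure \<Omega>) v \<le> ennreal (C * C0)"
      using holder_norm_le_of_boundary_interior[OF \<Omega> \<alpha>(1,2), of 32] zero_less_numeral by blast
    have in_class: "v \<in> holder_class \<alpha> (closure \<Omega>)" if "holder_norm \<alpha> (closure \<Omega>) v \<le> ennreal c" for v :: "'a \<Rightarrow> real" and c
      using that by (simp add: holder_class_def order_le_less_trans)
    show "\<exists>C>0. \<forall>(K :: 'a \<Rightarrow> real) (C\<^sub>0 :: real) (g :: 'a \<Rightarrow> real) (u :: 'a \<Rightarrow> real).
       admissible_kernel s lam Lam K \<and> 0 < C\<^sub>0 \<and>
       g \<in> borel_measurable (lebesgue_on (-\<Omega>)) \<and>
       (\<forall>x\<in>-\<Omega>. \<forall>z\<in>frontier \<Omega>. \<bar>g x - g z\<bar> \<le> C\<^sub>0 * norm (x - z) powr \<alpha>) \<and>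
       (\<forall>x\<in>-\<Omega>. \<bar>g x\<bar> \<le> C\<^sub>0 * (1 + norm x powr \<alpha>)) \<longrightarrow>
       (viscosity_solution K \<Omega> g u \<longrightarrow>
          u \<in> holder_class \<alpha> (closure \<Omega>) \<and>
          holder_norm \<alpha> (closure \<Omega>) u \<le> ennreal (C * C\<^sub>0)) \<and>
       (weak_solution K \<Omega> g u \<longrightarrow>
          (\<exists>v. (AE x in lebesgue. v x = u x) \<and> (\<forall>x\<in>-\<Omega>. v x = g x) \<and>
             v \<in> holder_class \<alpha> (closure \<Omega>) \<and>
             holder_norm \<alpha> (closure \<Omega>) v \<le> ennreal (C * C\<^sub>0)))"
    proof (rule exI[of _ C], rule conjI[OF C], intro allI impI)
      fix K :: "'a \<Rightarrow> real" and C0 :: real and g u :: "'a \<Rightarrow> real"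
      assume "admissible_kernel s lam Lam K \<and> 0 < C0 \<and>
       g \<in> borel_measurable (lebesgue_on (-\<Omega>)) \<and>
       (\<forall>x\<in>-\<Omega>. \<forall>z\<in>frontier \<Omega>. \<bar>g x - g z\<bar> \<le> C0 * norm (x - z) powr \<alpha>) \<and>
       (\<forall>x\<in>-\<Omega>. \<bar>g x\<bar> \<le> C0 * (1 + norm x powr \<alpha>))"
      then have adm: "admissible_kernel s lam Lam K" and C0: "0 < C0"
        and g: "\<forall>x\<in>-\<Omega>. \<forall>z\<in>frontier \<Omega>. \<bar>g x - g z\<bar> \<le> C0 * norm (x - z) powr \<alpha>"
        and gb: "\<forall>x\<in>-\<Omega>. \<bar>g x\<bar> \<le> C0 * (1 + norm x powr \<alpha>)" by blast+
      have "holder_norm \<alpha> (closure \<Omega>) u \<le> ennreal (C * C0)" if v: "viscosity_solution K \<Omega> g u"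
      proof -
        have ug: "u x = g x" if "x \<notin> \<Omega>" for x using v that by (simp add: viscosity_solution_def)
        have e: "(\<forall>y. \<forall>z\<in>frontier \<Omega>. \<bar>u y - u z\<bar> \<le> 2 * C0 * norm (y - z) powr \<alpha>) \<and>
          (\<forall>x\<in>\<Omega>. \<forall>y\<in>ball x (infdist x (- \<Omega>) / 2). \<bar>u y - u x\<bar> \<le> 32 * C0 * norm (y - x) powr \<alpha>)"
          by (rule visc[OF adm \<alpha>(1,3,2) \<Omega>(1,2) cork v C0]) (use g in auto)
        show ?thesis
        proof (rule est[OF C0])
          fix z assume z: "z \<in> frontier \<Omega>"
          then have "z \<notin> \<Omega>" using fr by blast
          then show "\<bar>u z\<bar> \<le> C0 * (1 + norm z powr \<alpha>)" using gb ug by simp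
        qed (use e in auto)
      qed
      moreover have "\<exists>v. (AE x in lebesgue. v x = u x) \<and> (\<forall>x\<in>-\<Omega>. v x = g x) \<and> holder_norm \<alpha> (closure \<Omega>) v \<le> ennreal (C * C0)"
        if w: "weak_solution K \<Omega> g u"
      proof -
        have ug: "u x = g x" if "x \<notin> \<Omega>" for x using w that by (simp add: weak_solution_def)
        have "\<exists>r. (AE x in lborel. x \<in> \<Omega> \<longrightarrow> r x = u x) \<and>
            (\<forall>x\<in>\<Omega>. \<forall>z\<in>frontier \<Omega>. \<bar>r x - g z\<bar> \<le> 2 * C0 * norm (x - z) powr \<alpha>) \<and>
            (\<forall>x\<in>\<Omega>. \<forall>y\<in>ball x (infdist x (- \<Omega>) / 2). \<bar>r y - r x\<bar> \<le> 32 * C0 * norm (y - x) powr \<alpha>)"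
          by (rule weak[OF adm \<alpha>(1,4) \<Omega> cork w C0 g])
        then obtain r where r: "AE x in lborel. x \<in> \<Omega> \<longrightarrow> r x = u x"
          "\<forall>x\<in>\<Omega>. \<forall>z\<in>frontier \<Omega>. \<bar>r x - g z\<bar> \<le> 2 * C0 * norm (x - z) powr \<alpha>"
          "\<forall>x\<in>\<Omega>. \<forall>y\<in>ball x (infdist x (- \<Omega>) / 2). \<bar>r y - r x\<bar> \<le> 32 * C0 * norm (y - x) powr \<alpha>" by blast
        define v where "v = (\<lambda>x. if x \<in> \<Omega> then r x else g x)"
        have "AE x in lborel. v x = u x" using r(1) by eventually_elim (auto simp: v_def ug)
        then have "AE x in lebesgue. v x = u x" by (rule AE_completion)
        moreover have "\<forall>x\<in>-\<Omega>. v x = g x" by (simp add: v_def)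
        moreover have "holder_norm \<alpha> (closure \<Omega>) v \<le> ennreal (C * C0)"
        proof (rule est[OF C0])
          fix y z assume z: "z \<in> frontier \<Omega>"
          then have z': "z \<notin> \<Omega>" using fr by blast
          show "\<bar>v z\<bar> \<le> C0 * (1 + norm z powr \<alpha>)" using gb z' by (simp add: v_def)
          show "\<bar>v y - v z\<bar> \<le> 2 * C0 * norm (y - z) powr \<alpha>"
          proof (cases "y \<in> \<Omega>")
            case True
            then show ?thesis using r(2) z z' by (simp add: v_def)
          next
            case False
            then have "\<bar>v y - v z\<bar> \<le> C0 * norm (y - z) powr \<alpha>" using g z z' by (simp add: v_def)
            also have "\<dots> \<le> 2 * C0 * norm (y - z) powr \<alpha>" using C0 by (intro mult_right_mono) auto
            finally show ?thesis .
          qed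
        next
          fix x y assume x: "x \<in> \<Omega>" and y: "y \<in> ball x (infdist x (- \<Omega>) / 2)"
          have "y \<in> \<Omega>"
          proof (rule ccontr)
            assume "y \<notin> \<Omega>"
            then have "infdist x (- \<Omega>) \<le> dist x y" by (intro infdist_le) simp
            moreover have "dist x y < infdist x (- \<Omega>) / 2" using y by simp
            ultimately show False using zero_le_dist[of x y] by linarith
          qed
          then show "\<bar>v y - v x\<bar> \<le> 32 * C0 * norm (y - x) powr \<alpha>" using r(3) x y by (simp add: v_def)
        qed
        ultimately show ?thesis by blast
      qed
      ultimately show "(viscosity_solution K \<Omega> g u \<longrightarrow>
          u \<in> holder_class \<alpha> (closure \<Omega>) \<and>
          holder_norm \<alpha> (closure \<Omega>) u \<le> ennreal (C * C0)) \<and>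
       (weak_solution K \<Omega> g u \<longrightarrow>
          (\<exists>v. (AE x in lebesgue. v x = u x) \<and> (\<forall>x\<in>-\<Omega>. v x = g x) \<and>
             v \<in> holder_class \<alpha> (closure \<Omega>) \<and>
             holder_norm \<alpha> (closure \<Omega>) v \<le> ennreal (C * C0)))"
        using in_class by fast
    qed
  qed
qed

end
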